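(* Consider the general coding structure with the optimal feedback generator (described in the context). For any $n\ge0$ and any admissible $(A,C)$ with $A$ of size $n+1$: (i) The asymptotic information rate is given by $$R_{\infty,n}(A,C):=\lim_{T\to\infty}\frac1{T+1}I(W;y^T)=\mathcal H(e)-\tfrac12\log 2\pi e=\log DI(A)=\int_{-1/2}^{1/2}\log S(e^{j2\pi\theta})\,d\theta=\tfrac12\log(\mathbb C\Sigma\mathbb C'+1)$$ $$=\lim_{T\to\infty}\frac{\log\det\mathcal I_{W,T}}{2(T+1)}=-\lim_{T\to\infty}\frac{\log\det\mathrm{MSE}_{W,T}}{2(T+1)}=-\lim_{T\to\infty}\frac{\log\det\mathrm{CRB}_{W,T}}{2(T+1)} .$$ (ii) The average channel input power is given by $$P_{\infty,n}(A,C):=\lim_{T\to\infty}\frac1{T+1}\mathbf E\,(u^T)'u^T=\mathbb D\Sigma\mathbb D' .$$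
   Context: Conventions. $'$ denotes transpose, $x^T$ denotes the stacked column vector of $x_0,\dots,x_T$, $\log$ is to base 2 (also in entropies). Channel. $\mathcal Z(z)$ is a single-input single-output finite-dimensional LTI transfer function, stable and minimum phase, with $\mathcal Z(\infty)=1$. $\mathcal Z_T$ is the $(T+1)\times(T+1)$ lower-triangular Toeplitz matrix of its impulse response. $\mathcal Z^{-1}$ has minimal realization $(F,G,H,1)$ with $F\in\mathbb R^{m\times m}$ stable, $m\ge1$. $\{N_t\}$ is white Gaussian noise, zero mean, unit variance. The channel $\mathcal F$ is $s_{t+1}=Fs_t+Gu_t$, $y_t=Hs_t+u_t+N_t$, $s_0=0$. General coding structure with optimal feedback generator. $W\sim\mathcal N(0,I_{n+1})$ independent of the noise; $x_0=W$, $x_{t+1}=Ax_t$, $r_t=Cx_t$, $u_t=r_t-\hat r_t$; admissible $(A,C)$ means $A\in\mathbb R^{(n+1)\times(n+1)}$, $C\in\mathbb R^{1\times(n+1)}$, $(A,C)$ observable, and no eigenvalue of $A$ on the unit circle or equal to an eigenvalue of $F$. Feedback: $\hat s_{t+1}=F\hat s_t+L_{2,t}e_t$, $e_t=y_t-H\hat s_t$, $\hat x_{t+1}=A\hat x_t+L_{1,t}e_t$, $\hat r_t=C\hat x_t$, $\hat s_0=0,\hat x_0=0$, with $$\begin{bmatrix}L_{1,t} \\ L_{2,t}\end{bmatrix}=\frac{\mathbb A\Sigma_t\mathbb C'}{\mathbb C\Sigma_t\mathbb C'+1},\quad \Sigma_{t+1}=\mathbb A\Sigma_t\mathbb A'-\frac{\mathbb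 A\Sigma_t\mathbb C'\mathbb C\Sigma_t\mathbb A'}{\mathbb C\Sigma_t\mathbb C'+1},\quad\Sigma_0=\begin{bmatrix}I_{n+1} & 0 \\ 0 & 0\end{bmatrix},$$ $\mathbb A=\begin{bmatrix}A & 0 \\ G C & F\end{bmatrix}$, $\mathbb C=[C\ \ H]$, $\mathbb D=[C\ \ 0]$. $\Sigma$ denotes the unique stabilizing solution of $\Sigma=\mathbb A\Sigma\mathbb A'-\mathbb A\Sigma\mathbb C'\mathbb C\Sigma\mathbb A'/(\mathbb C\Sigma\mathbb C'+1)$, i.e. the one for which, with $L=\mathbb A\Sigma\mathbb C'/(\mathbb C\Sigma\mathbb C'+1)$, all eigenvalues of $\mathbb A-L\mathbb C$ are in the open unit disc. The steady-state system is $\mathbb X_{t+1}=(\mathbb A-L\mathbb C)\mathbb X_t-LN_t$, $e_t=\mathbb C\mathbb X_t+N_t$, $u_t=\mathbb D\mathbb X_t$; $S(e^{j2\pi\theta})$ is the magnitude on the unit circle of its sensitivity function, the transfer function from $N$ to $e$. $\mathcal H(e)$ is the (differential) entropy rate of the innovations process $\{e_t\}$. $DI(A)=\prod_{i=0}^k|a_i|$, where $a_0,\dots,a_k$ are the unstable eigenvalues of $A$ (with multiplicity; those outside the closed unit disc; empty product $=1$). Estimation quantities refer to the feedback-free estimation system $\bar y^T=\mathcal Z_T^{-1}r^T+N^T$, $r_t=CA^tW$: $\mathrm{MSE}_{W,T}$ is the minimum mean-squared error matrix of $W$ given $\bar y^T$; $\mathcal I_{W,T}=\mathbf E[\nabla_W\ln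 p(\bar y^T,W)(\nabla_W\ln p(\bar y^T,W))']$ is the Bayesian Fisher information matrix; $\mathrm{CRB}_{W,T}=\mathcal I_{W,T}^{-1}$ is the Bayesian Cramer-Rao bound. *)

theory Defs
  imports
    "HOL-Probability.Probability"
    "HOL-Computational_Algebra.Computational_Algebra"
    "Jordan_Normal_Form.Char_Poly"
    "Jordan_Normal_Form.Gauss_Jordan_Elimination"
begin

hide_const (open) Determinants.det

section \<open>Linear systems and transfer functions\<close>

definition ceigenvalue :: "real mat \<Rightarrow> complex \<Rightarrow> bool" where
  "ceigenvalue A a \<longleftrightarrow> eigenvalue (map_mat complex_of_real A) a"

definition stable_mat :: "real mat \<Rightarrow> bool" where
  "stable_mat A \<longleftrightarrow> (\<forall>a. ceigenvalue A a \<longrightarrow> cmod a < 1)"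

text \<open>Only meaningful for invertible matrices.\<close>
definition mat_inv :: "'a :: field mat \<Rightarrow> 'a mat" where
  "mat_inv A = the (mat_inverse A)"

text \<open>The transfer function of \<open>x(t+1) = A x(t) + B v(t)\<close>, \<open>w(t) = C x(t) + d v(t)\<close>,
  evaluated at a point \<open>z\<close> that is not an eigenvalue of \<open>A\<close>.\<close>
definition ss_tf :: "real mat \<Rightarrow> real mat \<Rightarrow> real mat \<Rightarrow> real \<Rightarrow> complex \<Rightarrow> complex" where
  "ss_tf A B C d z =
     (map_mat complex_of_real C
      * mat_inv (z \<cdot>\<^sub>m 1\<^sub>m (dim_row A) - map_mat complex_of_real A)
      * map_mat complex_of_real B) $$ (0,0) + complex_of_real d"

definition cpoly :: "real poly \<Rightarrow> complex \<Rightarrow> complex" where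
  "cpoly p z = poly (map_poly complex_of_real p) z"

text \<open>\<open>(A, B, C, d)\<close> realizes the rational function \<open>p / q\<close>.\<close>
definition realizes ::
  "nat \<Rightarrow> real mat \<Rightarrow> real mat \<Rightarrow> real mat \<Rightarrow> real \<Rightarrow> real poly \<Rightarrow> real poly \<Rightarrow> bool" where
  "realizes k A B C d p q \<longleftrightarrow>
     A \<in> carrier_mat k k \<and> B \<in> carrier_mat k 1 \<and> C \<in> carrier_mat 1 k \<and>
     (\<forall>z. \<not> ceigenvalue A z \<and> cpoly q z \<noteq> 0 \<longrightarrow> ss_tf A B C d z = cpoly p z / cpoly q z)"

definition minimal_realization ::
  "nat \<Rightarrow> real mat \<Rightarrow> real mat \<Rightarrow> real mat \<Rightarrow> real \<Rightarrow> real poly \<Rightarrow> real poly \<Rightarrow> bool" where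
  "minimal_realization k A B C d p q \<longleftrightarrow>
     realizes k A B C d p q \<and>
     (\<forall>k' A' B' C' d'. realizes k' A' B' C' d' p q \<longrightarrow> k \<le> k')"

text \<open>The channel transfer function is the rational function \<open>Z = p / q\<close> in lowest terms: the
  first line below makes it proper with \<open>Z(\<infinity>) = 1\<close>; then come stability (poles) and minimum phase
  (zeros).\<close>
definition channel_tf :: "real poly \<Rightarrow> real poly \<Rightarrow> bool" where
  "channel_tf p q \<longleftrightarrow>
     q \<noteq> 0 \<and> coprime p q \<and> degree p = degree q \<and> lead_coeff p = lead_coeff q \<and>
     (\<forall>z. cpoly q z = 0 \<longrightarrow> cmod z < 1) \<and>
     (\<forall>z. cpoly p z = 0 \<longrightarrow> cmod z < 1)"

text \<open>Expansion of \<open>p / q\<close> in powers of \<open>1 / z\<close>. With \<open>degree p = degree q = d\<close>, the reflected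
  polynomials are \<open>p(1/x) x^d\<close> and \<open>q(1/x) x^d\<close>, so their quotient is \<open>p(1/x) / q(1/x)\<close>.\<close>
definition impulse_response :: "real poly \<Rightarrow> real poly \<Rightarrow> nat \<Rightarrow> real" where
  "impulse_response p q =
     fps_nth (fps_of_poly (reflect_poly p) / fps_of_poly (reflect_poly q))"

definition toeplitz :: "(nat \<Rightarrow> real) \<Rightarrow> nat \<Rightarrow> real mat" where
  "toeplitz h T = mat (T + 1) (T + 1) (\<lambda>(i, j). if j \<le> i then h (i - j) else 0)"

definition observable :: "real mat \<Rightarrow> real mat \<Rightarrow> bool" where
  "observable A C \<longleftrightarrow>
     (\<forall>v \<in> carrier_vec (dim_col A). (\<forall>t. C *\<^sub>v (A ^\<^sub>m t *\<^sub>v v) = 0\<^sub>v (dim_row C)) \<longrightarrow> v = 0\<^sub>v (dim_col A))"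

definition admissible :: "nat \<Rightarrow> real mat \<Rightarrow> real mat \<Rightarrow> real mat \<Rightarrow> bool" where
  "admissible n F A C \<longleftrightarrow>
     A \<in> carrier_mat (n + 1) (n + 1) \<and> C \<in> carrier_mat 1 (n + 1) \<and> observable A C \<and>
     (\<forall>a. ceigenvalue A a \<longrightarrow> cmod a \<noteq> 1 \<and> \<not> ceigenvalue F a)"

definition DI :: "real mat \<Rightarrow> real" where
  "DI A = (\<Prod>a | ceigenvalue A a \<and> cmod a > 1.
             cmod a ^ order a (char_poly (map_mat complex_of_real A)))"

section \<open>Riccati recursion and steady state\<close>

definition blockA :: "real mat \<Rightarrow> real mat \<Rightarrow> real mat \<Rightarrow> real mat \<Rightarrow> real mat" where
  "blockA F G A C = four_block_mat A (0\<^sub>m (dim_row A) (dim_col F)) (G * C) F"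

text \<open>Rows \<open>[C H]\<close> and \<open>[C 0]\<close>, the two lower blocks having no rows.\<close>
definition blockC :: "real mat \<Rightarrow> real mat \<Rightarrow> real mat" where
  "blockC H C = four_block_mat C H (0\<^sub>m 0 (dim_col C)) (0\<^sub>m 0 (dim_col H))"

definition blockD :: "real mat \<Rightarrow> real mat \<Rightarrow> real mat" where
  "blockD H C = blockC (0\<^sub>m 1 (dim_col H)) C"

definition innov_var :: "real mat \<Rightarrow> real mat \<Rightarrow> real" where
  "innov_var CC S = (CC * S * CC\<^sup>T) $$ (0,0) + 1"

definition kalman_gain :: "real mat \<Rightarrow> real mat \<Rightarrow> real mat \<Rightarrow> real mat" where
  "kalman_gain AA CC S = (1 / innov_var CC S) \<cdot>\<^sub>m (AA * S * CC\<^sup>T)"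

definition riccati_map :: "real mat \<Rightarrow> real mat \<Rightarrow> real mat \<Rightarrow> real mat" where
  "riccati_map AA CC S =
     AA * S * AA\<^sup>T - (1 / innov_var CC S) \<cdot>\<^sub>m (AA * S * CC\<^sup>T * CC * S * AA\<^sup>T)"

primrec riccati_seq :: "real mat \<Rightarrow> real mat \<Rightarrow> real mat \<Rightarrow> nat \<Rightarrow> real mat" where
  "riccati_seq AA CC S0 0 = S0"
| "riccati_seq AA CC S0 (Suc t) = riccati_map AA CC (riccati_seq AA CC S0 t)"

text \<open>As for any Riccati equation of a covariance, solutions are understood to be symmetric.\<close>
definition stabilizing_solution :: "real mat \<Rightarrow> real mat \<Rightarrow> real mat \<Rightarrow> bool" where
  "stabilizing_solution AA CC S \<longleftrightarrow>
     S \<in> carrier_mat (dim_row AA) (dim_row AA) \<and> S\<^sup>T = S \<and> S = riccati_map AA CC S \<and>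
     stable_mat (AA - kalman_gain AA CC S * CC)"

definition Sigma_inf :: "real mat \<Rightarrow> real mat \<Rightarrow> real mat" where
  "Sigma_inf AA CC = (THE S. stabilizing_solution AA CC S)"

text \<open>The steady-state system \<open>X(t+1) = (AA - L CC) X(t) - L N(t)\<close>, \<open>e(t) = CC X(t) + N(t)\<close>,
  as a transfer function from \<open>N\<close> to \<open>e\<close>.\<close>
definition sensitivity :: "real mat \<Rightarrow> real mat \<Rightarrow> complex \<Rightarrow> complex" where
  "sensitivity AA CC =
     (let L = kalman_gain AA CC (Sigma_inf AA CC) in ss_tf (AA - L * CC) (- L) CC 1)"

section \<open>Signals of the coding structure\<close>

text \<open>The signals are causal functions of the message \<open>w\<close> and of the noise path \<open>v\<close>. The state is
  the tuple of \<open>x\<close>, \<open>s\<close> and their estimates.\<close>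

type_synonym cstate = "real vec \<times> real vec \<times> real vec \<times> real vec"

fun sig_u :: "real mat \<Rightarrow> cstate \<Rightarrow> real" where
  "sig_u C (x, s, xh, sh) = (C *\<^sub>v x) $ 0 - (C *\<^sub>v xh) $ 0"

fun sig_y :: "real mat \<Rightarrow> real mat \<Rightarrow> cstate \<Rightarrow> real \<Rightarrow> real" where
  "sig_y H C (x, s, xh, sh) v = (H *\<^sub>v s) $ 0 + sig_u C (x, s, xh, sh) + v"

fun sig_e :: "real mat \<Rightarrow> real mat \<Rightarrow> cstate \<Rightarrow> real \<Rightarrow> real" where
  "sig_e H C (x, s, xh, sh) v = sig_y H C (x, s, xh, sh) v - (H *\<^sub>v sh) $ 0"

definition gain_t :: "real mat \<Rightarrow> real mat \<Rightarrow> real mat \<Rightarrow> real mat \<Rightarrow> real mat \<Rightarrow> nat \<Rightarrow> real mat" where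
  "gain_t F G H A C t =
     (let k = dim_row A; m = dim_row F; AA = blockA F G A C; CC = blockC H C
      in kalman_gain AA CC
           (riccati_seq AA CC (four_block_mat (1\<^sub>m k) (0\<^sub>m k m) (0\<^sub>m m k) (0\<^sub>m m m)) t))"

definition gain1 :: "real mat \<Rightarrow> real mat \<Rightarrow> real mat \<Rightarrow> real mat \<Rightarrow> real mat \<Rightarrow> nat \<Rightarrow> real vec" where
  "gain1 F G H A C t = vec (dim_row A) (\<lambda>i. gain_t F G H A C t $$ (i, 0))"

definition gain2 :: "real mat \<Rightarrow> real mat \<Rightarrow> real mat \<Rightarrow> real mat \<Rightarrow> real mat \<Rightarrow> nat \<Rightarrow> real vec" where
  "gain2 F G H A C t = vec (dim_row F) (\<lambda>i. gain_t F G H A C t $$ (dim_row A + i, 0))"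

fun cstep :: "real mat \<Rightarrow> real mat \<Rightarrow> real mat \<Rightarrow> real mat \<Rightarrow> real mat \<Rightarrow> nat \<Rightarrow> real \<Rightarrow> cstate \<Rightarrow> cstate" where
  "cstep F G H A C t v (x, s, xh, sh) =
     (let u = sig_u C (x, s, xh, sh); e = sig_e H C (x, s, xh, sh) v
      in (A *\<^sub>v x,
          F *\<^sub>v s + u \<cdot>\<^sub>v col G 0,
          A *\<^sub>v xh + e \<cdot>\<^sub>v gain1 F G H A C t,
          F *\<^sub>v sh + e \<cdot>\<^sub>v gain2 F G H A C t))"

primrec cstate_at ::
  "real mat \<Rightarrow> real mat \<Rightarrow> real mat \<Rightarrow> real mat \<Rightarrow> real mat \<Rightarrow> (nat \<Rightarrow> real) \<Rightarrow> (nat \<Rightarrow> real) \<Rightarrow> nat \<Rightarrow> cstate"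
where
  "cstate_at F G H A C w v 0 =
     (vec (dim_row A) w, 0\<^sub>v (dim_row F), 0\<^sub>v (dim_row A), 0\<^sub>v (dim_row F))"
| "cstate_at F G H A C w v (Suc t) = cstep F G H A C t (v t) (cstate_at F G H A C w v t)"

context
  fixes F G H A C :: "real mat"
    and W N :: "nat \<Rightarrow> 'a \<Rightarrow> real"
begin

definition proc_state :: "nat \<Rightarrow> 'a \<Rightarrow> cstate" where
  "proc_state t \<omega> = cstate_at F G H A C (\<lambda>i. W i \<omega>) (\<lambda>i. N i \<omega>) t"

definition proc_u :: "nat \<Rightarrow> 'a \<Rightarrow> real" where
  "proc_u t \<omega> = sig_u C (proc_state t \<omega>)"

definition proc_y :: "nat \<Rightarrow> 'a \<Rightarrow> real" where
  "proc_y t \<omega> = sig_y H C (proc_state t \<omega>) (N t \<omega>)"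

definition proc_e :: "nat \<Rightarrow> 'a \<Rightarrow> real" where
  "proc_e t \<omega> = sig_e H C (proc_state t \<omega>) (N t \<omega>)"

end

section \<open>Random vectors\<close>

text \<open>The random vector of \<open>X k\<close>, \<open>k \<le> T\<close>. Its values lie in the product space over the index
  set \<open>{..T}\<close>, which has \<open>T + 1\<close> elements.\<close>
definition rv_upto :: "(nat \<Rightarrow> 'a \<Rightarrow> real) \<Rightarrow> nat \<Rightarrow> 'a \<Rightarrow> nat \<Rightarrow> real" where
  "rv_upto X T \<omega> = (\<lambda>k\<in>{..T}. X k \<omega>)"

abbreviation borel_upto :: "nat \<Rightarrow> (nat \<Rightarrow> real) measure" where
  "borel_upto T \<equiv> \<Pi>\<^sub>M k\<in>{..T}. borel"

abbreviation lborel_upto :: "nat \<Rightarrow> (nat \<Rightarrow> real) measure" where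
  "lborel_upto T \<equiv> \<Pi>\<^sub>M k\<in>{..T}. lborel"

text \<open>\<open>W\<close> is \<open>\<N>(0, I)\<close> of dimension \<open>n + 1\<close>, \<open>N\<close> is white Gaussian of unit variance, and both are
  independent.\<close>
definition message_and_noise ::
  "'a measure \<Rightarrow> nat \<Rightarrow> (nat \<Rightarrow> 'a \<Rightarrow> real) \<Rightarrow> (nat \<Rightarrow> 'a \<Rightarrow> real) \<Rightarrow> bool" where
  "message_and_noise M n W N \<longleftrightarrow>
     prob_space M \<and>
     prob_space.indep_var M (borel_upto n) (rv_upto W n) (\<Pi>\<^sub>M t\<in>UNIV. borel) (\<lambda>\<omega> t. N t \<omega>) \<and>
     distr M (borel_upto n) (rv_upto W n) = (\<Pi>\<^sub>M i\<in>{..n}. density lborel std_normal_density) \<and>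
     distr M (\<Pi>\<^sub>M t\<in>UNIV. borel) (\<lambda>\<omega> t. N t \<omega>) = (\<Pi>\<^sub>M t\<in>UNIV. density lborel std_normal_density)"

text \<open>\<open>I(X^n; Y^T)\<close> and \<open>h(X^T)\<close> in bits.\<close>
definition mutual_info ::
  "'a measure \<Rightarrow> nat \<Rightarrow> (nat \<Rightarrow> 'a \<Rightarrow> real) \<Rightarrow> nat \<Rightarrow> (nat \<Rightarrow> 'a \<Rightarrow> real) \<Rightarrow> real" where
  "mutual_info M n X T Y =
     prob_space.mutual_information M 2 (borel_upto n) (borel_upto T) (rv_upto X n) (rv_upto Y T)"

definition diff_entropy :: "'a measure \<Rightarrow> nat \<Rightarrow> (nat \<Rightarrow> 'a \<Rightarrow> real) \<Rightarrow> real" where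
  "diff_entropy M T X = prob_space.entropy M 2 (lborel_upto T) (rv_upto X T)"

definition has_entropy_rate :: "'a measure \<Rightarrow> (nat \<Rightarrow> 'a \<Rightarrow> real) \<Rightarrow> real \<Rightarrow> bool" where
  "has_entropy_rate M X h \<longleftrightarrow> (\<lambda>T. diff_entropy M T X / (real T + 1)) \<longlonglongrightarrow> h"

section \<open>The feedback-free estimation problem\<close>

text \<open>\<open>est_obs h A C n W N T t\<close> is entry \<open>t \<le> T\<close> of the observation at horizon \<open>T\<close>, where \<open>h\<close> is the
  impulse response of the channel.\<close>
definition est_obs ::
  "(nat \<Rightarrow> real) \<Rightarrow> real mat \<Rightarrow> real mat \<Rightarrow> nat \<Rightarrow> (nat \<Rightarrow> 'a \<Rightarrow> real) \<Rightarrow> (nat \<Rightarrow> 'a \<Rightarrow> real) \<Rightarrow> nat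
    \<Rightarrow> nat \<Rightarrow> 'a \<Rightarrow> real" where
  "est_obs h A C n W N T t \<omega> =
     (let r = vec (T + 1) (\<lambda>i. (C *\<^sub>v (A ^\<^sub>m i *\<^sub>v vec (n + 1) (\<lambda>j. W j \<omega>))) $ 0)
      in (mat_inv (toeplitz h T) *\<^sub>v r) $ t + N t \<omega>)"

text \<open>Error covariance of the conditional mean \<open>E[W | Y^T]\<close>.\<close>
definition MSE ::
  "'a measure \<Rightarrow> nat \<Rightarrow> (nat \<Rightarrow> 'a \<Rightarrow> real) \<Rightarrow> nat \<Rightarrow> (nat \<Rightarrow> 'a \<Rightarrow> real) \<Rightarrow> real mat" where
  "MSE M n W T Y =
     (let What = (\<lambda>i. real_cond_exp M (vimage_algebra (space M) (rv_upto Y T) (borel_upto T)) (W i))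
      in mat (n + 1) (n + 1)
           (\<lambda>(i, j). \<integral>\<omega>. (W i \<omega> - What i \<omega>) * (W j \<omega> - What j \<omega>) \<partial>M))"

text \<open>Densities are only determined up to null sets, so the gradient in the Fisher information
  needs a version: the continuous one, which is unique on the underlying space.\<close>
definition joint_density ::
  "'a measure \<Rightarrow> nat \<Rightarrow> (nat \<Rightarrow> 'a \<Rightarrow> real) \<Rightarrow> nat \<Rightarrow> (nat \<Rightarrow> 'a \<Rightarrow> real)
    \<Rightarrow> (nat \<Rightarrow> real) \<times> (nat \<Rightarrow> real) \<Rightarrow> real" where
  "joint_density M n W T Y =
     (SOME p. distributed M (lborel_upto T \<Otimes>\<^sub>M lborel_upto n) (\<lambda>\<omega>. (rv_upto Y T \<omega>, rv_upto W n \<omega>))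
                (\<lambda>z. ennreal (p z)) \<and>
              continuous_on (space (lborel_upto T) \<times> space (lborel_upto n)) p)"

definition score ::
  "'a measure \<Rightarrow> nat \<Rightarrow> (nat \<Rightarrow> 'a \<Rightarrow> real) \<Rightarrow> nat \<Rightarrow> (nat \<Rightarrow> 'a \<Rightarrow> real) \<Rightarrow> nat \<Rightarrow> 'a \<Rightarrow> real" where
  "score M n W T Y i \<omega> =
     deriv (\<lambda>c. ln (joint_density M n W T Y (rv_upto Y T \<omega>, (rv_upto W n \<omega>)(i := c)))) (W i \<omega>)"

definition fisher_info ::
  "'a measure \<Rightarrow> nat \<Rightarrow> (nat \<Rightarrow> 'a \<Rightarrow> real) \<Rightarrow> nat \<Rightarrow> (nat \<Rightarrow> 'a \<Rightarrow> real) \<Rightarrow> real mat" where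
  "fisher_info M n W T Y =
     mat (n + 1) (n + 1) (\<lambda>(i, j). \<integral>\<omega>. score M n W T Y i \<omega> * score M n W T Y j \<omega> \<partial>M)"

definition CRB ::
  "'a measure \<Rightarrow> nat \<Rightarrow> (nat \<Rightarrow> 'a \<Rightarrow> real) \<Rightarrow> nat \<Rightarrow> (nat \<Rightarrow> 'a \<Rightarrow> real) \<Rightarrow> real mat" where
  "CRB M n W T Y = mat_inv (fisher_info M n W T Y)"

end

(* All quantities are governed by the recursive least squares problem of estimating the message w from
   the rows g(t) w + v(t), g(t) = CC AA^t E, where E embeds the message into the joint state of source
   and channel. Its precision J(t) = I + sum_{s<t} g(s)' g(s) satisfies det J(t) = prod_{s<t} K(s), where
   K(s) is the variance of the innovation e(s); both y and the feedback-free observation are causal,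
   causally invertible linear functions of the innovations. The joint Gaussian density factors into the
   density of the estimation error and that of the independent innovations; hence I(W; y^T) and, up to
   the constant log (2 pi e) / 2 per sample, h(e^T) equal half the sum of the log K(s), while the Fisher
   information is J(T + 1) and MSE and CRB are its inverse.

   In closed form the Riccati iterates are AA^t E J(t)^-1 E' AA'^t. Triangularizing A so that the
   unstable eigenvalues a_i come first, with matrix U on the unstable subspace, turns J(t), after
   rescaling the unstable coordinates by U^-t, into a convergent sequence. So the iterates converge to
   the stabilizing solution and K(t) tends to |det U|^2 = DI(A)^2; Cesaro means give all the rates. In
   the sensitivity function, the ratio of the open and closed loop characteristic polynomials, stable
   factors contribute 0 to the integral (mean value property of ln |1 - b/z|) and an unstable factor
   contributes log |a_i|. *)

theory Submission
  imports Defs "HOL-Complex_Analysis.Complex_Analysis"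
    "Jordan_Normal_Form.Spectral_Radius" "Jordan_Normal_Form.Schur_Decomposition"
begin

hide_const (open) Determinants.det
unbundle no vec_syntax
no_notation fps_nth (infixl "$" 75)

text \<open>The initial covariance \<open>E * E\<^sup>T\<close> may be singular and
  \<open>AA\<close> unstable: in the closed form of the iterates the outer factors grow while the
  inverse precision shrinks. Inserting the rescaling \<open>NN t\<close> between them balances both,
  and everything then rests on the limit of the rescaled precision being nonsingular. In that limit
  the unstable coordinates are seen backwards from the horizon, through the rows
  \<open>cc * Ui ^\<^sub>m j\<close>, so a null vector would produce an unstable eigenvector of
  \<open>AA\<close> invisible to \<open>CC\<close>. Here the channel enters: such a mode needs a
  zero of the inverse channel outside the unit disc, that is an unstable pole of the channel. On the
  probabilistic side no Gaussian integral with a matrix in the exponent is evaluated. All maps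
  between noise, innovations and observations are unit lower triangular, hence preserve Lebesgue
  measure, and the normalization of the error density follows from total mass one.\<close>

section \<open>Matrix algebra: inverses and determinants\<close>

lemma index_mult_mat_sum:
  assumes "A \<in> carrier_mat nr n" "B \<in> carrier_mat n nc" "i < nr" "j < nc"
  shows "(A * B) $$ (i,j) = (\<Sum>k<n. A $$ (i,k) * B $$ (k,j))"
  using assms by (simp add: scalar_prod_def atLeast0LessThan)

lemma index_mult_vec_sum:
  assumes "A \<in> carrier_mat nr n" "v \<in> carrier_vec n" "i < nr"
  shows "(A *\<^sub>v v) $ i = (\<Sum>k<n. A $$ (i,k) * v $ k)"
  using assms by (simp add: scalar_prod_def atLeast0LessThan)

text \<open>A nonzero determinant makes the matrix a unit of the matrix ring, so Gauss-Jordan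
  elimination returns \<open>Some\<close> and the \<open>the\<close> in \<open>mat_inv\<close> is
  well defined.\<close>

lemma mat_inv_inverse:
  fixes A :: "'a :: field mat"
  assumes "A \<in> carrier_mat n n" "det A \<noteq> 0"
  shows "mat_inv A \<in> carrier_mat n n" "A * mat_inv A = 1\<^sub>m n" "mat_inv A * A = 1\<^sub>m n"
proof -
  have "A \<in> Units (ring_mat TYPE('a) n undefined)"
    by (rule det_non_zero_imp_unit[OF assms])
  then obtain B where "mat_inverse A = Some B"
    using mat_inverse(1)[OF assms(1), where b = undefined] by (cases "mat_inverse A") auto
  with mat_inverse(2)[OF assms(1) this]
  show "mat_inv A \<in> carrier_mat n n" "A * mat_inv A = 1\<^sub>m n" "mat_inv A * A = 1\<^sub>m n"
    by (auto simp: mat_inv_def)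
qed

lemma mat_inv_unique:
  fixes A :: "'a :: field mat"
  assumes A: "A \<in> carrier_mat n n" and B: "B \<in> carrier_mat n n" and AB: "A * B = 1\<^sub>m n"
  shows "det A \<noteq> 0" "mat_inv A = B"
proof -
  have "det A * det B = 1" using det_mult[OF A B] AB by simp
  then show d: "det A \<noteq> 0" by auto
  note inv = mat_inv_inverse[OF A d]
  have "mat_inv A = mat_inv A * (A * B)" using AB inv by simp
  also have "\<dots> = B" using assoc_mult_mat[OF inv(1) A B] inv B by simp
  finally show "mat_inv A = B" .
qed

lemma det_mat_inv:
  fixes A :: "'a :: field mat"
  assumes "A \<in> carrier_mat n n" "det A \<noteq> 0"
  shows "det (mat_inv A) = inverse (det A)"
proof -
  note inv = mat_inv_inverse[OF assms]
  have "det A * det (mat_inv A) = 1" using det_mult[OF assms(1) inv(1)] inv by simp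
  then show ?thesis using assms(2) by (simp add: field_simps)
qed

text \<open>The determinant of the bordered matrix \<open>?M\<close> is computed twice: multiplying
  by \<open>?P\<close> clears its row \<open>w\<close> and leaves \<open>B + u * w\<close>, whereas
  splitting off \<open>?Q\<close> leaves \<open>B\<close> together with a scalar Schur
  complement.\<close>

lemma det_add_rank_one:
  fixes B :: "'a :: field mat"
  assumes B: "B \<in> carrier_mat n n" and u: "u \<in> carrier_mat n 1" and w: "w \<in> carrier_mat 1 n"
    and d: "det B \<noteq> 0"
  shows "det (B + u * w) = det B * (1 + (w * mat_inv B * u) $$ (0,0))"
proof -
  note inv = mat_inv_inverse[OF B d]
  let ?M = "four_block_mat B (- u) w (1\<^sub>m 1)"
  let ?P = "four_block_mat (1\<^sub>m n) (0\<^sub>m n 1) (- w) (1\<^sub>m 1)"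
  let ?Q = "four_block_mat (1\<^sub>m n) (0\<^sub>m n 1) (w * mat_inv B) (1\<^sub>m 1)"
  let ?R = "four_block_mat B (- u) (0\<^sub>m 1 n) (1\<^sub>m 1 + w * mat_inv B * u)"
  have car: "?M \<in> carrier_mat (n+1) (n+1)" "?P \<in> carrier_mat (n+1) (n+1)"
    "?Q \<in> carrier_mat (n+1) (n+1)" "?R \<in> carrier_mat (n+1) (n+1)"
    using B u w inv by auto
  have "?M * ?P = four_block_mat (B + u * w) (- u) (0\<^sub>m 1 n) (1\<^sub>m 1)"
    by (subst mult_four_block_mat[OF B _ w _ _ _ _]) (use B u w in auto)
  moreover have "det ?P = 1"
    by (subst det_four_block_mat_upper_right_zero) (use w in auto)
  moreover have "det (four_block_mat (B + u * w) (- u) (0\<^sub>m 1 n) (1\<^sub>m 1)) = det (B + u * w)"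
    by (subst det_four_block_mat_lower_left_zero) (use B u w in auto)
  ultimately have 1: "det ?M = det (B + u * w)" using det_mult[OF car(1,2)] by simp
  have "w * mat_inv B * B = w" using assoc_mult_mat[OF w inv(1) B] inv w by simp
  moreover have "w * mat_inv B * - u = - (w * mat_inv B * u)"
    by (rule uminus_mult_right_mat) (use w u inv in auto)
  moreover have "- (w * mat_inv B * u) + (1\<^sub>m 1 + w * mat_inv B * u) = 1\<^sub>m 1"
    by (rule eq_matI) (use w u inv in auto)
  ultimately have "?Q * ?R = ?M"
    by (subst mult_four_block_mat[of _ n n _ 1 _ 1 _ _ n _ 1])
       (use B u w inv in auto)
  moreover have "det ?Q = 1"
    by (subst det_four_block_mat_upper_right_zero) (use w inv in auto)
  moreover have "det ?R = det B * det (1\<^sub>m 1 + w * mat_inv B * u)"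
    by (subst det_four_block_mat_lower_left_zero) (use B u w inv in auto)
  moreover have "det (1\<^sub>m 1 + w * mat_inv B * u) = 1 + (w * mat_inv B * u) $$ (0,0)"
    by (subst det_single) (use w u inv in auto)
  ultimately show ?thesis using det_mult[OF car(3,4)] 1 by simp
qed

lemma smult_mat_mult_vec:
  fixes A :: "'a :: comm_ring_1 mat"
  assumes "A \<in> carrier_mat nr n" "v \<in> carrier_vec n"
  shows "(c \<cdot>\<^sub>m A) *\<^sub>v v = c \<cdot>\<^sub>v (A *\<^sub>v v)"
proof (rule eq_vecI)
  fix i assume "i < dim_vec (c \<cdot>\<^sub>v (A *\<^sub>v v))"
  then have i: "i < nr" using assms by simp
  then show "((c \<cdot>\<^sub>m A) *\<^sub>v v) $ i = (c \<cdot>\<^sub>v (A *\<^sub>v v)) $ i"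
    using assms index_mult_vec_sum[OF _ assms(2) i, of "c \<cdot>\<^sub>m A"] index_mult_vec_sum[OF assms i]
    by (auto simp: sum_distrib_left mult.assoc intro!: sum.cong)
qed (use assms in auto)

section \<open>Entrywise convergence of matrices\<close>

text \<open>Dimensions are not part of the type, so the carrier is recorded along with the entrywise
  limits.\<close>

definition mat_tendsto :: "nat \<Rightarrow> nat \<Rightarrow> (nat \<Rightarrow> 'a :: real_normed_field mat) \<Rightarrow> 'a mat \<Rightarrow> bool" where
  "mat_tendsto nr nc X L \<longleftrightarrow> L \<in> carrier_mat nr nc \<and> (\<forall>t. X t \<in> carrier_mat nr nc) \<and>
     (\<forall>i<nr. \<forall>j<nc. (\<lambda>t. X t $$ (i,j)) \<longlonglongrightarrow> L $$ (i,j))"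

lemma mat_tendsto_const: "L \<in> carrier_mat nr nc \<Longrightarrow> mat_tendsto nr nc (\<lambda>t. L) L"
  by (auto simp: mat_tendsto_def)

lemma mat_tendsto_entry:
  "mat_tendsto nr nc X L \<Longrightarrow> i < nr \<Longrightarrow> j < nc \<Longrightarrow> (\<lambda>t. X t $$ (i,j)) \<longlonglongrightarrow> L $$ (i,j)"
  by (auto simp: mat_tendsto_def)

lemma mat_tendsto_carrier:
  "mat_tendsto nr nc X L \<Longrightarrow> L \<in> carrier_mat nr nc" "mat_tendsto nr nc X L \<Longrightarrow> X t \<in> carrier_mat nr nc"
  by (auto simp: mat_tendsto_def)

lemma mat_tendsto_add:
  assumes "mat_tendsto nr nc X L" "mat_tendsto nr nc Y K"
  shows "mat_tendsto nr nc (\<lambda>t. X t + Y t) (L + K)"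
proof -
  have "dim_row (X t) = nr" "dim_col (X t) = nc" "dim_row (Y t) = nr" "dim_col (Y t) = nc" for t
    using assms by (auto simp: mat_tendsto_def)
  then show ?thesis using assms by (auto simp: mat_tendsto_def intro!: tendsto_intros)
qed

lemma mat_tendsto_minus:
  assumes "mat_tendsto nr nc X L" "mat_tendsto nr nc Y K"
  shows "mat_tendsto nr nc (\<lambda>t. X t - Y t) (L - K)"
proof -
  have "dim_row (X t) = nr" "dim_col (X t) = nc" "dim_row (Y t) = nr" "dim_col (Y t) = nc" for t
    using assms by (auto simp: mat_tendsto_def)
  then show ?thesis using assms by (auto simp: mat_tendsto_def intro!: tendsto_intros)
qed

lemma mat_tendsto_mult:
  assumes "mat_tendsto nr n X L" "mat_tendsto n nc Y K"
  shows "mat_tendsto nr nc (\<lambda>t. X t * Y t) (L * K)"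
proof -
  have "(\<lambda>t. (X t * Y t) $$ (i,j)) \<longlonglongrightarrow> (L * K) $$ (i,j)" if ij: "i < nr" "j < nc" for i j
    unfolding index_mult_mat_sum[OF mat_tendsto_carrier(2)[OF assms(1)] mat_tendsto_carrier(2)[OF assms(2)] ij]
      index_mult_mat_sum[OF mat_tendsto_carrier(1)[OF assms(1)] mat_tendsto_carrier(1)[OF assms(2)] ij]
    by (intro tendsto_sum tendsto_mult mat_tendsto_entry[OF assms(1)] mat_tendsto_entry[OF assms(2)])
       (use ij in auto)
  then show ?thesis
    using mat_tendsto_carrier[OF assms(1)] mat_tendsto_carrier[OF assms(2)]
    unfolding mat_tendsto_def by (auto intro!: mult_carrier_mat simp del: index_mult_mat(1))
qed

lemma mat_tendsto_smult:
  assumes "f \<longlonglongrightarrow> c" "mat_tendsto nr nc X L"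
  shows "mat_tendsto nr nc (\<lambda>t. f t \<cdot>\<^sub>m X t) (c \<cdot>\<^sub>m L)"
proof -
  have "dim_row (X t) = nr" "dim_col (X t) = nc" for t
    using assms by (auto simp: mat_tendsto_def)
  then show ?thesis using assms by (auto simp: mat_tendsto_def intro!: tendsto_mult)
qed

lemma mat_tendsto_transpose:
  assumes "mat_tendsto nr nc X L"
  shows "mat_tendsto nc nr (\<lambda>t. (X t)\<^sup>T) (L\<^sup>T)"
proof -
  have "dim_row (X t) = nr" "dim_col (X t) = nc" for t
    using assms by (auto simp: mat_tendsto_def)
  then show ?thesis using assms by (auto simp: mat_tendsto_def)
qed

lemma mat_tendsto_det:
  assumes "mat_tendsto n n X L"
  shows "(\<lambda>t. det (X t)) \<longlonglongrightarrow> det L"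
proof -
  have d: "dim_row (X t) = n" "dim_col (X t) = n" "dim_row L = n" "dim_col L = n" for t
    using assms by (auto simp: mat_tendsto_def)
  have "p i < n" if "p permutes {0..<n}" "i < n" for p i
    using permutes_in_image[OF that(1), of i] that(2) by simp
  then show ?thesis unfolding det_def using d mat_tendsto_entry[OF assms]
    by (simp) (intro tendsto_sum tendsto_mult tendsto_prod tendsto_const, auto)
qed

text \<open>Cramer's formula reduces continuity of inversion to continuity of determinants, the
  cofactors being determinants of submatrices.\<close>

lemma mat_inv_adj_mat:
  fixes A :: "'a :: field mat"
  assumes A: "A \<in> carrier_mat n n" and d: "det A \<noteq> 0"
  shows "mat_inv A = (1 / det A) \<cdot>\<^sub>m adj_mat A"
proof (rule mat_inv_unique(2)[OF A])
  note adj = adj_mat[OF A]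
  show "1 / det A \<cdot>\<^sub>m adj_mat A \<in> carrier_mat n n" using adj by simp
  show "A * (1 / det A \<cdot>\<^sub>m adj_mat A) = 1\<^sub>m n"
    using mult_smult_distrib[OF A adj(1)] adj(2) d by (intro eq_matI) auto
qed

lemma mat_tendsto_mat_inv:
  assumes X: "mat_tendsto n n X L" and d: "\<And>t. det (X t) \<noteq> 0" "det L \<noteq> 0"
  shows "mat_tendsto n n (\<lambda>t. mat_inv (X t)) (mat_inv L)"
proof -
  have c: "L \<in> carrier_mat n n" "X t \<in> carrier_mat n n" for t
    using mat_tendsto_carrier[OF X] by auto
  have del: "mat_tendsto (n - 1) (n - 1) (\<lambda>t. mat_delete (X t) i j) (mat_delete L i j)" if "i < n" "j < n" for i j
  proof -
    have ii: "insert_index k i' < n" if "i' < n - 1" for k i'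
      using that by (auto simp: insert_index_def)
    have e: "mat_delete B i j $$ (i',j') = B $$ (insert_index i i', insert_index j j')"
      if "i' < n - 1" "j' < n - 1" "B \<in> carrier_mat n n" for i' j' and B :: "'a mat"
      using that by (auto simp: mat_delete_def insert_index_def)
    show ?thesis unfolding mat_tendsto_def
    proof (intro conjI allI impI)
      show "mat_delete L i j \<in> carrier_mat (n-1) (n-1)" "mat_delete (X t) i j \<in> carrier_mat (n-1) (n-1)" for t
        using mat_delete_carrier[OF c(1)] mat_delete_carrier[OF c(2)] by auto
      fix i' j' assume "i' < n - 1" "j' < n - 1"
      then show "(\<lambda>t. mat_delete (X t) i j $$ (i',j')) \<longlonglongrightarrow> mat_delete L i j $$ (i',j')"
        using e c mat_tendsto_entry[OF X] ii by simp
    qed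
  qed
  have "mat_tendsto n n (\<lambda>t. adj_mat (X t)) (adj_mat L)"
    unfolding mat_tendsto_def
  proof (intro conjI allI impI)
    show "adj_mat L \<in> carrier_mat n n" "adj_mat (X t) \<in> carrier_mat n n" for t
      using adj_mat(1) c by auto
    fix i j assume "i < n" "j < n"
    then show "(\<lambda>t. adj_mat (X t) $$ (i,j)) \<longlonglongrightarrow> adj_mat L $$ (i,j)"
      using c(1) carrier_matD[OF c(2)] mat_tendsto_det[OF del[of j i]]
      by (auto simp: adj_mat_def cofactor_def intro!: tendsto_mult)
  qed
  then show ?thesis
    unfolding mat_inv_adj_mat[OF c(2) d(1)] mat_inv_adj_mat[OF c(1) d(2)]
    by (intro mat_tendsto_smult tendsto_divide tendsto_const mat_tendsto_det[OF X] d)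
qed

section \<open>Powers of stable matrices and invariant subspaces\<close>

lemma pow_smult_mat:
  fixes A :: "'a :: field mat"
  assumes A: "A \<in> carrier_mat n n"
  shows "(c \<cdot>\<^sub>m A) ^\<^sub>m k = c ^ k \<cdot>\<^sub>m (A ^\<^sub>m k)"
proof (induction k)
  case (Suc k)
  have "A ^\<^sub>m k \<in> carrier_mat n n" using A by simp
  then have "c ^ k \<cdot>\<^sub>m A ^\<^sub>m k * (c \<cdot>\<^sub>m A) = (c * c ^ k) \<cdot>\<^sub>m (A ^\<^sub>m k * A)"
    using A mult_smult_distrib[of "c ^ k \<cdot>\<^sub>m A ^\<^sub>m k" n n A n c]
      mult_smult_assoc_mat[of "A ^\<^sub>m k" n n A n "c ^ k"] by (intro eq_matI) (auto simp: mult_ac)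
  with Suc show ?case by simp
qed (use A in \<open>auto intro!: eq_matI\<close>)

text \<open>Stretching by \<open>1 / r\<close>, with \<open>r\<close> strictly between the spectral
  radius and 1, keeps all eigenvalues in the open disc. The powers of the stretched matrix are
  therefore bounded, and undoing the stretch yields the rate \<open>r\<close>.\<close>

lemma stable_power_bound:
  fixes A :: "complex mat"
  assumes A: "A \<in> carrier_mat n n" and st: "\<And>a. eigenvalue A a \<Longrightarrow> cmod a < 1"
  obtains c r where "0 < r" "r < 1" "0 \<le> c"
    "\<And>k i j. i < n \<Longrightarrow> j < n \<Longrightarrow> cmod ((A ^\<^sub>m k) $$ (i,j)) \<le> c * r ^ k"
proof -
  \<comment> \<open>The inserted 0 keeps the maximum defined for an empty spectrum.\<close>
  define s where "s = Max (insert 0 (cmod ` spectrum A))"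
  have fin: "finite (spectrum A)" using card_finite_spectrum[OF A] by simp
  have s: "0 \<le> s" "s < 1" unfolding s_def using fin st by (auto simp: spectrum_def)
  have sb: "cmod a \<le> s" if "eigenvalue A a" for a
    unfolding s_def using that fin by (intro Max_ge) (auto simp: spectrum_def)
  define r where "r = (s + 1) / 2"
  have r: "0 < r" "r < 1" "s < r" using s by (auto simp: r_def)
  define B where "B = (1 / complex_of_real r) \<cdot>\<^sub>m A"
  have B: "B \<in> carrier_mat n n" using A by (simp add: B_def)
  from char_poly_factorized[OF B] obtain bs where bs: "char_poly B = (\<Prod>b\<leftarrow>bs. [:- b, 1:])" by auto
  have lt: "norm b < 1" if "b \<in> set bs" for b
  proof -
    have "eigenvalue B b"
      using eigenvalue_root_char_poly[OF B] linear_poly_root[OF that] bs by simp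
    then obtain v where v: "v \<in> carrier_vec n" "v \<noteq> 0\<^sub>v n" "B *\<^sub>v v = b \<cdot>\<^sub>v v"
      using B by (auto simp: eigenvalue_def eigenvector_def)
    have "A = complex_of_real r \<cdot>\<^sub>m B" unfolding B_def using r by (intro eq_matI) auto
    then have "A *\<^sub>v v = complex_of_real r \<cdot>\<^sub>v (B *\<^sub>v v)"
      using smult_mat_mult_vec[OF B v(1)] by simp
    then have "A *\<^sub>v v = (complex_of_real r * b) \<cdot>\<^sub>v v"
      using v(3) by (simp add: smult_smult_assoc)
    then have "eigenvalue A (complex_of_real r * b)"
      using A v by (auto simp: eigenvalue_def eigenvector_def)
    from sb[OF this] r have "r * cmod b < r * 1"
      unfolding norm_mult norm_of_real by linarith
    then show ?thesis using r(1) mult_less_cancel_left_pos by blast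
  qed
  \<comment> \<open>No eigenvalue of \<open>B\<close> has modulus 1, so the multiplicity bound 0 is
    allowed. The exponent \<open>0 - 1\<close> is 0 on the naturals, which makes the bound constant
    in \<open>k\<close>.\<close>
  have "\<exists>c1 c2. \<forall>k. norm_bound (B ^\<^sub>m k) (c1 + c2 * of_nat k ^ (0 - 1))"
    by (rule factored_char_poly_norm_bound[OF B bs jordan_nf_exists[OF B bs]])
       (use lt in \<open>force intro: less_imp_le\<close>)+
  then obtain c where c: "norm_bound (B ^\<^sub>m k) c" for k by auto
  have "cmod ((A ^\<^sub>m k) $$ (i,j)) \<le> \<bar>c\<bar> * r ^ k" if ij: "i < n" "j < n" for k i j
  proof -
    have "norm ((B ^\<^sub>m k) $$ (i,j)) \<le> c"
      using c[of k] ij B by (auto simp: norm_bound_def)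
    moreover have "norm ((B ^\<^sub>m k) $$ (i,j)) = cmod ((A ^\<^sub>m k) $$ (i,j)) / r ^ k"
      unfolding B_def pow_smult_mat[OF A] using ij A r by (simp add: norm_mult norm_power norm_divide power_one_over)
    ultimately show ?thesis using r by (simp add: field_simps) (smt (verit) mult_right_mono zero_less_power)
  qed
  then show thesis using that[of r "\<bar>c\<bar>"] r by auto
qed

text \<open>The leading columns \<open>V\<close> of the Schur basis span the invariant subspace
  belonging to \<open>es1\<close>. The matrix \<open>L\<close>, taken from the inverse basis,
  witnesses their independence.\<close>

lemma schur_leading_block:
  fixes A :: "complex mat"
  assumes A: "A \<in> carrier_mat n n"
    and cp: "char_poly A = (\<Prod>e\<leftarrow>es1 @ es2. [:- e, 1:])"
  obtains V U L where "V \<in> carrier_mat n (length es1)" "U \<in> carrier_mat (length es1) (length es1)"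
    "L \<in> carrier_mat (length es1) n" "upper_triangular U" "diag_mat U = es1"
    "A * V = V * U" "L * V = 1\<^sub>m (length es1)"
proof -
  define p where "p = length es1"
  obtain B P Q where "schur_decomposition A (es1 @ es2) = (B, P, Q)" by (metis prod_cases3)
  from schur_decomposition[OF A cp this]
  have sim: "similar_mat_wit A B P Q" and ut: "upper_triangular B" and dB: "diag_mat B = es1 @ es2"
    by auto
  note w = similar_mat_witD2[OF A sim]
  have "length (diag_mat B) = n" using w by (simp add: diag_mat_def)
  then have pn: "p \<le> n" using dB by (simp add: p_def)
  define V where "V = mat n p (\<lambda>(i,j). P $$ (i,j))"
  define U where "U = mat p p (\<lambda>(i,j). B $$ (i,j))"
  define L where "L = mat p n (\<lambda>(i,j). Q $$ (i,j))"
  have AP: "A * P = P * B"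
  proof -
    have "A * P = P * B * (Q * P)" using w by (simp add: assoc_mult_mat[of _ n n _ n _ n])
    then show ?thesis using w by simp
  qed
  show thesis
  proof
    show "V \<in> carrier_mat n (length es1)" "U \<in> carrier_mat (length es1) (length es1)"
      "L \<in> carrier_mat (length es1) n" by (auto simp: V_def U_def L_def p_def)
    show "upper_triangular U" using ut pn carrier_matD[OF w(5)] unfolding upper_triangular_def by (auto simp: U_def)
    show "diag_mat U = es1"
    proof (rule nth_equalityI)
      fix i assume "i < length (diag_mat U)"
      then have i: "i < p" by (simp add: diag_mat_def U_def)
      then have "diag_mat B ! i = B $$ (i,i)" using pn w by (simp add: diag_mat_def)
      then show "diag_mat U ! i = es1 ! i" using i dB pn
        by (simp add: diag_mat_def U_def nth_append p_def)
    qed (simp add: diag_mat_def U_def p_def)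
    show "A * V = V * U"
    proof (rule eq_matI)
      fix i j assume "i < dim_row (V * U)" "j < dim_col (V * U)"
      then have ij: "i < n" "j < p" by (auto simp: V_def U_def)
      have jn: "j < n" using ij pn by simp
      have Vc: "V \<in> carrier_mat n p" "U \<in> carrier_mat p p" by (auto simp: V_def U_def)
      have "(A * V) $$ (i,j) = (A * P) $$ (i,j)"
        unfolding index_mult_mat_sum[OF A Vc(1) ij] index_mult_mat_sum[OF A w(6) ij(1) jn]
        using ij by (simp add: V_def)
      also have "\<dots> = (\<Sum>k<n. P $$ (i,k) * B $$ (k,j))"
        unfolding AP index_mult_mat_sum[OF w(6) w(5) ij(1) jn] ..
      \<comment> \<open>Below the diagonal \<open>B\<close> vanishes, so a column
        \<open>j < p\<close> involves only the first \<open>p\<close> basis vectors.\<close>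
      also have "\<dots> = (\<Sum>k<p. P $$ (i,k) * B $$ (k,j))"
        by (rule sum.mono_neutral_right) (use ij pn ut carrier_matD[OF w(5)] in \<open>auto simp: not_less upper_triangular_def\<close>)
      also have "\<dots> = (V * U) $$ (i,j)"
        unfolding index_mult_mat_sum[OF Vc ij] using ij pn by (simp add: V_def U_def)
      finally show "(A * V) $$ (i,j) = (V * U) $$ (i,j)" .
    qed (use A in \<open>auto simp: V_def U_def\<close>)
    show "L * V = 1\<^sub>m (length es1)"
    proof (rule eq_matI)
      fix i j assume "i < dim_row (1\<^sub>m (length es1))" "j < dim_col (1\<^sub>m (length es1))"
      then have ij: "i < p" "j < p" by (auto simp: p_def)
      have "(L * V) $$ (i,j) = (Q * P) $$ (i,j)"
        using ij pn index_mult_mat_sum[of L p n V p i j] index_mult_mat_sum[of Q n n P n i j] w(6,7)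
        by (auto simp: V_def L_def)
      then show "(L * V) $$ (i,j) = 1\<^sub>m (length es1) $$ (i,j)" using w ij pn by (simp add: p_def)
    qed (auto simp: L_def V_def p_def)
  qed
qed

lemma upper_triangular_eigenvalue:
  fixes U :: "complex mat"
  assumes U: "U \<in> carrier_mat p p" "upper_triangular U" and "eigenvalue U a"
  shows "a \<in> set (diag_mat U)"
proof -
  have "poly (char_poly U) a = 0" using assms eigenvalue_root_char_poly by blast
  then have "poly (\<Prod>e\<leftarrow>diag_mat U. [:- e, 1:]) a = 0"
    using char_poly_upper_triangular[OF U] by simp
  then show ?thesis by (induction "diag_mat U") (auto simp: poly_prod_list prod_list_zero_iff)
qed

text \<open>For \<open>x \<noteq> 0\<close> with last nonzero entry at index \<open>i\<close>, the vector \<open>U x - U(i,i) x\<close> vanishes from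
  index \<open>i\<close> on, so iterating this step ends at an eigenvector.\<close>
lemma upper_triangular_invariant_eigenvector:
  fixes U :: "complex mat"
  assumes U: "U \<in> carrier_mat p p" "upper_triangular U"
    and x: "x \<in> carrier_vec p" "x \<noteq> 0\<^sub>v p" "P x"
    and inv: "\<And>y a. y \<in> carrier_vec p \<Longrightarrow> P y \<Longrightarrow> P (U *\<^sub>v y - a \<cdot>\<^sub>v y)"
  obtains y a where "y \<in> carrier_vec p" "y \<noteq> 0\<^sub>v p" "P y" "U *\<^sub>v y = a \<cdot>\<^sub>v y" "a \<in> set (diag_mat U)"
proof -
  have "\<exists>y a. y \<in> carrier_vec p \<and> y \<noteq> 0\<^sub>v p \<and> P y \<and> U *\<^sub>v y = a \<cdot>\<^sub>v y"
    if "x \<in> carrier_vec p" "x \<noteq> 0\<^sub>v p" "P x" "\<And>j. N \<le> j \<Longrightarrow> j < p \<Longrightarrow> x $ j = 0" for N x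
    using that
  proof (induction N arbitrary: x)
    case 0
    then have "x = 0\<^sub>v p" by (intro eq_vecI) auto
    with 0 show ?case by simp
  next
    case (Suc N)
    show ?case
    proof (cases "N < p")
      case False
      with Suc show ?thesis by (intro Suc.IH) auto
    next
      case True
      define y where "y = U *\<^sub>v x - U $$ (N,N) \<cdot>\<^sub>v x"
      have y: "y \<in> carrier_vec p" using U Suc.prems by (auto simp: y_def)
      show ?thesis
      proof (cases "y = 0\<^sub>v p")
        case True
        have "U *\<^sub>v x = U $$ (N,N) \<cdot>\<^sub>v x"
        proof (rule eq_vecI)
          fix i assume "i < dim_vec (U $$ (N,N) \<cdot>\<^sub>v x)"
          then have "i < p" using Suc.prems by simp
          then have "y $ i = 0" using True by simp
          then show "(U *\<^sub>v x) $ i = (U $$ (N,N) \<cdot>\<^sub>v x) $ i"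
            using \<open>i < p\<close> Suc.prems U by (simp add: y_def)
        qed (use U Suc.prems in auto)
        with Suc.prems show ?thesis by blast
      next
        case False
        have "y $ j = 0" if j: "N \<le> j" "j < p" for j
        proof -
          have "(U *\<^sub>v x) $ j = (\<Sum>k<p. U $$ (j,k) * x $ k)"
            using U Suc.prems j by (auto simp: scalar_prod_def atLeast0LessThan)
          also have "\<dots> = (\<Sum>k\<in>{j}. U $$ (j,k) * x $ k)"
          proof (rule sum.mono_neutral_right)
            show "\<forall>i\<in>{..<p} - {j}. U $$ (j, i) * x $ i = 0"
            proof
              fix i assume i: "i \<in> {..<p} - {j}"
              show "U $$ (j, i) * x $ i = 0"
              proof (cases "i < j")
                case True with U j show ?thesis by auto
              next
                case False then have "Suc N \<le> i" "i < p" using i j by auto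
                then show ?thesis using Suc.prems by simp
              qed
            qed
          qed (use j in auto)
          finally have *: "(U *\<^sub>v x) $ j = U $$ (j,j) * x $ j" by simp
          show ?thesis
          proof (cases "j = N")
            case True then show ?thesis using * j U Suc.prems by (simp add: y_def)
          next
            case False
            then have "x $ j = 0" using j Suc.prems by simp
            then show ?thesis using * j U Suc.prems by (simp add: y_def)
          qed
        qed
        then show ?thesis using False y inv[of x "U $$ (N,N)"] Suc.prems
          by (intro Suc.IH[of y]) (auto simp: y_def)
      qed
    qed
  qed
  from this[of x p] x obtain y a where *: "y \<in> carrier_vec p" "y \<noteq> 0\<^sub>v p" "P y" "U *\<^sub>v y = a \<cdot>\<^sub>v y" by auto
  then have "eigenvalue U a" using U by (auto simp: eigenvalue_def eigenvector_def)
  from that[OF *] upper_triangular_eigenvalue[OF U this] show thesis .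
qed

section \<open>Ring laws of matrices under dimension equations\<close>

text \<open>Equations between dimensions replace the carrier memberships of the ring laws. They can
  be decided by rewriting, so that long products are normalized in one call of the
  simplifier.\<close>

lemma mult_assoc_dim:
  fixes A B C :: "'a :: comm_ring_1 mat"
  shows "dim_col A = dim_row B \<Longrightarrow> dim_col B = dim_row C \<Longrightarrow> A * B * C = A * (B * C)"
  by (rule assoc_mult_mat[of A "dim_row A" "dim_col A" B "dim_col B" C "dim_col C"]) (auto intro: carrier_matI)

lemma add_mult_distrib_dim:
  fixes A B C :: "'a :: comm_ring_1 mat"
  shows "dim_row A = dim_row B \<Longrightarrow> dim_col A = dim_col B \<Longrightarrow> dim_col B = dim_row C \<Longrightarrow> (A + B) * C = A * C + B * C"
  by (rule add_mult_distrib_mat[of A "dim_row A" "dim_col A" B C "dim_col C"]) (auto intro: carrier_matI)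

lemma minus_mult_distrib_dim:
  fixes A B C :: "'a :: comm_ring_1 mat"
  shows "dim_row A = dim_row B \<Longrightarrow> dim_col A = dim_col B \<Longrightarrow> dim_col B = dim_row C \<Longrightarrow> (A - B) * C = A * C - B * C"
  by (rule minus_mult_distrib_mat[of A "dim_row A" "dim_col A" B C "dim_col C"]) (auto intro: carrier_matI)

lemma mult_add_distrib_dim:
  fixes A B C :: "'a :: comm_ring_1 mat"
  shows "dim_row B = dim_row C \<Longrightarrow> dim_col B = dim_col C \<Longrightarrow> dim_col A = dim_row C \<Longrightarrow> A * (B + C) = A * B + A * C"
  by (rule mult_add_distrib_mat[of A "dim_row A" "dim_col A" B "dim_col B" C]) (auto intro: carrier_matI)

lemma mult_minus_distrib_dim:
  fixes A B C :: "'a :: comm_ring_1 mat"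
  shows "dim_row B = dim_row C \<Longrightarrow> dim_col B = dim_col C \<Longrightarrow> dim_col A = dim_row C \<Longrightarrow> A * (B - C) = A * B - A * C"
  by (rule mult_minus_distrib_mat[of A "dim_row A" "dim_col A" B "dim_col B" C]) (auto intro: carrier_matI)

lemma smult_mult_dim:
  fixes A B :: "'a :: comm_ring_1 mat"
  shows "dim_col A = dim_row B \<Longrightarrow> (c \<cdot>\<^sub>m A) * B = c \<cdot>\<^sub>m (A * B)"
  by (rule mult_smult_assoc_mat[of A "dim_row A" "dim_col A" B "dim_col B"]) (auto intro: carrier_matI)

lemma mult_smult_dim:
  fixes A B :: "'a :: comm_ring_1 mat"
  shows "dim_col A = dim_row B \<Longrightarrow> A * (c \<cdot>\<^sub>m B) = c \<cdot>\<^sub>m (A * B)"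
  by (rule mult_smult_distrib[of A "dim_row A" "dim_col A" B "dim_col B"]) (auto intro: carrier_matI)

lemma transpose_mult_dim:
  fixes A B :: "'a :: comm_ring_1 mat"
  shows "dim_col A = dim_row B \<Longrightarrow> (A * B)\<^sup>T = B\<^sup>T * A\<^sup>T"
  by (rule transpose_mult[of A "dim_row A" "dim_col A" B "dim_col B"]) (auto intro: carrier_matI)

lemma mult_one_by_one:
  fixes X :: "'a :: comm_ring_1 mat"
  assumes "X \<in> carrier_mat n 1" "Y \<in> carrier_mat 1 1"
  shows "X * Y = Y $$ (0,0) \<cdot>\<^sub>m X"
  using assms by (intro eq_matI) (auto simp: scalar_prod_def)

lemma transpose_smult_mat: "(c \<cdot>\<^sub>m A)\<^sup>T = c \<cdot>\<^sub>m A\<^sup>T"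
  by (intro eq_matI) auto

lemma transpose_add_dim: "dim_row A = dim_row B \<Longrightarrow> dim_col A = dim_col B \<Longrightarrow> (A + B)\<^sup>T = A\<^sup>T + B\<^sup>T"
  by (intro eq_matI) auto

lemma transpose_minus_dim: "dim_row A = dim_row B \<Longrightarrow> dim_col A = dim_col B \<Longrightarrow> (A - B)\<^sup>T = A\<^sup>T - B\<^sup>T"
  by (intro eq_matI) auto

lemmas mat_dim_simps = mult_assoc_dim add_mult_distrib_dim minus_mult_distrib_dim mult_add_distrib_dim
  mult_minus_distrib_dim smult_mult_dim mult_smult_dim transpose_mult_dim

section \<open>Recursive least squares\<close>

text \<open>Precision of \<open>w \<sim> \<N>(0, I)\<close> given \<open>g(s) w + v(s)\<close>, \<open>s < t\<close>, for white unit noise \<open>v\<close>.\<close>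
primrec precision :: "nat \<Rightarrow> (nat \<Rightarrow> real mat) \<Rightarrow> nat \<Rightarrow> real mat" where
  "precision k g 0 = 1\<^sub>m k"
| "precision k g (Suc t) = precision k g t + (g t)\<^sup>T * g t"

locale obs_rows =
  fixes k :: nat and g :: "nat \<Rightarrow> real mat"
  assumes g: "g t \<in> carrier_mat 1 k"
begin

abbreviation "J \<equiv> precision k g"

text \<open>The posterior covariance of the message. In \<open>K\<close> it gives the variance of
  predicting the noiseless row, to which the unit noise variance is added.\<close>

definition Ji :: "nat \<Rightarrow> real mat" where "Ji t = mat_inv (J t)"

definition K :: "nat \<Rightarrow> real" where "K t = (g t * Ji t * (g t)\<^sup>T) $$ (0,0) + 1"

lemma g_dim [simp]: "dim_row (g t) = Suc 0" "dim_col (g t) = k"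
  using g[of t] by auto

lemma J_carrier: "J t \<in> carrier_mat k k"
  by (induction t) (auto intro!: carrier_matI)

lemma J_dim [simp]: "dim_row (J t) = k" "dim_col (J t) = k"
  using J_carrier[of t] by auto

lemma J_sym: "(J t)\<^sup>T = J t"
  by (induction t) (simp_all add: transpose_add_dim transpose_mult_dim)

lemma J_entry:
  assumes "i < k" "j < k"
  shows "J t $$ (i,j) = (if i = j then 1 else 0) + (\<Sum>s<t. g s $$ (0,i) * g s $$ (0,j))"
  using assms by (induction t) (auto simp: scalar_prod_def)

text \<open>The sum of squares is the source of positivity: it yields
  \<open>1 \<le> K t\<close>.\<close>

lemma J_quad:
  assumes "Y \<in> carrier_mat k 1"
  shows "(Y\<^sup>T * J t * Y) $$ (0,0) = (\<Sum>i<k. (Y $$ (i,0))\<^sup>2) + (\<Sum>s<t. ((g s * Y) $$ (0,0))\<^sup>2)"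
proof (induction t)
  case 0
  have "Y\<^sup>T * 1\<^sub>m k * Y = Y\<^sup>T * Y" using assms by simp
  then show ?case using assms
    by (simp add: scalar_prod_def power2_eq_square atLeast0LessThan)
next
  case (Suc t)
  have d: "dim_row Y = k" "dim_col Y = Suc 0" using assms by auto
  have "Y\<^sup>T * ((g t)\<^sup>T * g t) * Y = (g t * Y)\<^sup>T * (g t * Y)"
    using d by (simp add: mat_dim_simps)
  moreover have "((g t * Y)\<^sup>T * (g t * Y)) $$ (0,0) = ((g t * Y) $$ (0,0))\<^sup>2"
    using d by (simp add: scalar_prod_def power2_eq_square)
  moreover have "Y\<^sup>T * J (Suc t) * Y = Y\<^sup>T * J t * Y + Y\<^sup>T * ((g t)\<^sup>T * g t) * Y"
    using d by (simp add: mult_add_distrib_dim add_mult_distrib_dim)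
  ultimately show ?case using Suc d by simp
qed

text \<open>With \<open>Y = Ji t * (g t)\<^sup>T\<close> the number \<open>K t - 1\<close> is the
  quadratic form of \<open>J t\<close> at \<open>Y\<close>. The determinant is assumed positive
  because this bound and that positivity support each other in the induction of
  \<open>det_J_pos\<close>.\<close>

lemma det_J_pos_aux: "0 < det (J t) \<Longrightarrow> 1 \<le> K t"
proof -
  assume "0 < det (J t)"
  then have d: "det (J t) \<noteq> 0" by simp
  note inv = mat_inv_inverse[OF J_carrier d, folded Ji_def]
  have dm: "dim_row (Ji t) = k" "dim_col (Ji t) = k" using inv by auto
  define Y where "Y = Ji t * (g t)\<^sup>T"
  have Y: "Y \<in> carrier_mat k 1" using dm by (auto simp: Y_def intro!: carrier_matI)
  have "J t * Y = (g t)\<^sup>T" unfolding Y_def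
    using mult_assoc_dim[of "J t" "Ji t" "(g t)\<^sup>T"] dm inv(2) by simp
  then have "Y\<^sup>T * J t * Y = Y\<^sup>T * (g t)\<^sup>T" using Y by (simp add: mult_assoc_dim)
  also have "\<dots> = (g t * Ji t * (g t)\<^sup>T)\<^sup>T"
    using Y dm by (simp add: transpose_mult_dim[symmetric] Y_def mult_assoc_dim)
  finally have "(Y\<^sup>T * J t * Y) $$ (0,0) = K t - 1"
    using dm by (simp add: K_def)
  moreover have "(Y\<^sup>T * J t * Y) $$ (0,0) \<ge> 0"
    unfolding J_quad[OF Y] by (intro add_nonneg_nonneg sum_nonneg) auto
  ultimately show ?thesis by simp
qed

lemma det_J_Suc_aux: "det (J t) \<noteq> 0 \<Longrightarrow> det (J (Suc t)) = det (J t) * K t"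
  using det_add_rank_one[OF J_carrier transpose_carrier_mat[THEN iffD2, OF g] g]
  by (simp add: K_def Ji_def add.commute)

lemma det_J_pos: "0 < det (J t)"
proof (induction t)
  case (Suc t)
  then show ?case using det_J_pos_aux[OF Suc] det_J_Suc_aux[of t] by simp
qed simp

lemma K_ge_1: "1 \<le> K t"
  by (rule det_J_pos_aux[OF det_J_pos])

lemma det_J_Suc: "det (J (Suc t)) = det (J t) * K t"
  using det_J_Suc_aux det_J_pos[of t] by simp

lemma det_J: "det (J t) = (\<Prod>s<t. K s)"
  by (induction t) (simp_all add: det_J_Suc del: precision.simps(2))

lemma Ji: "Ji t \<in> carrier_mat k k" "J t * Ji t = 1\<^sub>m k" "Ji t * J t = 1\<^sub>m k"
  using mat_inv_inverse[OF J_carrier] det_J_pos[of t] by (simp_all add: Ji_def)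

lemma Ji_dim [simp]: "dim_row (Ji t) = k" "dim_col (Ji t) = k"
  using Ji(1)[of t] by auto

lemma Ji_sym: "(Ji t)\<^sup>T = Ji t"
proof -
  have "J t * (Ji t)\<^sup>T = (Ji t * J t)\<^sup>T" by (simp add: transpose_mult_dim J_sym)
  then have "J t * (Ji t)\<^sup>T = 1\<^sub>m k" by (simp add: Ji)
  then show ?thesis using mat_inv_unique(2)[OF J_carrier, of "(Ji t)\<^sup>T" t] Ji(1)[of t] by (simp add: Ji_def)
qed

lemma gJg: "g t * (Ji t * (g t)\<^sup>T) = (K t - 1) \<cdot>\<^sub>m 1\<^sub>m 1"
  by (rule eq_matI) (auto simp: K_def mult_assoc_dim)

text \<open>The Sherman-Morrison formula, verified by multiplying out. It is the Riccati step in
  message coordinates.\<close>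

lemma Ji_Suc: "Ji (Suc t) = Ji t - (1 / K t) \<cdot>\<^sub>m (Ji t * ((g t)\<^sup>T * (g t * Ji t)))"
proof -
  define a where "a = (g t)\<^sup>T * (g t * Ji t)"
  define B where "B = Ji t - (1 / K t) \<cdot>\<^sub>m (Ji t * a)"
  have a [simp]: "dim_row a = k" "dim_col a = k" by (simp_all add: a_def)
  have B [simp]: "dim_row B = k" "dim_col B = k" by (simp_all add: B_def)
  have K: "K t \<noteq> 0" using K_ge_1[of t] by simp
  have "J t * B = J t * Ji t - (1 / K t) \<cdot>\<^sub>m (J t * Ji t * a)"
    by (simp add: B_def mat_dim_simps)
  then have 1: "J t * B = 1\<^sub>m k - (1 / K t) \<cdot>\<^sub>m a"
    by (simp add: Ji left_mult_one_mat')
  have "g t * (Ji t * a) = g t * (Ji t * (g t)\<^sup>T) * (g t * Ji t)"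
    by (simp add: a_def mult_assoc_dim)
  also have "\<dots> = (K t - 1) \<cdot>\<^sub>m (g t * Ji t)"
    unfolding gJg by (simp add: smult_mult_dim left_mult_one_mat')
  finally have 2: "(g t)\<^sup>T * (g t * (Ji t * a)) = (K t - 1) \<cdot>\<^sub>m a"
    by (simp add: a_def mult_smult_dim)
  have "(g t)\<^sup>T * g t * B = a - (1 / K t) \<cdot>\<^sub>m ((g t)\<^sup>T * (g t * (Ji t * a)))"
    by (simp add: B_def mat_dim_simps a_def)
  then have 3: "(g t)\<^sup>T * g t * B = a - (1 / K t) \<cdot>\<^sub>m ((K t - 1) \<cdot>\<^sub>m a)"
    unfolding 2 .
  have "J (Suc t) * B = (1\<^sub>m k - (1 / K t) \<cdot>\<^sub>m a) + (a - (1 / K t) \<cdot>\<^sub>m ((K t - 1) \<cdot>\<^sub>m a))"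
    by (simp add: add_mult_distrib_dim 1 3)
  also have "\<dots> = 1\<^sub>m k"
    using K by (intro eq_matI) (auto simp: field_simps)
  finally have "J (Suc t) * B = 1\<^sub>m k" .
  then have "mat_inv (J (Suc t)) = B"
    by (intro mat_inv_unique(2)[OF J_carrier] carrier_matI) simp_all
  then show ?thesis by (simp add: Ji_def B_def a_def del: precision.simps)
qed

text \<open>The least squares estimate is \<open>Ji t\<close> applied to the sum of the transposed
  rows times the observed values \<open>g s * w + v s\<close>. Subtracting that sum from
  \<open>J t * w\<close> leaves the residual, which is thus the precision times the estimation
  error; its update contains no gain.\<close>

primrec resid :: "real mat \<Rightarrow> (nat \<Rightarrow> real) \<Rightarrow> nat \<Rightarrow> real mat" where
  "resid w v 0 = w"
| "resid w v (Suc t) = resid w v t - v t \<cdot>\<^sub>m (g t)\<^sup>T"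

definition err :: "real mat \<Rightarrow> (nat \<Rightarrow> real) \<Rightarrow> nat \<Rightarrow> real mat" where
  "err w v t = Ji t * resid w v t"

text \<open>The prediction error of the observed value \<open>g t * w + v t\<close>, given the
  earlier ones.\<close>

definition innov :: "real mat \<Rightarrow> (nat \<Rightarrow> real) \<Rightarrow> nat \<Rightarrow> real" where
  "innov w v t = (g t * err w v t) $$ (0,0) + v t"

context
  fixes w :: "real mat" and v :: "nat \<Rightarrow> real"
  assumes w: "w \<in> carrier_mat k 1"
begin

lemma resid_dim [simp]: "dim_row (resid w v t) = k" "dim_col (resid w v t) = Suc 0"
  using w by (induction t) auto

lemma err_dim [simp]: "dim_row (err w v t) = k" "dim_col (err w v t) = Suc 0"
  by (simp_all add: err_def)

lemma resid_entry: "i < k \<Longrightarrow> resid w v t $$ (i,0) = w $$ (i,0) - (\<Sum>s<t. v s * g s $$ (0,i))"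
  by (induction t) auto

lemma g_err: "g t * err w v t = (innov w v t - v t) \<cdot>\<^sub>m 1\<^sub>m 1"
  by (rule eq_matI) (auto simp: innov_def)

lemma err_0: "err w v 0 = w"
proof -
  have "Ji 0 = 1\<^sub>m k" unfolding Ji_def by (rule mat_inv_unique) auto
  then show ?thesis using w by (simp add: err_def)
qed

text \<open>Sherman-Morrison applied to the new residual. The contributions of the old error and of
  the noise merge, by \<open>gJg\<close>, into the gain times the innovation.\<close>

lemma err_Suc: "err w v (Suc t) = err w v t - (innov w v t / K t) \<cdot>\<^sub>m (Ji t * (g t)\<^sup>T)"
proof -
  let ?h = "Ji t * (g t)\<^sup>T"
  have K: "K t \<noteq> 0" using K_ge_1[of t] by simp
  have D: "err w v (Suc t) = (Ji t - (1 / K t) \<cdot>\<^sub>m (?h * (g t * Ji t))) * (resid w v t - v t \<cdot>\<^sub>m (g t)\<^sup>T)"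
    unfolding err_def Ji_Suc by (simp add: mult_assoc_dim)
  have 1: "?h * (g t * Ji t) * resid w v t = (innov w v t - v t) \<cdot>\<^sub>m ?h"
  proof -
    have "?h * (g t * Ji t) * resid w v t = ?h * (g t * err w v t)"
      by (simp add: err_def mult_assoc_dim)
    also have "\<dots> = (innov w v t - v t) \<cdot>\<^sub>m ?h"
      unfolding g_err by (simp add: mult_smult_dim right_mult_one_mat')
    finally show ?thesis .
  qed
  have 2: "?h * (g t * Ji t) * (g t)\<^sup>T = (K t - 1) \<cdot>\<^sub>m ?h"
  proof -
    have "?h * (g t * Ji t) * (g t)\<^sup>T = ?h * (g t * (Ji t * (g t)\<^sup>T))"
      by (simp add: mult_assoc_dim)
    also have "\<dots> = (K t - 1) \<cdot>\<^sub>m ?h"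
      unfolding gJg by (simp add: mult_smult_dim right_mult_one_mat')
    finally show ?thesis .
  qed
  define h where "h = ?h"
  have [simp]: "dim_row h = k" "dim_col h = Suc 0" by (simp_all add: h_def)
  have "err w v (Suc t) = (Ji t * resid w v t - (1 / K t) \<cdot>\<^sub>m (h * (g t * Ji t) * resid w v t))
      - v t \<cdot>\<^sub>m (Ji t * (g t)\<^sup>T - (1 / K t) \<cdot>\<^sub>m (h * (g t * Ji t) * (g t)\<^sup>T))"
    unfolding D h_def[symmetric]
    by (simp add: mult_minus_distrib_dim minus_mult_distrib_dim smult_mult_dim mult_smult_dim mult_assoc_dim h_def[symmetric])
  also have "\<dots> = (err w v t - (1 / K t) \<cdot>\<^sub>m ((innov w v t - v t) \<cdot>\<^sub>m h)) - v t \<cdot>\<^sub>m (h - (1 / K t) \<cdot>\<^sub>m ((K t - 1) \<cdot>\<^sub>m h))"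
    unfolding 1[folded h_def] 2[folded h_def] by (simp add: err_def h_def)
  also have "\<dots> = err w v t - (innov w v t / K t) \<cdot>\<^sub>m h"
    using K by (intro eq_matI) (auto simp: field_simps)
  finally show ?thesis by (simp add: h_def)
qed

lemma err_sum:
  "err w v t = w - mat k 1 (\<lambda>(i,j). \<Sum>s<t. innov w v s / K s * (Ji s * (g s)\<^sup>T) $$ (i,0))"
proof (induction t)
  case 0
  show ?case using w by (intro eq_matI) (auto simp: err_0)
next
  case (Suc t)
  show ?case unfolding err_Suc Suc
    by (intro eq_matI) (use w in \<open>auto simp: algebra_simps simp del: index_mult_mat(1)\<close>)
qed

text \<open>For a fixed message the noise is a unit lower triangular function of the innovations, up
  to a shift by the message term. This is what makes the passage between them preserve Lebesgue
  measure.\<close>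

lemma innov_noise:
  "v t = innov w v t + (\<Sum>s<t. (g t * (Ji s * (g s)\<^sup>T)) $$ (0,0) / K s * innov w v s) - (g t * w) $$ (0,0)"
proof -
  let ?h = "\<lambda>s. Ji s * (g s)\<^sup>T"
  let ?M = "mat k 1 (\<lambda>(i,j). \<Sum>s<t. innov w v s / K s * ?h s $$ (i,0))"
  have M: "?M \<in> carrier_mat k 1" by simp
  have h: "?h s \<in> carrier_mat k 1" for s by (rule carrier_matI) simp_all
  have "(g t * err w v t) $$ (0,0) = (g t * w) $$ (0,0) - (g t * ?M) $$ (0,0)"
    unfolding err_sum using w by (subst mult_minus_distrib_dim) auto
  also have "(g t * ?M) $$ (0,0) = (\<Sum>i<k. g t $$ (0,i) * (\<Sum>s<t. innov w v s / K s * ?h s $$ (i,0)))"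
    using index_mult_mat_sum[OF g M, of 0 0 t] by (simp del: index_mult_mat(1))
  also have "\<dots> = (\<Sum>s<t. innov w v s / K s * (\<Sum>i<k. g t $$ (0,i) * ?h s $$ (i,0)))"
    unfolding sum_distrib_left by (subst sum.swap) (simp add: mult_ac del: index_mult_mat(1))
  also have "\<dots> = (\<Sum>s<t. (g t * ?h s) $$ (0,0) / K s * innov w v s)"
    using index_mult_mat_sum[OF g h, of 0 0 t] by (simp del: index_mult_mat(1) add: mult_ac)
  finally show ?thesis by (simp add: innov_def)
qed

text \<open>The left side is the exponent of the joint density of message and noise, the right side
  its form in error and innovations. One update exchanges the square of the noise for the square of
  the innovation divided by \<open>K t\<close>.\<close>

lemma innov_quadratic:
  "(\<Sum>i<k. (w $$ (i,0))\<^sup>2) + (\<Sum>s<t. (v s)\<^sup>2) =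
   ((err w v t)\<^sup>T * (J t * err w v t)) $$ (0,0) + (\<Sum>s<t. (innov w v s)\<^sup>2 / K s)"
proof (induction t)
  case 0
  have "(w\<^sup>T * w) $$ (0,0) = (\<Sum>i<k. (w $$ (i,0))\<^sup>2)"
    using w index_mult_mat_sum[of "w\<^sup>T" 1 k w 1 0 0] by (simp del: index_mult_mat(1) add: power2_eq_square)
  then show ?case using w by (simp add: err_0 del: index_mult_mat(1))
next
  case (Suc t)
  let ?D = "err w v t" and ?b = "resid w v t" and ?h = "Ji t * (g t)\<^sup>T"
  let ?e = "innov w v t"
  have K: "K t \<noteq> 0" using K_ge_1[of t] by simp
  \<comment> \<open>The precision turns the error back into the residual, so only one factor of the
    new quadratic form carries a gain.\<close>
  have Jerr: "J s * err w v s = resid w v s" for s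
    using mult_assoc_dim[of "J s" "Ji s" "resid w v s"]
    by (simp add: err_def Ji left_mult_one_mat')
  have sw: "(?D\<^sup>T * (g t)\<^sup>T) $$ (0,0) = ?e - v t"
    using arg_cong[OF g_err[of t], of transpose_mat]
    by (simp add: transpose_mult_dim transpose_smult_mat del: index_mult_mat(1))
  have hb: "?h\<^sup>T * ?b = g t * ?D"
    by (simp add: transpose_mult_dim Ji_sym err_def mult_assoc_dim)
  have "(err w v (Suc t))\<^sup>T * (J (Suc t) * err w v (Suc t)) =
      (?D - (?e / K t) \<cdot>\<^sub>m ?h)\<^sup>T * (?b - v t \<cdot>\<^sub>m (g t)\<^sup>T)"
    unfolding Jerr by (simp add: err_Suc)
  also have "\<dots> = (?D\<^sup>T * ?b - (?e / K t) \<cdot>\<^sub>m (?h\<^sup>T * ?b)) - v t \<cdot>\<^sub>m (?D\<^sup>T * (g t)\<^sup>T - (?e / K t) \<cdot>\<^sub>m (?h\<^sup>T * (g t)\<^sup>T))"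
    by (simp add: transpose_minus_dim transpose_smult_mat minus_mult_distrib_dim mult_minus_distrib_dim
        smult_mult_dim mult_smult_dim del: transpose_mult)
  also have "\<dots> = (?D\<^sup>T * ?b - v t \<cdot>\<^sub>m (?D\<^sup>T * (g t)\<^sup>T)) - (?e / K t) \<cdot>\<^sub>m (?h\<^sup>T * ?b - v t \<cdot>\<^sub>m (?h\<^sup>T * (g t)\<^sup>T))"
    by (rule eq_matI) (simp_all add: algebra_simps del: index_mult_mat(1))
  also have "?h\<^sup>T * (g t)\<^sup>T = (K t - 1) \<cdot>\<^sub>m 1\<^sub>m 1"
    using gJg[of t] by (simp add: transpose_mult_dim Ji_sym mult_assoc_dim)
  finally have "((err w v (Suc t))\<^sup>T * (J (Suc t) * err w v (Suc t))) $$ (0,0) =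
     ((?D\<^sup>T * ?b) $$ (0,0) - v t * (?e - v t)) - (?e / K t) * ((?e - v t) - v t * (K t - 1))"
    unfolding hb g_err sw[symmetric] by (simp del: index_mult_mat(1))
  also have "\<dots> = (?D\<^sup>T * ?b) $$ (0,0) + (v t)\<^sup>2 - ?e\<^sup>2 / K t"
    using K by (simp add: field_simps power2_eq_square)
  finally show ?case using Suc unfolding Jerr by (simp del: index_mult_mat(1) precision.simps)
qed

end

end

section \<open>Asymptotics of the Riccati recursion\<close>

abbreviation cm :: "real mat \<Rightarrow> complex mat" where "cm \<equiv> map_mat complex_of_real"

text \<open>The conjugate transpose, to be distinguished from the adjugate
  \<open>adj_mat\<close>.\<close>

definition adj :: "complex mat \<Rightarrow> complex mat" where "adj X = map_mat cnj (X\<^sup>T)"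

lemma adj_dim [simp]: "dim_row (adj X) = dim_col X" "dim_col (adj X) = dim_row X"
  by (simp_all add: adj_def)

lemma adj_index [simp]: "i < dim_col X \<Longrightarrow> j < dim_row X \<Longrightarrow> adj X $$ (i,j) = cnj (X $$ (j,i))"
  by (simp add: adj_def)

lemma adj_adj [simp]: "adj (adj X) = X"
  by (rule eq_matI) auto

lemma adj_mult: "dim_col X = dim_row Y \<Longrightarrow> adj (X * Y) = adj Y * adj X"
  by (rule eq_matI) (auto simp: scalar_prod_def mult.commute intro!: sum.cong)

lemma det_adj: "X \<in> carrier_mat n n \<Longrightarrow> det (adj X) = cnj (det X)"
proof -
  assume X: "X \<in> carrier_mat n n"
  have "det (adj X) = det (map_mat cnj X)"
    using X det_transpose[of "map_mat cnj X" n] by (simp add: adj_def map_mat_transpose)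
  moreover have "p i < n" if "p permutes {0..<n}" "i < n" for p i
    using permutes_in_image[OF that(1), of i] that(2) by simp
  ultimately show ?thesis using X
    by (auto simp: det_def intro!: sum.cong prod.cong)
qed

lemma cm_mult: "dim_col A = dim_row B \<Longrightarrow> cm (A * B) = cm A * cm B"
  by (rule of_real_hom.mat_hom_mult[of A "dim_row A" "dim_col A" B "dim_col B"]) (auto intro: carrier_matI)

lemma cm_add: "dim_row A = dim_row B \<Longrightarrow> dim_col A = dim_col B \<Longrightarrow> cm (A + B) = cm A + cm B"
  by (rule eq_matI) auto

lemma cm_minus: "dim_row A = dim_row B \<Longrightarrow> dim_col A = dim_col B \<Longrightarrow> cm (A - B) = cm A - cm B"
  by (rule eq_matI) auto

lemma cm_transpose: "cm (A\<^sup>T) = (cm A)\<^sup>T"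
  by (rule eq_matI) auto

lemma adj_cm: "adj (cm A) = cm (A\<^sup>T)"
  by (rule eq_matI) auto

lemma cm_pow: "A \<in> carrier_mat n n \<Longrightarrow> cm (A ^\<^sub>m t) = cm A ^\<^sub>m t"
  by (rule of_real_hom.mat_hom_pow)

lemma cm_one: "cm (1\<^sub>m n) = 1\<^sub>m n"
  by (rule eq_matI) auto

lemma det_cm: "det (cm A) = complex_of_real (det A)"
  by (rule of_real_hom.hom_det)

text \<open>Powers restrict to invariant subspaces. The instance \<open>T = U = A\<close> is used as
  well, to split a factor off a power on the left instead of the right.\<close>

lemma pow_intertwine:
  fixes A :: "'a :: comm_ring_1 mat"
  assumes "A \<in> carrier_mat n n" "T \<in> carrier_mat n p" "U \<in> carrier_mat p p" "A * T = T * U"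
  shows "A ^\<^sub>m t * T = T * U ^\<^sub>m t"
proof (induction t)
  case (Suc t)
  have d: "dim_row A = n" "dim_col A = n" "dim_row T = n" "dim_col T = p" "dim_row U = p" "dim_col U = p"
    "dim_row (A ^\<^sub>m t) = n" "dim_col (A ^\<^sub>m t) = n" "dim_row (U ^\<^sub>m t) = p" "dim_col (U ^\<^sub>m t) = p"
    using assms by (auto simp: pow_mat_dim_square[OF assms(1)] pow_mat_dim_square[OF assms(3)])
  have "A ^\<^sub>m Suc t * T = A ^\<^sub>m t * T * U"
    using d assms(4) by (simp add: mult_assoc_dim)
  also have "\<dots> = T * U ^\<^sub>m Suc t" unfolding Suc using d by (simp add: mult_assoc_dim)
  finally show ?case .
qed (use assms in simp)

lemma entry_bound_mult_left:
  fixes X :: "nat \<Rightarrow> complex mat"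
  assumes M: "M \<in> carrier_mat nr n" and X: "\<And>t. X t \<in> carrier_mat n nc"
    and b: "\<And>t i j. i < n \<Longrightarrow> j < nc \<Longrightarrow> cmod (X t $$ (i,j)) \<le> c * r ^ t" and "0 \<le> c" "0 < r"
  obtains c' where "0 \<le> c'" "\<And>t i j. i < nr \<Longrightarrow> j < nc \<Longrightarrow> cmod ((M * X t) $$ (i,j)) \<le> c' * r ^ t"
proof
  define c' where "c' = (\<Sum>i<nr. \<Sum>l<n. cmod (M $$ (i,l))) * c"
  show "0 \<le> c'" unfolding c'_def using \<open>0 \<le> c\<close> by (intro mult_nonneg_nonneg sum_nonneg) auto
  fix t i j assume ij: "i < nr" "j < nc"
  have "cmod ((M * X t) $$ (i,j)) \<le> (\<Sum>l<n. cmod (M $$ (i,l) * X t $$ (l,j)))"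
    unfolding index_mult_mat_sum[OF M X ij] by (rule norm_sum)
  also have "\<dots> \<le> (\<Sum>l<n. cmod (M $$ (i,l)) * (c * r ^ t))"
    unfolding norm_mult using b ij by (intro sum_mono mult_left_mono) auto
  also have "\<dots> = (\<Sum>l<n. cmod (M $$ (i,l))) * (c * r ^ t)" by (simp add: sum_distrib_right)
  also have "\<dots> \<le> (\<Sum>i<nr. \<Sum>l<n. cmod (M $$ (i,l))) * (c * r ^ t)"
    using ij \<open>0 \<le> c\<close> \<open>0 < r\<close> by (intro mult_right_mono member_le_sum) (auto intro!: sum_nonneg)
  finally show "cmod ((M * X t) $$ (i,j)) \<le> c' * r ^ t" by (simp add: c'_def mult.assoc)
qed

lemma mat_tendsto_zero:
  fixes X :: "nat \<Rightarrow> complex mat"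
  assumes X: "\<And>t. X t \<in> carrier_mat n nc" and "r < 1" "0 < r"
    and b: "\<And>t i j. i < n \<Longrightarrow> j < nc \<Longrightarrow> cmod (X t $$ (i,j)) \<le> c * r ^ t"
  shows "mat_tendsto n nc X (0\<^sub>m n nc)"
  unfolding mat_tendsto_def
proof (intro conjI allI impI)
  fix i j assume ij: "i < n" "j < nc"
  have "(\<lambda>t. c * r ^ t) \<longlonglongrightarrow> c * 0"
    by (intro tendsto_intros LIMSEQ_realpow_zero) (use assms in auto)
  then have "(\<lambda>t. X t $$ (i,j)) \<longlonglongrightarrow> 0"
    using b[OF ij] by (intro Lim_null_comparison[of "\<lambda>t. X t $$ (i,j)" "\<lambda>t. c * r ^ t"]) auto
  then show "(\<lambda>t. X t $$ (i,j)) \<longlonglongrightarrow> 0\<^sub>m n nc $$ (i,j)" using ij by simp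
qed (use X in auto)

text \<open>Dominated convergence for sums counted backwards from the horizon: the term at distance
  \<open>j\<close> from the end converges and is dominated by a geometric sequence in
  \<open>j\<close>. The unstable part of the precision concentrates at the end in this way.\<close>

lemma convergent_sum_tannery:
  fixes x :: "nat \<Rightarrow> nat \<Rightarrow> complex"
  assumes lim: "\<And>j. (\<lambda>T. x T (T - Suc j)) \<longlonglongrightarrow> b j"
    and bd: "\<And>T s. s < T \<Longrightarrow> cmod (x T s) \<le> M * r ^ (T - Suc s)" and r: "0 < r" "r < 1" "0 \<le> M"
  shows "(\<lambda>T. \<Sum>s<T. x T s) \<longlonglongrightarrow> suminf b"
proof -
  define a where "a j T = (if j < T then x T (T - Suc j) else 0)" for j T
  have "(\<lambda>T. suminf (\<lambda>j. a j T)) \<longlonglongrightarrow> suminf b"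
  proof (rule tannerys_theorem[THEN conjunct2, THEN conjunct2])
    fix j
    have "eventually (\<lambda>T. x T (T - Suc j) = a j T) sequentially"
      using eventually_gt_at_top[of j] by eventually_elim (simp add: a_def)
    then show "(\<lambda>T. a j T) \<longlonglongrightarrow> b j" using lim[of j] by (rule Lim_transform_eventually[rotated])
  next
    have "norm (a j T) \<le> M * r ^ j" for j T
      using bd[of "T - Suc j" T] r by (auto simp: a_def)
    then show "eventually (\<lambda>(j,T). norm (a j T) \<le> M * r ^ j) (at_top \<times>\<^sub>F sequentially)"
      by (auto intro!: always_eventually)
  qed (use r in \<open>auto intro!: summable_mult summable_geometric\<close>)
  moreover have "suminf (\<lambda>j. a j T) = (\<Sum>s<T. x T s)" for T
  proof -
    have "suminf (\<lambda>j. a j T) = (\<Sum>j<T. a j T)"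
      by (rule suminf_finite) (auto simp: a_def)
    also have "\<dots> = (\<Sum>j<T. x T (T - Suc j))" by (rule sum.cong) (auto simp: a_def)
    also have "\<dots> = (\<Sum>s<T. x T s)" by (rule sum.nat_diff_reindex)
    finally show ?thesis .
  qed
  ultimately show ?thesis by simp
qed

section \<open>The Riccati iterates in closed form\<close>

locale kalman =
  fixes k d :: nat and AA CC E :: "real mat"
  assumes AA: "AA \<in> carrier_mat d d" and CC: "CC \<in> carrier_mat 1 d" and E: "E \<in> carrier_mat d k"
begin

text \<open>Response of the joint state of source and channel at time \<open>t\<close> to the
  message when nothing is fed back.\<close>

definition Phi :: "nat \<Rightarrow> real mat" where "Phi t = AA ^\<^sub>m t * E"
definition g :: "nat \<Rightarrow> real mat" where "g t = CC * Phi t"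

lemma dims [simp]: "dim_row AA = d" "dim_col AA = d" "dim_row CC = Suc 0" "dim_col CC = d"
  "dim_row E = d" "dim_col E = k" "dim_row (AA ^\<^sub>m t) = d" "dim_col (AA ^\<^sub>m t) = d"
  "dim_row (Phi t) = d" "dim_col (Phi t) = k"
  using AA CC E by (auto simp: Phi_def pow_mat_dim_square[OF AA])

sublocale obs_rows k g
  by unfold_locales (auto simp: g_def intro!: carrier_matI)

lemma Phi_Suc: "Phi (Suc t) = AA * Phi t"
proof -
  have "AA ^\<^sub>m Suc t = AA * AA ^\<^sub>m t"
    using pow_intertwine[OF AA AA AA refl, of t] by simp
  then show ?thesis by (simp add: Phi_def mult_assoc_dim)
qed

text \<open>The iterate is the covariance of the state error, and this error is \<open>Phi t\<close>
  applied to the message error. Absorbing \<open>AA\<close> into \<open>Phi\<close> turns the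
  Riccati map into the rank-one update \<open>Ji_Suc\<close>.\<close>

lemma riccati_seq_closed_form: "riccati_seq AA CC (E * E\<^sup>T) t = Phi t * Ji t * (Phi t)\<^sup>T"
  and innov_var_riccati_seq: "innov_var CC (riccati_seq AA CC (E * E\<^sup>T) t) = K t"
proof -
  let ?S = "\<lambda>t. Phi t * Ji t * (Phi t)\<^sup>T"
  have K: "innov_var CC (?S t) = K t" for t
  proof -
    have "CC * ?S t * CC\<^sup>T = g t * Ji t * (g t)\<^sup>T"
      by (simp add: g_def mult_assoc_dim transpose_mult_dim)
    then show ?thesis unfolding innov_var_def K_def by simp
  qed
  have step: "riccati_map AA CC (?S t) = ?S (Suc t)" for t
  proof -
    let ?P = "AA * Phi t"
    have "AA * ?S t * CC\<^sup>T * CC * ?S t * AA\<^sup>T = ?P * (Ji t * ((g t)\<^sup>T * (g t * Ji t))) * ?P\<^sup>T"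
      by (simp add: g_def mult_assoc_dim transpose_mult_dim)
    moreover have "AA * ?S t * AA\<^sup>T = ?P * Ji t * ?P\<^sup>T"
      by (simp add: mult_assoc_dim transpose_mult_dim)
    ultimately have "riccati_map AA CC (?S t) =
        ?P * Ji t * ?P\<^sup>T - (1 / K t) \<cdot>\<^sub>m (?P * (Ji t * ((g t)\<^sup>T * (g t * Ji t))) * ?P\<^sup>T)"
      by (simp only: riccati_map_def K)
    also have "\<dots> = ?P * (Ji t - (1 / K t) \<cdot>\<^sub>m (Ji t * ((g t)\<^sup>T * (g t * Ji t)))) * ?P\<^sup>T"
      by (simp add: mult_minus_distrib_dim minus_mult_distrib_dim mult_smult_dim smult_mult_dim)
    finally show ?thesis by (simp add: Ji_Suc Phi_Suc)
  qed
  show *: "riccati_seq AA CC (E * E\<^sup>T) t = ?S t"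
  proof (induction t)
    case 0
    have "Ji 0 = 1\<^sub>m k" unfolding Ji_def by (rule mat_inv_unique) auto
    moreover have "AA ^\<^sub>m 0 * E = E" using AA by simp
    ultimately show ?case by (simp add: Phi_def)
  next
    case (Suc t)
    then show ?case using step by simp
  qed
  show "innov_var CC (riccati_seq AA CC (E * E\<^sup>T) t) = K t" by (simp only: * K)
qed

text \<open>Each entry becomes an inner product of transformed rows, to which the limits are
  applied. Used with all columns for the entries of the rescaled precision, and with a single column
  for its quadratic form.\<close>

lemma J_congruence:
  assumes X: "X \<in> carrier_mat k c" and ab: "a < c" "b < c"
  shows "(adj X * (cm (J t) * X)) $$ (a,b) = (\<Sum>i<k. cnj (X $$ (i,a)) * X $$ (i,b)) +
     (\<Sum>s<t. cnj ((cm (g s) * X) $$ (0,a)) * (cm (g s) * X) $$ (0,b))"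
proof (induction t)
  case 0
  have "adj X * (cm (1\<^sub>m k) * X) = adj X * X" using X by (simp add: cm_one)
  moreover have "(adj X * X) $$ (a,b) = (\<Sum>i<k. adj X $$ (a,i) * X $$ (i,b))"
    by (rule index_mult_mat_sum) (use X ab in auto)
  ultimately show ?case using X ab by (simp del: index_mult_mat(1))
next
  case (Suc t)
  have d: "dim_row X = k" "dim_col X = c" using X by auto
  have c: "adj (cm (g t) * X) \<in> carrier_mat c 1" "cm (g t) * X \<in> carrier_mat 1 c"
    using d by (auto intro!: carrier_matI)
  have "adj X * (cm (J (Suc t)) * X) = adj X * (cm (J t) * X) + adj (cm (g t) * X) * (cm (g t) * X)"
    using d by (simp add: cm_add cm_mult cm_transpose adj_mult adj_cm mat_dim_simps)
  then show ?case using Suc ab d index_mult_mat_sum[OF c ab]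
    by (simp del: index_mult_mat(1) precision.simps)
qed

end

text \<open>The splitting data: \<open>Tu\<close> spans the unstable invariant subspace of \<open>AA\<close> and \<open>Q\<close> lies in the
  stable one; \<open>V\<close> is a change of basis of the message space adapted to them.\<close>
locale kalman_split = kalman +
  fixes p l :: nat and Tu U Q S R V :: "complex mat"
  assumes pk: "p \<le> k"
    and car: "Tu \<in> carrier_mat d p" "U \<in> carrier_mat p p" "Q \<in> carrier_mat d l" "S \<in> carrier_mat l l"
      "R \<in> carrier_mat l k" "V \<in> carrier_mat k k"
    and U: "upper_triangular U" "\<And>a. a \<in> set (diag_mat U) \<Longrightarrow> 1 < cmod a"
    and S: "\<And>a. eigenvalue S a \<Longrightarrow> cmod a < 1"
    and V: "det V \<noteq> 0"
    and AA_Tu: "cm AA * Tu = Tu * U" and AA_Q: "cm AA * Q = Q * S"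
    and EV: "cm E * V = Tu * mat p k (\<lambda>(i,j). if i = j then 1 else 0) + Q * R"
    and Tu_inj: "\<And>x. x \<in> carrier_vec p \<Longrightarrow> Tu *\<^sub>v x = 0\<^sub>v d \<Longrightarrow> x = 0\<^sub>v p"
    and detectable: "\<And>x a. x \<in> carrier_vec d \<Longrightarrow> 1 < cmod a \<Longrightarrow> cm AA *\<^sub>v x = a \<cdot>\<^sub>v x \<Longrightarrow>
      cm CC *\<^sub>v x = 0\<^sub>v 1 \<Longrightarrow> x = 0\<^sub>v d"
begin

definition P1 :: "complex mat" where "P1 = mat p k (\<lambda>(i,j). if i = j then 1 else 0)"

lemma cdims [simp]: "dim_row Tu = d" "dim_col Tu = p" "dim_row U = p" "dim_col U = p" "dim_row Q = d"
  "dim_col Q = l" "dim_row S = l" "dim_col S = l" "dim_row R = l" "dim_col R = k" "dim_row V = k" "dim_col V = k"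
  "dim_row P1 = p" "dim_col P1 = k" "dim_row (S ^\<^sub>m t) = l" "dim_col (S ^\<^sub>m t) = l"
  "dim_row (U ^\<^sub>m t) = p" "dim_col (U ^\<^sub>m t) = p"
  using car by (auto simp: P1_def pow_mat_dim_square[OF car(2)] pow_mat_dim_square[OF car(4)])

lemma det_U: "det U = prod_list (diag_mat U)"
  by (rule det_upper_triangular[OF U(1) car(2)])

lemma det_U_nz: "det U \<noteq> 0"
  using U(2)[of 0] by (auto simp: det_U prod_list_zero_iff)

definition Ui :: "complex mat" where "Ui = mat_inv U"

lemma Ui: "Ui \<in> carrier_mat p p" "U * Ui = 1\<^sub>m p" "Ui * U = 1\<^sub>m p"
  using mat_inv_inverse[OF car(2) det_U_nz] by (simp_all add: Ui_def)

lemma Ui_dim [simp]: "dim_row Ui = p" "dim_col Ui = p" "dim_row (Ui ^\<^sub>m t) = p" "dim_col (Ui ^\<^sub>m t) = p"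
  using Ui(1) by (auto simp: pow_mat_dim_square[OF Ui(1)])

lemma eigenvalue_Ui: assumes "eigenvalue Ui a" shows "cmod a < 1"
proof -
  from assms obtain x where x: "x \<in> carrier_vec p" "x \<noteq> 0\<^sub>v p" "Ui *\<^sub>v x = a \<cdot>\<^sub>v x"
    using Ui(1) by (auto simp: eigenvalue_def eigenvector_def)
  have "U *\<^sub>v (Ui *\<^sub>v x) = x"
    using assoc_mult_mat_vec[OF car(2) Ui(1) x(1)] x Ui(2) by simp
  then have xa: "x = a \<cdot>\<^sub>v (U *\<^sub>v x)" using x mult_mat_vec[OF car(2) x(1)] by simp
  moreover have "0 \<cdot>\<^sub>v (U *\<^sub>v x) = 0\<^sub>v p" by (rule eq_vecI) auto
  ultimately have "a \<noteq> 0" using x by metis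
  have "U *\<^sub>v x = (1 / a) \<cdot>\<^sub>v (a \<cdot>\<^sub>v (U *\<^sub>v x))" using \<open>a \<noteq> 0\<close> by (simp add: smult_smult_assoc)
  then have "U *\<^sub>v x = (1 / a) \<cdot>\<^sub>v x" using xa by simp
  then have "eigenvalue U (1 / a)" using x car(2) by (auto simp: eigenvalue_def eigenvector_def)
  then have "1 < cmod (1 / a)" using U(2) upper_triangular_eigenvalue[OF car(2) U(1)] by blast
  then show ?thesis using \<open>a \<noteq> 0\<close> by (simp add: norm_divide divide_simps split: if_splits)
qed

lemma U_pow_Ui_pow: "s \<le> t \<Longrightarrow> U ^\<^sub>m s * Ui ^\<^sub>m t = Ui ^\<^sub>m (t - s)"
proof (induction s arbitrary: t)
  case (Suc s)
  then obtain t' where t: "t = Suc t'" by (cases t) auto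
  have "Ui ^\<^sub>m Suc t' = Ui * Ui ^\<^sub>m t'"
    using pow_intertwine[OF Ui(1) Ui(1) Ui(1) refl, of t'] by simp
  then have "U ^\<^sub>m Suc s * Ui ^\<^sub>m t = U ^\<^sub>m s * (U * Ui) * Ui ^\<^sub>m t'"
    unfolding t by (simp add: mult_assoc_dim)
  also have "\<dots> = U ^\<^sub>m s * Ui ^\<^sub>m t'" by (simp add: Ui)
  finally show ?case using Suc t by simp
qed simp

text \<open>Only the unstable coordinates are rescaled: in the stable ones the precision is already
  the partial sum of a convergent series.\<close>

definition NN :: "nat \<Rightarrow> complex mat" where
  "NN t = four_block_mat (Ui ^\<^sub>m t) (0\<^sub>m p (k - p)) (0\<^sub>m (k - p) p) (1\<^sub>m (k - p))"

lemma NN_dim [simp]: "dim_row (NN t) = k" "dim_col (NN t) = k"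
  using pk by (simp_all add: NN_def)

lemma NN_entry: "i < k \<Longrightarrow> j < k \<Longrightarrow>
   NN t $$ (i,j) = (if i < p \<and> j < p then (Ui ^\<^sub>m t) $$ (i,j) else if i = j then 1 else 0)"
  unfolding NN_def by (subst index_mat_four_block) (use pk in auto)

lemma det_NN: "det (NN t) = inverse (det U) ^ t"
proof -
  have "det (NN t) = det (Ui ^\<^sub>m t)" unfolding NN_def
    by (subst det_four_block_mat_lower_left_zero[of _ p _ "k - p"]) (auto intro: carrier_matI)
  moreover have "det (Ui ^\<^sub>m t) = det Ui ^ t"
  proof (induction t)
    case (Suc t)
    then show ?case using det_mult[of "Ui ^\<^sub>m t" p Ui] Ui(1) by (simp add: carrier_matI mult.commute)
  qed (use Ui(1) in simp)
  ultimately show ?thesis using det_mat_inv[OF car(2) det_U_nz] by (simp add: Ui_def)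
qed

lemma mult_P1_entry:
  assumes "X \<in> carrier_mat n p" "i < n" "j < k"
  shows "(X * P1) $$ (i,j) = (if j < p then X $$ (i,j) else 0)"
proof -
  have "(X * P1) $$ (i,j) = (\<Sum>a<p. X $$ (i,a) * P1 $$ (a,j))"
    by (rule index_mult_mat_sum) (use assms in \<open>auto intro!: carrier_matI\<close>)
  also have "\<dots> = (\<Sum>a<p. if a = j then X $$ (i,a) else 0)"
    by (rule sum.cong) (use assms in \<open>auto simp: P1_def\<close>)
  finally show ?thesis by (simp add: sum.delta)
qed

lemma P1_NN: "P1 * NN t = Ui ^\<^sub>m t * P1"
proof (rule eq_matI)
  fix i j assume "i < dim_row (Ui ^\<^sub>m t * P1)" "j < dim_col (Ui ^\<^sub>m t * P1)"
  then have ij: "i < p" "j < k" by auto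
  have "(P1 * NN t) $$ (i,j) = (\<Sum>a<k. P1 $$ (i,a) * NN t $$ (a,j))"
    by (rule index_mult_mat_sum) (use ij in \<open>auto intro!: carrier_matI\<close>)
  also have "\<dots> = (\<Sum>a<k. if a = i then NN t $$ (a,j) else 0)"
    by (rule sum.cong) (use ij in \<open>auto simp: P1_def\<close>)
  also have "\<dots> = NN t $$ (i,j)" using ij pk by (simp add: sum.delta)
  also have "\<dots> = (Ui ^\<^sub>m t * P1) $$ (i,j)"
    using ij pk mult_P1_entry[OF carrier_matI[of "Ui ^\<^sub>m t" p p], of i j] by (auto simp: NN_entry simp del: index_mult_mat(1))
  finally show "(P1 * NN t) $$ (i,j) = (Ui ^\<^sub>m t * P1) $$ (i,j)" .
qed auto

definition cc :: "complex mat" where "cc = cm CC * Tu"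

lemma cc_dim [simp]: "dim_row cc = Suc 0" "dim_col cc = p"
  by (simp_all add: cc_def)

text \<open>The unstable part depends on the distance \<open>t - s\<close> to the horizon alone,
  since powers of \<open>U\<close> and \<open>Ui\<close> cancel; the remainder carries a decaying
  power of \<open>S\<close>.\<close>

lemma Phi_V_NN:
  assumes "s \<le> t"
  shows "cm (Phi s) * (V * NN t) = Tu * (Ui ^\<^sub>m (t - s) * P1) + Q * (S ^\<^sub>m s * (R * NN t))"
proof -
  have A: "cm AA \<in> carrier_mat d d" using AA by simp
  have [simp]: "dim_row (cm AA ^\<^sub>m s) = d" "dim_col (cm AA ^\<^sub>m s) = d"
    by (simp_all add: pow_mat_dim_square[OF A])
  have "cm (Phi s) * (V * NN t) = cm AA ^\<^sub>m s * (cm E * V) * NN t"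
    by (simp add: Phi_def cm_mult cm_pow[OF AA] mult_assoc_dim)
  also have "\<dots> = cm AA ^\<^sub>m s * Tu * P1 * NN t + cm AA ^\<^sub>m s * Q * R * NN t"
    unfolding EV P1_def[symmetric] by (simp add: mult_add_distrib_dim add_mult_distrib_dim mult_assoc_dim)
  also have "\<dots> = Tu * (U ^\<^sub>m s * Ui ^\<^sub>m t * P1) + Q * (S ^\<^sub>m s * (R * NN t))"
    unfolding pow_intertwine[OF A car(1,2) AA_Tu] pow_intertwine[OF A car(3,4) AA_Q]
    by (simp add: mult_assoc_dim P1_NN)
  finally show ?thesis using U_pow_Ui_pow[OF assms] by (simp add: mult_assoc_dim)
qed

text \<open>The observation rows in rescaled coordinates. They split into \<open>al\<close>, the
  unstable part seen from the horizon, and \<open>be\<close>, the contribution of the stable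
  subspace.\<close>

definition gh :: "nat \<Rightarrow> nat \<Rightarrow> complex mat" where "gh t s = cm (g s) * (V * NN t)"
definition al :: "nat \<Rightarrow> complex mat" where "al j = cc * Ui ^\<^sub>m j"
definition be :: "nat \<Rightarrow> nat \<Rightarrow> complex mat" where "be t s = cm CC * Q * S ^\<^sub>m s * (R * NN t)"

lemma gh_dims [simp]: "dim_row (gh t s) = Suc 0" "dim_col (gh t s) = k" "dim_row (al j) = Suc 0" "dim_col (al j) = p"
   "dim_row (be t s) = Suc 0" "dim_col (be t s) = k"
  by (simp_all add: gh_def al_def be_def)

lemma gh_split:
  assumes "s \<le> t" "a < k"
  shows "gh t s $$ (0,a) = (if a < p then al (t - s) $$ (0,a) else 0) + be t s $$ (0,a)"
proof -
  have "gh t s = cm CC * (cm (Phi s) * (V * NN t))"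
    by (simp add: gh_def g_def cm_mult mult_assoc_dim)
  also have "\<dots> = al (t - s) * P1 + be t s"
    unfolding Phi_V_NN[OF assms(1)]
    by (simp add: al_def be_def cc_def mult_assoc_dim mult_add_distrib_dim)
  finally show ?thesis using assms mult_P1_entry[of "al (t - s)" 1 0 a]
    by (simp add: carrier_matI del: index_mult_mat(1))
qed

text \<open>One constant and one rate serve all sequences. In the unstable columns \<open>be\<close>
  decays in both times, because the rescaling multiplies them by a power of \<open>Ui\<close>; in
  the other columns it decays in \<open>s\<close> only.\<close>

lemma bounds:
  obtains c r where "0 \<le> c" "0 < r" "r < 1"
    "\<And>j a. a < p \<Longrightarrow> cmod (al j $$ (0,a)) \<le> c * r ^ j"
    "\<And>t s a. a < p \<Longrightarrow> cmod (be t s $$ (0,a)) \<le> c * r ^ s * r ^ t"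
    "\<And>t s a. a < k \<Longrightarrow> cmod (be t s $$ (0,a)) \<le> c * r ^ s"
    "\<And>t i j. i < p \<Longrightarrow> j < p \<Longrightarrow> cmod ((Ui ^\<^sub>m t) $$ (i,j)) \<le> c * r ^ t"
    "\<And>t i j. i < l \<Longrightarrow> j < l \<Longrightarrow> cmod ((S ^\<^sub>m t) $$ (i,j)) \<le> c * r ^ t"
proof -
  obtain c1 r1 where 1: "0 < r1" "r1 < 1" "0 \<le> c1"
    "\<And>t i j. i < p \<Longrightarrow> j < p \<Longrightarrow> cmod ((Ui ^\<^sub>m t) $$ (i,j)) \<le> c1 * r1 ^ t"
    using stable_power_bound[OF Ui(1) eigenvalue_Ui] by metis
  obtain c2 r2 where 2: "0 < r2" "r2 < 1" "0 \<le> c2"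
    "\<And>t i j. i < l \<Longrightarrow> j < l \<Longrightarrow> cmod ((S ^\<^sub>m t) $$ (i,j)) \<le> c2 * r2 ^ t"
    using stable_power_bound[OF car(4) S] by metis
  define r where "r = max r1 r2"
  have r: "0 < r" "r < 1" using 1 2 by (auto simp: r_def)
  have pw: "c1 * r1 ^ t \<le> c1 * r ^ t" "c2 * r2 ^ t \<le> c2 * r ^ t" for t
    using 1 2 by (auto simp: r_def intro!: mult_left_mono power_mono)
  have Uib: "i < p \<Longrightarrow> j < p \<Longrightarrow> cmod ((Ui ^\<^sub>m t) $$ (i,j)) \<le> c1 * r ^ t" for t i j
    using 1(4) pw(1) order_trans by blast
  have Sb: "i < l \<Longrightarrow> j < l \<Longrightarrow> cmod ((S ^\<^sub>m t) $$ (i,j)) \<le> c2 * r ^ t" for t i j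
    using 2(4) pw(2) order_trans by blast
  have Uic: "Ui ^\<^sub>m t \<in> carrier_mat p p" "S ^\<^sub>m t \<in> carrier_mat l l" for t by (auto intro: carrier_matI)
  have ccc: "cc \<in> carrier_mat 1 p" "cm CC * Q \<in> carrier_mat 1 l" by (auto intro: carrier_matI)
  obtain c3 where c3: "0 \<le> c3" "\<And>j i a. i < 1 \<Longrightarrow> a < p \<Longrightarrow> cmod (al j $$ (i,a)) \<le> c3 * r ^ j"
    using entry_bound_mult_left[OF ccc(1) Uic(1) Uib 1(3) r(1)] unfolding al_def by metis
  note 3 = c3(1) c3(2)[of 0, simplified]
  obtain c4 where c4: "0 \<le> c4" "\<And>s j i. j < 1 \<Longrightarrow> i < l \<Longrightarrow> cmod ((cm CC * Q * S ^\<^sub>m s) $$ (j,i)) \<le> c4 * r ^ s"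
    using entry_bound_mult_left[OF ccc(2) Uic(2) Sb 2(3) r(1)] by metis
  have 4: "0 \<le> c4" "\<And>s i. i < l \<Longrightarrow> cmod ((cm CC * Q * S ^\<^sub>m s) $$ (0,i)) \<le> c4 * r ^ s"
    by (fact c4(1), rule c4(2), simp_all)
  \<comment> \<open>The first \<open>p\<close> columns of \<open>R\<close>, the ones that the
    rescaling multiplies by powers of \<open>Ui\<close>.\<close>
  define R1 where "R1 = mat l p (\<lambda>(i,j). R $$ (i,j))"
  have R1: "R1 \<in> carrier_mat l p" by (simp add: R1_def)
  obtain c5 where 5: "0 \<le> c5" "\<And>t i a. i < l \<Longrightarrow> a < p \<Longrightarrow> cmod ((R1 * Ui ^\<^sub>m t) $$ (i,a)) \<le> c5 * r ^ t"
    using entry_bound_mult_left[OF R1 Uic(1) Uib 1(3) r(1)] by metis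
  define c6 where "c6 = (\<Sum>i<l. \<Sum>a<k. cmod (R $$ (i,a)))"
  have c6: "0 \<le> c6" unfolding c6_def by (intro sum_nonneg) auto
  have RN: "(R * NN t) $$ (i,a) = (if a < p then (R1 * Ui ^\<^sub>m t) $$ (i,a) else R $$ (i,a))"
    if "i < l" "a < k" for t i a
  proof -
    have "(R * NN t) $$ (i,a) = (\<Sum>b<k. R $$ (i,b) * NN t $$ (b,a))"
      by (rule index_mult_mat_sum) (use that in \<open>auto intro!: carrier_matI\<close>)
    also have "\<dots> = (if a < p then (R1 * Ui ^\<^sub>m t) $$ (i,a) else R $$ (i,a))"
    proof (cases "a < p")
      case True
      have "(\<Sum>b<k. R $$ (i,b) * NN t $$ (b,a)) = (\<Sum>b<p. R $$ (i,b) * NN t $$ (b,a))"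
        by (rule sum.mono_neutral_right) (use True pk that in \<open>auto simp: NN_entry\<close>)
      also have "\<dots> = (R1 * Ui ^\<^sub>m t) $$ (i,a)"
        unfolding index_mult_mat_sum[OF R1 Uic(1) that(1) True]
        by (rule sum.cong) (use True pk that in \<open>auto simp: NN_entry R1_def\<close>)
      finally show ?thesis using True by simp
    next
      case False
      have "(\<Sum>b<k. R $$ (i,b) * NN t $$ (b,a)) = (\<Sum>b<k. if b = a then R $$ (i,b) else 0)"
        by (rule sum.cong) (use False that in \<open>auto simp: NN_entry\<close>)
      then show ?thesis using False that by (simp add: sum.delta)
    qed
    finally show ?thesis .
  qed
  have be_le: "cmod (be t s $$ (0,a)) \<le> real l * (c4 * r ^ s) * b"
    if "a < k" "\<And>i. i < l \<Longrightarrow> cmod ((R * NN t) $$ (i,a)) \<le> b" for t s a b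
  proof -
    have "be t s $$ (0,a) = (\<Sum>i<l. (cm CC * Q * S ^\<^sub>m s) $$ (0,i) * (R * NN t) $$ (i,a))"
      unfolding be_def by (rule index_mult_mat_sum) (use that in \<open>auto intro!: carrier_matI\<close>)
    then have "cmod (be t s $$ (0,a)) \<le> (\<Sum>i<l. cmod ((cm CC * Q * S ^\<^sub>m s) $$ (0,i) * (R * NN t) $$ (i,a)))"
      by (simp only: norm_sum)
    also have "\<dots> \<le> (\<Sum>i<l. (c4 * r ^ s) * b)"
      unfolding norm_mult using 4 that r by (intro sum_mono mult_mono) auto
    finally show ?thesis by simp
  qed
  have RN1: "cmod ((R * NN t) $$ (i,a)) \<le> c5 * r ^ t" if "i < l" "a < p" for t i a
    using RN[of i a t] 5(2)[of i a t] that pk by simp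
  have RN2: "cmod ((R * NN t) $$ (i,a)) \<le> c5 + c6" if "i < l" "a < k" for t i a
  proof (cases "a < p")
    case True
    have "c5 * r ^ t \<le> c5 * 1" using 5(1) r by (intro mult_left_mono power_le_one) auto
    then show ?thesis using RN1[OF that(1) True, of t] c6 by simp
  next
    case False
    have "cmod (R $$ (i,a)) \<le> (\<Sum>a<k. cmod (R $$ (i,a)))"
      using that by (intro member_le_sum) auto
    also have "\<dots> \<le> c6" unfolding c6_def using that by (intro member_le_sum) (auto intro: sum_nonneg)
    finally show ?thesis using RN[OF that, of t] False 5(1) by simp
  qed
  define c where "c = c1 + c2 + c3 + real l * c4 * (c5 + c6)"
  have c7: "0 \<le> real l * c4 * c5" "0 \<le> real l * c4 * c6" using 4 5 c6 by auto
  then have cle: "0 \<le> c" "c1 \<le> c" "c2 \<le> c" "c3 \<le> c" "real l * c4 * c5 \<le> c" "real l * c4 * (c5 + c6) \<le> c"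
    using 1 2 3 by (auto simp: c_def distrib_left)
  have mono: "x * r ^ t \<le> c * r ^ t" if "x \<le> c" for x t
    using that r by (intro mult_right_mono) auto
  show thesis
  proof (rule that[OF cle(1) r])
    fix j a assume "a < p"
    then show "cmod (al j $$ (0,a)) \<le> c * r ^ j" using 3(2) mono[OF cle(4)] order_trans by blast
  next
    fix t s a assume a: "a < p"
    have "cmod (be t s $$ (0,a)) \<le> real l * (c4 * r ^ s) * (c5 * r ^ t)"
      using be_le[of a t "c5 * r ^ t" s] RN1[OF _ a] a pk by simp
    also have "\<dots> = real l * c4 * c5 * r ^ s * r ^ t" by (simp add: mult_ac)
    also have "\<dots> \<le> c * r ^ s * r ^ t" using cle(5) r by (intro mult_right_mono) auto
    finally show "cmod (be t s $$ (0,a)) \<le> c * r ^ s * r ^ t" .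
  next
    fix t s a assume a: "a < k"
    have "cmod (be t s $$ (0,a)) \<le> real l * (c4 * r ^ s) * (c5 + c6)"
      using be_le[of a t "c5 + c6" s] RN2[OF _ a] a by simp
    also have "\<dots> = real l * c4 * (c5 + c6) * r ^ s" by (simp add: mult_ac)
    also have "\<dots> \<le> c * r ^ s" using cle(6) r by (intro mult_right_mono) auto
    finally show "cmod (be t s $$ (0,a)) \<le> c * r ^ s" .
  next
    fix t i j assume "i < p" "j < p"
    then show "cmod ((Ui ^\<^sub>m t) $$ (i,j)) \<le> c * r ^ t" using Uib mono[OF cle(2)] order_trans by blast
  next
    fix t i j assume "i < l" "j < l"
    then show "cmod ((S ^\<^sub>m t) $$ (i,j)) \<le> c * r ^ t" using Sb mono[OF cle(3)] order_trans by blast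
  qed
qed

end

section \<open>Convergence of the rescaled precision to a definite limit\<close>

context kalman_split
begin

definition Jh :: "nat \<Rightarrow> complex mat" where
  "Jh t = adj (V * NN t) * (cm (J t) * (V * NN t))"

lemma Jh_dim [simp]: "dim_row (Jh t) = k" "dim_col (Jh t) = k"
  by (simp_all add: Jh_def)

lemma Jh_entry:
  assumes "a < k" "b < k"
  shows "Jh t $$ (a,b) = (\<Sum>i<k. cnj ((V * NN t) $$ (i,a)) * (V * NN t) $$ (i,b)) +
    (\<Sum>s<t. cnj (gh t s $$ (0,a)) * gh t s $$ (0,b))"
  unfolding Jh_def gh_def by (rule J_congruence) (use assms in \<open>auto intro: carrier_matI\<close>)

lemma NN_tendsto: "mat_tendsto k k NN (mat k k (\<lambda>(i,j). if i = j \<and> p \<le> i then 1 else 0))"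
  unfolding mat_tendsto_def
proof (intro conjI allI impI)
  fix i j assume ij: "i < k" "j < k"
  obtain c r where cr: "0 \<le> c" "0 < r" "r < 1" "\<And>t i j. i < p \<Longrightarrow> j < p \<Longrightarrow> cmod ((Ui ^\<^sub>m t) $$ (i,j)) \<le> c * r ^ t"
    using bounds by metis
  have "mat_tendsto p p (\<lambda>t. Ui ^\<^sub>m t) (0\<^sub>m p p)"
    by (rule mat_tendsto_zero[OF _ cr(3,2,4)]) (auto intro: carrier_matI)
  then have "i < p \<Longrightarrow> j < p \<Longrightarrow> (\<lambda>t. (Ui ^\<^sub>m t) $$ (i,j)) \<longlonglongrightarrow> 0"
    using mat_tendsto_entry[of p p "\<lambda>t. Ui ^\<^sub>m t" "0\<^sub>m p p" i j] by simp
  then show "(\<lambda>t. NN t $$ (i,j)) \<longlonglongrightarrow> mat k k (\<lambda>(i,j). if i = j \<and> p \<le> i then 1 else 0) $$ (i,j)"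
    using ij by (cases "i < p \<and> j < p") (auto simp: NN_entry)
qed (auto intro: carrier_matI)

lemma mult_NN_entry:
  assumes "X \<in> carrier_mat n k" "i < n" "p \<le> a" "a < k"
  shows "(X * NN t) $$ (i,a) = X $$ (i,a)"
proof -
  have "(X * NN t) $$ (i,a) = (\<Sum>b<k. X $$ (i,b) * NN t $$ (b,a))"
    by (rule index_mult_mat_sum) (use assms in \<open>auto intro!: carrier_matI\<close>)
  also have "\<dots> = (\<Sum>b<k. if b = a then X $$ (i,b) else 0)"
    by (rule sum.cong) (use assms in \<open>auto simp: NN_entry\<close>)
  finally show ?thesis using assms by (simp add: sum.delta)
qed

lemma be_const:
  assumes "p \<le> a" "a < k"
  shows "be t s $$ (0,a) = be 0 s $$ (0,a)"
proof -
  have "be t s = cm CC * Q * S ^\<^sub>m s * R * NN t" for t by (simp add: be_def mult_assoc_dim)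
  then show ?thesis
    using mult_NN_entry[of "cm CC * Q * S ^\<^sub>m s * R" 1 0 a] assms by (simp add: carrier_matI del: index_mult_mat(1))
qed

text \<open>At a fixed distance from the horizon the time \<open>t - Suc j\<close> tends to
  infinity, which removes the stable contribution.\<close>

lemma gh_limit:
  assumes a: "a < k"
  shows "(\<lambda>t. gh t (t - Suc j) $$ (0,a)) \<longlonglongrightarrow> (if a < p then al (Suc j) $$ (0,a) else 0)"
proof -
  obtain c r where cr: "0 \<le> c" "0 < r" "r < 1" "\<And>t s a. a < k \<Longrightarrow> cmod (be t s $$ (0,a)) \<le> c * r ^ s"
    using bounds by metis
  have "filterlim (\<lambda>t. t - Suc j) sequentially sequentially"
    by (rule filterlim_minus_const_nat_at_top)
  then have "(\<lambda>t. r ^ (t - Suc j)) \<longlonglongrightarrow> 0"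
    using filterlim_compose[of "\<lambda>t. r ^ t" "nhds 0" sequentially "\<lambda>t. t - Suc j" sequentially]
      LIMSEQ_realpow_zero[of r] cr by simp
  then have "(\<lambda>t. c * r ^ (t - Suc j)) \<longlonglongrightarrow> 0" by (rule tendsto_mult_right_zero)
  then have "(\<lambda>t. be t (t - Suc j) $$ (0,a)) \<longlonglongrightarrow> 0"
    using cr(4)[OF a]
    by (intro Lim_null_comparison[of "\<lambda>t. be t (t - Suc j) $$ (0,a)" "\<lambda>t. c * r ^ (t - Suc j)"]) auto
  then have "(\<lambda>t. (if a < p then al (Suc j) $$ (0,a) else 0) + be t (t - Suc j) $$ (0,a))
       \<longlonglongrightarrow> (if a < p then al (Suc j) $$ (0,a) else 0) + 0"
    by (intro tendsto_add tendsto_const)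
  moreover have "eventually (\<lambda>t. (if a < p then al (Suc j) $$ (0,a) else 0) + be t (t - Suc j) $$ (0,a)
      = gh t (t - Suc j) $$ (0,a)) sequentially"
    using eventually_gt_at_top[of j] by eventually_elim (use gh_split a in auto)
  ultimately show ?thesis by (auto intro: Lim_transform_eventually)
qed

text \<open>An entry with at least one unstable index is a sum dominated geometrically from the
  horizon backwards. An entry with two stable indices is a partial sum of a fixed summable series.
  The message part converges because \<open>NN\<close> does.\<close>

lemma Jh_convergent: "\<exists>L. mat_tendsto k k Jh L"
proof -
  obtain c r where cr: "0 \<le> c" "0 < r" "r < 1"
    "\<And>j a. a < p \<Longrightarrow> cmod (al j $$ (0,a)) \<le> c * r ^ j"
    "\<And>t s a. a < p \<Longrightarrow> cmod (be t s $$ (0,a)) \<le> c * r ^ s * r ^ t"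
    "\<And>t s a. a < k \<Longrightarrow> cmod (be t s $$ (0,a)) \<le> c * r ^ s"
    using bounds by metis
  have gh1: "cmod (gh t s $$ (0,a)) \<le> 2 * c * r ^ (t - s)" if "a < p" "s \<le> t" for a t s
  proof -
    have "cmod (gh t s $$ (0,a)) \<le> cmod (al (t - s) $$ (0,a)) + cmod (be t s $$ (0,a))"
      using gh_split[of s t a] that pk norm_triangle_ineq by simp
    also have "\<dots> \<le> c * r ^ (t - s) + c * r ^ s * r ^ t"
      using cr that by (intro add_mono) auto
    also have "c * r ^ s * r ^ t \<le> c * 1 * r ^ (t - s)"
      using cr by (intro mult_mono power_le_one power_decreasing mult_nonneg_nonneg) auto
    finally show ?thesis by simp
  qed
  have gh2: "cmod (gh t s $$ (0,a)) \<le> 2 * c" if "a < k" "s \<le> t" for a t s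
  proof (cases "a < p")
    case True
    have "2 * c * r ^ (t - s) \<le> 2 * c * 1" using cr by (intro mult_left_mono power_le_one) auto
    then show ?thesis using gh1[OF True that(2)] by simp
  next
    case False
    have "c * r ^ s \<le> c * 1" using cr by (intro mult_left_mono power_le_one) auto
    then show ?thesis using gh_split[OF that(2,1)] False cr(6)[OF that(1), of t s] cr(1) by simp
  qed
  have conv: "convergent (\<lambda>t. \<Sum>s<t. cnj (gh t s $$ (0,a)) * gh t s $$ (0,b))" if ab: "a < k" "b < k" for a b
  proof (cases "a < p \<or> b < p")
    case True
    \<comment> \<open>The unstable factor supplies the decay while the other factor is merely
      bounded.\<close>
    have bd: "cmod (cnj (gh t s $$ (0,a)) * gh t s $$ (0,b)) \<le> (4 * c * c) * r ^ (t - Suc s)" if "s < t" for t s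
    proof -
      have "cmod (gh t s $$ (0,a)) * cmod (gh t s $$ (0,b)) \<le> (2 * c * r ^ (t - s)) * (2 * c)"
      proof (cases "a < p")
        case True
        then show ?thesis using gh1[of a s t] gh2[of b s t] that ab cr by (intro mult_mono) auto
      next
        case False
        then have "cmod (gh t s $$ (0,b)) * cmod (gh t s $$ (0,a)) \<le> (2 * c * r ^ (t - s)) * (2 * c)"
          using \<open>a < p \<or> b < p\<close> gh1[of b s t] gh2[of a s t] that ab cr by (intro mult_mono) auto
        then show ?thesis by (simp add: mult.commute)
      qed
      also have "\<dots> \<le> (2 * c * r ^ (t - Suc s)) * (2 * c)"
        using cr by (intro mult_right_mono mult_left_mono power_decreasing) auto
      finally show ?thesis by (simp add: norm_mult mult_ac)
    qed
    have lim: "(\<lambda>t. cnj (gh t (t - Suc j) $$ (0,a)) * gh t (t - Suc j) $$ (0,b)) \<longlonglongrightarrow>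
       cnj (if a < p then al (Suc j) $$ (0,a) else 0) * (if b < p then al (Suc j) $$ (0,b) else 0)" for j
      by (intro tendsto_mult tendsto_cnj gh_limit ab)
    show ?thesis
      unfolding convergent_def using convergent_sum_tannery[OF lim bd cr(2,3)] cr(1) by auto
  next
    case False
    \<comment> \<open>Rescaling is the identity on stable columns, so these rows do not depend on
      the horizon.\<close>
    have eq: "gh t s $$ (0,a) = be 0 s $$ (0,a)" if "s < t" "p \<le> a" "a < k" for t s a
      using gh_split[of s t a] be_const[of a t s] that by simp
    have "summable (\<lambda>s. cnj (be 0 s $$ (0,a)) * be 0 s $$ (0,b))"
    proof (rule summable_comparison_test')
      show "summable (\<lambda>s. c * c * r ^ s)" using cr by (intro summable_mult summable_geometric) auto
      fix s :: nat
      have "cmod (be 0 s $$ (0,a)) * cmod (be 0 s $$ (0,b)) \<le> (c * r ^ s) * (c * 1)"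
        using cr(6)[OF ab(1), of 0 s] cr(6)[OF ab(2), of 0 s] cr(1,2,3)
        by (intro mult_mono order_trans[OF cr(6)[OF ab(2), of 0 s]] mult_left_mono power_le_one) auto
      then show "norm (cnj (be 0 s $$ (0,a)) * be 0 s $$ (0,b)) \<le> c * c * r ^ s"
        by (simp add: norm_mult mult_ac)
    qed
    then have "(\<lambda>t. \<Sum>s<t. cnj (be 0 s $$ (0,a)) * be 0 s $$ (0,b)) \<longlonglongrightarrow> (\<Sum>s. cnj (be 0 s $$ (0,a)) * be 0 s $$ (0,b))"
      by (rule summable_LIMSEQ)
    moreover have "(\<Sum>s<t. cnj (gh t s $$ (0,a)) * gh t s $$ (0,b)) = (\<Sum>s<t. cnj (be 0 s $$ (0,a)) * be 0 s $$ (0,b))" for t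
      by (rule sum.cong) (use eq False ab in auto)
    ultimately show ?thesis unfolding convergent_def by auto
  qed
  have VN: "mat_tendsto k k (\<lambda>t. V * NN t) (V * mat k k (\<lambda>(i,j). if i = j \<and> p \<le> i then 1 else 0))"
    by (intro mat_tendsto_mult[where n = k] mat_tendsto_const NN_tendsto car)
  have "convergent (\<lambda>t. Jh t $$ (a,b))" if ab: "a < k" "b < k" for a b
    unfolding Jh_entry[OF ab]
  proof (rule convergent_add)
    show "convergent (\<lambda>t. \<Sum>i<k. cnj ((V * NN t) $$ (i,a)) * (V * NN t) $$ (i,b))"
    proof -
      let ?W = "V * mat k k (\<lambda>(i,j). if i = j \<and> p \<le> i then 1 else 0)"
      have "(\<lambda>t. \<Sum>i<k. cnj ((V * NN t) $$ (i,a)) * (V * NN t) $$ (i,b)) \<longlonglongrightarrow>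
          (\<Sum>i<k. cnj (?W $$ (i,a)) * ?W $$ (i,b))"
        by (intro tendsto_sum tendsto_mult tendsto_cnj mat_tendsto_entry[OF VN]) (use ab in auto)
      then show ?thesis unfolding convergent_def by blast
    qed
  qed (rule conv[OF ab])
  then have "mat_tendsto k k Jh (mat k k (\<lambda>(a,b). lim (\<lambda>t. Jh t $$ (a,b))))"
    unfolding mat_tendsto_def by (auto intro!: carrier_matI simp: convergent_LIMSEQ_iff)
  then show ?thesis by blast
qed

text \<open>A vector unseen by all \<open>al (Suc j)\<close> generates a \<open>U\<close>-invariant
  set of vectors unseen from some index on, and this set contains an eigenvector. Its image under
  \<open>Tu\<close> is an eigenvector of \<open>AA\<close> outside the disc that \<open>CC\<close>
  does not see, against \<open>detectable\<close>.\<close>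

lemma observable_backwards:
  assumes x: "x \<in> carrier_vec p" and z: "\<And>j. (\<Sum>a<p. al (Suc j) $$ (0,a) * x $ a) = 0"
  shows "x = 0\<^sub>v p"
proof (rule ccontr)
  assume nz: "x \<noteq> 0\<^sub>v p"
  have ccc: "cc \<in> carrier_mat 1 p" and Uic: "Ui ^\<^sub>m j \<in> carrier_mat p p" for j by (auto intro: carrier_matI)
  have alv: "al j *\<^sub>v y = cc *\<^sub>v (Ui ^\<^sub>m j *\<^sub>v y)" if "y \<in> carrier_vec p" for j y
    unfolding al_def using assoc_mult_mat_vec[OF ccc Uic that] .
  have alc: "al j \<in> carrier_mat 1 p" for j by (auto intro: carrier_matI)
  \<comment> \<open>Vanishing is required only from some index on, because each application of
    \<open>U\<close> costs one index.\<close>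
  let ?P = "\<lambda>y. \<exists>j0. \<forall>j\<ge>j0. al j *\<^sub>v y = 0\<^sub>v 1"
  have "al (Suc j) *\<^sub>v x = 0\<^sub>v 1" for j
    using z[of j] index_mult_vec_sum[OF alc x, of 0] by (intro eq_vecI) auto
  then have Px: "?P x" by (metis Suc_le_D)
  have inv: "?P (U *\<^sub>v y - a \<cdot>\<^sub>v y)" if y: "y \<in> carrier_vec p" "?P y" for y a
  proof -
    from y(2) obtain j0 where j0: "\<And>j. j \<ge> j0 \<Longrightarrow> al j *\<^sub>v y = 0\<^sub>v 1" by blast
    have "al j *\<^sub>v (U *\<^sub>v y - a \<cdot>\<^sub>v y) = 0\<^sub>v 1" if j: "j \<ge> Suc j0" for j
    proof -
      obtain i where i: "j = Suc i" "i \<ge> j0" using j by (cases j) auto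
      have "al j * U = al i"
        unfolding i(1) al_def using Ui by (simp add: mult_assoc_dim)
      then have "al j *\<^sub>v (U *\<^sub>v y) = al i *\<^sub>v y"
        using assoc_mult_mat_vec[OF alc car(2) y(1), of j] by simp
      moreover have "al j *\<^sub>v (a \<cdot>\<^sub>v y) = a \<cdot>\<^sub>v (al j *\<^sub>v y)" by (rule mult_mat_vec[OF alc y(1)])
      moreover have "al j *\<^sub>v (U *\<^sub>v y - a \<cdot>\<^sub>v y) = al j *\<^sub>v (U *\<^sub>v y) - al j *\<^sub>v (a \<cdot>\<^sub>v y)"
        by (rule mult_minus_distrib_mat_vec[OF alc]) (use y car in auto)
      ultimately show ?thesis using j0[of i] j0[of j] i
        by (intro eq_vecI) simp_all
    qed
    then show ?thesis by blast
  qed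
  obtain y a where y: "y \<in> carrier_vec p" "y \<noteq> 0\<^sub>v p" "?P y" "U *\<^sub>v y = a \<cdot>\<^sub>v y" "a \<in> set (diag_mat U)"
    using upper_triangular_invariant_eigenvector[OF car(2) U(1) x nz Px inv] by metis
  have a: "1 < cmod a" using U(2) y(5) by blast
  then have a0: "a \<noteq> 0" by auto
  have Uiy: "Ui *\<^sub>v y = (1 / a) \<cdot>\<^sub>v y"
  proof -
    have "y = Ui *\<^sub>v (U *\<^sub>v y)" using assoc_mult_mat_vec[OF Ui(1) car(2) y(1)] Ui(3) y(1) by simp
    also have "\<dots> = a \<cdot>\<^sub>v (Ui *\<^sub>v y)" unfolding y(4) by (rule mult_mat_vec[OF Ui(1) y(1)])
    finally have "(1 / a) \<cdot>\<^sub>v y = (1 / a) \<cdot>\<^sub>v (a \<cdot>\<^sub>v (Ui *\<^sub>v y))" by simp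
    then show ?thesis using a0 by (simp add: smult_smult_assoc)
  qed
  have pw: "Ui ^\<^sub>m j *\<^sub>v y = (1 / a) ^ j \<cdot>\<^sub>v y" for j
  proof (induction j)
    case 0 then show ?case using y Ui(1) by simp
  next
    case (Suc j)
    have "Ui ^\<^sub>m Suc j *\<^sub>v y = Ui ^\<^sub>m j *\<^sub>v (Ui *\<^sub>v y)"
      using assoc_mult_mat_vec[OF Uic Ui(1) y(1), of j] by simp
    also have "\<dots> = (1 / a) \<cdot>\<^sub>v (Ui ^\<^sub>m j *\<^sub>v y)" unfolding Uiy by (rule mult_mat_vec[OF Uic y(1)])
    finally show ?case unfolding Suc by (simp add: smult_smult_assoc)
  qed
  from y(3) obtain j where "al j *\<^sub>v y = 0\<^sub>v 1" by blast
  then have "(1 / a) ^ j \<cdot>\<^sub>v (cc *\<^sub>v y) = 0\<^sub>v 1"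
    unfolding alv[OF y(1)] pw mult_mat_vec[OF ccc y(1)] .
  then have "(1 / a) ^ j * (cc *\<^sub>v y) $ 0 = 0"
    by (metis carrier_vecD cc_dim(1) dim_mult_mat_vec index_smult_vec(1) index_zero_vec(1) less_one One_nat_def)
  then have "cc *\<^sub>v y = 0\<^sub>v 1" using a0 by (intro eq_vecI) auto
  then have 1: "cm CC *\<^sub>v (Tu *\<^sub>v y) = 0\<^sub>v 1"
    using assoc_mult_mat_vec[of "cm CC" 1 d Tu p y] CC car y by (simp add: cc_def)
  have "cm AA *\<^sub>v (Tu *\<^sub>v y) = Tu *\<^sub>v (U *\<^sub>v y)"
    using assoc_mult_mat_vec[of "cm AA" d d Tu p y] assoc_mult_mat_vec[of Tu d p U p y] AA car y AA_Tu by simp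
  also have "\<dots> = a \<cdot>\<^sub>v (Tu *\<^sub>v y)" unfolding y(4) by (rule mult_mat_vec[OF car(1) y(1)])
  finally have "Tu *\<^sub>v y = 0\<^sub>v d" using detectable[OF _ a _ 1] car y by simp
  then show False using Tu_inj y by blast
qed

text \<open>All summands of the quadratic forms are nonnegative while the forms tend to 0, so each
  summand does. The rows close to the horizon force the unstable coordinates to vanish; then the
  message part, constant in time, forces \<open>V * x = 0\<close>.\<close>

lemma limit_definite:
  assumes L: "mat_tendsto k k Jh L" and x: "x \<in> carrier_mat k 1" and q: "(adj x * (L * x)) $$ (0,0) = 0"
  shows "x = 0\<^sub>m k 1"
proof -
  have xd [simp]: "dim_row x = k" "dim_col x = Suc 0" using x by auto
  define qt where "qt t = (\<Sum>i<k. (cmod ((V * NN t * x) $$ (i,0)))\<^sup>2) + (\<Sum>s<t. (cmod ((gh t s * x) $$ (0,0)))\<^sup>2)" for t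
  have qt: "(adj x * (Jh t * x)) $$ (0,0) = complex_of_real (qt t)" for t
  proof -
    have "adj x * (Jh t * x) = adj (V * NN t * x) * (cm (J t) * (V * NN t * x))"
      by (simp add: Jh_def adj_mult mult_assoc_dim)
    moreover have "cm (g s) * (V * NN t * x) = gh t s * x" for s
      by (simp add: gh_def mult_assoc_dim)
    ultimately show ?thesis
      using J_congruence[of "V * NN t * x" 1 0 0 t] unfolding qt_def of_real_add of_real_sum complex_norm_square
      by (simp add: carrier_matI mult.commute del: index_mult_mat(1))
  qed
  have "mat_tendsto 1 1 (\<lambda>t. adj x * (Jh t * x)) (adj x * (L * x))"
    by (intro mat_tendsto_mult[where n = k] mat_tendsto_const L) (auto intro: carrier_matI)
  from mat_tendsto_entry[OF this, of 0 0] have "(\<lambda>t. complex_of_real (qt t)) \<longlonglongrightarrow> 0" by (simp only: qt q zero_less_one)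
  from tendsto_Re[OF this] have qt0: "qt \<longlonglongrightarrow> 0" by simp
  \<comment> \<open>A limit dominated by the quadratic forms vanishes.\<close>
  have lez: "y = 0" if "f \<longlonglongrightarrow> y" "eventually (\<lambda>t. (cmod (f t))\<^sup>2 \<le> qt t) sequentially" for f and y :: complex
  proof -
    have "(\<lambda>t. (cmod (f t))\<^sup>2) \<longlonglongrightarrow> (cmod y)\<^sup>2" by (intro tendsto_intros that)
    then have "(cmod y)\<^sup>2 \<le> 0" by (rule tendsto_le[OF trivial_limit_sequentially qt0 _ that(2)])
    then show ?thesis by simp
  qed
  have z: "(\<Sum>a<p. al (Suc j) $$ (0,a) * x $$ (a,0)) = 0" for j
  proof -
    have e: "(gh t s * x) $$ (0,0) = (\<Sum>a<k. gh t s $$ (0,a) * x $$ (a,0))" for t s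
      by (rule index_mult_mat_sum) (auto intro: carrier_matI)
    have "(\<lambda>t. (gh t (t - Suc j) * x) $$ (0,0)) \<longlonglongrightarrow> (\<Sum>a<k. (if a < p then al (Suc j) $$ (0,a) else 0) * x $$ (a,0))"
      unfolding e by (intro tendsto_sum tendsto_mult tendsto_const gh_limit) auto
    moreover have "eventually (\<lambda>t. (cmod ((gh t (t - Suc j) * x) $$ (0,0)))\<^sup>2 \<le> qt t) sequentially"
      using eventually_gt_at_top[of j]
    proof eventually_elim
      case (elim t)
      then have "(cmod ((gh t (t - Suc j) * x) $$ (0,0)))\<^sup>2 \<le> (\<Sum>s<t. (cmod ((gh t s * x) $$ (0,0)))\<^sup>2)"
        by (intro member_le_sum[of "t - Suc j" "{..<t}" "\<lambda>s. (cmod ((gh t s * x) $$ (0,0)))\<^sup>2"]) auto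
      then show ?case unfolding qt_def by (smt (verit) sum_nonneg zero_le_power2)
    qed
    ultimately have "(\<Sum>a<k. (if a < p then al (Suc j) $$ (0,a) else 0) * x $$ (a,0)) = 0" by (rule lez)
    moreover have "(\<Sum>a<k. (if a < p then al (Suc j) $$ (0,a) else 0) * x $$ (a,0)) = (\<Sum>a<p. al (Suc j) $$ (0,a) * x $$ (a,0))"
      by (rule sum.mono_neutral_cong_right) (use pk in auto)
    ultimately show ?thesis by simp
  qed
  have "vec p (\<lambda>a. x $$ (a,0)) = 0\<^sub>v p"
    by (rule observable_backwards) (use z in auto)
  then have xu: "x $$ (a,0) = 0" if "a < p" for a
    using that by (metis index_vec index_zero_vec(1))
  \<comment> \<open>Without unstable coordinates the rescaling acts trivially, so the message
    summand is the same for all \<open>t\<close>.\<close>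
  have NNx: "NN t * x = x" for t
  proof (rule eq_matI)
    fix i j assume "i < dim_row x" "j < dim_col x"
    then have ij: "i < k" "j = 0" by auto
    have "(NN t * x) $$ (i,0) = (\<Sum>a<k. NN t $$ (i,a) * x $$ (a,0))"
      by (rule index_mult_mat_sum) (use ij in \<open>auto intro: carrier_matI\<close>)
    also have "\<dots> = (\<Sum>a<k. if a = i then x $$ (a,0) else 0)"
      by (rule sum.cong) (use ij xu in \<open>auto simp: NN_entry\<close>)
    finally show "(NN t * x) $$ (i,j) = x $$ (i,j)" using ij by (simp add: sum.delta)
  qed auto
  have Vx: "(V * x) $$ (i,0) = 0" if "i < k" for i
  proof (rule lez[of "\<lambda>t. (V * x) $$ (i,0)"])
    have "(cmod ((V * x) $$ (i,0)))\<^sup>2 \<le> qt t" for t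
    proof -
      have "V * NN t * x = V * x" using NNx[of t] by (simp add: mult_assoc_dim)
      moreover have "(cmod ((V * x) $$ (i,0)))\<^sup>2 \<le> (\<Sum>i<k. (cmod ((V * x) $$ (i,0)))\<^sup>2)"
        using that by (intro member_le_sum[of i "{..<k}" "\<lambda>i. (cmod ((V * x) $$ (i,0)))\<^sup>2"]) auto
      ultimately have "(cmod ((V * x) $$ (i,0)))\<^sup>2 \<le> (\<Sum>i<k. (cmod ((V * NN t * x) $$ (i,0)))\<^sup>2)" by simp
      then show ?thesis unfolding qt_def by (rule order_trans) (auto intro!: sum_nonneg)
    qed
    then show "eventually (\<lambda>t. (cmod ((V * x) $$ (i,0)))\<^sup>2 \<le> qt t) sequentially" by simp
  qed simp
  have "V * x = 0\<^sub>m k 1" by (rule eq_matI) (use Vx in \<open>auto simp del: index_mult_mat(1)\<close>)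
  then have "mat_inv V * (V * x) = 0\<^sub>m k 1" using mat_inv_inverse(1)[OF car(6) V] by simp
  moreover have "mat_inv V * (V * x) = x"
    using mat_inv_inverse[OF car(6) V] mult_assoc_dim[of "mat_inv V" V x] by simp
  ultimately show ?thesis by simp
qed

end

lemma mat_tendsto_unique:
  assumes "mat_tendsto nr nc X L" "mat_tendsto nr nc X L'"
  shows "L = L'"
proof (rule eq_matI)
  fix i j assume "i < dim_row L'" "j < dim_col L'"
  then have "i < nr" "j < nc" using assms by (auto simp: mat_tendsto_def)
  then show "L $$ (i,j) = L' $$ (i,j)"
    using mat_tendsto_entry[OF assms(1)] mat_tendsto_entry[OF assms(2)] LIMSEQ_unique by blast
qed (use assms in \<open>auto simp: mat_tendsto_def\<close>)

lemma mat_tendsto_adj: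
  assumes "mat_tendsto nr nc X L"
  shows "mat_tendsto nc nr (\<lambda>t. adj (X t)) (adj L)"
proof -
  have "dim_row (X t) = nr" "dim_col (X t) = nc" "dim_row L = nr" "dim_col L = nc" for t
    using assms by (auto simp: mat_tendsto_def)
  then show ?thesis using mat_tendsto_entry[OF assms]
    by (auto simp: mat_tendsto_def intro!: tendsto_cnj carrier_matI)
qed

lemma mat_tendsto_Suc: "mat_tendsto nr nc X L \<Longrightarrow> mat_tendsto nr nc (\<lambda>t. X (Suc t)) L"
  unfolding mat_tendsto_def by (auto intro: LIMSEQ_Suc)

lemma mat_tendsto_cm_iff: "mat_tendsto nr nc (\<lambda>t. cm (X t)) (cm L) \<longleftrightarrow> mat_tendsto nr nc X L"
proof -
  have "(\<lambda>t. cm (X t) $$ (i,j)) \<longlonglongrightarrow> cm L $$ (i,j) \<longleftrightarrow> (\<lambda>t. X t $$ (i,j)) \<longlonglongrightarrow> L $$ (i,j)"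
    if "\<And>t. X t \<in> carrier_mat nr nc" "L \<in> carrier_mat nr nc" "i < nr" "j < nc" for i j
  proof -
    have "cm (X t) $$ (i,j) = complex_of_real (X t $$ (i,j))" "cm L $$ (i,j) = complex_of_real (L $$ (i,j))" for t
      using that(1)[of t] that(2-) by auto
    then show ?thesis by (simp only: tendsto_of_real_iff)
  qed
  then show ?thesis unfolding mat_tendsto_def by auto
qed

section \<open>Uniqueness of the stabilizing solution\<close>

lemma stable_mat_power_tendsto_zero:
  assumes A: "A \<in> carrier_mat n n" and st: "stable_mat A"
  shows "mat_tendsto n n (\<lambda>t. cm A ^\<^sub>m t) (0\<^sub>m n n)"
proof -
  obtain c r where "0 < r" "r < 1" "\<And>t i j. i < n \<Longrightarrow> j < n \<Longrightarrow> cmod ((cm A ^\<^sub>m t) $$ (i,j)) \<le> c * r ^ t"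
    using stable_power_bound[of "cm A" n] A st unfolding stable_mat_def ceigenvalue_def
    by (metis map_carrier_mat)
  then show ?thesis using A by (intro mat_tendsto_zero[of _ n n r c]) auto
qed

text \<open>Iterating the equation surrounds \<open>D\<close> by powers of \<open>A\<close> and
  \<open>B\<^sup>T\<close>, which tend to 0.\<close>

lemma stable_sandwich_zero:
  assumes A: "A \<in> carrier_mat n n" "stable_mat A" and B: "B \<in> carrier_mat n n" "stable_mat B"
    and D: "D \<in> carrier_mat n n" "D = A * (D * B\<^sup>T)"
  shows "D = 0\<^sub>m n n"
proof -
  have dA: "dim_row (A ^\<^sub>m t) = n" "dim_col (A ^\<^sub>m t) = n" "dim_row (B ^\<^sub>m t) = n" "dim_col (B ^\<^sub>m t) = n" for t
    using pow_mat_dim_square[OF A(1)] pow_mat_dim_square[OF B(1)] by auto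
  have d: "dim_row D = n" "dim_col D = n" "dim_row A = n" "dim_col A = n" "dim_row B = n" "dim_col B = n"
    using A B D by auto
  have "D = A ^\<^sub>m t * (D * (B ^\<^sub>m t)\<^sup>T)" for t
  proof (induction t)
    case 0 then show ?case using A B D by simp
  next
    case (Suc t)
    have "B ^\<^sub>m Suc t = B * B ^\<^sub>m t" "A ^\<^sub>m Suc t = A * A ^\<^sub>m t"
      using pow_intertwine[OF B(1) B(1) B(1) refl, of t] pow_intertwine[OF A(1) A(1) A(1) refl, of t] by simp_all
    then have "A ^\<^sub>m Suc t * (D * (B ^\<^sub>m Suc t)\<^sup>T) = A * (A ^\<^sub>m t * (D * (B ^\<^sub>m t)\<^sup>T) * B\<^sup>T)"
      using d dA by (simp add: mult_assoc_dim transpose_mult_dim)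
    also have "\<dots> = A * (D * B\<^sup>T)" using Suc by simp
    finally show ?case using D(2) by simp
  qed
  then have "cm D = cm A ^\<^sub>m t * (cm D * (cm B ^\<^sub>m t)\<^sup>T)" for t
    using d dA by (metis (no_types, lifting) cm_mult cm_pow[OF A(1)] cm_pow[OF B(1)] cm_transpose index_mult_mat(2,3) index_transpose_mat(2,3))
  moreover have "mat_tendsto n n (\<lambda>t. cm A ^\<^sub>m t * (cm D * (cm B ^\<^sub>m t)\<^sup>T)) (0\<^sub>m n n * (cm D * (0\<^sub>m n n)\<^sup>T))"
    by (intro mat_tendsto_mult[where n = n] mat_tendsto_const mat_tendsto_transpose stable_mat_power_tendsto_zero A B)
       (use D in auto)
  ultimately have "mat_tendsto n n (\<lambda>t. cm D) (0\<^sub>m n n * (cm D * (0\<^sub>m n n)\<^sup>T))" by simp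
  moreover have "mat_tendsto n n (\<lambda>t. cm D) (cm D)" using D by (intro mat_tendsto_const) auto
  ultimately have "cm D = 0\<^sub>m n n * (cm D * (0\<^sub>m n n)\<^sup>T)" using mat_tendsto_unique by blast
  also have "\<dots> = 0\<^sub>m n n" using d by (intro left_mult_zero_mat) (auto intro: carrier_matI)
  finally have z: "cm D = 0\<^sub>m n n" .
  show ?thesis
  proof (rule eq_matI)
    fix i j assume "i < dim_row (0\<^sub>m n n)" "j < dim_col (0\<^sub>m n n)"
    then have ij: "i < n" "j < n" by auto
    then have "cm D $$ (i,j) = 0" using z by simp
    then show "D $$ (i,j) = 0\<^sub>m n n $$ (i,j)" using ij d by simp
  qed (use d in auto)
qed

text \<open>Once the gain is fixed, the Riccati map is linear in the covariance; this makes two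
  solutions comparable.\<close>

lemma riccati_map_closed_loop:
  assumes "AA \<in> carrier_mat d d" "CC \<in> carrier_mat 1 d" "S \<in> carrier_mat d d"
  shows "riccati_map AA CC S = (AA - kalman_gain AA CC S * CC) * (S * AA\<^sup>T)"
proof -
  have d: "dim_row AA = d" "dim_col AA = d" "dim_row CC = Suc 0" "dim_col CC = d" "dim_row S = d" "dim_col S = d"
    using assms by auto
  show ?thesis unfolding riccati_map_def kalman_gain_def
    using d by (simp add: mat_dim_simps)
qed

text \<open>With innovation variance \<kappa>, the matrix \<open>AA\<close> sends
  \<open>S * CC\<^sup>T\<close> to \<kappa> times the gain, and \<open>CC\<close> sends it to
  \<kappa> - 1. The difference leaves the gain once.\<close>

lemma kalman_gain_closed_loop:
  assumes "AA \<in> carrier_mat d d" "CC \<in> carrier_mat 1 d" "S \<in> carrier_mat d d" and K: "innov_var CC S \<noteq> 0"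
  shows "(AA - kalman_gain AA CC S * CC) * (S * CC\<^sup>T) = kalman_gain AA CC S"
proof -
  have d: "dim_row AA = d" "dim_col AA = d" "dim_row CC = Suc 0" "dim_col CC = d" "dim_row S = d" "dim_col S = d"
    using assms by auto
  define \<kappa> where "\<kappa> = innov_var CC S"
  define L where "L = kalman_gain AA CC S"
  have L: "L = (1 / \<kappa>) \<cdot>\<^sub>m (AA * (S * CC\<^sup>T))"
    using d by (simp add: L_def kalman_gain_def \<kappa>_def mult_assoc_dim)
  then have dL: "dim_row L = d" "dim_col L = Suc 0" using d by auto
  have AL: "AA * (S * CC\<^sup>T) = \<kappa> \<cdot>\<^sub>m L" using K unfolding L \<kappa>_def[symmetric]
    by (intro eq_matI) (auto simp: \<kappa>_def)
  have "CC * (S * CC\<^sup>T) = (\<kappa> - 1) \<cdot>\<^sub>m 1\<^sub>m 1"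
    by (rule eq_matI) (use d in \<open>auto simp: \<kappa>_def innov_var_def mult_assoc_dim simp del: index_mult_mat(1)\<close>)
  then have "L * (CC * (S * CC\<^sup>T)) = (\<kappa> - 1) \<cdot>\<^sub>m L"
    using dL by (simp add: mult_smult_dim)
  then have "(AA - L * CC) * (S * CC\<^sup>T) = \<kappa> \<cdot>\<^sub>m L - (\<kappa> - 1) \<cdot>\<^sub>m L"
    using d dL AL by (simp add: minus_mult_distrib_dim mult_assoc_dim)
  also have "\<dots> = L" by (rule eq_matI) (auto simp: algebra_simps)
  finally show ?thesis by (simp add: L_def)
qed

text \<open>Conjugating both solutions by the closed loop of the first on the left and that of the
  second on the right changes each by the same cross term \<open>L1 * L2\<^sup>T\<close>. The
  difference thus reproduces itself between two stable matrices.\<close>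

lemma stabilizing_solution_unique:
  assumes AA: "AA \<in> carrier_mat d d" and CC: "CC \<in> carrier_mat 1 d"
    and 1: "stabilizing_solution AA CC S1" and 2: "stabilizing_solution AA CC S2"
  shows "S1 = S2"
proof -
  let ?A = "\<lambda>S. AA - kalman_gain AA CC S * CC"
  have sol: "S \<in> carrier_mat d d \<and> S\<^sup>T = S \<and> S = ?A S * (S * AA\<^sup>T) \<and> stable_mat (?A S) \<and>
      ?A S \<in> carrier_mat d d \<and> kalman_gain AA CC S \<in> carrier_mat d 1 \<and> ?A S * (S * CC\<^sup>T) = kalman_gain AA CC S"
    if st: "stabilizing_solution AA CC S" for S
  proof -
    have S: "S \<in> carrier_mat d d" "S\<^sup>T = S" "S = riccati_map AA CC S" "stable_mat (?A S)"
      using st AA by (auto simp: stabilizing_solution_def)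
    have kc: "kalman_gain AA CC S \<in> carrier_mat d 1" using AA CC S by (auto simp: kalman_gain_def)
    have Ac: "?A S \<in> carrier_mat d d" using AA CC kc by auto
    have eq: "S = ?A S * (S * AA\<^sup>T)" using S(3) riccati_map_closed_loop[OF AA CC S(1)] by simp
    \<comment> \<open>Solutions are not assumed positive, so a vanishing variance must be excluded.
      Division by 0 would give gain 0, hence \<open>AA\<close> would be stable and
      \<open>S = 0\<close>, whose innovation variance is 1.\<close>
    have "innov_var CC S \<noteq> 0"
    proof
      assume z: "innov_var CC S = 0"
      then have "kalman_gain AA CC S = 0\<^sub>m d 1" using AA CC S
        by (auto simp: kalman_gain_def intro!: eq_matI)
      then have "?A S = AA" using AA CC by (intro eq_matI) auto
      then have "S = 0\<^sub>m d d"
        using stable_sandwich_zero[OF AA _ AA _ S(1)] S(4) eq by simp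
      then show False using z CC by (simp add: innov_var_def)
    qed
    then show ?thesis using S kc Ac eq kalman_gain_closed_loop[OF AA CC S(1)] by blast
  qed
  define L1 L2 where "L1 = kalman_gain AA CC S1" and "L2 = kalman_gain AA CC S2"
  note s1 = sol[OF 1, folded L1_def] and s2 = sol[OF 2, folded L2_def]
  have d: "dim_row AA = d" "dim_col AA = d" "dim_row CC = Suc 0" "dim_col CC = d"
    "dim_row S1 = d" "dim_col S1 = d" "dim_row S2 = d" "dim_col S2 = d"
    "dim_row L1 = d" "dim_col L1 = Suc 0" "dim_row L2 = d" "dim_col L2 = Suc 0"
    using AA CC s1 s2 by auto
  define A1 A2 where "A1 = AA - L1 * CC" and "A2 = AA - L2 * CC"
  have dA: "dim_row A1 = d" "dim_col A1 = d" "dim_row A2 = d" "dim_col A2 = d"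
    using d by (auto simp: A1_def A2_def)
  have e1: "A1 * (S1 * AA\<^sup>T) = S1" "A1 * (S1 * CC\<^sup>T) = L1" using s1 by (simp_all add: A1_def)
  have e2: "AA * (S2 * A2\<^sup>T) = S2"
  proof -
    have "(A2 * (S2 * AA\<^sup>T))\<^sup>T = S2\<^sup>T" using s2 by (simp add: A2_def)
    then show ?thesis using s2 d dA by (simp add: transpose_mult_dim mult_assoc_dim)
  qed
  have e3: "CC * (S2 * A2\<^sup>T) = L2\<^sup>T"
  proof -
    have "(A2 * (S2 * CC\<^sup>T))\<^sup>T = L2\<^sup>T" using s2 by (simp add: A2_def)
    then show ?thesis using s2 d dA by (simp add: transpose_mult_dim mult_assoc_dim)
  qed
  have A2T: "A2\<^sup>T = AA\<^sup>T - CC\<^sup>T * L2\<^sup>T" using d by (simp add: A2_def transpose_minus_dim transpose_mult_dim)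
  have "A1 * (S1 * A2\<^sup>T) = S1 - L1 * L2\<^sup>T"
  proof -
    have "A1 * (S1 * A2\<^sup>T) = A1 * (S1 * AA\<^sup>T) - A1 * (S1 * CC\<^sup>T) * L2\<^sup>T"
      unfolding A2T using d dA by (simp add: mult_minus_distrib_dim mult_assoc_dim)
    then show ?thesis by (simp only: e1)
  qed
  moreover have "A1 * (S2 * A2\<^sup>T) = S2 - L1 * L2\<^sup>T"
  proof -
    have "A1 * (S2 * A2\<^sup>T) = AA * (S2 * A2\<^sup>T) - L1 * (CC * (S2 * A2\<^sup>T))"
      unfolding A1_def using d dA by (simp add: minus_mult_distrib_dim mult_assoc_dim)
    then show ?thesis by (simp only: e2 e3)
  qed
  ultimately have "A1 * ((S1 - S2) * A2\<^sup>T) = (S1 - L1 * L2\<^sup>T) - (S2 - L1 * L2\<^sup>T)"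
    using d dA by (simp add: minus_mult_distrib_dim mult_minus_distrib_dim)
  also have "\<dots> = S1 - S2" using d by (intro eq_matI) auto
  finally have "S1 - S2 = A1 * ((S1 - S2) * A2\<^sup>T)" by simp
  then have z: "S1 - S2 = 0\<^sub>m d d"
    using stable_sandwich_zero[of A1 d A2 "S1 - S2"] s1 s2 d unfolding A1_def A2_def
    by (metis minus_carrier_mat)
  show ?thesis
  proof (rule eq_matI)
    fix i j assume "i < dim_row S2" "j < dim_col S2"
    then have ij: "i < d" "j < d" using d by auto
    then have "(S1 - S2) $$ (i,j) = 0" unfolding z by simp
    then show "S1 $$ (i,j) = S2 $$ (i,j)" using ij d by simp
  qed (use d in auto)
qed

section \<open>Limits of the innovation variance and of the Riccati iterates\<close>

context kalman_split
begin

lemma det_Jh: "det (Jh t) = complex_of_real ((cmod (det V))\<^sup>2 * (inverse (cmod (det U)))\<^sup>2 ^ t * det (J t))"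
proof -
  let ?X = "V * NN t"
  have X: "?X \<in> carrier_mat k k" "adj ?X \<in> carrier_mat k k" "cm (J t) \<in> carrier_mat k k"
    by (auto intro!: carrier_matI)
  have dX: "det ?X = det V * inverse (det U) ^ t"
    using det_mult[OF car(6), of "NN t"] by (simp add: det_NN carrier_matI)
  have "det (Jh t) = cnj (det ?X) * (complex_of_real (det (J t)) * det ?X)"
    unfolding Jh_def det_mult[OF X(2) mult_carrier_mat[OF X(3) X(1)]] det_mult[OF X(3) X(1)] det_adj[OF X(1)] det_cm ..
  also have "\<dots> = complex_of_real (det (J t)) * (det ?X * cnj (det ?X))" by (simp add: mult_ac)
  also have "\<dots> = complex_of_real (det (J t)) * complex_of_real ((cmod (det ?X))\<^sup>2)"
    by (simp only: complex_norm_square)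
  also have "(cmod (det ?X))\<^sup>2 = (cmod (det V))\<^sup>2 * (inverse (cmod (det U)))\<^sup>2 ^ t"
    unfolding dX by (simp add: norm_mult norm_power norm_inverse power_mult_distrib power_mult[symmetric] mult.commute)
  finally show ?thesis by (simp add: mult_ac)
qed

lemma limit_nonsingular:
  assumes L: "mat_tendsto k k Jh L"
  shows "det L \<noteq> 0"
proof
  note Lc = mat_tendsto_carrier(1)[OF L]
  assume "det L = 0"
  then obtain v where v: "v \<in> carrier_vec k" "v \<noteq> 0\<^sub>v k" "L *\<^sub>v v = 0\<^sub>v k"
    using det_0_iff_vec_prod_zero_field[OF Lc] by blast
  define x where "x = mat k 1 (\<lambda>(i,j). v $ i)"
  have x: "x \<in> carrier_mat k 1" by (simp add: x_def)
  have "L * x = 0\<^sub>m k 1"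
  proof (rule eq_matI)
    fix i j assume "i < dim_row (0\<^sub>m k 1)" "j < dim_col (0\<^sub>m k 1)"
    then have ij: "i < k" "j < 1" by auto
    have "(L * x) $$ (i,j) = (\<Sum>a<k. L $$ (i,a) * v $ a)"
      unfolding index_mult_mat_sum[OF Lc x ij] using ij by (simp add: x_def)
    also have "\<dots> = (L *\<^sub>v v) $ i" using index_mult_vec_sum[OF Lc v(1) ij(1)] by simp
    finally show "(L * x) $$ (i,j) = 0\<^sub>m k 1 $$ (i,j)" using v(3) ij by simp
  qed (use Lc x in auto)
  then have "(adj x * (L * x)) $$ (0,0) = 0" using x by simp
  then have "x = 0\<^sub>m k 1" by (rule limit_definite[OF L x])
  then have "x $$ (i,0) = 0" if "i < k" for i using that by simp
  then have "v $ i = 0" if "i < k" for i using that by (simp add: x_def)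
  then have "v = 0\<^sub>v k" using v(1) by (intro eq_vecI) auto
  then show False using v(2) by blast
qed

text \<open>The variance \<open>K t\<close> is the ratio of consecutive determinants of the
  precision. Rescaled by powers of \<rho> these determinants converge to a nonzero limit, so their
  ratio tends to 1.\<close>

lemma K_tendsto: "K \<longlonglongrightarrow> (cmod (det U))\<^sup>2"
proof -
  obtain L where L: "mat_tendsto k k Jh L" using Jh_convergent by blast
  define \<rho> where "\<rho> = (inverse (cmod (det U)))\<^sup>2"
  define D where "D t = (cmod (det V))\<^sup>2 * \<rho> ^ t * det (J t)" for t
  have nz: "\<rho> \<noteq> 0" "D t \<noteq> 0" for t
    using det_U_nz V det_J_pos[of t] by (auto simp: \<rho>_def D_def)
  have lim: "(\<lambda>t. complex_of_real (D t)) \<longlonglongrightarrow> det L"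
    using mat_tendsto_det[OF L] unfolding det_Jh D_def \<rho>_def .
  have "(\<lambda>t. complex_of_real (D (Suc t)) / complex_of_real (D t)) \<longlonglongrightarrow> det L / det L"
    by (intro tendsto_divide lim LIMSEQ_Suc[OF lim] limit_nonsingular[OF L])
  moreover have "complex_of_real (D (Suc t)) / complex_of_real (D t) = complex_of_real (\<rho> * K t)" for t
  proof -
    have "D (Suc t) = D t * (\<rho> * K t)" by (simp add: D_def det_J_Suc del: precision.simps)
    then show ?thesis using nz(2)[of t] by simp
  qed
  ultimately have "(\<lambda>t. complex_of_real (\<rho> * K t)) \<longlonglongrightarrow> 1"
    using limit_nonsingular[OF L] by simp
  from tendsto_Re[OF this] have "(\<lambda>t. \<rho> * K t) \<longlonglongrightarrow> 1" by simp
  then have "(\<lambda>t. (\<rho> * K t) / \<rho>) \<longlonglongrightarrow> 1 / \<rho>" by (intro tendsto_divide tendsto_const nz)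
  then show ?thesis using nz(1) by (simp add: \<rho>_def field_simps)
qed

text \<open>The rescaling cancels in the closed form, and each of the three factors left converges.
  The limit has its range in the unstable subspace, and a vector on which its form vanishes is
  orthogonal to that subspace; both facts serve in the stability proof.\<close>

lemma riccati_limit:
  obtains Sg P where "mat_tendsto d d (riccati_seq AA CC (E * E\<^sup>T)) Sg" "Sg\<^sup>T = Sg"
    "P \<in> carrier_mat p d" "cm Sg = Tu * P"
    "\<And>w. w \<in> carrier_mat d 1 \<Longrightarrow> (adj w * (cm Sg * w)) $$ (0,0) = 0 \<Longrightarrow> adj Tu * w = 0\<^sub>m p 1"
proof -
  obtain L where L: "mat_tendsto k k Jh L" using Jh_convergent by blast
  note Lc = mat_tendsto_carrier(1)[OF L]
  note Li = mat_inv_inverse[OF Lc limit_nonsingular[OF L]]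
  have Ld [simp]: "dim_row L = k" "dim_col L = k" "dim_row (mat_inv L) = k" "dim_col (mat_inv L) = k"
    using Lc Li by auto
  let ?S = "riccati_seq AA CC (E * E\<^sup>T)"
  define Sc where "Sc = Tu * P1 * mat_inv L * adj (Tu * P1)"
  have Scd [simp]: "dim_row Sc = d" "dim_col Sc = d" by (simp_all add: Sc_def)
  have cS: "cm (?S t) = cm (Phi t) * (V * NN t) * mat_inv (Jh t) * adj (cm (Phi t) * (V * NN t))" for t
  proof -
    let ?X = "V * NN t"
    have Xc: "?X \<in> carrier_mat k k" by (auto intro: carrier_matI)
    have "det ?X \<noteq> 0" using det_mult[OF car(6), of "NN t"] V det_U_nz by (simp add: det_NN carrier_matI)
    note Xi = mat_inv_inverse[OF Xc this]
    have Xd [simp]: "dim_row (mat_inv ?X) = k" "dim_col (mat_inv ?X) = k" using Xi by auto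
    have JJ: "cm (J t) * cm (Ji t) = 1\<^sub>m k"
      using arg_cong[OF Ji(2)[of t], of cm] by (simp add: cm_mult cm_one)
    have "mat_inv (Jh t) = mat_inv ?X * cm (Ji t) * adj (mat_inv ?X)"
    proof (rule mat_inv_unique(2))
      have "Jh t * (mat_inv ?X * cm (Ji t) * adj (mat_inv ?X)) =
          adj ?X * (cm (J t) * ((?X * mat_inv ?X) * cm (Ji t)) * adj (mat_inv ?X))"
        unfolding Jh_def by (simp add: mult_assoc_dim)
      also have "\<dots> = adj ?X * adj (mat_inv ?X)"
        unfolding Xi(2) by (simp add: JJ)
      also have "\<dots> = adj (mat_inv ?X * ?X)" by (simp only: adj_mult Xd index_mult_mat cdims)
      also have "\<dots> = 1\<^sub>m k" unfolding Xi(3) by (rule eq_matI) auto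
      finally show "Jh t * (mat_inv ?X * cm (Ji t) * adj (mat_inv ?X)) = 1\<^sub>m k" .
    qed (auto intro!: carrier_matI)
    then have "?X * mat_inv (Jh t) * adj ?X = (?X * mat_inv ?X) * cm (Ji t) * (adj (mat_inv ?X) * adj ?X)"
      by (simp add: mult_assoc_dim)
    also have "adj (mat_inv ?X) * adj ?X = adj (?X * mat_inv ?X)" by (subst adj_mult) simp_all
    also have "?X * mat_inv ?X * cm (Ji t) * adj (?X * mat_inv ?X) = cm (Ji t)"
    proof -
      have "adj (1\<^sub>m k) = 1\<^sub>m k" by (rule eq_matI) auto
      then show ?thesis unfolding Xi(2) by simp
    qed
    finally have XX: "?X * mat_inv (Jh t) * adj ?X = cm (Ji t)" .
    have dj [simp]: "dim_row (mat_inv (Jh t)) = k" "dim_col (mat_inv (Jh t)) = k"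
      using \<open>mat_inv (Jh t) = _\<close> by auto
    have "cm (Phi t) * ?X * mat_inv (Jh t) * adj (cm (Phi t) * ?X) = cm (Phi t) * (?X * mat_inv (Jh t) * adj ?X) * adj (cm (Phi t))"
      by (simp add: adj_mult mult_assoc_dim)
    also have "\<dots> = cm (?S t)"
      unfolding XX riccati_seq_closed_form by (simp add: cm_mult adj_cm cm_transpose)
    finally show ?thesis by simp
  qed
  have Sz: "mat_tendsto l l (\<lambda>t. S ^\<^sub>m t) (0\<^sub>m l l)"
  proof -
    obtain c r where cr: "0 < r" "r < 1" "\<And>t i j. i < l \<Longrightarrow> j < l \<Longrightarrow> cmod ((S ^\<^sub>m t) $$ (i,j)) \<le> c * r ^ t"
      using bounds by metis
    show ?thesis by (rule mat_tendsto_zero[OF _ cr(2,1,3)]) (auto intro: carrier_matI)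
  qed
  have G: "mat_tendsto d k (\<lambda>t. cm (Phi t) * (V * NN t)) (Tu * P1)"
  proof -
    let ?N = "mat k k (\<lambda>(i,j). if i = j \<and> p \<le> i then 1 else 0) :: complex mat"
    have "mat_tendsto d k (\<lambda>t. Tu * P1 + Q * (S ^\<^sub>m t * (R * NN t))) (Tu * P1 + Q * (0\<^sub>m l l * (R * ?N)))"
      by (intro mat_tendsto_add mat_tendsto_mult[where n = l] mat_tendsto_mult[where n = k] Sz NN_tendsto mat_tendsto_const)
         (auto intro: carrier_matI)
    moreover have "0\<^sub>m l l * (R * ?N) = 0\<^sub>m l k" by (rule left_mult_zero_mat) (auto intro: carrier_matI)
    moreover have "Tu * P1 + Q * 0\<^sub>m l k = Tu * P1" by (rule eq_matI) auto
    moreover have "cm (Phi t) * (V * NN t) = Tu * P1 + Q * (S ^\<^sub>m t * (R * NN t))" for t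
      using Phi_V_NN[of t t] by simp
    ultimately show ?thesis by simp
  qed
  have "mat_tendsto d d (\<lambda>t. cm (Phi t) * (V * NN t) * mat_inv (Jh t) * adj (cm (Phi t) * (V * NN t))) Sc"
    unfolding Sc_def
  proof (rule mat_tendsto_mult[where n = k, OF mat_tendsto_mult[where n = k, OF G] mat_tendsto_adj[OF G]])
    show "mat_tendsto k k (\<lambda>t. mat_inv (Jh t)) (mat_inv L)"
      by (rule mat_tendsto_mat_inv[OF L _ limit_nonsingular[OF L]])
         (use V det_U_nz less_imp_neq[OF det_J_pos] in \<open>auto simp: det_Jh\<close>)
  qed
  then have Sl: "mat_tendsto d d (\<lambda>t. cm (?S t)) Sc" by (simp only: cS)
  \<comment> \<open>The iterates are real, so the complex limit equals its real part.\<close>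
  define Sg where "Sg = map_mat Re Sc"
  have Sdim: "dim_row (?S t) = d" "dim_col (?S t) = d" for t by (simp_all add: riccati_seq_closed_form)
  have cSg: "cm Sg = Sc"
  proof (rule eq_matI)
    fix i j assume "i < dim_row Sc" "j < dim_col Sc"
    then have ij: "i < d" "j < d" by auto
    have "(\<lambda>t. Im (cm (?S t) $$ (i,j))) \<longlonglongrightarrow> Im (Sc $$ (i,j))"
      by (intro tendsto_Im mat_tendsto_entry[OF Sl] ij)
    then have "(\<lambda>t. 0) \<longlonglongrightarrow> Im (Sc $$ (i,j))" using ij by (simp add: Sdim)
    then have "Im (Sc $$ (i,j)) = 0" using LIMSEQ_unique tendsto_const by blast
    then show "cm Sg $$ (i,j) = Sc $$ (i,j)" using ij by (simp add: Sg_def complex_eq_iff)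
  qed (auto simp: Sg_def)
  have lim: "mat_tendsto d d ?S Sg" using Sl unfolding cSg[symmetric] mat_tendsto_cm_iff .
  have "(?S t)\<^sup>T = ?S t" for t
    unfolding riccati_seq_closed_form by (simp add: transpose_mult_dim Ji_sym mult_assoc_dim)
  then have sym: "Sg\<^sup>T = Sg"
    using mat_tendsto_unique[OF mat_tendsto_transpose[OF lim]] lim by simp
  define P where "P = P1 * mat_inv L * adj (Tu * P1)"
  have P: "P \<in> carrier_mat p d" by (auto simp: P_def intro!: carrier_matI)
  have SgP: "cm Sg = Tu * P" unfolding cSg by (simp add: Sc_def P_def mult_assoc_dim)
  have "adj Tu * w = 0\<^sub>m p 1" if w: "w \<in> carrier_mat d 1" "(adj w * (cm Sg * w)) $$ (0,0) = 0" for w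
  proof -
    have wd [simp]: "dim_row w = d" "dim_col w = Suc 0" using w by auto
    define y where "y = adj (Tu * P1) * w"
    define x where "x = mat_inv L * y"
    have yd [simp]: "dim_row y = k" "dim_col y = Suc 0" "dim_row x = k" "dim_col x = Suc 0" by (simp_all add: y_def x_def)
    have Lx: "L * x = y" unfolding x_def using Li(2) mult_assoc_dim[of L "mat_inv L" y] by simp
    have "adj w * (cm Sg * w) = adj y * x"
      unfolding cSg Sc_def x_def y_def by (simp add: adj_mult mult_assoc_dim)
    then have "(adj y * x) $$ (0,0) = 0" using w by simp
    moreover have "adj x * y = adj (adj y * x)" by (simp add: adj_mult)
    ultimately have "(adj x * (L * x)) $$ (0,0) = 0" unfolding Lx by (simp del: index_mult_mat(1))
    then have "x = 0\<^sub>m k 1" by (intro limit_definite[OF L]) (auto intro: carrier_matI)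
    then have y0: "y = 0\<^sub>m k 1" using Lx by simp
    \<comment> \<open>Applying \<open>P1\<close> to \<open>y\<close> thereby recovers
      \<open>adj Tu * w\<close>.\<close>
    have "P1 * adj P1 = 1\<^sub>m p"
    proof (rule eq_matI)
      fix i j assume "i < dim_row (1\<^sub>m p)" "j < dim_col (1\<^sub>m p)"
      then have ij: "i < p" "j < p" by auto
      have "(P1 * adj P1) $$ (i,j) = (\<Sum>a<k. P1 $$ (i,a) * adj P1 $$ (a,j))"
        by (rule index_mult_mat_sum) (use ij in \<open>auto intro: carrier_matI\<close>)
      also have "\<dots> = (\<Sum>a<k. if a = i then adj P1 $$ (a,j) else 0)"
        by (rule sum.cong) (use ij in \<open>auto simp: P1_def\<close>)
      also have "\<dots> = 1\<^sub>m p $$ (i,j)" using ij pk by (auto simp: sum.delta P1_def)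
      finally show "(P1 * adj P1) $$ (i,j) = 1\<^sub>m p $$ (i,j)" .
    qed auto
    then have "P1 * y = adj Tu * w"
      unfolding y_def using mult_assoc_dim[of P1 "adj P1" "adj Tu * w"] by (simp add: adj_mult mult_assoc_dim)
    then show ?thesis using y0 by simp
  qed
  then show thesis using that[OF lim sym P SgP] by blast
qed

end

text \<open>Left eigenvectors of \<open>AA\<close> at non-stable eigenvalues are seen by the initial covariance.\<close>
locale kalman_stabilizable = kalman_split +
  assumes left_unstable: "\<And>w a. w \<in> carrier_mat d 1 \<Longrightarrow> 1 \<le> cmod a \<Longrightarrow> adj w * cm AA = a \<cdot>\<^sub>m adj w \<Longrightarrow>
    adj Tu * w = 0\<^sub>m p 1 \<Longrightarrow> w = 0\<^sub>m d 1"
begin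

text \<open>Let \<open>adj w\<close> be a left eigenvector of the closed loop with eigenvalue
  \<open>a\<close> outside the open disc. The fixed-point equation makes \<open>cm Sg * w\<close>
  satisfy the eigenvector equation of \<open>AA\<close> with value \<open>1 / cnj a\<close>, of
  modulus at most 1, inside a subspace where all eigenvalues exceed 1 in modulus. So it vanishes,
  and \<open>adj w\<close> is a left eigenvector of \<open>AA\<close> itself that the initial
  covariance does not see.\<close>

lemma stabilizing_limit:
  obtains Sg where "mat_tendsto d d (riccati_seq AA CC (E * E\<^sup>T)) Sg" "stabilizing_solution AA CC Sg"
    "innov_var CC Sg = (cmod (det U))\<^sup>2"
proof -
  let ?S = "riccati_seq AA CC (E * E\<^sup>T)"
  obtain Sg P where lim: "mat_tendsto d d ?S Sg" and sym: "Sg\<^sup>T = Sg"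
    and P: "P \<in> carrier_mat p d" and SgP: "cm Sg = Tu * P"
    and def: "\<And>w. w \<in> carrier_mat d 1 \<Longrightarrow> (adj w * (cm Sg * w)) $$ (0,0) = 0 \<Longrightarrow> adj Tu * w = 0\<^sub>m p 1"
    using riccati_limit by blast
  note Sgc = mat_tendsto_carrier(1)[OF lim]
  have Sgd [simp]: "dim_row Sg = d" "dim_col Sg = d" using Sgc by auto
  have CCt: "CC\<^sup>T \<in> carrier_mat d 1" "AA\<^sup>T \<in> carrier_mat d d" using CC AA by auto
  have "mat_tendsto 1 1 (\<lambda>t. CC * ?S t * CC\<^sup>T) (CC * Sg * CC\<^sup>T)"
    by (intro mat_tendsto_mult[where n = d] mat_tendsto_const lim CC CCt)
  from mat_tendsto_entry[OF this, of 0 0] have "(\<lambda>t. innov_var CC (?S t)) \<longlonglongrightarrow> innov_var CC Sg"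
    unfolding innov_var_def by (intro tendsto_add tendsto_const) simp
  then have Kl: "K \<longlonglongrightarrow> innov_var CC Sg" unfolding innov_var_riccati_seq .
  then have iv: "innov_var CC Sg = (cmod (det U))\<^sup>2" using K_tendsto LIMSEQ_unique by blast
  have ivnz: "innov_var CC Sg \<noteq> 0" using iv det_U_nz by simp
  have "mat_tendsto d d (\<lambda>t. riccati_map AA CC (?S t)) (riccati_map AA CC Sg)"
    unfolding riccati_map_def innov_var_riccati_seq
    by (intro mat_tendsto_minus mat_tendsto_smult tendsto_divide tendsto_const Kl ivnz
        mat_tendsto_mult[where n = d] mat_tendsto_const lim CC CCt AA
        mat_tendsto_mult[where n = 1 and Y = "\<lambda>t. CC"])
  moreover have "mat_tendsto d d (\<lambda>t. riccati_map AA CC (?S t)) Sg"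
    using mat_tendsto_Suc[OF lim] by simp
  ultimately have fx: "Sg = riccati_map AA CC Sg" using mat_tendsto_unique by blast
  define L where "L = kalman_gain AA CC Sg"
  define M where "M = AA - L * CC"
  have Ld [simp]: "dim_row L = d" "dim_col L = Suc 0" by (simp_all add: L_def kalman_gain_def)
  have Md [simp]: "dim_row M = d" "dim_col M = d" by (simp_all add: M_def)
  have e1: "M * (Sg * AA\<^sup>T) = Sg" using fx riccati_map_closed_loop[OF AA CC Sgc] by (simp add: M_def L_def)
  have e2: "M * (Sg * CC\<^sup>T) = L" using kalman_gain_closed_loop[OF AA CC Sgc ivnz] by (simp add: M_def L_def)
  have "cmod a < 1" if "ceigenvalue M a" for a
  proof (rule ccontr)
    assume "\<not> cmod a < 1"
    then have a: "1 \<le> cmod a" by simp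
    have Mc: "cm M \<in> carrier_mat d d" by (auto intro: carrier_matI)
    have "eigenvalue (cm M)\<^sup>T a"
      using that eigenvalue_root_char_poly[OF Mc] eigenvalue_root_char_poly[of "(cm M)\<^sup>T" d] Mc
      by (simp add: ceigenvalue_def)
    then obtain u where u: "u \<in> carrier_vec d" "u \<noteq> 0\<^sub>v d" "(cm M)\<^sup>T *\<^sub>v u = a \<cdot>\<^sub>v u"
      by (auto simp: eigenvalue_def eigenvector_def)
    \<comment> \<open>Conjugated so that the row \<open>adj w\<close> has the entries of
      \<open>u\<close>.\<close>
    define w where "w = mat d 1 (\<lambda>(i,j). cnj (u $ i))"
    have w: "w \<in> carrier_mat d 1" by (simp add: w_def)
    have wd [simp]: "dim_row w = d" "dim_col w = Suc 0" by (simp_all add: w_def)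
    have wM: "adj w * cm M = a \<cdot>\<^sub>m adj w"
    proof (rule eq_matI)
      fix i j assume "i < dim_row (a \<cdot>\<^sub>m adj w)" "j < dim_col (a \<cdot>\<^sub>m adj w)"
      then have ij: "i = 0" "j < d" by auto
      have "(adj w * cm M) $$ (0,j) = (\<Sum>b<d. adj w $$ (0,b) * cm M $$ (b,j))"
        by (rule index_mult_mat_sum) (use ij in \<open>auto intro: carrier_matI\<close>)
      also have "\<dots> = (\<Sum>b<d. (cm M)\<^sup>T $$ (j,b) * u $ b)"
        by (rule sum.cong) (use ij in \<open>auto simp: w_def\<close>)
      also have "\<dots> = ((cm M)\<^sup>T *\<^sub>v u) $ j"
        using index_mult_vec_sum[of "(cm M)\<^sup>T" d d u j] ij u by (simp add: carrier_matI)
      also have "\<dots> = a * u $ j" using u ij by simp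
      finally show "(adj w * cm M) $$ (i,j) = (a \<cdot>\<^sub>m adj w) $$ (i,j)" using ij by (simp add: w_def)
    qed auto
    have wnz: "w \<noteq> 0\<^sub>m d 1"
    proof
      assume "w = 0\<^sub>m d 1"
      then have "w $$ (i,0) = 0" if "i < d" for i using that by simp
      then have "u $ i = 0" if "i < d" for i using that by (simp add: w_def)
      then have "u = 0\<^sub>v d" using u(1) by (intro eq_vecI) auto
      then show False using u(2) by blast
    qed
    have e1c: "cm M * (cm Sg * (cm AA)\<^sup>T) = cm Sg"
      using arg_cong[OF e1, of cm] by (simp add: cm_mult cm_transpose)
    have e2c: "cm M * (cm Sg * (cm CC)\<^sup>T) = cm L"
      using arg_cong[OF e2, of cm] by (simp add: cm_mult cm_transpose)
    define v where "v = cm Sg * w"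
    have vd [simp]: "dim_row v = d" "dim_col v = Suc 0" by (simp_all add: v_def)
    have adjv: "adj v = adj w * cm Sg" by (simp add: v_def adj_mult adj_cm sym)
    have "adj v = adj w * cm M * (cm Sg * (cm AA)\<^sup>T)" unfolding adjv by (simp add: mult_assoc_dim e1c)
    also have "\<dots> = a \<cdot>\<^sub>m (adj v * (cm AA)\<^sup>T)"
      unfolding wM adjv by (simp add: smult_mult_dim mult_assoc_dim)
    finally have "adj (adj v) = adj (a \<cdot>\<^sub>m (adj v * (cm AA)\<^sup>T))" by simp
    also have "\<dots> = cnj a \<cdot>\<^sub>m (cm AA * v)"
    proof -
      have "adj (a \<cdot>\<^sub>m X) = cnj a \<cdot>\<^sub>m adj X" for X by (rule eq_matI) auto
      moreover have "adj ((cm AA)\<^sup>T) = cm AA" by (rule eq_matI) auto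
      ultimately show ?thesis by (simp add: adj_mult)
    qed
    finally have v1: "v = cnj a \<cdot>\<^sub>m (cm AA * v)" by simp
    have a0: "cnj a \<noteq> 0" using a by auto
    have v2: "cm AA * v = (1 / cnj a) \<cdot>\<^sub>m v"
      by (subst (2) v1, rule eq_matI) (use a0 in \<open>auto simp del: index_mult_mat(1)\<close>)
    \<comment> \<open>Coordinates of \<open>v\<close> in the unstable subspace, where the
      eigenvector equation can be pulled back to \<open>U\<close>.\<close>
    define z where "z = P * w"
    have zd [simp]: "dim_row z = p" "dim_col z = Suc 0" using P by (auto simp: z_def)
    have vz: "v = Tu * z" unfolding v_def SgP z_def using P by (simp add: mult_assoc_dim)
    have v0: "v = 0\<^sub>m d 1"
    proof (rule ccontr)
      assume "v \<noteq> 0\<^sub>m d 1"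
      then have znz: "z \<noteq> 0\<^sub>m p 1" using vz by auto
      define zv where "zv = col z 0"
      have zv: "zv \<in> carrier_vec p" unfolding zv_def by (rule carrier_vecI) simp
      have zvnz: "zv \<noteq> 0\<^sub>v p"
      proof
        assume "zv = 0\<^sub>v p"
        then have "zv $ i = 0" if "i < p" for i using that by simp
        then have "z $$ (i,0) = 0" if "i < p" for i using that by (simp add: zv_def)
        then show False using znz by (auto intro!: eq_matI)
      qed
      have "Tu * (U * z) = Tu * ((1 / cnj a) \<cdot>\<^sub>m z)"
        using v2 AA_Tu unfolding vz by (simp add: mult_smult_dim flip: mult_assoc_dim)
      then have "Tu *\<^sub>v (U *\<^sub>v zv - (1 / cnj a) \<cdot>\<^sub>v zv) = 0\<^sub>v d"
      proof -
        assume eq: "Tu * (U * z) = Tu * ((1 / cnj a) \<cdot>\<^sub>m z)"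
        have c1: "col (Tu * (U * z)) 0 = Tu *\<^sub>v (U *\<^sub>v zv)"
          unfolding zv_def by (simp add: col_mult2[of Tu d p "U * z" 1] col_mult2[of U p p z 1] carrier_matI)
        have "col ((1 / cnj a) \<cdot>\<^sub>m z) 0 = (1 / cnj a) \<cdot>\<^sub>v zv" unfolding zv_def by (rule eq_vecI) auto
        then have c2: "col (Tu * ((1 / cnj a) \<cdot>\<^sub>m z)) 0 = Tu *\<^sub>v ((1 / cnj a) \<cdot>\<^sub>v zv)"
          by (simp add: col_mult2[of Tu d p "(1 / cnj a) \<cdot>\<^sub>m z" 1] carrier_matI)
        have "Tu *\<^sub>v (U *\<^sub>v zv - (1 / cnj a) \<cdot>\<^sub>v zv) = Tu *\<^sub>v (U *\<^sub>v zv) - Tu *\<^sub>v ((1 / cnj a) \<cdot>\<^sub>v zv)"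
          by (rule mult_minus_distrib_mat_vec[OF car(1)]) (use car zv in auto)
        also have "\<dots> = 0\<^sub>v d" using c1 c2 eq car by (intro eq_vecI) auto
        finally show ?thesis .
      qed
      then have d0: "U *\<^sub>v zv - (1 / cnj a) \<cdot>\<^sub>v zv = 0\<^sub>v p"
        by (intro Tu_inj) (use car zv in auto)
      have "U *\<^sub>v zv = (1 / cnj a) \<cdot>\<^sub>v zv"
      proof (rule eq_vecI)
        fix i assume "i < dim_vec ((1 / cnj a) \<cdot>\<^sub>v zv)"
        then have i: "i < p" using zv by simp
        then have "(U *\<^sub>v zv - (1 / cnj a) \<cdot>\<^sub>v zv) $ i = 0" unfolding d0 by simp
        then show "(U *\<^sub>v zv) $ i = ((1 / cnj a) \<cdot>\<^sub>v zv) $ i" using i zv by simp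
      qed (use zv in simp)
      then have "eigenvalue U (1 / cnj a)"
        using zv zvnz by (auto simp: eigenvalue_def eigenvector_def)
      then have "1 < cmod (1 / cnj a)" using U(2) upper_triangular_eigenvalue[OF car(2) U(1)] by blast
      then show False using a by (simp add: norm_divide divide_simps split: if_splits)
    qed
    then have "adj Tu * w = 0\<^sub>m p 1" using def[OF w] unfolding v_def[symmetric] by simp
    \<comment> \<open>Since the closed loop maps \<open>Sg * CC\<^sup>T\<close> to the gain,
      \<open>v = 0\<close> gives \<open>adj w * cm L = 0\<close>: open and closed loop agree on this
      row.\<close>
    moreover have "adj w * cm AA = a \<cdot>\<^sub>m adj w"
    proof -
      have "adj w * cm L = adj w * cm M * (cm Sg * (cm CC)\<^sup>T)" by (simp add: mult_assoc_dim e2c)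
      also have "\<dots> = a \<cdot>\<^sub>m (adj v * (cm CC)\<^sup>T)"
        unfolding wM adjv by (simp add: smult_mult_dim mult_assoc_dim)
      also have "adj v = 0\<^sub>m 1 d" unfolding v0 by (rule eq_matI) auto
      finally have wL: "adj w * cm L = 0\<^sub>m 1 1" by (auto intro!: eq_matI)
      have "cm AA = cm M + cm L * cm CC"
        unfolding M_def by (simp add: cm_minus cm_mult) (rule eq_matI, auto simp del: index_mult_mat(1))
      then have "adj w * cm AA = adj w * cm M + adj w * cm L * cm CC"
        by (simp add: mult_add_distrib_dim mult_assoc_dim)
      also have "adj w * cm L * cm CC = 0\<^sub>m 1 d" unfolding wL using CC by simp
      finally have "adj w * cm AA = a \<cdot>\<^sub>m adj w + 0\<^sub>m 1 d" unfolding wM .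
      also have "\<dots> = a \<cdot>\<^sub>m adj w" by (rule eq_matI) auto
      finally show ?thesis .
    qed
    ultimately show False using left_unstable[OF w a] wnz by blast
  qed
  then have "stable_mat M" by (auto simp: stable_mat_def)
  then have "stabilizing_solution AA CC Sg"
    unfolding stabilizing_solution_def using Sgc sym fx by (simp add: M_def L_def)
  then show thesis using that lim iv by blast
qed

end

section \<open>The coding structure\<close>

text \<open>Translates multiplicities into a list of roots with repetition, the form delivered by
  the Schur decomposition and by factored polynomials.\<close>

lemma DI_eq_prod_list:
  assumes A: "A \<in> carrier_mat k k" and es: "char_poly (cm A) = (\<Prod>e\<leftarrow>es. [:- e, 1:])"
  shows "DI A = prod_list (map cmod (filter (\<lambda>e. 1 < cmod e) es))"
proof -
  have cA: "cm A \<in> carrier_mat k k" using A by simp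
  let ?M = "filter_mset (\<lambda>e. 1 < cmod e) (mset es)"
  have ord: "order a (\<Prod>e\<leftarrow>es. [:- e, 1:]) = count (mset es) a" for es :: "complex list" and a
  proof (induction es)
    case (Cons e es)
    have "(\<Prod>e\<leftarrow>e # es. [:- e, 1:]) \<noteq> 0" by (subst prod_list_zero_iff) auto
    then have "order a (\<Prod>e\<leftarrow>e # es. [:- e, 1:]) = order a [:- e, 1:] + order a (\<Prod>e\<leftarrow>es. [:- e, 1:])"
      unfolding list.map prod_list.Cons by (rule order_mult)
    moreover have "order a [:- e, 1:] = (if e = a then 1 else 0)"
    proof (cases "e = a")
      case True then show ?thesis using order_power_n_n[of a 1] by simp
    next
      case False then show ?thesis by (simp add: order_0I)
    qed
    ultimately show ?case using Cons by simp
  qed (simp add: order_0I)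
  have ev: "ceigenvalue A a \<longleftrightarrow> a \<in> set es" for a
    unfolding ceigenvalue_def eigenvalue_root_char_poly[OF cA] es
    by (simp add: poly_prod_list prod_list_zero_iff image_iff)
  have "DI A = (\<Prod>a\<in>set_mset ?M. cmod a ^ count ?M a)"
    unfolding DI_def ev es ord by (rule prod.cong) auto
  also have "\<dots> = prod_mset (image_mset cmod ?M)" by (rule image_prod_mset_multiplicity[symmetric])
  also have "\<dots> = prod_list (map cmod (filter (\<lambda>e. 1 < cmod e) es))"
    by (simp flip: mset_filter mset_map add: prod_mset_prod_list)
  finally show ?thesis .
qed

lemma prod_list_partition:
  fixes f :: "'a \<Rightarrow> 'b :: comm_monoid_mult"
  shows "(\<Prod>e\<leftarrow>es. f e) = (\<Prod>e\<leftarrow>filter P es @ filter (\<lambda>e. \<not> P e) es. f e)"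
  by (induction es) (auto simp: mult_ac)

lemma eigenvalue_transpose:
  fixes A :: "complex mat"
  assumes "A \<in> carrier_mat n n"
  shows "eigenvalue A\<^sup>T a \<longleftrightarrow> eigenvalue A a"
  using eigenvalue_root_char_poly[OF assms] eigenvalue_root_char_poly[of "A\<^sup>T" n] assms by simp

lemma no_eigenvector:
  fixes A :: "complex mat"
  assumes "A \<in> carrier_mat n n" "\<not> eigenvalue A a" "x \<in> carrier_vec n" "A *\<^sub>v x = a \<cdot>\<^sub>v x"
  shows "x = 0\<^sub>v n"
  using assms by (auto simp: eigenvalue_def eigenvector_def)

text \<open>The hypothesis \<open>inverse_channel\<close> is the state-space form of the absence of
  zeros of the inverse channel outside the closed disc: a growing mode fed in with amplitude
  \<open>r\<close> cannot be cancelled at the output unless \<open>r = 0\<close>.\<close>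

locale coding =
  fixes k m :: nat and F G H A C :: "real mat"
  assumes A: "A \<in> carrier_mat k k" and C: "C \<in> carrier_mat 1 k" and F: "F \<in> carrier_mat m m"
    and G: "G \<in> carrier_mat m 1" and H: "H \<in> carrier_mat 1 m"
    and F_stable: "stable_mat F" and obs: "observable A C"
    and A_unit: "\<And>a. ceigenvalue A a \<Longrightarrow> cmod a \<noteq> 1"
    and inverse_channel: "\<And>a x r. 1 < cmod a \<Longrightarrow> x \<in> carrier_vec m \<Longrightarrow>
      cm F *\<^sub>v x + r \<cdot>\<^sub>v col (cm G) 0 = a \<cdot>\<^sub>v x \<Longrightarrow> (cm H *\<^sub>v x) $ 0 + r = 0 \<Longrightarrow> r = 0"
begin

abbreviation "AA \<equiv> blockA F G A C"
abbreviation "CC \<equiv> blockC H C"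
definition E :: "real mat" where "E = mat (k + m) k (\<lambda>(i,j). if i = j then 1 else 0)"

lemma dims [simp]: "dim_row A = k" "dim_col A = k" "dim_row C = Suc 0" "dim_col C = k" "dim_row F = m" "dim_col F = m"
  "dim_row G = m" "dim_col G = Suc 0" "dim_row H = Suc 0" "dim_col H = m" "dim_row E = k + m" "dim_col E = k"
  using A C F G H by (auto simp: E_def)

lemma AA: "AA \<in> carrier_mat (k + m) (k + m)" and CC: "CC \<in> carrier_mat 1 (k + m)"
  by (auto simp: blockA_def blockC_def intro!: carrier_matI)

sublocale kalman k "k + m" AA CC E
  by unfold_locales (rule AA, rule CC, rule carrier_matI, simp_all)

lemma cAA: "cm AA = four_block_mat (cm A) (0\<^sub>m k m) (cm G * cm C) (cm F)"
proof -
  have "cm AA = four_block_mat (cm A) (cm (0\<^sub>m k m)) (cm (G * C)) (cm F)"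
    by (rule eq_matI) (auto simp: blockA_def simp del: index_mult_mat(1))
  moreover have "cm (0\<^sub>m k m) = 0\<^sub>m k m" by (rule eq_matI) auto
  ultimately show ?thesis by (simp add: cm_mult)
qed

lemma cCC_mult: "x \<in> carrier_vec k \<Longrightarrow> y \<in> carrier_vec m \<Longrightarrow>
  (cm CC *\<^sub>v (x @\<^sub>v y)) $ 0 = (cm C *\<^sub>v x) $ 0 + (cm H *\<^sub>v y) $ 0"
proof -
  assume xy: "x \<in> carrier_vec k" "y \<in> carrier_vec m"
  have "cm CC = four_block_mat (cm C) (cm H) (0\<^sub>m 0 k) (0\<^sub>m 0 m)"
    by (rule eq_matI) (auto simp: blockC_def)
  then have "cm CC *\<^sub>v (x @\<^sub>v y) = (cm C *\<^sub>v x + cm H *\<^sub>v y) @\<^sub>v (0\<^sub>m 0 k *\<^sub>v x + 0\<^sub>m 0 m *\<^sub>v y)"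
    using four_block_mat_mult_vec[of "cm C" 1 k "cm H" m "0\<^sub>m 0 k" 0 "0\<^sub>m 0 m" x y] xy C H by simp
  then show ?thesis by simp
qed

lemma cAA_mult:
  assumes "x \<in> carrier_vec k" "y \<in> carrier_vec m"
  shows "cm AA *\<^sub>v (x @\<^sub>v y) = (cm A *\<^sub>v x) @\<^sub>v (cm F *\<^sub>v y + (cm C *\<^sub>v x) $ 0 \<cdot>\<^sub>v col (cm G) 0)"
proof -
  have "cm AA *\<^sub>v (x @\<^sub>v y) = (cm A *\<^sub>v x + 0\<^sub>m k m *\<^sub>v y) @\<^sub>v (cm G * cm C *\<^sub>v x + cm F *\<^sub>v y)"
    unfolding cAA using four_block_mat_mult_vec[of "cm A" k k "0\<^sub>m k m" m "cm G * cm C" m "cm F" x y] A F G C assms by simp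
  moreover have "cm A *\<^sub>v x + 0\<^sub>m k m *\<^sub>v y = cm A *\<^sub>v x"
    using assms by (intro eq_vecI) auto
  moreover have "cm G * cm C *\<^sub>v x = (cm C *\<^sub>v x) $ 0 \<cdot>\<^sub>v col (cm G) 0"
  proof (rule eq_vecI)
    fix i assume "i < dim_vec ((cm C *\<^sub>v x) $ 0 \<cdot>\<^sub>v col (cm G) 0)"
    then have i: "i < m" by simp
    have Gc: "cm G \<in> carrier_mat m 1" and Cc: "cm C \<in> carrier_mat 1 k" and xc: "cm C *\<^sub>v x \<in> carrier_vec 1"
      using G C by (auto intro: carrier_vecI)
    have "(cm G * cm C *\<^sub>v x) $ i = (cm G *\<^sub>v (cm C *\<^sub>v x)) $ i"
      using assoc_mult_mat_vec[OF Gc Cc assms(1)] by simp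
    also have "\<dots> = (\<Sum>a<1. cm G $$ (i,a) * (cm C *\<^sub>v x) $ a)" by (rule index_mult_vec_sum[OF Gc xc i])
    finally show "(cm G * cm C *\<^sub>v x) $ i = ((cm C *\<^sub>v x) $ 0 \<cdot>\<^sub>v col (cm G) 0) $ i"
      using i by simp
  qed simp
  moreover have "r \<cdot>\<^sub>v col (cm G) 0 + cm F *\<^sub>v y = cm F *\<^sub>v y + r \<cdot>\<^sub>v col (cm G) 0" for r
    by (rule comm_add_vec[of _ m]) (rule carrier_vecI, simp)+
  ultimately show ?thesis by (simp only:)
qed

lemma F_eigen: "eigenvalue (cm F) a \<Longrightarrow> cmod a < 1"
  using F_stable by (auto simp: stable_mat_def ceigenvalue_def)

text \<open>Observability is stated for real vectors. The matrices being real, it is applied to the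
  real and the imaginary part, both covered by the real-linear map \<open>f\<close>.\<close>

lemma observable_complex:
  assumes x: "x \<in> carrier_vec k" and z: "\<And>t. (cm C *\<^sub>v (cm A ^\<^sub>m t *\<^sub>v x)) $ 0 = 0"
  shows "x = 0\<^sub>v k"
proof -
  have At: "A ^\<^sub>m t \<in> carrier_mat k k" "cm (A ^\<^sub>m t) \<in> carrier_mat k k" for t using A by auto
  have CAt: "C * A ^\<^sub>m t \<in> carrier_mat 1 k" "cm (C * A ^\<^sub>m t) \<in> carrier_mat 1 k" for t
    using C At(1)[of t] by (metis map_carrier_mat mult_carrier_mat)+
  have cz: "(\<Sum>a<k. complex_of_real ((C * A ^\<^sub>m t) $$ (0,a)) * x $ a) = 0" for t
  proof -
    have "cm C *\<^sub>v (cm A ^\<^sub>m t *\<^sub>v x) = cm (C * A ^\<^sub>m t) *\<^sub>v x"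
      using assoc_mult_mat_vec[of "cm C" 1 k "cm (A ^\<^sub>m t)" k x] C At x
      by (simp add: cm_mult cm_pow[OF A] flip: cm_pow[OF A])
    then have "0 = (cm (C * A ^\<^sub>m t) *\<^sub>v x) $ 0" using z[of t] by simp
    also have "\<dots> = (\<Sum>a<k. cm (C * A ^\<^sub>m t) $$ (0,a) * x $ a)"
      by (rule index_mult_vec_sum[OF CAt(2) x]) simp
    finally show ?thesis using CAt(1)[of t] by simp
  qed
  have real0: "vec k (\<lambda>i. f (x $ i)) = 0\<^sub>v k"
    if f: "\<And>a b. f (a + b) = f a + f b" "\<And>r b. f (complex_of_real r * b) = r * f b" "f 0 = 0" for f
  proof -
    let ?v = "vec k (\<lambda>i. f (x $ i))"
    have fs: "f (sum g S) = (\<Sum>i\<in>S. f (g i))" if "finite S" for g :: "nat \<Rightarrow> complex" and S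
      using that by (induction S rule: finite_induct) (auto simp: f)
    have "C *\<^sub>v (A ^\<^sub>m t *\<^sub>v ?v) = 0\<^sub>v (dim_row C)" for t
    proof (rule eq_vecI)
      fix i assume "i < dim_vec (0\<^sub>v (dim_row C))"
      then have i: "i = 0" by simp
      have "(C *\<^sub>v (A ^\<^sub>m t *\<^sub>v ?v)) $ 0 = (C * A ^\<^sub>m t *\<^sub>v ?v) $ 0"
        using assoc_mult_mat_vec[OF C At(1), of ?v t] by simp
      also have "\<dots> = (\<Sum>a<k. (C * A ^\<^sub>m t) $$ (0,a) * ?v $ a)"
        by (rule index_mult_vec_sum[OF CAt(1)]) auto
      also have "\<dots> = (\<Sum>a<k. f (complex_of_real ((C * A ^\<^sub>m t) $$ (0,a)) * x $ a))"
        unfolding f(2) by (rule sum.cong) auto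
      also have "\<dots> = f (\<Sum>a<k. complex_of_real ((C * A ^\<^sub>m t) $$ (0,a)) * x $ a)"
        by (rule fs[symmetric]) simp
      finally show "(C *\<^sub>v (A ^\<^sub>m t *\<^sub>v ?v)) $ i = 0\<^sub>v (dim_row C) $ i" using cz i f(3) by simp
    qed simp
    then show ?thesis using obs unfolding observable_def by simp
  qed
  have "Re (x $ i) = 0" "Im (x $ i) = 0" if "i < k" for i
    using arg_cong[OF real0[of Re], of "\<lambda>v. v $ i"] arg_cong[OF real0[of Im], of "\<lambda>v. v $ i"] that by auto
  then show ?thesis using x by (intro eq_vecI) (auto simp: complex_eq_iff)
qed

text \<open>The source part of an unseen unstable eigenvector is cancelled by the inverse channel,
  so \<open>inverse_channel\<close> makes the source output 0 and observability makes the source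
  part 0. The channel part is then an eigenvector of the stable \<open>F\<close>.\<close>

lemma detectable:
  assumes x: "x \<in> carrier_vec (k + m)" and a: "1 < cmod a" and ev: "cm AA *\<^sub>v x = a \<cdot>\<^sub>v x"
    and z: "cm CC *\<^sub>v x = 0\<^sub>v 1"
  shows "x = 0\<^sub>v (k + m)"
proof -
  define x1 x2 where "x1 = vec_first x k" and "x2 = vec_last x m"
  have c [simp]: "x1 \<in> carrier_vec k" "x2 \<in> carrier_vec m" by (auto simp: x1_def x2_def)
  have xs: "x = x1 @\<^sub>v x2" using x by (simp add: x1_def x2_def)
  have "a \<cdot>\<^sub>v (x1 @\<^sub>v x2) = (a \<cdot>\<^sub>v x1) @\<^sub>v (a \<cdot>\<^sub>v x2)" using c by (intro eq_vecI) auto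
  with ev have "cm A *\<^sub>v x1 = a \<cdot>\<^sub>v x1 \<and> cm F *\<^sub>v x2 + (cm C *\<^sub>v x1) $ 0 \<cdot>\<^sub>v col (cm G) 0 = a \<cdot>\<^sub>v x2"
    unfolding xs cAA_mult[OF c] by (subst (asm) (1) append_vec_eq[of _ k, symmetric] | simp add: append_vec_eq[of _ k] carrier_vecI)+
  then have e: "cm A *\<^sub>v x1 = a \<cdot>\<^sub>v x1" "cm F *\<^sub>v x2 + (cm C *\<^sub>v x1) $ 0 \<cdot>\<^sub>v col (cm G) 0 = a \<cdot>\<^sub>v x2" by auto
  have "(cm CC *\<^sub>v x) $ 0 = 0" unfolding z by simp
  then have z': "(cm H *\<^sub>v x2) $ 0 + (cm C *\<^sub>v x1) $ 0 = 0" unfolding xs cCC_mult[OF c] by (simp only: add.commute)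
  have r: "(cm C *\<^sub>v x1) $ 0 = 0" by (rule inverse_channel[OF a c(2) e(2) z'])
  have Ac: "cm A \<in> carrier_mat k k" using A by simp
  have Ccar: "cm C \<in> carrier_mat 1 k" using C by simp
  have pw: "cm A ^\<^sub>m t *\<^sub>v x1 = a ^ t \<cdot>\<^sub>v x1" for t
  proof (induction t)
    case 0 then show ?case using Ac by simp
  next
    case (Suc t)
    have At: "cm A ^\<^sub>m t \<in> carrier_mat k k" using Ac by simp
    have "cm A ^\<^sub>m Suc t *\<^sub>v x1 = cm A ^\<^sub>m t *\<^sub>v (cm A *\<^sub>v x1)"
      using assoc_mult_mat_vec[OF At Ac c(1)] by simp
    also have "\<dots> = a \<cdot>\<^sub>v (cm A ^\<^sub>m t *\<^sub>v x1)" unfolding e(1) by (rule mult_mat_vec[OF At c(1)])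
    finally show ?case unfolding Suc by (simp add: smult_smult_assoc)
  qed
  have x10: "x1 = 0\<^sub>v k"
  proof (rule observable_complex[OF c(1)])
    fix t
    have "cm C *\<^sub>v (cm A ^\<^sub>m t *\<^sub>v x1) = a ^ t \<cdot>\<^sub>v (cm C *\<^sub>v x1)"
      unfolding pw by (rule mult_mat_vec[OF Ccar c(1)])
    then show "(cm C *\<^sub>v (cm A ^\<^sub>m t *\<^sub>v x1)) $ 0 = 0" using r by simp
  qed
  have "cm F *\<^sub>v x2 = a \<cdot>\<^sub>v x2"
  proof -
    have "cm F *\<^sub>v x2 + 0 \<cdot>\<^sub>v col (cm G) 0 = cm F *\<^sub>v x2" by (rule eq_vecI) auto
    then show ?thesis using e(2) unfolding r by simp
  qed
  then have "x2 = 0\<^sub>v m" by (intro no_eigenvector[of "cm F" m a]) (use F F_eigen[of a] a in auto)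
  then show ?thesis unfolding xs x10 by (intro eq_vecI) auto
qed

end

lemma sum_lessThan_add: "(\<Sum>j<p + q. f j) = (\<Sum>j<p. f j) + (\<Sum>j<q. f (p + j :: nat))"
  for f :: "nat \<Rightarrow> 'a :: comm_monoid_add"
  by (induction q) (simp_all add: add.assoc)

lemma mult_mat_vec_zero: "A \<in> carrier_mat nr n \<Longrightarrow> A *\<^sub>v 0\<^sub>v n = 0\<^sub>v nr"
  for A :: "'a :: comm_ring_1 mat"
  by (intro eq_vecI) (auto simp: scalar_prod_def)

context coding
begin

lemma char_poly_AA:
  assumes es: "char_poly (cm A) = (\<Prod>e\<leftarrow>es. [:- e, 1:])" and fs: "char_poly (cm F) = (\<Prod>e\<leftarrow>fs. [:- e, 1:])"
  shows "char_poly (cm AA) = (\<Prod>e\<leftarrow>es @ fs. [:- e, 1:])"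
proof -
  have "char_poly (cm AA) = char_poly (cm A) * char_poly (cm F)"
    by (rule char_poly_0_block'[OF cAA]) (use es fs A F G C in auto)
  then show ?thesis using es fs by simp
qed

text \<open>Since \<open>F\<close> is stable, the unstable eigenvalues of \<open>AA\<close> are
  those of \<open>A\<close>, and a Schur form of \<open>AA\<close> listing them first provides
  \<open>Tu\<close> and \<open>U\<close>. A Schur form of \<open>A\<close> listing the stable ones
  first provides the complement \<open>Vs\<close>.\<close>

lemma splitting:
  obtains p l Tu U Q S R V where "kalman_stabilizable k (k + m) AA CC E p l Tu U Q S R V" "cmod (det U) = DI A"
proof -
  have cA: "cm A \<in> carrier_mat k k" and cF: "cm F \<in> carrier_mat m m" and cGC: "cm G * cm C \<in> carrier_mat m k"
    and cAAc: "cm AA \<in> carrier_mat (k + m) (k + m)"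
    using A F G C AA by auto
  obtain es where es: "char_poly (cm A) = (\<Prod>e\<leftarrow>es. [:- e, 1:])" "length es = k"
    using char_poly_factorized[OF cA] by auto
  obtain fs where fs: "char_poly (cm F) = (\<Prod>e\<leftarrow>fs. [:- e, 1:])"
    using char_poly_factorized[OF cF] by auto
  define eu where "eu = filter (\<lambda>e. 1 < cmod e) es"
  define eb where "eb = filter (\<lambda>e. \<not> 1 < cmod e) es"
  define p where "p = length eu"
  define q where "q = length eb"
  have pq: "p + q = k" unfolding p_def q_def eu_def eb_def using sum_length_filter_compl[of _ es] es(2) by simp
  have es_eig: "eigenvalue (cm A) e" if "e \<in> set es" for e
    unfolding eigenvalue_root_char_poly[OF cA] es(1) using that by (rule linear_poly_root)
  have eb: "cmod e < 1" if "e \<in> set eb" for e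
    using that A_unit[of e] es_eig[of e] by (auto simp: eb_def ceigenvalue_def)
  have cp1: "char_poly (cm A) = (\<Prod>e\<leftarrow>eb @ eu. [:- e, 1:])"
    unfolding es(1) eu_def eb_def by (subst prod_list_partition[where P = "\<lambda>e. 1 < cmod e"]) (simp add: mult.commute)
  have cp2: "char_poly (cm AA) = (\<Prod>e\<leftarrow>eu @ (eb @ fs). [:- e, 1:])"
    using char_poly_AA[OF es(1) fs] cp1 es(1) by (simp add: mult_ac)
  obtain Tu U Lu where Tu: "Tu \<in> carrier_mat (k + m) p" "U \<in> carrier_mat p p" "Lu \<in> carrier_mat p (k + m)"
    "upper_triangular U" "diag_mat U = eu" "cm AA * Tu = Tu * U" "Lu * Tu = 1\<^sub>m p"
    using schur_leading_block[OF cAAc cp2] unfolding p_def by metis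
  obtain Vs S1 Ls where Vs: "Vs \<in> carrier_mat k q" "S1 \<in> carrier_mat q q" "Ls \<in> carrier_mat q k"
    "upper_triangular S1" "diag_mat S1 = eb" "cm A * Vs = Vs * S1" "Ls * Vs = 1\<^sub>m q"
    using schur_leading_block[OF cA cp1] unfolding q_def by metis
  define l where "l = q + m"
  define Vu where "Vu = mat k p (\<lambda>(i,j). Tu $$ (i,j))"
  define X where "X = mat m p (\<lambda>(i,j). Tu $$ (k + i,j))"
  \<comment> \<open>The message basis: source components of the unstable subspace, followed by the
    stable subspace of \<open>A\<close>.\<close>
  define V where "V = mat k k (\<lambda>(i,j). if j < p then Tu $$ (i,j) else Vs $$ (i,j - p))"
  \<comment> \<open>Stable source directions together with all channel states.\<close>
  define Q where "Q = four_block_mat Vs (0\<^sub>m k m) (0\<^sub>m m q) (1\<^sub>m m)"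
  define S where "S = four_block_mat S1 (0\<^sub>m q m) (cm G * cm C * Vs) (cm F)"
  \<comment> \<open>The message enters with channel state 0 whereas the columns of \<open>Tu\<close>
    have channel components; the lower rows of \<open>R\<close> subtract these.\<close>
  define R where "R = mat l k (\<lambda>(i,j). if i < q then (if j = p + i then 1 else 0)
     else if j < p then - Tu $$ (k + (i - q),j) else (0 :: complex))"
  have Vu: "Vu \<in> carrier_mat k p" and X: "X \<in> carrier_mat m p" and V: "V \<in> carrier_mat k k"
    and Q: "Q \<in> carrier_mat (k + m) l" and S: "S \<in> carrier_mat l l" and R: "R \<in> carrier_mat l k"
    using Vs cF by (auto simp: Vu_def X_def V_def Q_def S_def R_def l_def)
  have eu: "1 < cmod e" if "e \<in> set eu" for e using that by (auto simp: eu_def)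
  have S1_eig: "cmod a < 1" if "eigenvalue S1 a" for a
    using upper_triangular_eigenvalue[OF Vs(2,4) that] eb Vs(5) by auto
  have U_eig: "1 < cmod a" if "a \<in> set (diag_mat U)" for a using that eu Tu(5) by simp
  have S_eig: "cmod a < 1" if "eigenvalue S a" for a
  proof -
    have "char_poly S = char_poly S1 * char_poly (cm F)"
      by (rule char_poly_0_block'[OF S_def]) (use fs Vs cF cGC char_poly_upper_triangular[OF Vs(2,4)] in auto)
    then have "poly (char_poly S1) a = 0 \<or> poly (char_poly (cm F)) a = 0"
      using that eigenvalue_root_char_poly[OF S] by simp
    then show ?thesis using S1_eig F_eigen eigenvalue_root_char_poly[OF Vs(2)] eigenvalue_root_char_poly[OF cF] by blast
  qed
  have AAQ: "cm AA * Q = Q * S"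
  proof -
    have "cm AA * Q = four_block_mat (cm A * Vs) (0\<^sub>m k m) (cm G * cm C * Vs) (cm F)"
      unfolding cAA Q_def
      unfolding mult_four_block_mat[OF cA zero_carrier_mat cGC cF Vs(1) zero_carrier_mat zero_carrier_mat one_carrier_mat]
      using right_mult_zero_mat[OF cA] right_mult_zero_mat[OF cF] right_mult_zero_mat[OF cGC] right_mult_one_mat[OF cF]
        right_add_zero_mat[OF mult_carrier_mat[OF cA Vs(1)]] right_add_zero_mat[OF mult_carrier_mat[OF cGC Vs(1)]]
        left_add_zero_mat[OF cF] by simp
    moreover have "Q * S = four_block_mat (Vs * S1) (0\<^sub>m k m) (cm G * cm C * Vs) (cm F)"
    proof -
      have gcv: "cm G * cm C * Vs \<in> carrier_mat m q" using cGC Vs by auto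
      show ?thesis
        unfolding S_def Q_def by (subst mult_four_block_mat[of _ k q _ m _ m]) (use cF Vs gcv in \<open>auto simp: left_add_zero_mat\<close>)
    qed
    ultimately show ?thesis using Vs(6) by simp
  qed
  have EV: "cm E * V = Tu * mat p k (\<lambda>(i,j). if i = j then 1 else 0) + Q * R"
  proof (rule eq_matI)
    fix i j assume "i < dim_row (Tu * mat p k (\<lambda>(i,j). if i = j then 1 else 0) + Q * R)"
      "j < dim_col (Tu * mat p k (\<lambda>(i,j). if i = j then 1 else 0) + Q * R)"
    then have ij: "i < k + m" "j < k" using Tu Q R by auto
    have cE: "cm E \<in> carrier_mat (k + m) k" by (auto intro: carrier_matI)
    have "(cm E * V) $$ (i,j) = (\<Sum>a<k. cm E $$ (i,a) * V $$ (a,j))" by (rule index_mult_mat_sum[OF cE V ij])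
    also have "\<dots> = (\<Sum>a<k. if a = i then V $$ (a,j) else 0)"
      by (rule sum.cong) (use ij in \<open>auto simp: E_def\<close>)
    finally have 1: "(cm E * V) $$ (i,j) = (if i < k then V $$ (i,j) else 0)" by (simp add: sum.delta)
    let ?P = "mat p k (\<lambda>(i,j). if i = j then 1 else 0) :: complex mat"
    have P: "?P \<in> carrier_mat p k" by simp
    have "(Tu * ?P) $$ (i,j) = (\<Sum>a<p. Tu $$ (i,a) * ?P $$ (a,j))" by (rule index_mult_mat_sum[OF Tu(1) P ij])
    also have "\<dots> = (\<Sum>a<p. if a = j then Tu $$ (i,a) else 0)"
      by (rule sum.cong) (use ij in auto)
    finally have 2: "(Tu * ?P) $$ (i,j) = (if j < p then Tu $$ (i,j) else 0)" by (simp add: sum.delta)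
    have "(Q * R) $$ (i,j) = (\<Sum>a<q. Q $$ (i,a) * R $$ (a,j)) + (\<Sum>a<m. Q $$ (i,q + a) * R $$ (q + a,j))"
      using index_mult_mat_sum[OF Q R ij] by (simp only: l_def sum_lessThan_add)
    also have "(\<Sum>a<q. Q $$ (i,a) * R $$ (a,j)) = (\<Sum>a<q. if a = j - p then (if i < k \<and> p \<le> j then Vs $$ (i,a) else 0) else 0)"
      by (rule sum.cong) (use ij pq Vs in \<open>auto simp: Q_def R_def l_def\<close>)
    also have "\<dots> = (if i < k \<and> p \<le> j then Vs $$ (i,j - p) else 0)" using ij pq by (auto simp: sum.delta)
    also have "(\<Sum>a<m. Q $$ (i,q + a) * R $$ (q + a,j)) = (\<Sum>a<m. if a = i - k then (if k \<le> i \<and> j < p then - Tu $$ (k + a,j) else 0) else 0)"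
      by (rule sum.cong) (use ij pq Vs in \<open>auto simp: Q_def R_def l_def\<close>)
    also have "\<dots> = (if k \<le> i \<and> j < p then - Tu $$ (i,j) else 0)" using ij by (auto simp: sum.delta)
    finally have 3: "(Q * R) $$ (i,j) = (if i < k \<and> p \<le> j then Vs $$ (i,j - p) else 0) + (if k \<le> i \<and> j < p then - Tu $$ (i,j) else 0)" .
    show "(cm E * V) $$ (i,j) = (Tu * ?P + Q * R) $$ (i,j)"
      using 1 2 3 ij Tu Q R by (auto simp: V_def simp del: index_mult_mat(1))
  qed (use Tu Q R V in auto)
  have Tu_inj: "x = 0\<^sub>v p" if "x \<in> carrier_vec p" "Tu *\<^sub>v x = 0\<^sub>v (k + m)" for x
  proof -
    have "x = Lu *\<^sub>v (Tu *\<^sub>v x)" using assoc_mult_mat_vec[OF Tu(3,1) that(1)] Tu(7) that(1) by simp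
    then show ?thesis using that(2) Tu(3) by (metis mult_mat_vec_zero)
  qed
  have Vs_inj: "x = 0\<^sub>v q" if "x \<in> carrier_vec q" "Vs *\<^sub>v x = 0\<^sub>v k" for x
  proof -
    have "x = Ls *\<^sub>v (Vs *\<^sub>v x)" using assoc_mult_mat_vec[OF Vs(3,1) that(1)] Vs(7) that(1) by simp
    then show ?thesis using that(2) Vs(3) by (metis mult_mat_vec_zero)
  qed
  have Tuy: "Tu *\<^sub>v y = (Vu *\<^sub>v y) @\<^sub>v (X *\<^sub>v y)" if y: "y \<in> carrier_vec p" for y
  proof (rule eq_vecI)
    fix i assume "i < dim_vec ((Vu *\<^sub>v y) @\<^sub>v (X *\<^sub>v y))"
    then have i: "i < k + m" using Vu X by simp
    show "(Tu *\<^sub>v y) $ i = ((Vu *\<^sub>v y) @\<^sub>v (X *\<^sub>v y)) $ i"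
    proof (cases "i < k")
      case True
      then show ?thesis using i index_mult_vec_sum[OF Tu(1) y i] index_mult_vec_sum[OF Vu y True] Vu X
        by (simp add: Vu_def del: index_mult_mat_vec)
    next
      case False
      then have i2: "i - k < m" using i by simp
      show ?thesis using False i index_mult_vec_sum[OF Tu(1) y i] index_mult_vec_sum[OF X y i2] Vu X
        by (simp add: X_def del: index_mult_mat_vec)
    qed
  qed (use Tu Vu X in auto)
  have AVu: "cm A *\<^sub>v (Vu *\<^sub>v y) = Vu *\<^sub>v (U *\<^sub>v y)"
    and FX: "cm F *\<^sub>v (X *\<^sub>v y) + (cm C *\<^sub>v (Vu *\<^sub>v y)) $ 0 \<cdot>\<^sub>v col (cm G) 0 = X *\<^sub>v (U *\<^sub>v y)"
    if y: "y \<in> carrier_vec p" for y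
  proof -
    have Uy: "U *\<^sub>v y \<in> carrier_vec p" and Vy: "Vu *\<^sub>v y \<in> carrier_vec k" and Xy: "X *\<^sub>v y \<in> carrier_vec m"
      using Tu Vu X y by auto
    have "cm AA *\<^sub>v (Tu *\<^sub>v y) = Tu *\<^sub>v (U *\<^sub>v y)"
      using assoc_mult_mat_vec[OF cAAc Tu(1) y] assoc_mult_mat_vec[OF Tu(1,2) y] Tu(6) by simp
    then have "(cm A *\<^sub>v (Vu *\<^sub>v y)) @\<^sub>v (cm F *\<^sub>v (X *\<^sub>v y) + (cm C *\<^sub>v (Vu *\<^sub>v y)) $ 0 \<cdot>\<^sub>v col (cm G) 0) =
        (Vu *\<^sub>v (U *\<^sub>v y)) @\<^sub>v (X *\<^sub>v (U *\<^sub>v y))"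
      unfolding Tuy[OF y] Tuy[OF Uy] cAA_mult[OF Vy Xy] .
    moreover have "cm A *\<^sub>v (Vu *\<^sub>v y) \<in> carrier_vec k" "Vu *\<^sub>v (U *\<^sub>v y) \<in> carrier_vec k"
      using cA Vu Vy Uy by auto
    ultimately show "cm A *\<^sub>v (Vu *\<^sub>v y) = Vu *\<^sub>v (U *\<^sub>v y)"
      "cm F *\<^sub>v (X *\<^sub>v y) + (cm C *\<^sub>v (Vu *\<^sub>v y)) $ 0 \<cdot>\<^sub>v col (cm G) 0 = X *\<^sub>v (U *\<^sub>v y)"
      using append_vec_eq by blast+
  qed
  have AVs: "cm A *\<^sub>v (Vs *\<^sub>v z) = Vs *\<^sub>v (S1 *\<^sub>v z)" if "z \<in> carrier_vec q" for z
    using assoc_mult_mat_vec[OF cA Vs(1) that] assoc_mult_mat_vec[OF Vs(1,2) that] Vs(6) by simp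
  have detV: "det V \<noteq> 0"
  proof
    assume "det V = 0"
    then obtain v where v: "v \<in> carrier_vec k" "v \<noteq> 0\<^sub>v k" "V *\<^sub>v v = 0\<^sub>v k"
      using det_0_iff_vec_prod_zero_field[OF V] by blast
    define xu where "xu = vec p (\<lambda>i. v $ i)"
    define xs where "xs = vec q (\<lambda>i. v $ (p + i))"
    have xu: "xu \<in> carrier_vec p" and xs: "xs \<in> carrier_vec q" by (auto simp: xu_def xs_def)
    \<comment> \<open>Vectors whose source component falls into the stable subspace. The set is
      invariant under \<open>U\<close>, so a nonzero member would give an eigenvector; its stable
      component, its source component and its channel component then vanish in turn.\<close>
    let ?P = "\<lambda>y. \<exists>z \<in> carrier_vec q. Vu *\<^sub>v y + Vs *\<^sub>v z = 0\<^sub>v k"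
    have z0: "Vu *\<^sub>v xu + Vs *\<^sub>v xs = 0\<^sub>v k"
    proof (rule eq_vecI)
      fix i assume "i < dim_vec (0\<^sub>v k)"
      then have i: "i < k" by simp
      have "0 = (V *\<^sub>v v) $ i" using v(3) i by simp
      also have "\<dots> = (\<Sum>j<p. V $$ (i,j) * v $ j) + (\<Sum>j<q. V $$ (i,p + j) * v $ (p + j))"
        using index_mult_vec_sum[OF V v(1) i] by (simp only: pq[symmetric] sum_lessThan_add)
      also have "(\<Sum>j<p. V $$ (i,j) * v $ j) = (Vu *\<^sub>v xu) $ i"
        unfolding index_mult_vec_sum[OF Vu xu i] by (rule sum.cong) (use i pq in \<open>auto simp: V_def Vu_def xu_def\<close>)
      also have "(\<Sum>j<q. V $$ (i,p + j) * v $ (p + j)) = (Vs *\<^sub>v xs) $ i"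
        unfolding index_mult_vec_sum[OF Vs(1) xs i] by (rule sum.cong) (use i pq in \<open>auto simp: V_def xs_def\<close>)
      finally show "(Vu *\<^sub>v xu + Vs *\<^sub>v xs) $ i = 0\<^sub>v k $ i" using i Vu Vs by (simp del: index_mult_mat_vec)
    qed (use Vu Vs in auto)
    have xu0: "xu = 0\<^sub>v p"
    proof (rule ccontr)
      assume nz: "xu \<noteq> 0\<^sub>v p"
      have Pxu: "?P xu" using z0 xs by blast
      have inv: "?P (U *\<^sub>v y - a \<cdot>\<^sub>v y)" if y: "y \<in> carrier_vec p" and Py: "?P y" for y a
      proof -
        obtain z where z: "z \<in> carrier_vec q" "Vu *\<^sub>v y + Vs *\<^sub>v z = 0\<^sub>v k" using Py by blast
        have c: "Vu *\<^sub>v y \<in> carrier_vec k" "Vs *\<^sub>v z \<in> carrier_vec k" "U *\<^sub>v y \<in> carrier_vec p" "S1 *\<^sub>v z \<in> carrier_vec q"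
          using Vu Vs Tu y z by auto
        have "cm A *\<^sub>v (Vu *\<^sub>v y + Vs *\<^sub>v z) = cm A *\<^sub>v (Vu *\<^sub>v y) + cm A *\<^sub>v (Vs *\<^sub>v z)"
          by (rule mult_add_distrib_mat_vec[OF cA c(1,2)])
        then have e1: "Vu *\<^sub>v (U *\<^sub>v y) + Vs *\<^sub>v (S1 *\<^sub>v z) = 0\<^sub>v k"
          unfolding z(2) AVu[OF y] AVs[OF z(1)] using cA by (metis mult_mat_vec_zero)
        have "Vu *\<^sub>v (U *\<^sub>v y - a \<cdot>\<^sub>v y) = Vu *\<^sub>v (U *\<^sub>v y) - a \<cdot>\<^sub>v (Vu *\<^sub>v y)"
          using mult_minus_distrib_mat_vec[OF Vu c(3), of "a \<cdot>\<^sub>v y"] mult_mat_vec[OF Vu y] y by simp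
        moreover have "Vs *\<^sub>v (S1 *\<^sub>v z - a \<cdot>\<^sub>v z) = Vs *\<^sub>v (S1 *\<^sub>v z) - a \<cdot>\<^sub>v (Vs *\<^sub>v z)"
          using mult_minus_distrib_mat_vec[OF Vs(1) c(4), of "a \<cdot>\<^sub>v z"] mult_mat_vec[OF Vs(1) z(1)] z by simp
        moreover have "(Vu *\<^sub>v (U *\<^sub>v y) - a \<cdot>\<^sub>v (Vu *\<^sub>v y)) + (Vs *\<^sub>v (S1 *\<^sub>v z) - a \<cdot>\<^sub>v (Vs *\<^sub>v z)) = 0\<^sub>v k"
        proof (rule eq_vecI)
          fix i assume "i < dim_vec (0\<^sub>v k)"
          then have i: "i < k" by simp
          have 1: "(Vu *\<^sub>v (U *\<^sub>v y)) $ i + (Vs *\<^sub>v (S1 *\<^sub>v z)) $ i = 0"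
            using arg_cong[OF e1, of "\<lambda>v. v $ i"] i Vs by (simp del: index_mult_mat_vec)
          have 2: "(Vu *\<^sub>v y) $ i + (Vs *\<^sub>v z) $ i = 0"
            using arg_cong[OF z(2), of "\<lambda>v. v $ i"] i Vs by (simp del: index_mult_mat_vec)
          have "(Vu *\<^sub>v (U *\<^sub>v y)) $ i - a * (Vu *\<^sub>v y) $ i + ((Vs *\<^sub>v (S1 *\<^sub>v z)) $ i - a * (Vs *\<^sub>v z) $ i) = 0"
          proof -
            have "(Vs *\<^sub>v (S1 *\<^sub>v z)) $ i = - (Vu *\<^sub>v (U *\<^sub>v y)) $ i" "(Vs *\<^sub>v z) $ i = - (Vu *\<^sub>v y) $ i"
              using 1 2 by (simp_all add: eq_neg_iff_add_eq_0 add.commute del: index_mult_mat_vec)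
            then show ?thesis by (simp del: index_mult_mat_vec)
          qed
          then show "((Vu *\<^sub>v (U *\<^sub>v y) - a \<cdot>\<^sub>v (Vu *\<^sub>v y)) + (Vs *\<^sub>v (S1 *\<^sub>v z) - a \<cdot>\<^sub>v (Vs *\<^sub>v z))) $ i = 0\<^sub>v k $ i"
            using i Vu Vs by (simp del: index_mult_mat_vec)
        qed (use Vs in auto)
        ultimately have "Vu *\<^sub>v (U *\<^sub>v y - a \<cdot>\<^sub>v y) + Vs *\<^sub>v (S1 *\<^sub>v z - a \<cdot>\<^sub>v z) = 0\<^sub>v k" by simp
        moreover have "S1 *\<^sub>v z - a \<cdot>\<^sub>v z \<in> carrier_vec q" using c z by auto
        ultimately show ?thesis by blast
      qed
      obtain y a where y: "y \<in> carrier_vec p" "y \<noteq> 0\<^sub>v p" "?P y" "U *\<^sub>v y = a \<cdot>\<^sub>v y" "a \<in> set (diag_mat U)"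
        using upper_triangular_invariant_eigenvector[OF Tu(2,4) xu nz, of ?P] Pxu inv by metis
      have a: "1 < cmod a" using U_eig y(5) .
      obtain z where z: "z \<in> carrier_vec q" "Vu *\<^sub>v y + Vs *\<^sub>v z = 0\<^sub>v k" using y(3) by blast
      have c: "Vu *\<^sub>v y \<in> carrier_vec k" "Vs *\<^sub>v z \<in> carrier_vec k" "S1 *\<^sub>v z \<in> carrier_vec q" "X *\<^sub>v y \<in> carrier_vec m"
        using Vu Vs X y z by auto
      have "cm A *\<^sub>v (Vu *\<^sub>v y + Vs *\<^sub>v z) = cm A *\<^sub>v (Vu *\<^sub>v y) + cm A *\<^sub>v (Vs *\<^sub>v z)"
        by (rule mult_add_distrib_mat_vec[OF cA c(1,2)])
      then have e1: "a \<cdot>\<^sub>v (Vu *\<^sub>v y) + Vs *\<^sub>v (S1 *\<^sub>v z) = 0\<^sub>v k"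
        unfolding z(2) AVu[OF y(1)] AVs[OF z(1)] y(4) mult_mat_vec[OF Vu y(1)] using cA by (metis mult_mat_vec_zero)
      have "Vs *\<^sub>v (S1 *\<^sub>v z - a \<cdot>\<^sub>v z) = Vs *\<^sub>v (S1 *\<^sub>v z) - a \<cdot>\<^sub>v (Vs *\<^sub>v z)"
        using mult_minus_distrib_mat_vec[OF Vs(1) c(3), of "a \<cdot>\<^sub>v z"] mult_mat_vec[OF Vs(1) z(1)] z by simp
      also have "\<dots> = 0\<^sub>v k"
      proof (rule eq_vecI)
        fix i assume "i < dim_vec (0\<^sub>v k)"
        then have i: "i < k" by simp
        have 1: "a * (Vu *\<^sub>v y) $ i + (Vs *\<^sub>v (S1 *\<^sub>v z)) $ i = 0"
          using arg_cong[OF e1, of "\<lambda>v. v $ i"] i Vs Vu by (simp del: index_mult_mat_vec)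
        have 2: "(Vu *\<^sub>v y) $ i + (Vs *\<^sub>v z) $ i = 0"
          using arg_cong[OF z(2), of "\<lambda>v. v $ i"] i Vs by (simp del: index_mult_mat_vec)
        have "(Vs *\<^sub>v (S1 *\<^sub>v z)) $ i - a * (Vs *\<^sub>v z) $ i = 0" using 1 arg_cong[OF 2, of "\<lambda>x. a * x"] by (simp add: algebra_simps) (metis add.commute add_left_cancel)
        then show "(Vs *\<^sub>v (S1 *\<^sub>v z) - a \<cdot>\<^sub>v (Vs *\<^sub>v z)) $ i = 0\<^sub>v k $ i"
          using i Vs by (simp del: index_mult_mat_vec)
      qed (use Vs in auto)
      finally have d0: "S1 *\<^sub>v z - a \<cdot>\<^sub>v z = 0\<^sub>v q" by (intro Vs_inj) (use c z in auto)
      have "S1 *\<^sub>v z = a \<cdot>\<^sub>v z"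
      proof (rule eq_vecI)
        fix i assume "i < dim_vec (a \<cdot>\<^sub>v z)"
        then have i: "i < q" using z by simp
        then have "(S1 *\<^sub>v z - a \<cdot>\<^sub>v z) $ i = 0" unfolding d0 by simp
        then show "(S1 *\<^sub>v z) $ i = (a \<cdot>\<^sub>v z) $ i" using i z by simp
      qed (use z Vs in simp)
      then have "z = 0\<^sub>v q" using no_eigenvector[OF Vs(2) _ z(1)] S1_eig[of a] a by auto
      moreover have "Vs *\<^sub>v 0\<^sub>v q = 0\<^sub>v k" by (rule mult_mat_vec_zero[OF Vs(1)])
      ultimately have Vuy: "Vu *\<^sub>v y = 0\<^sub>v k" using z(2) c(1) by simp
      have "X *\<^sub>v (U *\<^sub>v y) = cm F *\<^sub>v (X *\<^sub>v y) + 0 \<cdot>\<^sub>v col (cm G) 0"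
      proof -
        have "cm C *\<^sub>v 0\<^sub>v k = 0\<^sub>v 1" by (rule mult_mat_vec_zero) (use C in simp)
        then have "(cm C *\<^sub>v 0\<^sub>v k) $ 0 = 0" by (simp del: index_mult_mat_vec)
        then show ?thesis using FX[OF y(1)] unfolding Vuy by simp
      qed
      also have "\<dots> = cm F *\<^sub>v (X *\<^sub>v y)" by (rule eq_vecI) auto
      finally have "cm F *\<^sub>v (X *\<^sub>v y) = a \<cdot>\<^sub>v (X *\<^sub>v y)"
        unfolding y(4) using mult_mat_vec[OF X y(1)] by simp
      then have "X *\<^sub>v y = 0\<^sub>v m" using no_eigenvector[OF cF _ c(4)] F_eigen[of a] a by auto
      then have "Tu *\<^sub>v y = 0\<^sub>v (k + m)" unfolding Tuy[OF y(1)] Vuy by (intro eq_vecI) auto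
      then show False using Tu_inj y(1,2) by blast
    qed
    have "Vu *\<^sub>v 0\<^sub>v p = 0\<^sub>v k" by (rule mult_mat_vec_zero[OF Vu])
    then have "Vs *\<^sub>v xs = 0\<^sub>v k" using z0 xu0 Vs xs by simp
    then have xs0: "xs = 0\<^sub>v q" by (rule Vs_inj[OF xs])
    have "v = 0\<^sub>v k"
    proof (rule eq_vecI)
      fix i assume "i < dim_vec (0\<^sub>v k)"
      then have i: "i < k" by simp
      show "v $ i = 0\<^sub>v k $ i"
      proof (cases "i < p")
        case True
        then have "xu $ i = 0" unfolding xu0 by simp
        then show ?thesis using True i by (simp add: xu_def)
      next
        case False
        then have "i - p < q" using i pq by simp
        then have "xs $ (i - p) = 0" unfolding xs0 by simp
        moreover have "p + (i - p) = i" using False by simp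
        ultimately show ?thesis using \<open>i - p < q\<close> i by (simp add: xs_def)
      qed
    qed (use v in simp)
    then show False using v(2) by blast
  qed
  \<comment> \<open>The channel part of the row is a left eigenvector of the stable
    \<open>F\<close>, hence 0. The source part annihilates \<open>Vs\<close> because
    \<open>S1\<close> is stable, and the other columns of \<open>V\<close> by the hypothesis on
    \<open>Tu\<close>; the basis \<open>V\<close> leaves nothing.\<close>
  have left: "w = 0\<^sub>m (k + m) 1"
    if w: "w \<in> carrier_mat (k + m) 1" and a: "1 \<le> cmod a" and ev: "adj w * cm AA = a \<cdot>\<^sub>m adj w"
      and Tw: "adj Tu * w = 0\<^sub>m p 1" for w a
  proof -
    define u where "u = vec (k + m) (\<lambda>i. cnj (w $$ (i,0)))"
    have u: "u \<in> carrier_vec (k + m)" by (simp add: u_def)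
    define u1 u2 where "u1 = vec_first u k" and "u2 = vec_last u m"
    have c [simp]: "u1 \<in> carrier_vec k" "u2 \<in> carrier_vec m" by (auto simp: u1_def u2_def)
    have ud [simp]: "dim_vec u1 = k" "dim_vec u2 = m" by (simp_all add: u1_def u2_def)
    have us: "u = u1 @\<^sub>v u2" using u by (simp add: u1_def u2_def)
    have aw: "adj w \<in> carrier_mat 1 (k + m)" using w by (auto intro!: carrier_matI)
    have "(cm AA)\<^sup>T *\<^sub>v u = a \<cdot>\<^sub>v u"
    proof (rule eq_vecI)
      fix i assume "i < dim_vec (a \<cdot>\<^sub>v u)"
      then have i: "i < k + m" using u by simp
      have "((cm AA)\<^sup>T *\<^sub>v u) $ i = (\<Sum>j<k + m. (cm AA)\<^sup>T $$ (i,j) * u $ j)"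
        using cAAc by (intro index_mult_vec_sum[OF _ u i]) simp
      also have "\<dots> = (\<Sum>j<k + m. adj w $$ (0,j) * cm AA $$ (j,i))"
        by (rule sum.cong) (use i w cAAc in \<open>auto simp: u_def\<close>)
      also have "\<dots> = (adj w * cm AA) $$ (0,i)" using index_mult_mat_sum[OF aw cAAc, of 0 i] i by simp
      also have "\<dots> = a * u $ i" unfolding ev using w i by (simp add: u_def)
      finally show "((cm AA)\<^sup>T *\<^sub>v u) $ i = (a \<cdot>\<^sub>v u) $ i" using i u by simp
    qed (use u cAAc in auto)
    moreover have "(cm AA)\<^sup>T = four_block_mat (cm A)\<^sup>T (cm G * cm C)\<^sup>T (0\<^sub>m m k) (cm F)\<^sup>T"
      unfolding cAA by (subst transpose_four_block_mat[OF cA _ cGC cF]) auto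
    moreover have "four_block_mat (cm A)\<^sup>T (cm G * cm C)\<^sup>T (0\<^sub>m m k) (cm F)\<^sup>T *\<^sub>v (u1 @\<^sub>v u2) =
        ((cm A)\<^sup>T *\<^sub>v u1 + (cm G * cm C)\<^sup>T *\<^sub>v u2) @\<^sub>v (0\<^sub>m m k *\<^sub>v u1 + (cm F)\<^sup>T *\<^sub>v u2)"
      by (rule four_block_mat_mult_vec) (use cA cGC cF in auto)
    moreover have "a \<cdot>\<^sub>v (u1 @\<^sub>v u2) = (a \<cdot>\<^sub>v u1) @\<^sub>v (a \<cdot>\<^sub>v u2)" by (rule eq_vecI) auto
    ultimately have "((cm A)\<^sup>T *\<^sub>v u1 + (cm G * cm C)\<^sup>T *\<^sub>v u2) @\<^sub>v (0\<^sub>m m k *\<^sub>v u1 + (cm F)\<^sup>T *\<^sub>v u2) =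
        (a \<cdot>\<^sub>v u1) @\<^sub>v (a \<cdot>\<^sub>v u2)" unfolding us by simp
    moreover have "(cm A)\<^sup>T *\<^sub>v u1 + (cm G * cm C)\<^sup>T *\<^sub>v u2 \<in> carrier_vec k" "a \<cdot>\<^sub>v u1 \<in> carrier_vec k"
      by (rule carrier_vecI, simp)+
    ultimately have e1: "(cm A)\<^sup>T *\<^sub>v u1 + (cm G * cm C)\<^sup>T *\<^sub>v u2 = a \<cdot>\<^sub>v u1"
      and e2: "0\<^sub>m m k *\<^sub>v u1 + (cm F)\<^sup>T *\<^sub>v u2 = a \<cdot>\<^sub>v u2" using append_vec_eq by blast+
    have FT: "(cm F)\<^sup>T \<in> carrier_mat m m" and AT: "(cm A)\<^sup>T \<in> carrier_mat k k" using cF cA by auto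
    have "0\<^sub>m m k *\<^sub>v u1 + (cm F)\<^sup>T *\<^sub>v u2 = (cm F)\<^sup>T *\<^sub>v u2" by (intro eq_vecI) auto
    then have "u2 = 0\<^sub>v m" using no_eigenvector[OF FT, of a u2] F_eigen[of a] a eigenvalue_transpose[OF cF, of a] e2 c(2) by fastforce
    then have u20: "u2 = 0\<^sub>v m" .
    have "(cm G * cm C)\<^sup>T *\<^sub>v u2 = 0\<^sub>v k" unfolding u20 by (rule mult_mat_vec_zero) (use cGC in simp)
    moreover have "(cm A)\<^sup>T *\<^sub>v u1 + 0\<^sub>v k = (cm A)\<^sup>T *\<^sub>v u1" by (intro eq_vecI) auto
    ultimately have A1: "(cm A)\<^sup>T *\<^sub>v u1 = a \<cdot>\<^sub>v u1" using e1 by simp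
    have VsT: "Vs\<^sup>T \<in> carrier_mat q k" and S1T: "S1\<^sup>T \<in> carrier_mat q q" using Vs by auto
    define b where "b = Vs\<^sup>T *\<^sub>v u1"
    have b: "b \<in> carrier_vec q" using VsT by (auto simp: b_def)
    have "S1\<^sup>T *\<^sub>v b = (S1\<^sup>T * Vs\<^sup>T) *\<^sub>v u1" unfolding b_def by (rule assoc_mult_mat_vec[OF S1T VsT c(1), symmetric])
    also have "S1\<^sup>T * Vs\<^sup>T = Vs\<^sup>T * (cm A)\<^sup>T"
      using arg_cong[OF Vs(6), of transpose_mat] unfolding transpose_mult[OF cA Vs(1)] transpose_mult[OF Vs(1,2)] by simp
    also have "(Vs\<^sup>T * (cm A)\<^sup>T) *\<^sub>v u1 = a \<cdot>\<^sub>v b"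
      using assoc_mult_mat_vec[OF VsT AT c(1)] A1 mult_mat_vec[OF VsT c(1)] by (simp add: b_def)
    finally have b0: "b = 0\<^sub>v q"
      using no_eigenvector[OF S1T _ b] S1_eig[of a] a eigenvalue_transpose[OF Vs(2)] by auto
    have VT: "V\<^sup>T \<in> carrier_mat k k" using V by simp
    have ui: "u $ i = (if i < k then u1 $ i else 0)" if "i < k + m" for i
      using that u20 by (simp add: us)
    have "V\<^sup>T *\<^sub>v u1 = 0\<^sub>v k"
    proof (rule eq_vecI)
      fix j assume "j < dim_vec (0\<^sub>v k)"
      then have j: "j < k" by simp
      have Vj: "(V\<^sup>T *\<^sub>v u1) $ j = (\<Sum>i<k. V\<^sup>T $$ (j,i) * u1 $ i)" by (rule index_mult_vec_sum[OF VT c(1) j])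
      show "(V\<^sup>T *\<^sub>v u1) $ j = 0\<^sub>v k $ j"
      proof (cases "j < p")
        case True
        have aT: "adj Tu \<in> carrier_mat p (k + m)" using Tu by (auto intro!: carrier_matI)
        have "0 = cnj ((adj Tu * w) $$ (j,0))" unfolding Tw using True by simp
        also have "\<dots> = (\<Sum>i<k + m. Tu $$ (i,j) * u $ i)"
        proof -
          have "(adj Tu * w) $$ (j,0) = (\<Sum>i<k + m. adj Tu $$ (j,i) * w $$ (i,0))"
            by (rule index_mult_mat_sum[OF aT w True]) simp
          then show ?thesis
            unfolding cnj_sum[symmetric] using True Tu by (simp add: u_def del: index_mult_mat(1))
        qed
        also have "\<dots> = (\<Sum>i<k. V\<^sup>T $$ (j,i) * u1 $ i)"
          unfolding sum_lessThan_add using True j V by (simp add: ui V_def)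
        finally show ?thesis using Vj j by (simp del: index_mult_mat_vec)
      next
        case False
        then have jp: "j - p < q" using j pq by simp
        have "(\<Sum>i<k. V\<^sup>T $$ (j,i) * u1 $ i) = (\<Sum>i<k. Vs\<^sup>T $$ (j - p,i) * u1 $ i)"
          by (rule sum.cong) (use False j jp V Vs in \<open>auto simp: V_def\<close>)
        also have "\<dots> = b $ (j - p)" unfolding b_def using index_mult_vec_sum[OF VsT c(1) jp] by simp
        finally show ?thesis using Vj j jp b0 by (simp del: index_mult_mat_vec)
      qed
    qed (use V in auto)
    moreover have "det V\<^sup>T \<noteq> 0" using detV det_transpose[OF V] by simp
    ultimately have u10: "u1 = 0\<^sub>v k" using det_0_iff_vec_prod_zero_field[OF VT] c(1) by blast
    show ?thesis
    proof (rule eq_matI)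
      fix i j assume "i < dim_row (0\<^sub>m (k + m) 1)" "j < dim_col (0\<^sub>m (k + m) 1)"
      then have ij: "i < k + m" "j = 0" by auto
      have "u $ i = 0" using ui[OF ij(1)] u10 by auto
      then show "w $$ (i,j) = 0\<^sub>m (k + m) 1 $$ (i,j)" using ij by (simp add: u_def)
    qed (use w in auto)
  qed
  have "kalman_stabilizable k (k + m) AA CC E p l Tu U Q S R V"
  proof (intro kalman_stabilizable.intro kalman_split.intro kalman_stabilizable_axioms.intro kalman_split_axioms.intro)
    show "kalman k (k + m) AA CC E" by (rule kalman_axioms)
    show "p \<le> k" using pq by simp
    show "cmod a < 1" if "eigenvalue S a" for a by (rule S_eig[OF that])
    show "1 < cmod a" if "a \<in> set (diag_mat U)" for a by (rule U_eig[OF that])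
    show "x = 0\<^sub>v p" if "x \<in> carrier_vec p" "Tu *\<^sub>v x = 0\<^sub>v (k + m)" for x by (rule Tu_inj[OF that])
    show "x = 0\<^sub>v (k + m)" if "x \<in> carrier_vec (k + m)" "1 < cmod a" "cm AA *\<^sub>v x = a \<cdot>\<^sub>v x" "cm CC *\<^sub>v x = 0\<^sub>v 1" for x a
      by (rule detectable[OF that])
    show "w = 0\<^sub>m (k + m) 1" if "w \<in> carrier_mat (k + m) 1" "1 \<le> cmod a" "adj w * cm AA = a \<cdot>\<^sub>m adj w" "adj Tu * w = 0\<^sub>m p 1" for w a
      by (rule left[OF that])
  qed (fact Tu Q S R V detV AAQ EV)+
  moreover have "cmod (det U) = DI A"
  proof -
    have "cmod (prod_list xs) = prod_list (map cmod xs)" for xs by (induction xs) (auto simp: norm_mult)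
    then show ?thesis
      unfolding DI_eq_prod_list[OF A es(1)] det_upper_triangular[OF Tu(4,2)] Tu(5) eu_def by blast
  qed
  ultimately show thesis by (rule that)
qed

theorem K_tendsto_DI: "K \<longlonglongrightarrow> (DI A)\<^sup>2"
proof -
  obtain p l Tu U Q S R V where "kalman_stabilizable k (k + m) AA CC E p l Tu U Q S R V" and d: "cmod (det U) = DI A"
    by (rule splitting)
  then interpret kalman_stabilizable k "k + m" AA CC E p l Tu U Q S R V by blast
  show ?thesis using K_tendsto unfolding d .
qed

theorem stabilizing_limit_DI:
  obtains Sg where "mat_tendsto (k + m) (k + m) (riccati_seq AA CC (E * E\<^sup>T)) Sg" "stabilizing_solution AA CC Sg"
    "innov_var CC Sg = (DI A)\<^sup>2"
proof -
  obtain p l Tu U Q S R V where "kalman_stabilizable k (k + m) AA CC E p l Tu U Q S R V" and d: "cmod (det U) = DI A"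
    by (rule splitting)
  then interpret kalman_stabilizable k "k + m" AA CC E p l Tu U Q S R V by blast
  show thesis using stabilizing_limit that unfolding d by blast
qed

end

section \<open>The sensitivity integral\<close>

text \<open>Mean value property of the harmonic function \<open>ln |1 + b u|\<close> on the unit disc. Hence stable
  factors do not contribute to the sensitivity integral.\<close>
lemma has_integral_ln_one_minus:
  assumes b: "cmod b < 1"
  shows "((\<lambda>\<theta>. ln (cmod (1 - b * cis (2 * pi * \<theta>)))) has_integral 0) {-1/2..1/2}"
proof -
  define f where "f u = Ln (1 + b * u)" for u
  have re: "0 < Re (1 + b * u)" if "cmod u \<le> 1" for u
  proof -
    have "cmod (b * u) < 1" using b that by (simp add: norm_mult) (meson le_less_trans mult_left_le norm_ge_zero)
    then show ?thesis using abs_Re_le_cmod[of "b * u"] by simp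
  qed
  then have nn: "1 + b * u \<notin> \<real>\<^sub>\<le>\<^sub>0" if "cmod u \<le> 1" for u
    using that complex_nonpos_Reals_iff by fastforce
  have hol: "f holomorphic_on cball 0 1"
    unfolding f_def by (intro holomorphic_intros nn) (auto simp: dist_norm)
  \<comment> \<open>Cauchy's formula at the centre, where \<open>f 0\<close> is the logarithm of
    1.\<close>
  have "((\<lambda>u. f u / (u - 0)) has_contour_integral (2 * of_real pi * \<i> * f 0)) (circlepath 0 1)"
    by (rule Cauchy_integral_circlepath)
       (auto intro: holomorphic_on_imp_continuous_on hol holomorphic_on_subset[OF hol])
  then have "((\<lambda>x. f (circlepath 0 1 x) / (circlepath 0 1 x - 0) * vector_derivative (circlepath 0 1) (at x)) has_integral 0) {0..1}"
    by (simp add: has_contour_integral f_def)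
  moreover have "circlepath 0 1 x = cis (2 * pi * x)" for x
    by (simp add: circlepath cis_conv_exp mult_ac)
  moreover have "vector_derivative (circlepath 0 1) (at x) = 2 * of_real pi * \<i> * cis (2 * pi * x)" for x
    by (simp add: vector_derivative_circlepath cis_conv_exp mult_ac)
  ultimately have "((\<lambda>x. f (cis (2 * pi * x)) * (2 * of_real pi * \<i>)) has_integral 0) {0..1}"
    by (simp add: mult.assoc)
  from has_integral_mult_left[OF this, of "1 / (2 * of_real pi * \<i>)"]
  have "((\<lambda>x. f (cis (2 * pi * x))) has_integral 0) {0..1}" by simp
  from has_integral_linear[OF this bounded_linear_Re]
  have "((\<lambda>x. Re (f (cis (2 * pi * x)))) has_integral 0) {0..1}" by (simp add: o_def)
  moreover have "Re (f (cis (2 * pi * x))) = ln (cmod (1 + b * cis (2 * pi * x)))" for x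
    proof -
    have "1 + b * cis (2 * pi * x) \<noteq> 0"
      using re[of "cis (2 * pi * x)"] by (metis less_irrefl norm_cis order_refl zero_complex.sel(1))
    then show ?thesis unfolding f_def by (rule Re_Ln)
  qed
  ultimately have "((\<lambda>x. ln (cmod (1 + b * cis (2 * pi * x)))) has_integral 0) {0..1}" by simp
  \<comment> \<open>A shift by half a period changes the sign in front of \<open>b\<close> and
    carries the unit interval to the symmetric one.\<close>
  moreover have eq: "1 + b * cis (2 * pi * x) = 1 - b * cis (2 * pi * (- 1/2 + x))" for x
  proof -
    have "cis (2 * pi * (- 1/2 + x)) = - cis (2 * pi * x)"
      by (simp add: algebra_simps complex_eq_iff)
    then show ?thesis by simp
  qed
  ultimately have "((\<lambda>x. ln (cmod (1 - b * cis (2 * pi * (- 1/2 + x))))) has_integral 0) {0..1}" unfolding eq by blast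
  then show ?thesis
    using has_integral_shift_Icc_real[of "\<lambda>\<theta>. ln (cmod (1 - b * cis (2 * pi * \<theta>)))" "- 1/2" 0 0 1] by (simp add: o_def)
qed

text \<open>Jensen's formula for a single factor. For \<open>a\<close> outside the disc the factor
  \<open>a\<close> is pulled out; for \<open>a\<close> inside, the distance equals that of a
  reflected factor.\<close>

lemma has_integral_ln_dist:
  assumes "cmod a \<noteq> 1"
  shows "((\<lambda>\<theta>. ln (cmod (cis (2 * pi * \<theta>) - a))) has_integral (if 1 < cmod a then ln (cmod a) else 0)) {-1/2..1/2}"
proof (cases "1 < cmod a")
  case True
  then have a0: "a \<noteq> 0" by auto
  have e: "ln (cmod (cis (2 * pi * \<theta>) - a)) = ln (cmod a) + ln (cmod (1 - (1 / a) * cis (2 * pi * \<theta>)))" for \<theta>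
  proof -
    have "cis (2 * pi * \<theta>) - a = - (a * (1 - (1 / a) * cis (2 * pi * \<theta>)))" using a0 by (simp add: algebra_simps)
    then have "cmod (cis (2 * pi * \<theta>) - a) = cmod a * cmod (1 - (1 / a) * cis (2 * pi * \<theta>))"
      by (simp only: norm_minus_cancel norm_mult)
    moreover have "1 - (1 / a) * cis (2 * pi * \<theta>) \<noteq> 0"
    proof
      assume "1 - (1 / a) * cis (2 * pi * \<theta>) = 0"
      then have "a = cis (2 * pi * \<theta>)" using a0 by (simp add: field_simps)
      then show False using True by simp
    qed
    ultimately show ?thesis using a0 by (simp add: ln_mult_pos)
  qed
  have "((\<lambda>\<theta>. ln (cmod a) + ln (cmod (1 - (1 / a) * cis (2 * pi * \<theta>)))) has_integral (ln (cmod a) + 0)) {-1/2..1/2}"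
  proof (rule has_integral_add)
    show "((\<lambda>\<theta>::real. ln (cmod a)) has_integral ln (cmod a)) {-1/2..1/2}"
      by (rule has_integral_eq_rhs[OF has_integral_const_real]) simp
    show "((\<lambda>\<theta>. ln (cmod (1 - (1 / a) * cis (2 * pi * \<theta>)))) has_integral 0) {-1/2..1/2}"
      by (rule has_integral_ln_one_minus) (use True a0 in \<open>simp add: norm_divide divide_less_eq_1\<close>)
  qed
  then show ?thesis using True by (simp only: e) simp
next
  case False
  then have "cmod (cnj a) < 1" using assms by simp
  from has_integral_ln_one_minus[OF this]
  have "((\<lambda>\<theta>. ln (cmod (1 - cnj a * cis (2 * pi * \<theta>)))) has_integral 0) {-1/2..1/2}" .
  moreover have "cmod (1 - cnj a * cis (2 * pi * \<theta>)) = cmod (cis (2 * pi * \<theta>) - a)" for \<theta>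
  proof -
    \<comment> \<open>On the circle conjugation is inversion, so multiplying by the point turns the
      reflected factor into the original one.\<close>
    have "cis (2 * pi * \<theta>) * cnj (1 - cnj a * cis (2 * pi * \<theta>)) = cis (2 * pi * \<theta>) - a"
      by (simp add: algebra_simps cis_cnj cis_mult)
    then have "cmod (cis (2 * pi * \<theta>)) * cmod (cnj (1 - cnj a * cis (2 * pi * \<theta>))) = cmod (cis (2 * pi * \<theta>) - a)"
      by (metis norm_mult)
    then show ?thesis by (simp only: norm_cis complex_mod_cnj mult_1)
  qed
  ultimately show ?thesis using False by simp
qed

lemma has_integral_ln_poly:
  assumes "\<And>e. e \<in> set es \<Longrightarrow> cmod e \<noteq> 1"
  shows "((\<lambda>\<theta>. ln (cmod (poly (\<Prod>e\<leftarrow>es. [:- e, 1:]) (cis (2 * pi * \<theta>))))) has_integral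
    ln (prod_list (map cmod (filter (\<lambda>e. 1 < cmod e) es)))) {-1/2..1/2}"
  using assms
proof (induction es)
  case (Cons e es)
  let ?P = "\<lambda>\<theta>. poly (\<Prod>e\<leftarrow>es. [:- e, 1:]) (cis (2 * pi * \<theta>))"
  have nz: "cis (2 * pi * \<theta>) - e \<noteq> 0" "?P \<theta> \<noteq> 0" for \<theta>
  proof -
    have "cis (2 * pi * \<theta>) \<notin> set (e # es)" using Cons.prems norm_cis by metis
    then show "cis (2 * pi * \<theta>) - e \<noteq> 0" "?P \<theta> \<noteq> 0" by (auto simp: poly_prod_list prod_list_zero_iff)
  qed
  have pos: "0 < prod_list (map cmod (filter (\<lambda>e. 1 < cmod e) es))"
    by (induction es) (auto intro!: mult_pos_pos)
  have eq: "ln (cmod (poly (\<Prod>e\<leftarrow>e # es. [:- e, 1:]) (cis (2 * pi * \<theta>)))) = ln (cmod (cis (2 * pi * \<theta>) - e)) + ln (cmod (?P \<theta>))" for \<theta>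
  proof -
    have "poly (\<Prod>e\<leftarrow>e # es. [:- e, 1:]) (cis (2 * pi * \<theta>)) = (cis (2 * pi * \<theta>) - e) * ?P \<theta>"
      by (simp add: algebra_simps)
    then show ?thesis using nz[of \<theta>] by (simp only: norm_mult) (simp add: ln_mult_pos)
  qed
  have "((\<lambda>\<theta>. ln (cmod (cis (2 * pi * \<theta>) - e)) + ln (cmod (?P \<theta>))) has_integral
     ((if 1 < cmod e then ln (cmod e) else 0) + ln (prod_list (map cmod (filter (\<lambda>e. 1 < cmod e) es))))) {-1/2..1/2}"
    by (intro has_integral_add has_integral_ln_dist Cons.IH) (use Cons.prems in auto)
  moreover have "ln (cmod e * prod_list (map cmod (filter (\<lambda>e. 1 < cmod e) es))) =
      ln (cmod e) + ln (prod_list (map cmod (filter (\<lambda>e. 1 < cmod e) es)))" if "1 < cmod e"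
    using that pos by (intro ln_mult_pos) auto
  ultimately show ?case unfolding eq by (cases "1 < cmod e") simp_all
qed simp

lemma det_char_poly:
  fixes A :: "'a :: field mat"
  assumes A: "A \<in> carrier_mat n n"
  shows "det (z \<cdot>\<^sub>m 1\<^sub>m n - A) = poly (char_poly A) z"
proof -
  have "- (char_matrix A z) = z \<cdot>\<^sub>m 1\<^sub>m n - A"
    using A by (intro eq_matI) (auto simp: char_matrix_def)
  then show ?thesis using char_poly_matrix[OF A, of z] by simp
qed

text \<open>With \<open>AA - L CC\<close> for the closed loop, the transfer function is the ratio of the two
  characteristic polynomials, by the determinant formula for rank-one perturbations.\<close>
lemma ss_tf_closed_loop:
  assumes AA: "AA \<in> carrier_mat d d" and CC: "CC \<in> carrier_mat 1 d" and L: "L \<in> carrier_mat d 1"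
    and z: "poly (char_poly (cm (AA - L * CC))) z \<noteq> 0"
  shows "ss_tf (AA - L * CC) (- L) CC 1 z = poly (char_poly (cm AA)) z / poly (char_poly (cm (AA - L * CC))) z"
proof -
  define B where "B = z \<cdot>\<^sub>m 1\<^sub>m d - cm (AA - L * CC)"
  have Acl: "cm (AA - L * CC) \<in> carrier_mat d d" using AA CC L by auto
  have B: "B \<in> carrier_mat d d" unfolding B_def by (rule minus_carrier_mat[OF Acl])
  have dB: "det B = poly (char_poly (cm (AA - L * CC))) z" unfolding B_def by (rule det_char_poly[OF Acl])
  have u: "cm (- L) \<in> carrier_mat d 1" and w: "cm CC \<in> carrier_mat 1 d" using L CC by auto
  have "B + cm (- L) * cm CC = z \<cdot>\<^sub>m 1\<^sub>m d - cm AA"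
  proof -
    have "cm (- L) * cm CC = - cm (L * CC)"
      using L CC by (intro eq_matI) (auto simp: scalar_prod_def sum_negf)
    then show ?thesis unfolding B_def using AA CC L by (intro eq_matI) (auto simp del: index_mult_mat(1))
  qed
  then have "poly (char_poly (cm AA)) z = det B * (1 + (cm CC * mat_inv B * cm (- L)) $$ (0,0))"
    using det_add_rank_one[OF B u w] z dB det_char_poly[of "cm AA" d z] AA by simp
  moreover have "dim_row (AA - L * CC) = d" using AA CC L by simp
  ultimately show ?thesis using z unfolding ss_tf_def dB[symmetric] B_def[symmetric]
    by (simp add: B_def[symmetric] field_simps del: index_mult_mat(1))
qed

lemma (in coding) sensitivity_integral:
  assumes Sg: "stabilizing_solution AA CC Sg"
  shows "(LINT \<theta>:{-1/2..1/2}|lborel. log 2 (cmod (sensitivity AA CC (cis (2 * pi * \<theta>))))) = log 2 (DI A)"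
proof -
  have SgI: "Sigma_inf AA CC = Sg"
    unfolding Sigma_inf_def using Sg stabilizing_solution_unique[OF AA CC _ Sg] by (rule the_equality)
  define L where "L = kalman_gain AA CC Sg"
  have Sgc: "Sg \<in> carrier_mat (k + m) (k + m)" using Sg AA by (simp add: stabilizing_solution_def)
  have L: "L \<in> carrier_mat (k + m) 1" unfolding L_def kalman_gain_def using AA CC Sgc by auto
  have Acl: "cm (AA - L * CC) \<in> carrier_mat (k + m) (k + m)" using AA CC L by auto
  have cA: "cm A \<in> carrier_mat k k" and cF: "cm F \<in> carrier_mat m m" using A F by auto
  obtain es where es: "char_poly (cm A) = (\<Prod>e\<leftarrow>es. [:- e, 1:])" using char_poly_factorized[OF cA] by auto
  obtain fs where fs: "char_poly (cm F) = (\<Prod>e\<leftarrow>fs. [:- e, 1:])" using char_poly_factorized[OF cF] by auto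
  obtain gs where gs: "char_poly (cm (AA - L * CC)) = (\<Prod>e\<leftarrow>gs. [:- e, 1:])" using char_poly_factorized[OF Acl] by auto
  note cAA = char_poly_AA[OF es fs]
  have gs1: "cmod e < 1" if "e \<in> set gs" for e
  proof -
    have "eigenvalue (cm (AA - L * CC)) e"
      unfolding eigenvalue_root_char_poly[OF Acl] gs using that by (rule linear_poly_root)
    then show ?thesis using Sg unfolding stabilizing_solution_def stable_mat_def ceigenvalue_def L_def by blast
  qed
  have fs1: "cmod e < 1" if "e \<in> set fs" for e
    by (rule F_eigen) (unfold eigenvalue_root_char_poly[OF cF] fs, rule linear_poly_root[OF that])
  have es1: "cmod e \<noteq> 1" if "e \<in> set es" for e
    using A_unit[of e] linear_poly_root[OF that] unfolding ceigenvalue_def eigenvalue_root_char_poly[OF cA] es by blast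
  let ?num = "\<lambda>\<theta>. poly (char_poly (cm AA)) (cis (2 * pi * \<theta>))"
  let ?den = "\<lambda>\<theta>. poly (char_poly (cm (AA - L * CC))) (cis (2 * pi * \<theta>))"
  have den: "?den \<theta> \<noteq> 0" for \<theta>
  proof -
    have "cis (2 * pi * \<theta>) \<notin> set gs" using gs1 norm_cis by (metis less_irrefl)
    then show ?thesis unfolding gs by (auto simp: poly_prod_list prod_list_zero_iff)
  qed
  have num: "?num \<theta> \<noteq> 0" for \<theta>
  proof -
    have "cis (2 * pi * \<theta>) \<notin> set es" "cis (2 * pi * \<theta>) \<notin> set fs" using es1 fs1 norm_cis by (metis less_irrefl)+
    then show ?thesis unfolding cAA by (auto simp: poly_prod_list prod_list_zero_iff)
  qed
  have S: "sensitivity AA CC (cis (2 * pi * \<theta>)) = ?num \<theta> / ?den \<theta>" for \<theta>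
    unfolding sensitivity_def SgI Let_def L_def[symmetric] by (rule ss_tf_closed_loop[OF AA CC L den])
  have eq: "log 2 (cmod (sensitivity AA CC (cis (2 * pi * \<theta>)))) = (ln (cmod (?num \<theta>)) - ln (cmod (?den \<theta>))) / ln 2" for \<theta>
    unfolding S log_def norm_divide using num[of \<theta>] den[of \<theta>] by (simp add: ln_div)
  have f1: "filter (\<lambda>e. 1 < cmod e) fs = []" "filter (\<lambda>e. 1 < cmod e) gs = []"
    using fs1 gs1 by (force simp: filter_empty_conv)+
  have "((\<lambda>\<theta>. ln (cmod (?num \<theta>))) has_integral ln (DI A)) {-1/2..1/2}"
    using has_integral_ln_poly[of "es @ fs"] es1 fs1 unfolding cAA DI_eq_prod_list[OF A es]
    by (force simp: f1 simp del: list.map prod_list.append map_append)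
  moreover have "((\<lambda>\<theta>. ln (cmod (?den \<theta>))) has_integral 0) {-1/2..1/2}"
    using has_integral_ln_poly[of gs] gs1 unfolding gs by (force simp: f1)
  ultimately have "((\<lambda>\<theta>. (ln (cmod (?num \<theta>)) - ln (cmod (?den \<theta>))) / ln 2) has_integral (ln (DI A) - 0) / ln 2) {-1/2..1/2}"
    by (intro has_integral_divide has_integral_diff)
  then have int: "((\<lambda>\<theta>. log 2 (cmod (sensitivity AA CC (cis (2 * pi * \<theta>))))) has_integral log 2 (DI A)) {-1/2..1/2}"
    unfolding eq by (simp add: log_def)
  \<comment> \<open>The value was found as a gauge integral; continuity on the compact interval
    transfers it to the Lebesgue integral.\<close>
  have "continuous_on {-1/2..1/2} (\<lambda>\<theta>. log 2 (cmod (sensitivity AA CC (cis (2 * pi * \<theta>)))))"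
    unfolding eq by (intro continuous_intros) (use num den in auto)
  then have "set_integrable lborel {-1/2..1/2} (\<lambda>\<theta>. log 2 (cmod (sensitivity AA CC (cis (2 * pi * \<theta>)))))"
    by (rule borel_integrable_atLeastAtMost')
  from set_borel_integral_eq_integral(2)[OF this] show ?thesis using integral_unique[OF int] by simp
qed

section \<open>The inverse channel\<close>

text \<open>The Markov parameters, that is the impulse response of the inverse channel with direct
  term 1.\<close>

definition markov :: "real mat \<Rightarrow> real mat \<Rightarrow> real mat \<Rightarrow> nat \<Rightarrow> real" where
  "markov F G H i = (case i of 0 \<Rightarrow> 1 | Suc j \<Rightarrow> (H * F ^\<^sub>m j * G) $$ (0,0))"

lemma resolvent_nonsingular:
  assumes F: "F \<in> carrier_mat m m" and "\<not> ceigenvalue F z"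
  shows "det (z \<cdot>\<^sub>m 1\<^sub>m m - cm F) \<noteq> 0"
proof -
  have "cm F \<in> carrier_mat m m" using F by simp
  then show ?thesis
    using det_char_poly[of "cm F" m z] eigenvalue_root_char_poly[of "cm F" m z] assms(2) by (simp add: ceigenvalue_def)
qed

text \<open>As \<open>a\<close> is not an eigenvalue of \<open>F\<close>, the state is
  \<open>r\<close> times the resolvent applied to \<open>G\<close>, and the output is
  \<open>r\<close> times \<open>q / p\<close> at \<open>a\<close>. Its numerator is nonzero there
  since the channel poles lie in the open disc.\<close>

lemma realization_inverse_channel:
  assumes ch: "channel_tf p q" and re: "realizes m F G H 1 q p" and st: "stable_mat F"
    and a: "1 < cmod a" and x: "x \<in> carrier_vec m"
    and ev: "cm F *\<^sub>v x + r \<cdot>\<^sub>v col (cm G) 0 = a \<cdot>\<^sub>v x" and z: "(cm H *\<^sub>v x) $ 0 + r = 0"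
  shows "r = 0"
proof -
  have F: "F \<in> carrier_mat m m" and G: "G \<in> carrier_mat m 1" and H: "H \<in> carrier_mat 1 m"
    using re by (auto simp: realizes_def)
  have ne: "\<not> ceigenvalue F a" using st a unfolding stable_mat_def by (metis less_asym)
  have pa: "cpoly p a \<noteq> 0" "cpoly q a \<noteq> 0" using ch a unfolding channel_tf_def by (metis less_asym)+
  define B where "B = a \<cdot>\<^sub>m 1\<^sub>m m - cm F"
  have cF: "cm F \<in> carrier_mat m m" and cG: "cm G \<in> carrier_mat m 1" and cH: "cm H \<in> carrier_mat 1 m" using F G H by auto
  have B: "B \<in> carrier_mat m m" unfolding B_def by (rule minus_carrier_mat[OF cF])
  note Bi = mat_inv_inverse[OF B resolvent_nonsingular[OF F ne, folded B_def]]
  have cgc: "col (cm G) 0 \<in> carrier_vec m" using G by (intro carrier_vecI) simp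
  have "B *\<^sub>v x = r \<cdot>\<^sub>v col (cm G) 0"
  proof (rule eq_vecI)
    fix i assume "i < dim_vec (r \<cdot>\<^sub>v col (cm G) 0)"
    then have i: "i < m" using G by simp
    have 1: "(cm F *\<^sub>v x) $ i + r * col (cm G) 0 $ i = a * x $ i"
      using arg_cong[OF ev, of "\<lambda>v. v $ i"] i x F G by (simp del: index_mult_mat_vec)
    have 2: "(B *\<^sub>v x) $ i = a * x $ i - (cm F *\<^sub>v x) $ i"
    proof -
      have "B *\<^sub>v x = (a \<cdot>\<^sub>m 1\<^sub>m m) *\<^sub>v x - cm F *\<^sub>v x" unfolding B_def
        by (rule minus_mult_distrib_mat_vec[OF _ cF x]) simp
      also have "(a \<cdot>\<^sub>m 1\<^sub>m m) *\<^sub>v x = a \<cdot>\<^sub>v x" using smult_mat_mult_vec[of "1\<^sub>m m" m m x a] x by simp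
      finally show ?thesis using i x F by (simp del: index_mult_mat_vec)
    qed
    show "(B *\<^sub>v x) $ i = (r \<cdot>\<^sub>v col (cm G) 0) $ i" unfolding 2 1[symmetric] using i G by simp
  qed (use B G in auto)
  then have "x = mat_inv B *\<^sub>v (r \<cdot>\<^sub>v col (cm G) 0)"
    using assoc_mult_mat_vec[OF Bi(1) B x] Bi(3) x by simp
  then have "x = r \<cdot>\<^sub>v (mat_inv B *\<^sub>v col (cm G) 0)" using mult_mat_vec[OF Bi(1) cgc] by simp
  then have "cm H *\<^sub>v x = r \<cdot>\<^sub>v (cm H *\<^sub>v (mat_inv B *\<^sub>v col (cm G) 0))"
    using mult_mat_vec[OF cH, of "mat_inv B *\<^sub>v col (cm G) 0" r] Bi(1) cgc by simp
  also have "mat_inv B *\<^sub>v col (cm G) 0 = col (mat_inv B * cm G) 0"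
    using col_mult2[OF Bi(1) cG, of 0] by simp
  also have "cm H *\<^sub>v col (mat_inv B * cm G) 0 = col (cm H * (mat_inv B * cm G)) 0"
    using col_mult2[OF cH mult_carrier_mat[OF Bi(1) cG], of 0] by simp
  also have "cm H * (mat_inv B * cm G) = cm H * mat_inv B * cm G"
    using assoc_mult_mat[OF cH Bi(1) cG] by simp
  finally have Hx: "(cm H *\<^sub>v x) $ 0 = r * (cm H * mat_inv B * cm G) $$ (0,0)"
    using H G Bi(1) by (simp del: index_mult_mat(1) index_mult_mat_vec)
  have "ss_tf F G H 1 a = cpoly q a / cpoly p a" using re ne pa by (simp add: realizes_def)
  moreover have "ss_tf F G H 1 a = (cm H * mat_inv B * cm G) $$ (0,0) + 1"
    using F by (simp add: ss_tf_def B_def del: index_mult_mat(1))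
  ultimately have M: "(cm H * mat_inv B * cm G) $$ (0,0) + 1 = cpoly q a / cpoly p a" by simp
  have "r * ((cm H * mat_inv B * cm G) $$ (0,0) + 1) = 0"
    using z unfolding Hx by (simp add: algebra_simps)
  then have "r * (cpoly q a / cpoly p a) = 0" unfolding M .
  then show ?thesis using pa by simp
qed

text \<open>A telescoping Neumann series: with \<open>R\<close> the row \<open>H\<close> times the
  resolvent, \<open>x \<cdot>\<^sub>m cm H\<close> is
  \<open>R - x \<cdot>\<^sub>m (R * cm F)\<close>, and the remainders \<open>f i\<close> tend to
  0.\<close>

lemma markov_sums:
  assumes F: "F \<in> carrier_mat m m" and G: "G \<in> carrier_mat m 1" and H: "H \<in> carrier_mat 1 m"
    and st: "stable_mat F" and x: "x \<noteq> 0" "cmod x < 1"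
  shows "(\<lambda>i. complex_of_real (markov F G H i) * x ^ i) sums ss_tf F G H 1 (1 / x)"
proof -
  have x1: "1 < cmod (1 / x)" using x by (simp add: norm_divide divide_simps)
  have ne: "\<not> ceigenvalue F (1 / x)" using st x1 unfolding stable_mat_def by (metis less_asym)
  define B where "B = (1 / x) \<cdot>\<^sub>m 1\<^sub>m m - cm F"
  have cF: "cm F \<in> carrier_mat m m" and cG: "cm G \<in> carrier_mat m 1" and cH: "cm H \<in> carrier_mat 1 m" using F G H by auto
  have B: "B \<in> carrier_mat m m" unfolding B_def by (rule minus_carrier_mat[OF cF])
  note Bi = mat_inv_inverse[OF B resolvent_nonsingular[OF F ne, folded B_def]]
  have d [simp]: "dim_row F = m" "dim_col F = m" "dim_row G = m" "dim_col G = Suc 0" "dim_row H = Suc 0" "dim_col H = m"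
    "dim_row B = m" "dim_col B = m" "dim_row (mat_inv B) = m" "dim_col (mat_inv B) = m"
    "dim_row (cm F ^\<^sub>m i) = m" "dim_col (cm F ^\<^sub>m i) = m" "dim_row (F ^\<^sub>m i) = m" "dim_col (F ^\<^sub>m i) = m" for i
    using F G H B Bi(1) pow_mat_dim_square[OF cF, of i] pow_mat_dim_square[OF F, of i] by auto
  define R where "R = cm H * mat_inv B"
  have Rd [simp]: "dim_row R = Suc 0" "dim_col R = m" by (simp_all add: R_def)
  have RB: "R * B = cm H" unfolding R_def using mult_assoc_dim[of "cm H" "mat_inv B" B] Bi(3) by simp
  have "x \<cdot>\<^sub>m B = 1\<^sub>m m - x \<cdot>\<^sub>m cm F" unfolding B_def using x by (intro eq_matI) (auto simp: field_simps)
  then have "x \<cdot>\<^sub>m (R * B) = R - x \<cdot>\<^sub>m (R * cm F)"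
    using mult_smult_dim[of R B x] mult_minus_distrib_dim[of "1\<^sub>m m" "x \<cdot>\<^sub>m cm F" R] mult_smult_dim[of R "cm F" x] by simp
  then have RH: "x \<cdot>\<^sub>m cm H = R - x \<cdot>\<^sub>m (R * cm F)" unfolding RB .
  define f where "f i = x ^ i * (R * cm F ^\<^sub>m i * cm G) $$ (0,0)" for i
  have mk: "complex_of_real (markov F G H (Suc i)) * x ^ Suc i = f i - f (Suc i)" for i
  proof -
    have "complex_of_real (markov F G H (Suc i)) = (cm H * cm F ^\<^sub>m i * cm G) $$ (0,0)"
    proof -
      have "cm (H * F ^\<^sub>m i * G) = cm H * cm F ^\<^sub>m i * cm G" by (simp add: cm_mult cm_pow[OF F])
      moreover have "complex_of_real (markov F G H (Suc i)) = cm (H * F ^\<^sub>m i * G) $$ (0,0)"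
        unfolding markov_def by simp
      ultimately show ?thesis by (simp only:)
    qed
    then have "complex_of_real (markov F G H (Suc i)) * x = (x \<cdot>\<^sub>m cm H * (cm F ^\<^sub>m i * cm G)) $$ (0,0)"
      by (simp add: smult_mult_dim mult_assoc_dim del: index_mult_mat(1))
    also have "x \<cdot>\<^sub>m cm H * (cm F ^\<^sub>m i * cm G) = R * cm F ^\<^sub>m i * cm G - x \<cdot>\<^sub>m (R * (cm F * cm F ^\<^sub>m i) * cm G)"
      unfolding RH by (simp add: minus_mult_distrib_dim smult_mult_dim mult_assoc_dim)
    also have "cm F * cm F ^\<^sub>m i = cm F ^\<^sub>m Suc i" using pow_intertwine[OF cF cF cF refl, of i] by simp
    finally have "complex_of_real (markov F G H (Suc i)) * x =
        (R * cm F ^\<^sub>m i * cm G) $$ (0,0) - x * (R * cm F ^\<^sub>m Suc i * cm G) $$ (0,0)"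
      by (simp del: index_mult_mat(1) pow_mat.simps)
    then have "x ^ i * (complex_of_real (markov F G H (Suc i)) * x) =
        x ^ i * ((R * cm F ^\<^sub>m i * cm G) $$ (0,0) - x * (R * cm F ^\<^sub>m Suc i * cm G) $$ (0,0))" by simp
    then show ?thesis by (simp add: f_def algebra_simps del: index_mult_mat(1) pow_mat.simps)
  qed
  have "f \<longlonglongrightarrow> 0"
  proof -
    have "mat_tendsto 1 1 (\<lambda>i. R * cm F ^\<^sub>m i * cm G) (R * 0\<^sub>m m m * cm G)"
      by (intro mat_tendsto_mult[where n = m] mat_tendsto_const stable_mat_power_tendsto_zero F st cG) (rule carrier_matI, simp_all)
    from mat_tendsto_entry[OF this, of 0 0] have "(\<lambda>i. (R * cm F ^\<^sub>m i * cm G) $$ (0,0)) \<longlonglongrightarrow> (R * 0\<^sub>m m m * cm G) $$ (0,0)" by simp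
    moreover have "(\<lambda>i. x ^ i) \<longlonglongrightarrow> 0" by (rule LIMSEQ_power_zero[OF x(2)])
    ultimately have "f \<longlonglongrightarrow> 0 * (R * 0\<^sub>m m m * cm G) $$ (0,0)" unfolding f_def by (intro tendsto_mult)
    then show ?thesis by simp
  qed
  from telescope_sums'[OF this] have "(\<lambda>i. complex_of_real (markov F G H (Suc i)) * x ^ Suc i) sums f 0"
    unfolding mk by simp
  then have "(\<lambda>i. complex_of_real (markov F G H i) * x ^ i) sums (f 0 + complex_of_real (markov F G H 0) * x ^ 0)"
    by (rule sums_Suc)
  moreover have "f 0 + complex_of_real (markov F G H 0) * x ^ 0 = ss_tf F G H 1 (1 / x)"
  proof -
    have "R * cm F ^\<^sub>m 0 = R" using cF by simp
    moreover have "ss_tf F G H 1 (1 / x) = (R * cm G) $$ (0,0) + 1"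
      by (simp add: ss_tf_def R_def B_def del: index_mult_mat(1))
    ultimately show ?thesis by (simp only: f_def markov_def) simp
  qed
  ultimately show ?thesis by simp
qed

text \<open>Rational functions are compared by values, so the identity is shown first for the
  evaluated complex series at \<open>x\<close>, that is at the point \<open>1 / x\<close> outside
  the disc. Coefficients agree because the values agree near 0.\<close>

lemma markov_fps:
  assumes ch: "channel_tf p q" and re: "realizes m F G H 1 q p" and st: "stable_mat F"
  shows "Abs_fps (markov F G H) * fps_of_poly (reflect_poly p) = fps_of_poly (reflect_poly q)"
proof -
  have F: "F \<in> carrier_mat m m" and G: "G \<in> carrier_mat m 1" and H: "H \<in> carrier_mat 1 m"
    using re by (auto simp: realizes_def)
  let ?c = "map_poly complex_of_real"
  have refl: "reflect_poly (?c p) = ?c (reflect_poly p)" for p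
    by (rule poly_eqI) (simp add: coeff_reflect_poly coeff_map_poly degree_map_poly)
  define f where "f = Abs_fps (\<lambda>i. complex_of_real (markov F G H i))"
  have fs: "(\<lambda>i. fps_nth f i * x ^ i) sums ss_tf F G H 1 (1 / x)" if "x \<noteq> 0" "cmod x < 1" for x
    unfolding f_def using markov_sums[OF F G H st that] by simp
  have rad: "fps_conv_radius f > 0"
  proof -
    have "ereal (norm (1 / 2 :: complex)) \<le> fps_conv_radius f"
      \<comment> \<open>Convergence at a single nonzero point suffices for a positive
        radius.\<close>
      unfolding fps_conv_radius_def by (rule conv_radius_geI) (use fs[of "1/2"] in \<open>auto simp: sums_iff\<close>)
    moreover have "ereal (norm (1 / 2 :: complex)) > 0" by simp
    ultimately show ?thesis by (rule less_le_trans[rotated])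
  qed
  have "f * fps_of_poly (?c (reflect_poly p)) = fps_of_poly (?c (reflect_poly q))"
  proof (rule eval_fps_eqD)
    have "min (fps_conv_radius f) (fps_conv_radius (fps_of_poly (?c (reflect_poly p)))) \<le> fps_conv_radius (f * fps_of_poly (?c (reflect_poly p)))"
      by (rule fps_conv_radius_mult)
    then show "0 < fps_conv_radius (f * fps_of_poly (?c (reflect_poly p)))" using rad by (simp add: less_le_trans)
    show "0 < fps_conv_radius (fps_of_poly (?c (reflect_poly q)))" by simp
    have "eval_fps (f * fps_of_poly (?c (reflect_poly p))) x = eval_fps (fps_of_poly (?c (reflect_poly q))) x"
      if x: "ereal (cmod x) < fps_conv_radius f" "cmod x < 1" for x
    proof -
      have e: "eval_fps (f * fps_of_poly (?c (reflect_poly p))) x = eval_fps f x * poly (?c (reflect_poly p)) x"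
        using x by (simp add: eval_fps_mult)
      show ?thesis
      proof (cases "x = 0")
        case True
        \<comment> \<open>At 0 the reflected polynomials take the leading coefficients, which agree
          because the channel is 1 at infinity.\<close>
        have "lead_coeff p = lead_coeff q" using ch unfolding channel_tf_def by blast
        then show ?thesis unfolding e True
          by (simp add: eval_fps_at_0 f_def markov_def poly_0_coeff_0 coeff_map_poly)
      next
        case False
        have a: "1 < cmod (1 / x)" using False x by (simp add: norm_divide divide_simps)
        have ne: "\<not> ceigenvalue F (1 / x)" using st a unfolding stable_mat_def by (metis less_asym)
        have pa: "cpoly p (1 / x) \<noteq> 0" using ch a unfolding channel_tf_def by (metis less_asym)
        have "eval_fps f x = ss_tf F G H 1 (1 / x)" using fs[OF False x(2)] by (simp add: eval_fps_def sums_iff)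
        also have "\<dots> = cpoly q (1 / x) / cpoly p (1 / x)" using re ne pa by (simp add: realizes_def)
        finally have ef: "eval_fps f x = cpoly q (1 / x) / cpoly p (1 / x)" .
        have rp: "poly (?c (reflect_poly p)) x = x ^ degree p * cpoly p (1 / x)" for p
          unfolding refl[symmetric] poly_reflect_poly_nz[OF False] cpoly_def
          by (simp add: inverse_eq_divide degree_map_poly)
        have "degree p = degree q" using ch by (simp add: channel_tf_def)
        then show ?thesis unfolding e ef using pa by (simp add: rp)
      qed
    qed
    moreover have "eventually (\<lambda>x. ereal (cmod x) < fps_conv_radius f \<and> cmod x < 1) (nhds 0)"
    proof -
      have "eventually (\<lambda>x. x \<in> eball 0 (fps_conv_radius f)) (nhds (0 :: complex))"
        using rad by (intro eventually_nhds_in_open) (auto simp: zero_ereal_def)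
      moreover have "eventually (\<lambda>x. x \<in> ball 0 1) (nhds (0 :: complex))"
        by (intro eventually_nhds_in_open) auto
      ultimately show ?thesis by eventually_elim (auto simp: eball_def dist_norm)
    qed
    ultimately show "eventually (\<lambda>x. eval_fps (f * fps_of_poly (?c (reflect_poly p))) x = eval_fps (fps_of_poly (?c (reflect_poly q))) x) (nhds 0)"
      by (auto elim: eventually_mono)
  qed
  then have "complex_of_real (fps_nth (Abs_fps (markov F G H) * fps_of_poly (reflect_poly p)) n) =
     complex_of_real (fps_nth (fps_of_poly (reflect_poly q)) n)" for n
    by (auto simp: fps_eq_iff fps_mult_nth f_def coeff_map_poly dest: spec[of _ n])
  then show ?thesis unfolding of_real_eq_iff by (simp add: fps_eq_iff)
qed

lemma impulse_response_markov:
  assumes ch: "channel_tf p q" and re: "realizes m F G H 1 q p" and st: "stable_mat F"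
  shows "Abs_fps (impulse_response p q) * Abs_fps (markov F G H) = 1"
proof -
  let ?P = "fps_of_poly (reflect_poly p)" and ?Q = "fps_of_poly (reflect_poly q)"
  have q0: "fps_nth ?Q 0 \<noteq> 0" using ch by (simp add: channel_tf_def)
  have "Abs_fps (impulse_response p q) = ?P * inverse ?Q"
    using fps_divide_unit[OF q0, of ?P] by (simp add: impulse_response_def fps_eq_iff)
  then have "Abs_fps (impulse_response p q) * Abs_fps (markov F G H) = inverse ?Q * (Abs_fps (markov F G H) * ?P)"
    by (simp add: mult_ac)
  also have "\<dots> = 1" unfolding markov_fps[OF assms] by (rule inverse_mult_eq_1[OF q0])
  finally show ?thesis .
qed

text \<open>Lower triangular Toeplitz matrices multiply like truncated power series: an entry of the
  product is a Cauchy coefficient.\<close>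

lemma toeplitz_inverse:
  assumes "Abs_fps h * Abs_fps h' = 1"
  shows "mat_inv (toeplitz h T) = toeplitz h' T"
proof (rule mat_inv_unique(2))
  show c: "toeplitz h T \<in> carrier_mat (T + 1) (T + 1)" "toeplitz h' T \<in> carrier_mat (T + 1) (T + 1)"
    by (auto simp: toeplitz_def)
  show "toeplitz h T * toeplitz h' T = 1\<^sub>m (T + 1)"
  proof (rule eq_matI)
    fix i j assume "i < dim_row (1\<^sub>m (T + 1))" "j < dim_col (1\<^sub>m (T + 1))"
    then have ij: "i < T + 1" "j < T + 1" by auto
    have "(toeplitz h T * toeplitz h' T) $$ (i,j) = (\<Sum>l<T + 1. toeplitz h T $$ (i,l) * toeplitz h' T $$ (l,j))"
      by (rule index_mult_mat_sum[OF c ij])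
    also have "\<dots> = (\<Sum>l\<in>{j..i}. h (i - l) * h' (l - j))"
      by (rule sum.mono_neutral_cong_right) (use ij in \<open>auto simp: toeplitz_def\<close>)
    also have "\<dots> = (if j = i then 1 else 0)"
    proof (cases "j \<le> i")
      case True
      have "(\<Sum>l\<in>{j..i}. h (i - l) * h' (l - j)) = (\<Sum>a=0..i - j. h a * h' (i - j - a))"
        by (rule sum.reindex_bij_witness[of _ "\<lambda>a. i - a" "\<lambda>l. i - l"]) (use True in auto)
      also have "\<dots> = fps_nth (Abs_fps h * Abs_fps h') (i - j)" by (simp add: fps_mult_nth)
      finally show ?thesis using True by (simp add: assms)
    qed auto
    finally show "(toeplitz h T * toeplitz h' T) $$ (i,j) = 1\<^sub>m (T + 1) $$ (i,j)" using ij by auto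
  qed (use c in auto)
qed

section \<open>Observation rows and the feedback-free observation\<close>

context coding
begin

definition X :: "nat \<Rightarrow> real mat" where
  "X t = mat m k (\<lambda>(i,j). Phi t $$ (k + i,j))"

text \<open>The blocks without columns turn a stack of two matrices into an instance of
  \<open>four_block_mat\<close>, so that block multiplication applies.\<close>

lemma Phi_blocks: "Phi t = four_block_mat (A ^\<^sub>m t) (0\<^sub>m k 0) (X t) (0\<^sub>m m 0)"
  and X_Suc: "X (Suc t) = G * C * A ^\<^sub>m t + F * X t"
  and X_0: "X 0 = 0\<^sub>m m k"
proof -
  have At: "A ^\<^sub>m t \<in> carrier_mat k k" for t using A by simp
  have GC: "G * C \<in> carrier_mat m k" using G C by auto
  have Xc: "X t \<in> carrier_mat m k" for t by (simp add: X_def)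
  have X_of: "X t = Y" if "Phi t = four_block_mat (A ^\<^sub>m t) (0\<^sub>m k 0) Y (0\<^sub>m m 0)" "Y \<in> carrier_mat m k" for t Y
    unfolding X_def that(1) using that(2) At[of t] by (intro eq_matI) auto
  have "Phi 0 = E" using AA by (simp add: Phi_def)
  also have "E = four_block_mat (A ^\<^sub>m 0) (0\<^sub>m k 0) (0\<^sub>m m k) (0\<^sub>m m 0)"
    by (rule eq_matI) (auto simp: E_def)
  finally have P0: "Phi 0 = four_block_mat (A ^\<^sub>m 0) (0\<^sub>m k 0) (0\<^sub>m m k) (0\<^sub>m m 0)" .
  then show X0: "X 0 = 0\<^sub>m m k" by (intro X_of) auto
  have step: "Phi (Suc t) = four_block_mat (A ^\<^sub>m Suc t) (0\<^sub>m k 0) (G * C * A ^\<^sub>m t + F * X t) (0\<^sub>m m 0)"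
    if "Phi t = four_block_mat (A ^\<^sub>m t) (0\<^sub>m k 0) (X t) (0\<^sub>m m 0)" for t
  proof -
    have AAb: "AA = four_block_mat A (0\<^sub>m k m) (G * C) F" by (simp add: blockA_def)
    have "Phi (Suc t) = AA * Phi t" by (rule Phi_Suc)
    also have "\<dots> = four_block_mat (A * A ^\<^sub>m t + 0\<^sub>m k m * X t) (A * 0\<^sub>m k 0 + 0\<^sub>m k m * 0\<^sub>m m 0)
        (G * C * A ^\<^sub>m t + F * X t) (G * C * 0\<^sub>m k 0 + F * 0\<^sub>m m 0)"
      unfolding that unfolding AAb by (rule mult_four_block_mat[OF A zero_carrier_mat GC F At zero_carrier_mat Xc zero_carrier_mat])
    also have "A * A ^\<^sub>m t + 0\<^sub>m k m * X t = A ^\<^sub>m Suc t"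
      using pow_intertwine[OF A A A refl, of t] left_mult_zero_mat[OF Xc[of t], of k] right_add_zero_mat[OF mult_carrier_mat[OF A At[of t]]] by simp
    also have "A * 0\<^sub>m k 0 + 0\<^sub>m k m * 0\<^sub>m m 0 = 0\<^sub>m k 0" by (rule eq_matI) auto
    also have "G * C * 0\<^sub>m k 0 + F * 0\<^sub>m m 0 = 0\<^sub>m m 0" by (rule eq_matI) auto
    finally show ?thesis .
  qed
  have bl: "Phi t = four_block_mat (A ^\<^sub>m t) (0\<^sub>m k 0) (X t) (0\<^sub>m m 0)" for t
  proof (induction t)
    case 0 show ?case using P0 X0 by simp
  next
    case (Suc t)
    have "G * C * A ^\<^sub>m t + F * X t \<in> carrier_mat m k" using F Xc[of t] by auto
    then have "X (Suc t) = G * C * A ^\<^sub>m t + F * X t" by (rule X_of[OF step[OF Suc]])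
    then show ?case using step[OF Suc] by simp
  qed
  show "Phi t = four_block_mat (A ^\<^sub>m t) (0\<^sub>m k 0) (X t) (0\<^sub>m m 0)" by (rule bl)
  have "G * C * A ^\<^sub>m t + F * X t \<in> carrier_mat m k" using F Xc[of t] by auto
  then show "X (Suc t) = G * C * A ^\<^sub>m t + F * X t" by (rule X_of[OF step[OF bl]])
qed

lemma X_dim [simp]: "dim_row (X t) = m" "dim_col (X t) = k"
  by (simp_all add: X_def)

lemma pow_dims [simp]: "dim_row (A ^\<^sub>m t) = k" "dim_col (A ^\<^sub>m t) = k" "dim_row (F ^\<^sub>m t) = m" "dim_col (F ^\<^sub>m t) = m"
  using pow_mat_dim_square[OF A, of t] pow_mat_dim_square[OF F, of t] by auto

lemma g_blocks: "g t = C * A ^\<^sub>m t + H * X t"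
proof -
  have At: "A ^\<^sub>m t \<in> carrier_mat k k" and Xc: "X t \<in> carrier_mat m k" using A by (simp_all add: X_def)
  have CCb: "CC = four_block_mat C H (0\<^sub>m 0 k) (0\<^sub>m 0 m)" by (simp add: blockC_def)
  have "g t = four_block_mat (C * A ^\<^sub>m t + H * X t) (C * 0\<^sub>m k 0 + H * 0\<^sub>m m 0)
      (0\<^sub>m 0 k * A ^\<^sub>m t + 0\<^sub>m 0 m * X t) (0\<^sub>m 0 k * 0\<^sub>m k 0 + 0\<^sub>m 0 m * 0\<^sub>m m 0)"
    unfolding g_def Phi_blocks unfolding CCb
    by (rule mult_four_block_mat[OF C H zero_carrier_mat zero_carrier_mat At zero_carrier_mat Xc zero_carrier_mat])
  also have "\<dots> = C * A ^\<^sub>m t + H * X t"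
    by (rule eq_matI) (auto simp del: index_mult_mat(1))
  finally show ?thesis .
qed

text \<open>The row \<open>g t\<close> applied to the message is the source output filtered by the
  inverse channel: the direct term comes from \<open>C\<close>, the delayed ones from the channel
  state.\<close>

lemma g_markov:
  assumes w: "w \<in> carrier_mat k 1"
  shows "(g t * w) $$ (0,0) = (\<Sum>s\<le>t. markov F G H (t - s) * (C * A ^\<^sub>m s * w) $$ (0,0))"
proof -
  have wd [simp]: "dim_row w = k" "dim_col w = Suc 0" using w by auto
  define c where "c s = (C * A ^\<^sub>m s * w) $$ (0,0)" for s
  \<comment> \<open>The power \<open>j\<close> is kept general because each step of the recursion
    for \<open>X\<close> moves one factor \<open>F\<close> into it.\<close>
  have HX: "(H * F ^\<^sub>m j * (X t * w)) $$ (0,0) = (\<Sum>s<t. markov F G H (t - s + j) * c s)" for j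
  proof (induction t arbitrary: j)
    case 0
    have "X 0 * w = 0\<^sub>m m 1" unfolding X_0 using w by simp
    then have "H * F ^\<^sub>m j * (X 0 * w) = 0\<^sub>m 1 1" by (simp add: right_mult_zero_mat[of _ 1 m] carrier_matI)
    then show ?case by simp
  next
    case (Suc t)
    have F1: "F ^\<^sub>m Suc j = F ^\<^sub>m j * F" by simp
    have "H * F ^\<^sub>m j * (X (Suc t) * w) = H * F ^\<^sub>m j * G * (C * A ^\<^sub>m t * w) + H * F ^\<^sub>m Suc j * (X t * w)"
      unfolding X_Suc F1 by (simp add: add_mult_distrib_dim mult_add_distrib_dim mult_assoc_dim del: pow_mat.simps)
    moreover have "H * F ^\<^sub>m j * G * (C * A ^\<^sub>m t * w) = c t \<cdot>\<^sub>m (H * F ^\<^sub>m j * G)"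
      unfolding c_def by (rule mult_one_by_one) (rule carrier_matI, simp_all)+
    ultimately have "(H * F ^\<^sub>m j * (X (Suc t) * w)) $$ (0,0) = c t * (H * F ^\<^sub>m j * G) $$ (0,0) + (H * F ^\<^sub>m Suc j * (X t * w)) $$ (0,0)"
      by (simp del: index_mult_mat(1) pow_mat.simps)
    also have "\<dots> = c t * markov F G H (Suc j) + (\<Sum>s<t. markov F G H (t - s + Suc j) * c s)"
      unfolding Suc markov_def by simp
    also have "(\<Sum>s<t. markov F G H (t - s + Suc j) * c s) = (\<Sum>s<t. markov F G H (Suc t - s + j) * c s)"
      by (rule sum.cong) (auto simp: Suc_diff_le)
    finally show ?case by simp
  qed
  have "(g t * w) $$ (0,0) = c t + (H * F ^\<^sub>m 0 * (X t * w)) $$ (0,0)"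
    using F H by (simp add: g_blocks c_def add_mult_distrib_dim mult_assoc_dim del: index_mult_mat(1))
  also have "\<dots> = c t + (\<Sum>s<t. markov F G H (t - s) * c s)" unfolding HX by simp
  also have "\<dots> = (\<Sum>s\<le>t. markov F G H (t - s) * c s)"
    by (simp add: lessThan_Suc_atMost[symmetric] markov_def)
  finally show ?thesis by (simp add: c_def)
qed

text \<open>Inverting the Toeplitz matrix amounts to filtering with the Markov parameters, so the
  feedback-free observation is the one of the least squares problem with the same rows.\<close>

lemma est_obs_eq:
  assumes ch: "channel_tf p q" and re: "realizes m F G H 1 q p" and t: "t \<le> T" and kn: "k = n + 1"
  shows "est_obs (impulse_response p q) A C n W N T t \<omega> = (\<Sum>i\<le>n. g t $$ (0,i) * W i \<omega>) + N t \<omega>"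
proof -
  define v where "v = vec (n + 1) (\<lambda>j. W j \<omega>)"
  define w where "w = mat k 1 (\<lambda>(i,j). W i \<omega>)"
  have v: "v \<in> carrier_vec k" by (simp add: v_def kn)
  have w: "w \<in> carrier_mat k 1" by (simp add: w_def)
  define r where "r = vec (T + 1) (\<lambda>i. (C *\<^sub>v (A ^\<^sub>m i *\<^sub>v v)) $ 0)"
  have r: "r \<in> carrier_vec (T + 1)" by (simp add: r_def)
  have rs: "(C *\<^sub>v (A ^\<^sub>m s *\<^sub>v v)) $ 0 = (C * A ^\<^sub>m s * w) $$ (0,0)" for s
  proof -
    have As: "A ^\<^sub>m s \<in> carrier_mat k k" using A by simp
    have CA: "C * A ^\<^sub>m s \<in> carrier_mat 1 k" using C As by auto
    have "(C *\<^sub>v (A ^\<^sub>m s *\<^sub>v v)) $ 0 = (C * A ^\<^sub>m s *\<^sub>v v) $ 0"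
      using assoc_mult_mat_vec[OF C As v] by simp
    also have "\<dots> = (\<Sum>i<k. (C * A ^\<^sub>m s) $$ (0,i) * v $ i)" by (rule index_mult_vec_sum[OF CA v]) simp
    also have "\<dots> = (C * A ^\<^sub>m s * w) $$ (0,0)"
      by (subst index_mult_mat_sum[OF CA w]) (auto simp: v_def w_def kn simp del: index_mult_mat(1) intro!: sum.cong)
    finally show ?thesis .
  qed
  have tT: "t < T + 1" using t by simp
  have tc: "toeplitz (markov F G H) T \<in> carrier_mat (T + 1) (T + 1)" by (simp add: toeplitz_def)
  have "est_obs (impulse_response p q) A C n W N T t \<omega> = (toeplitz (markov F G H) T *\<^sub>v r) $ t + N t \<omega>"
    unfolding est_obs_def Let_def v_def[symmetric] r_def[symmetric]
      toeplitz_inverse[OF impulse_response_markov[OF ch re F_stable]] ..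
  also have "(toeplitz (markov F G H) T *\<^sub>v r) $ t = (\<Sum>s<T + 1. toeplitz (markov F G H) T $$ (t,s) * r $ s)"
    by (rule index_mult_vec_sum[OF tc r tT])
  also have "\<dots> = (\<Sum>s\<le>t. markov F G H (t - s) * (C * A ^\<^sub>m s * w) $$ (0,0))"
    by (rule sum.mono_neutral_cong_right) (use t in \<open>auto simp: toeplitz_def r_def rs simp del: index_mult_mat(1) index_mult_mat_vec\<close>)
  also have "\<dots> = (g t * w) $$ (0,0)" by (rule g_markov[OF w, symmetric])
  also have "\<dots> = (\<Sum>i<k. g t $$ (0,i) * w $$ (i,0))" by (rule index_mult_mat_sum[OF g w]) simp_all
  also have "\<dots> = (\<Sum>i\<le>n. g t $$ (0,i) * W i \<omega>)"
    by (rule sum.cong) (auto simp: kn w_def)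
  finally show ?thesis .
qed

end

section \<open>Signals\<close>

lemma smult_smult_mat: "a \<cdot>\<^sub>m (b \<cdot>\<^sub>m M) = (a * b) \<cdot>\<^sub>m (M :: real mat)"
  by (rule eq_matI) auto

context coding
begin

lemma EE: "four_block_mat (1\<^sub>m k) (0\<^sub>m k m) (0\<^sub>m m k) (0\<^sub>m m m) = E * E\<^sup>T"
proof (rule eq_matI)
  fix i j assume "i < dim_row (E * E\<^sup>T)" "j < dim_col (E * E\<^sup>T)"
  then have ij: "i < k + m" "j < k + m" by auto
  have Ec: "E \<in> carrier_mat (k + m) k" "E\<^sup>T \<in> carrier_mat k (k + m)" by (rule carrier_matI, simp_all)+
  have "(E * E\<^sup>T) $$ (i,j) = (\<Sum>a<k. E $$ (i,a) * E\<^sup>T $$ (a,j))" by (rule index_mult_mat_sum[OF Ec ij])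
  also have "\<dots> = (\<Sum>a<k. if a = i then E $$ (j,a) else 0)"
    by (rule sum.cong) (use ij in \<open>auto simp: E_def\<close>)
  also have "\<dots> = (if i < k then E $$ (j,i) else 0)" by (simp add: sum.delta)
  finally show "four_block_mat (1\<^sub>m k) (0\<^sub>m k m) (0\<^sub>m m k) (0\<^sub>m m m) $$ (i,j) = (E * E\<^sup>T) $$ (i,j)"
    using ij by (auto simp: E_def)
qed auto

text \<open>The feedback gain is the least squares gain transported by \<open>Phi\<close>, which
  ties the coding structure to the recursion for \<open>err\<close>.\<close>

lemma gain_t_eq: "gain_t F G H A C t = (1 / K t) \<cdot>\<^sub>m (Phi (Suc t) * (Ji t * (g t)\<^sup>T))"
  unfolding gain_t_def Let_def dims EE kalman_gain_def innov_var_riccati_seq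
  unfolding riccati_seq_closed_form Phi_Suc
  by (simp add: g_def mult_assoc_dim transpose_mult_dim)

lemma AA_dims: "dim_row AA = k + m" "dim_col AA = k + m"
  using AA by auto

lemma AA_mult_entry:
  assumes z: "z \<in> carrier_mat (k + m) 1"
  shows "i < k \<Longrightarrow> (AA * z) $$ (i,0) = (\<Sum>j<k. A $$ (i,j) * z $$ (j,0))"
    and "i < m \<Longrightarrow> (AA * z) $$ (k + i,0) = G $$ (i,0) * (\<Sum>j<k. C $$ (0,j) * z $$ (j,0)) + (\<Sum>j<m. F $$ (i,j) * z $$ (k + j,0))"
proof -
  assume i: "i < k"
  have "(AA * z) $$ (i,0) = (\<Sum>j<k + m. AA $$ (i,j) * z $$ (j,0))"
    by (rule index_mult_mat_sum[OF AA z]) (use i in auto)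
  also have "\<dots> = (\<Sum>j<k. A $$ (i,j) * z $$ (j,0))"
    unfolding sum_lessThan_add using i by (simp add: blockA_def)
  finally show "(AA * z) $$ (i,0) = (\<Sum>j<k. A $$ (i,j) * z $$ (j,0))" .
next
  assume i: "i < m"
  have "(AA * z) $$ (k + i,0) = (\<Sum>j<k + m. AA $$ (k + i,j) * z $$ (j,0))"
    by (rule index_mult_mat_sum[OF AA z]) (use i in auto)
  also have "\<dots> = (\<Sum>j<k. G $$ (i,0) * C $$ (0,j) * z $$ (j,0)) + (\<Sum>j<m. F $$ (i,j) * z $$ (k + j,0))"
    unfolding sum_lessThan_add using i by (simp add: blockA_def scalar_prod_def)
  finally show "(AA * z) $$ (k + i,0) = G $$ (i,0) * (\<Sum>j<k. C $$ (0,j) * z $$ (j,0)) + (\<Sum>j<m. F $$ (i,j) * z $$ (k + j,0))"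
    by (simp add: sum_distrib_left mult.assoc)
qed

lemma CC_mult_entry:
  assumes z: "z \<in> carrier_mat (k + m) 1"
  shows "(CC * z) $$ (0,0) = (\<Sum>j<k. C $$ (0,j) * z $$ (j,0)) + (\<Sum>j<m. H $$ (0,j) * z $$ (k + j,0))"
proof -
  have "(CC * z) $$ (0,0) = (\<Sum>j<k + m. CC $$ (0,j) * z $$ (j,0))"
    by (rule index_mult_mat_sum[OF CC z]) auto
  then show ?thesis unfolding sum_lessThan_add by (simp add: blockC_def)
qed

definition DD :: "real mat" where "DD = blockD H C"

lemma DD_dims [simp]: "dim_row DD = Suc 0" "dim_col DD = k + m"
  by (simp_all add: DD_def blockD_def blockC_def)

lemma DD_mult_entry:
  assumes z: "z \<in> carrier_mat (k + m) 1"
  shows "(DD * z) $$ (0,0) = (\<Sum>j<k. C $$ (0,j) * z $$ (j,0))"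
proof -
  have "(DD * z) $$ (0,0) = (\<Sum>j<k + m. DD $$ (0,j) * z $$ (j,0))"
    by (rule index_mult_mat_sum[OF _ z]) (auto intro: carrier_matI)
  then show ?thesis unfolding sum_lessThan_add by (simp add: DD_def blockD_def blockC_def)
qed

context
  fixes wv v :: "nat \<Rightarrow> real"
begin

definition wcol :: "real mat" where "wcol = mat k 1 (\<lambda>(i,j). wv i)"

lemma wcol: "wcol \<in> carrier_mat k 1"
  by (simp add: wcol_def)

text \<open>The estimation error of the joint state, with source part \<open>x - xh\<close> and
  channel part \<open>s - sh\<close>; this is verified in \<open>cstate_at_eq\<close>.\<close>

definition Xt :: "nat \<Rightarrow> real mat" where "Xt t = Phi t * err wcol v t"

lemma Xt: "Xt t \<in> carrier_mat (k + m) 1"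
  unfolding Xt_def by (rule carrier_matI) (simp_all add: err_dim[OF wcol])

lemma Xt_Suc: "Xt (Suc t) = AA * Xt t - innov wcol v t \<cdot>\<^sub>m gain_t F G H A C t"
proof -
  note ed = err_dim[OF wcol]
  have "Xt (Suc t) = Phi (Suc t) * err wcol v t - (innov wcol v t / K t) \<cdot>\<^sub>m (Phi (Suc t) * (Ji t * (g t)\<^sup>T))"
    unfolding Xt_def err_Suc[OF wcol] using ed by (simp add: mult_minus_distrib_dim mult_smult_dim)
  also have "Phi (Suc t) * err wcol v t = AA * Xt t"
    unfolding Xt_def Phi_Suc using ed by (simp add: mult_assoc_dim)
  finally show ?thesis unfolding gain_t_eq by (simp add: smult_smult_mat)
qed

text \<open>Plant and observer differ only by the innovation term, so their difference obeys
  \<open>Xt_Suc\<close> and starts at the embedded message.\<close>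

lemma cstate_at_eq:
  obtains x s xh sh where "cstate_at F G H A C wv v t = (x, s, xh, sh)"
    "x \<in> carrier_vec k" "s \<in> carrier_vec m" "xh \<in> carrier_vec k" "sh \<in> carrier_vec m"
    "\<And>i. i < k \<Longrightarrow> x $ i - xh $ i = Xt t $$ (i,0)" "\<And>i. i < m \<Longrightarrow> s $ i - sh $ i = Xt t $$ (k + i,0)"
    "sig_u C (x, s, xh, sh) = (DD * Xt t) $$ (0,0)" "sig_e H C (x, s, xh, sh) (v t) = innov wcol v t"
    "\<And>r. sig_y H C (x, s, xh, sh) r = sig_e H C (x, s, xh, sh) r + (H *\<^sub>v sh) $ 0"
proof -
  have sig: "sig_u C (x, s, xh, sh) = (DD * Xt t) $$ (0,0) \<and> sig_e H C (x, s, xh, sh) (v t) = innov wcol v t"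
    if c: "x \<in> carrier_vec k" "s \<in> carrier_vec m" "xh \<in> carrier_vec k" "sh \<in> carrier_vec m"
    and e: "\<And>i. i < k \<Longrightarrow> x $ i - xh $ i = Xt t $$ (i,0)" "\<And>i. i < m \<Longrightarrow> s $ i - sh $ i = Xt t $$ (k + i,0)"
    for x s xh sh t
  proof -
    have u: "sig_u C (x, s, xh, sh) = (\<Sum>j<k. C $$ (0,j) * Xt t $$ (j,0))"
      using index_mult_vec_sum[OF C c(1), of 0] index_mult_vec_sum[OF C c(3), of 0]
      by (simp add: e(1)[symmetric] right_diff_distrib sum_subtractf del: index_mult_mat_vec)
    have h: "(H *\<^sub>v s) $ 0 - (H *\<^sub>v sh) $ 0 = (\<Sum>j<m. H $$ (0,j) * Xt t $$ (k + j,0))"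
      using index_mult_vec_sum[OF H c(2), of 0] index_mult_vec_sum[OF H c(4), of 0]
      by (simp add: e(2)[symmetric] right_diff_distrib sum_subtractf del: index_mult_mat_vec)
    have "innov wcol v t = (CC * Xt t) $$ (0,0) + v t"
    proof -
      have "g t * err wcol v t = CC * Phi t * err wcol v t" by (subst g_def) (rule refl)
      also have "\<dots> = CC * Xt t" unfolding Xt_def by (rule mult_assoc_dim) (simp_all add: err_dim[OF wcol])
      finally show ?thesis unfolding innov_def by (simp only:)
    qed
    then have "sig_e H C (x, s, xh, sh) (v t) = innov wcol v t"
      using u h unfolding CC_mult_entry[OF Xt] by (simp del: index_mult_mat_vec sig_u.simps)
    then show ?thesis using u DD_mult_entry[OF Xt] by simp
  qed
  have "\<exists>x s xh sh. cstate_at F G H A C wv v t = (x, s, xh, sh) \<and>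
    x \<in> carrier_vec k \<and> s \<in> carrier_vec m \<and> xh \<in> carrier_vec k \<and> sh \<in> carrier_vec m \<and>
    (\<forall>i<k. x $ i - xh $ i = Xt t $$ (i,0)) \<and> (\<forall>i<m. s $ i - sh $ i = Xt t $$ (k + i,0))"
  proof (induction t)
    case 0
    have P0: "Phi 0 = E" using AA by (simp add: Phi_def)
    have Ec: "E \<in> carrier_mat (k + m) k" by (rule carrier_matI) simp_all
    have X0: "Xt 0 $$ (i,0) = (if i < k then wv i else 0)" if "i < k + m" for i
    proof -
      have "Xt 0 $$ (i,0) = (\<Sum>a<k. E $$ (i,a) * wcol $$ (a,0))"
        unfolding Xt_def P0 err_0[OF wcol] by (rule index_mult_mat_sum[OF Ec wcol that]) simp
      also have "\<dots> = (\<Sum>a<k. if a = i then wv a else 0)"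
        by (rule sum.cong) (use that in \<open>auto simp: E_def wcol_def\<close>)
      finally show ?thesis by (simp add: sum.delta)
    qed
    show ?case
      by (rule exI[of _ "vec k wv"], rule exI[of _ "0\<^sub>v m"], rule exI[of _ "0\<^sub>v k"], rule exI[of _ "0\<^sub>v m"]) (simp add: X0)
  next
    case (Suc t)
    then obtain x s xh sh where st: "cstate_at F G H A C wv v t = (x, s, xh, sh)"
      and c: "x \<in> carrier_vec k" "s \<in> carrier_vec m" "xh \<in> carrier_vec k" "sh \<in> carrier_vec m"
      and e: "\<And>i. i < k \<Longrightarrow> x $ i - xh $ i = Xt t $$ (i,0)" "\<And>i. i < m \<Longrightarrow> s $ i - sh $ i = Xt t $$ (k + i,0)" by blast
    define u where "u = sig_u C (x, s, xh, sh)"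
    define ee where "ee = sig_e H C (x, s, xh, sh) (v t)"
    have u: "u = (\<Sum>j<k. C $$ (0,j) * Xt t $$ (j,0))" and ee: "ee = innov wcol v t"
      using sig[OF c e] DD_mult_entry[OF Xt] by (simp_all add: u_def ee_def)
    have nx: "cstate_at F G H A C wv v (Suc t) = (A *\<^sub>v x, F *\<^sub>v s + u \<cdot>\<^sub>v col G 0,
        A *\<^sub>v xh + ee \<cdot>\<^sub>v gain1 F G H A C t, F *\<^sub>v sh + ee \<cdot>\<^sub>v gain2 F G H A C t)"
      unfolding cstate_at.simps st by (simp add: Let_def u_def ee_def del: sig_u.simps sig_e.simps)
    have gd: "dim_row (gain_t F G H A C t) = k + m" "dim_col (gain_t F G H A C t) = Suc 0"
      by (simp_all add: gain_t_eq)
    have Xs: "Xt (Suc t) $$ (i,0) = (AA * Xt t) $$ (i,0) - ee * gain_t F G H A C t $$ (i,0)" if "i < k + m" for i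
      unfolding Xt_Suc ee using that gd Xt[of t] by (simp add: AA_dims del: index_mult_mat(1))
    have 1: "(A *\<^sub>v x) $ i - (A *\<^sub>v xh + ee \<cdot>\<^sub>v gain1 F G H A C t) $ i = Xt (Suc t) $$ (i,0)" if i: "i < k" for i
    proof -
      have "(A *\<^sub>v x) $ i - (A *\<^sub>v xh) $ i = (\<Sum>j<k. A $$ (i,j) * Xt t $$ (j,0))"
        unfolding index_mult_vec_sum[OF A c(1) i] index_mult_vec_sum[OF A c(3) i]
        by (simp add: e(1)[symmetric] right_diff_distrib sum_subtractf)
      then show ?thesis using i Xs[of i] AA_mult_entry(1)[OF Xt i] by (simp add: gain1_def del: index_mult_mat_vec)
    qed
    have 2: "(F *\<^sub>v s + u \<cdot>\<^sub>v col G 0) $ i - (F *\<^sub>v sh + ee \<cdot>\<^sub>v gain2 F G H A C t) $ i = Xt (Suc t) $$ (k + i,0)" if i: "i < m" for i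
    proof -
      have "(F *\<^sub>v s) $ i - (F *\<^sub>v sh) $ i = (\<Sum>j<m. F $$ (i,j) * Xt t $$ (k + j,0))"
        unfolding index_mult_vec_sum[OF F c(2) i] index_mult_vec_sum[OF F c(4) i]
        by (simp add: e(2)[symmetric] right_diff_distrib sum_subtractf)
      then show ?thesis using i Xs[of "k + i"] AA_mult_entry(2)[OF Xt i] u by (simp add: gain2_def del: index_mult_mat_vec)
    qed
    show ?case unfolding nx using 1 2
      by (intro exI conjI) (rule refl | (rule carrier_vecI, simp add: gain1_def gain2_def) | blast)+
  qed
  then obtain x s xh sh where st: "cstate_at F G H A C wv v t = (x, s, xh, sh)"
      and c: "x \<in> carrier_vec k" "s \<in> carrier_vec m" "xh \<in> carrier_vec k" "sh \<in> carrier_vec m"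
      and e: "\<And>i. i < k \<Longrightarrow> x $ i - xh $ i = Xt t $$ (i,0)" "\<And>i. i < m \<Longrightarrow> s $ i - sh $ i = Xt t $$ (k + i,0)" by blast
  show thesis using that[OF st c e] sig[OF c e] by simp
qed

lemma sig_u_eq: "sig_u C (cstate_at F G H A C wv v t) = (DD * Xt t) $$ (0,0)"
  and sig_e_eq: "sig_e H C (cstate_at F G H A C wv v t) (v t) = innov wcol v t"
  by (rule cstate_at_eq[of t], simp)+

definition shat :: "nat \<Rightarrow> real vec" where "shat t = snd (snd (snd (cstate_at F G H A C wv v t)))"

lemma shat: "shat t \<in> carrier_vec m" "shat 0 = 0\<^sub>v m"
    "shat (Suc t) = F *\<^sub>v shat t + innov wcol v t \<cdot>\<^sub>v gain2 F G H A C t"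
    "sig_y H C (cstate_at F G H A C wv v t) (v t) = innov wcol v t + (H *\<^sub>v shat t) $ 0"
proof -
  show "shat t \<in> carrier_vec m" by (rule cstate_at_eq[of t]) (simp add: shat_def)
  show "shat 0 = 0\<^sub>v m" by (simp add: shat_def)
  obtain x s xh sh where *: "cstate_at F G H A C wv v t = (x, s, xh, sh)" "sig_e H C (x, s, xh, sh) (v t) = innov wcol v t"
    "\<And>r. sig_y H C (x, s, xh, sh) r = sig_e H C (x, s, xh, sh) r + (H *\<^sub>v sh) $ 0"
    using cstate_at_eq[of t] by metis
  show "sig_y H C (cstate_at F G H A C wv v t) (v t) = innov wcol v t + (H *\<^sub>v shat t) $ 0"
    unfolding shat_def *(1) *(3) *(2) by simp
  show "shat (Suc t) = F *\<^sub>v shat t + innov wcol v t \<cdot>\<^sub>v gain2 F G H A C t"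
    unfolding shat_def cstate_at.simps *(1) cstep.simps Let_def *(2) by simp
qed

end

text \<open>Variation of constants: the weight with which an earlier innovation reaches the
  predicted channel output through \<open>sh\<close>.\<close>

definition kap :: "nat \<Rightarrow> nat \<Rightarrow> real" where
  "kap t s = (H *\<^sub>v (F ^\<^sub>m (t - Suc s) *\<^sub>v gain2 F G H A C s)) $ 0"

text \<open>The estimate \<open>sh\<close> is driven by innovations alone, so the output is a unit
  lower triangular function of them and carries the same information about the message.\<close>

lemma sig_y_eq:
  "sig_y H C (cstate_at F G H A C wv v t) (v t) = innov (wcol wv) v t + (\<Sum>s<t. kap t s * innov (wcol wv) v s)"
proof -
  let ?e = "innov (wcol wv) v" and ?g = "gain2 F G H A C"
  have gc: "?g s \<in> carrier_vec m" for s by (simp add: gain2_def carrier_vecI)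
  have Fc: "F ^\<^sub>m j \<in> carrier_mat m m" for j using F by simp
  have Fg: "F ^\<^sub>m j *\<^sub>v ?g s \<in> carrier_vec m" for j s by (rule mult_mat_vec_carrier[OF Fc gc])
  \<comment> \<open>Generalized over the power \<open>j\<close>, which absorbs the factor
    \<open>F\<close> of each step.\<close>
  have sh: "(H *\<^sub>v (F ^\<^sub>m j *\<^sub>v shat wv v t)) $ 0 = (\<Sum>s<t. (H *\<^sub>v (F ^\<^sub>m (j + (t - Suc s)) *\<^sub>v ?g s)) $ 0 * ?e s)" for j
  proof (induction t arbitrary: j)
    case 0
    have "F ^\<^sub>m j *\<^sub>v shat wv v 0 = 0\<^sub>v m" unfolding shat(2) by (rule mult_mat_vec_zero[OF Fc])
    then have "H *\<^sub>v (F ^\<^sub>m j *\<^sub>v shat wv v 0) = 0\<^sub>v 1" using mult_mat_vec_zero[OF H] by simp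
    then show ?case by (simp del: index_mult_mat_vec)
  next
    case (Suc t)
    have c1: "F *\<^sub>v shat wv v t \<in> carrier_vec m" by (rule mult_mat_vec_carrier[OF F shat(1)])
    have "F ^\<^sub>m j *\<^sub>v shat wv v (Suc t) = F ^\<^sub>m j *\<^sub>v (F *\<^sub>v shat wv v t) + F ^\<^sub>m j *\<^sub>v (?e t \<cdot>\<^sub>v ?g t)"
      unfolding shat(3) by (rule mult_add_distrib_mat_vec[OF Fc c1]) (use gc in simp)
    also have "F ^\<^sub>m j *\<^sub>v (F *\<^sub>v shat wv v t) = F ^\<^sub>m Suc j *\<^sub>v shat wv v t"
      using assoc_mult_mat_vec[OF Fc F shat(1)] by simp
    also have "F ^\<^sub>m j *\<^sub>v (?e t \<cdot>\<^sub>v ?g t) = ?e t \<cdot>\<^sub>v (F ^\<^sub>m j *\<^sub>v ?g t)" by (rule mult_mat_vec[OF Fc gc])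
    finally have 1: "F ^\<^sub>m j *\<^sub>v shat wv v (Suc t) = F ^\<^sub>m Suc j *\<^sub>v shat wv v t + ?e t \<cdot>\<^sub>v (F ^\<^sub>m j *\<^sub>v ?g t)" .
    have "H *\<^sub>v (F ^\<^sub>m j *\<^sub>v shat wv v (Suc t)) = H *\<^sub>v (F ^\<^sub>m Suc j *\<^sub>v shat wv v t) + H *\<^sub>v (?e t \<cdot>\<^sub>v (F ^\<^sub>m j *\<^sub>v ?g t))"
      unfolding 1 by (rule mult_add_distrib_mat_vec[OF H mult_mat_vec_carrier[OF Fc shat(1)]]) (use Fg in simp)
    also have "H *\<^sub>v (?e t \<cdot>\<^sub>v (F ^\<^sub>m j *\<^sub>v ?g t)) = ?e t \<cdot>\<^sub>v (H *\<^sub>v (F ^\<^sub>m j *\<^sub>v ?g t))" by (rule mult_mat_vec[OF H Fg])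
    finally have "(H *\<^sub>v (F ^\<^sub>m j *\<^sub>v shat wv v (Suc t))) $ 0 =
       (H *\<^sub>v (F ^\<^sub>m Suc j *\<^sub>v shat wv v t)) $ 0 + ?e t * (H *\<^sub>v (F ^\<^sub>m j *\<^sub>v ?g t)) $ 0"
      by (simp del: index_mult_mat_vec pow_mat.simps)
    also have "\<dots> = (\<Sum>s<t. (H *\<^sub>v (F ^\<^sub>m (Suc j + (t - Suc s)) *\<^sub>v ?g s)) $ 0 * ?e s) + ?e t * (H *\<^sub>v (F ^\<^sub>m j *\<^sub>v ?g t)) $ 0"
      unfolding Suc ..
    also have "(\<Sum>s<t. (H *\<^sub>v (F ^\<^sub>m (Suc j + (t - Suc s)) *\<^sub>v ?g s)) $ 0 * ?e s) = (\<Sum>s<t. (H *\<^sub>v (F ^\<^sub>m (j + (Suc t - Suc s)) *\<^sub>v ?g s)) $ 0 * ?e s)"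
    proof (rule sum.cong)
      fix s assume "s \<in> {..<t}"
      then have "Suc j + (t - Suc s) = j + (Suc t - Suc s)" by auto
      then show "(H *\<^sub>v (F ^\<^sub>m (Suc j + (t - Suc s)) *\<^sub>v ?g s)) $ 0 * ?e s = (H *\<^sub>v (F ^\<^sub>m (j + (Suc t - Suc s)) *\<^sub>v ?g s)) $ 0 * ?e s" by (simp only:)
    qed simp
    finally show ?case by (simp del: index_mult_mat_vec add: mult.commute)
  qed
  have "(H *\<^sub>v shat wv v t) $ 0 = (H *\<^sub>v (F ^\<^sub>m 0 *\<^sub>v shat wv v t)) $ 0" using shat(1)[of wv v t] F by simp
  also have "\<dots> = (\<Sum>s<t. kap t s * ?e s)" unfolding sh kap_def by simp
  finally show ?thesis unfolding shat(4) by simp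
qed

end

section \<open>Triangular changes of variables\<close>

abbreviation lb :: "nat set \<Rightarrow> (nat \<Rightarrow> real) measure" where "lb I \<equiv> Pi\<^sub>M I (\<lambda>_. lborel)"

interpretation lbp: product_sigma_finite "\<lambda>_::nat. lborel :: real measure"
  by unfold_locales

text \<open>All passages between noise, innovations, outputs and estimation errors are maps of this
  form.\<close>

definition tri :: "(nat \<Rightarrow> nat \<Rightarrow> real) \<Rightarrow> nat set \<Rightarrow> (nat \<Rightarrow> real) \<Rightarrow> (nat \<Rightarrow> real) \<Rightarrow> nat \<Rightarrow> real" where
  "tri \<kappa> I b v = (\<lambda>t\<in>I. v t + (\<Sum>s<t. \<kappa> t s * v s) + b t)"

fun tri_inv :: "(nat \<Rightarrow> nat \<Rightarrow> real) \<Rightarrow> (nat \<Rightarrow> real) \<Rightarrow> (nat \<Rightarrow> real) \<Rightarrow> nat \<Rightarrow> real" where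
  "tri_inv \<kappa> b z t = z t - (\<Sum>s<t. \<kappa> t s * tri_inv \<kappa> b z s) - b t"
declare tri_inv.simps [simp del]

lemma tri_inv_tri: "t \<le> T \<Longrightarrow> tri_inv \<kappa> b (tri \<kappa> {..T} b v) t = v t"
proof (induction t rule: less_induct)
  case (less t)
  have "(\<Sum>s<t. \<kappa> t s * tri_inv \<kappa> b (tri \<kappa> {..T} b v) s) = (\<Sum>s<t. \<kappa> t s * v s)"
    by (rule sum.cong) (use less in auto)
  then show ?case using less.prems by (subst tri_inv.simps) (simp add: tri_def)
qed

lemma tri_tri_inv: "t \<le> T \<Longrightarrow> tri \<kappa> {..T} b (tri_inv \<kappa> b z) t = z t"
  using tri_inv.simps[of \<kappa> b z t] by (simp add: tri_def)

lemma component_measurable [measurable]: "t \<in> I \<Longrightarrow> (\<lambda>v. v t) \<in> borel_measurable (lb I)"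
  using measurable_component_singleton[of t I "\<lambda>_. lborel :: real measure"] by simp

lemma measurable_restrict_lborel:
  "(\<And>t. t \<in> I \<Longrightarrow> (\<lambda>x. f x t) \<in> borel_measurable M) \<Longrightarrow> (\<lambda>x. \<lambda>t\<in>I. f x t) \<in> measurable M (lb I)"
  by (rule measurable_restrict) simp

lemma tri_measurable:
  assumes "\<And>t. t \<le> T \<Longrightarrow> (\<lambda>x. b x t) \<in> borel_measurable M"
  shows "(\<lambda>(x, v). tri \<kappa> {..T} (b x) v) \<in> measurable (M \<Otimes>\<^sub>M lb {..T}) (lb {..T})"
  unfolding tri_def case_prod_beta
proof (rule measurable_restrict_lborel)
  fix t assume "t \<in> {..T}"
  then have t: "t \<le> T" by simp
  have c: "(\<lambda>x. snd x s) \<in> borel_measurable (M \<Otimes>\<^sub>M lb {..T})" if "s \<le> T" for s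
    by (rule measurable_compose[OF measurable_snd component_measurable]) (use that in auto)
  have bm: "(\<lambda>x. b (fst x) t) \<in> borel_measurable (M \<Otimes>\<^sub>M lb {..T})"
    by (rule measurable_compose[OF measurable_fst assms[OF t]])
  show "(\<lambda>x. snd x t + (\<Sum>s<t. \<kappa> t s * snd x s) + b (fst x) t) \<in> borel_measurable (M \<Otimes>\<^sub>M lb {..T})"
    by (intro borel_measurable_add borel_measurable_sum borel_measurable_times borel_measurable_const c bm) (use t in auto)
qed

lemma tri_inv_measurable:
  assumes "\<And>t. t \<le> T \<Longrightarrow> (\<lambda>x. b x t) \<in> borel_measurable M"
  shows "(\<lambda>(x, v). \<lambda>t\<in>{..T}. tri_inv \<kappa> (b x) v t) \<in> measurable (M \<Otimes>\<^sub>M lb {..T}) (lb {..T})"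
  unfolding case_prod_beta
proof (rule measurable_restrict_lborel)
  have "(\<lambda>x. tri_inv \<kappa> (b (fst x)) (snd x) t) \<in> borel_measurable (M \<Otimes>\<^sub>M lb {..T})" if "t \<le> T" for t
    using that
  proof (induction t rule: less_induct)
    case (less t)
    have c: "(\<lambda>x. snd x t) \<in> borel_measurable (M \<Otimes>\<^sub>M lb {..T})"
      by (rule measurable_compose[OF measurable_snd component_measurable]) (use less in auto)
    have bm: "(\<lambda>x. b (fst x) t) \<in> borel_measurable (M \<Otimes>\<^sub>M lb {..T})"
      by (rule measurable_compose[OF measurable_fst assms[OF less.prems]])
    show ?case unfolding tri_inv.simps[of _ _ _ t]
      by (intro borel_measurable_diff borel_measurable_sum borel_measurable_times borel_measurable_const c bm less.IH)
         (use less in auto)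
  qed
  then show "t \<in> {..T} \<Longrightarrow> (\<lambda>x. tri_inv \<kappa> (b (fst x)) (snd x) t) \<in> borel_measurable (M \<Otimes>\<^sub>M lb {..T})" for t by simp
qed

lemma nn_integral_shift: "f \<in> borel_measurable borel \<Longrightarrow> (\<integral>\<^sup>+y. f (y + c) \<partial>lborel) = (\<integral>\<^sup>+y. f y \<partial>(lborel :: real measure))"
  using nn_integral_real_affine[of f 1 c] by (simp add: add.commute)

lemma tri_measurable1: "tri \<kappa> {..<n} b \<in> measurable (lb {..<n}) (lb {..<n})"
proof -
  have "(\<lambda>v. \<lambda>t\<in>{..<n}. v t + (\<Sum>s<t. \<kappa> t s * v s) + b t) \<in> measurable (lb {..<n}) (lb {..<n})"
  proof (rule measurable_restrict_lborel)
    fix t assume "t \<in> {..<n}"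
    then show "(\<lambda>v. v t + (\<Sum>s<t. \<kappa> t s * v s) + b t) \<in> borel_measurable (lb {..<n})"
      by (intro borel_measurable_add borel_measurable_sum borel_measurable_times borel_measurable_const component_measurable) auto
  qed
  then show ?thesis unfolding tri_def .
qed

text \<open>The Jacobian is 1: given the earlier coordinates the last one is merely translated, so
  it is integrated first and the induction handles the others.\<close>

lemma nn_integral_tri_lessThan:
  assumes "f \<in> borel_measurable (lb {..<n})"
  shows "(\<integral>\<^sup>+v. f (tri \<kappa> {..<n} b v) \<partial>lb {..<n}) = (\<integral>\<^sup>+v. f v \<partial>lb {..<n})"
  using assms
proof (induction n arbitrary: f)
  case 0
  have "(\<integral>\<^sup>+v. f (tri \<kappa> {} b v) \<partial>lb {}) = (\<integral>\<^sup>+v. f v \<partial>lb {})"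
    by (rule nn_integral_cong) (auto simp: space_PiM tri_def restrict_def)
  then show ?case by simp
next
  case (Suc n)
  have I: "{..<Suc n} = insert n {..<n}" by auto
  have f: "f \<in> borel_measurable (lb (insert n {..<n}))" using Suc.prems unfolding I .
  have ft: "(\<lambda>v. f (tri \<kappa> {..<Suc n} b v)) \<in> borel_measurable (lb (insert n {..<n}))"
    using measurable_compose[OF tri_measurable1 Suc.prems] unfolding I .
  have fu: "(\<lambda>y. f (x(n := y))) \<in> borel_measurable borel" if "x \<in> space (lb {..<n})" for x
    using measurable_compose[OF measurable_Pair1'[OF that, of lborel] measurable_compose[OF measurable_add_dim f]] by simp
  have fi: "(\<lambda>x. \<integral>\<^sup>+y. f (x(n := y)) \<partial>lborel) \<in> borel_measurable (lb {..<n})"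
    by (rule sigma_finite_measure.borel_measurable_nn_integral[OF lborel.sigma_finite_measure_axioms])
       (use measurable_compose[OF measurable_add_dim f] in \<open>simp add: case_prod_beta'\<close>)
  have "(\<integral>\<^sup>+v. f (tri \<kappa> {..<Suc n} b v) \<partial>lb (insert n {..<n})) =
     (\<integral>\<^sup>+x. (\<integral>\<^sup>+y. f (tri \<kappa> {..<Suc n} b (x(n := y))) \<partial>lborel) \<partial>lb {..<n})"
    by (rule lbp.product_nn_integral_insert[OF _ _ ft]) auto
  also have "\<dots> = (\<integral>\<^sup>+x. (\<integral>\<^sup>+y. f ((tri \<kappa> {..<n} b x)(n := y)) \<partial>lborel) \<partial>lb {..<n})"
  proof (rule nn_integral_cong)
    fix x assume x: "x \<in> space (lb {..<n})"
    have t: "tri \<kappa> {..<n} b x \<in> space (lb {..<n})" by (auto simp: space_PiM tri_def)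
    have "tri \<kappa> {..<Suc n} b (x(n := y)) = (tri \<kappa> {..<n} b x)(n := y + ((\<Sum>s<n. \<kappa> n s * x s) + b n))" for y
      by (rule ext) (auto simp: tri_def)
    then show "(\<integral>\<^sup>+y. f (tri \<kappa> {..<Suc n} b (x(n := y))) \<partial>lborel) = (\<integral>\<^sup>+y. f ((tri \<kappa> {..<n} b x)(n := y)) \<partial>lborel)"
      using nn_integral_shift[OF fu[OF t]] by simp
  qed
  also have "\<dots> = (\<integral>\<^sup>+x. (\<integral>\<^sup>+y. f (x(n := y)) \<partial>lborel) \<partial>lb {..<n})"
    by (rule Suc.IH[OF fi])
  also have "\<dots> = (\<integral>\<^sup>+v. f v \<partial>lb (insert n {..<n}))"
    by (rule lbp.product_nn_integral_insert[OF _ _ f, symmetric]) auto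
  finally show ?case unfolding I .
qed

lemma nn_integral_tri:
  assumes "f \<in> borel_measurable (lb {..T})"
  shows "(\<integral>\<^sup>+v. f (tri \<kappa> {..T} b v) \<partial>lb {..T}) = (\<integral>\<^sup>+v. f v \<partial>lb {..T})"
  using nn_integral_tri_lessThan[of f "Suc T" \<kappa> b] assms by (simp add: lessThan_Suc_atMost)

lemma sigma_finite_lb: "sigma_finite_measure (lb {..T})"
  using lbp.sigma_finite[of "{..T}"] by simp

lemma nn_integral_lb_pair:
  assumes "sigma_finite_measure L" "f \<in> borel_measurable (L \<Otimes>\<^sub>M lb {..T})"
  shows "(\<integral>\<^sup>+z. f z \<partial>(L \<Otimes>\<^sub>M lb {..T})) = (\<integral>\<^sup>+x. (\<integral>\<^sup>+v. f (x, v) \<partial>lb {..T}) \<partial>L)"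
  using sigma_finite_measure.nn_integral_fst[OF sigma_finite_lb assms(2)] by simp

lemma nn_integral_tri_pair:
  assumes L: "sigma_finite_measure L" and b: "\<And>t. t \<le> T \<Longrightarrow> (\<lambda>x. b x t) \<in> borel_measurable L"
    and f: "f \<in> borel_measurable (L \<Otimes>\<^sub>M lb {..T})"
  shows "(\<integral>\<^sup>+z. f (fst z, tri \<kappa> {..T} (b (fst z)) (snd z)) \<partial>(L \<Otimes>\<^sub>M lb {..T})) = (\<integral>\<^sup>+z. f z \<partial>(L \<Otimes>\<^sub>M lb {..T}))"
proof -
  have m: "(\<lambda>z. (fst z, tri \<kappa> {..T} (b (fst z)) (snd z))) \<in> measurable (L \<Otimes>\<^sub>M lb {..T}) (L \<Otimes>\<^sub>M lb {..T})"
  proof -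
    have "(\<lambda>z. tri \<kappa> {..T} (b (fst z)) (snd z)) \<in> measurable (L \<Otimes>\<^sub>M lb {..T}) (lb {..T})"
      using tri_measurable[of T b L \<kappa>, OF b] by (simp add: case_prod_beta')
    then show ?thesis by (intro measurable_Pair measurable_fst)
  qed
  have "(\<integral>\<^sup>+z. f (fst z, tri \<kappa> {..T} (b (fst z)) (snd z)) \<partial>(L \<Otimes>\<^sub>M lb {..T})) =
      (\<integral>\<^sup>+x. (\<integral>\<^sup>+v. f (x, tri \<kappa> {..T} (b x) v) \<partial>lb {..T}) \<partial>L)"
    using nn_integral_lb_pair[OF L measurable_compose[OF m f]] by simp
  also have "\<dots> = (\<integral>\<^sup>+x. (\<integral>\<^sup>+v. f (x, v) \<partial>lb {..T}) \<partial>L)"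
    by (rule nn_integral_cong) (rule nn_integral_tri, rule measurable_compose[OF measurable_Pair1' f])
  also have "\<dots> = (\<integral>\<^sup>+z. f z \<partial>(L \<Otimes>\<^sub>M lb {..T}))" using nn_integral_lb_pair[OF L f] by simp
  finally show ?thesis .
qed

text \<open>Here \<Theta> maps the old variables to the new ones and \<Xi> maps back. Preservation
  of the reference measure by \<Xi> is why the density acquires no Jacobian factor.\<close>

lemma distributed_change_of_variables:
  assumes X: "distributed M S X p" and Xi: "\<Xi> \<in> measurable S S" and Th: "\<Theta> \<in> measurable S S"
    and pres: "\<And>f. f \<in> borel_measurable S \<Longrightarrow> (\<integral>\<^sup>+z. f (\<Xi> z) \<partial>S) = (\<integral>\<^sup>+z. f z \<partial>S)"
    and inv: "\<And>z. z \<in> space S \<Longrightarrow> \<Theta> (\<Xi> z) = z" and Z: "\<And>\<omega>. \<omega> \<in> space M \<Longrightarrow> Z \<omega> = \<Theta> (X \<omega>)"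
  shows "distributed M S Z (\<lambda>z. p (\<Xi> z))"
  unfolding distributed_def
proof (intro conjI)
  note XD = distributed_measurable[OF X] distributed_borel_measurable[OF X] distributed_distr_eq_density[OF X]
  have "(\<lambda>\<omega>. \<Theta> (X \<omega>)) \<in> measurable M S" by (rule measurable_compose[OF XD(1) Th])
  then show Zm: "Z \<in> measurable M S" using measurable_cong[of M Z "\<lambda>\<omega>. \<Theta> (X \<omega>)" S] Z by simp
  show pm: "(\<lambda>z. p (\<Xi> z)) \<in> borel_measurable S" by (rule measurable_compose[OF Xi XD(2)])
  show "distr M S Z = density S (\<lambda>z. p (\<Xi> z))"
  proof (rule measure_eqI)
    fix B assume "B \<in> sets (distr M S Z)"
    then have B: "B \<in> sets S" by simp
    have TB: "\<Theta> -` B \<inter> space S \<in> sets S" by (rule measurable_sets[OF Th B])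
    have "emeasure (distr M S Z) B = emeasure (distr M S X) (\<Theta> -` B \<inter> space S)"
      unfolding emeasure_distr[OF Zm B] emeasure_distr[OF XD(1) TB]
      by (rule arg_cong[where f = "emeasure M"]) (use Z measurable_space[OF XD(1)] in auto)
    also have "\<dots> = (\<integral>\<^sup>+x. p x * indicator (\<Theta> -` B \<inter> space S) x \<partial>S)"
      unfolding XD(3) by (rule emeasure_density[OF XD(2) TB])
    also have "\<dots> = (\<integral>\<^sup>+z. p (\<Xi> z) * indicator (\<Theta> -` B \<inter> space S) (\<Xi> z) \<partial>S)"
      by (rule pres[symmetric]) (use XD(2) TB in auto)
    also have "\<dots> = (\<integral>\<^sup>+z. p (\<Xi> z) * indicator B z \<partial>S)"
      by (rule nn_integral_cong) (use inv measurable_space[OF Xi] in \<open>auto simp: indicator_def\<close>)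
    also have "\<dots> = emeasure (density S (\<lambda>z. p (\<Xi> z))) B" by (rule emeasure_density[OF pm B, symmetric])
    finally show "emeasure (distr M S Z) B = emeasure (density S (\<lambda>z. p (\<Xi> z))) B" .
  qed simp
qed

section \<open>The law of message and noise\<close>

lemma PiM_density_lborel:
  assumes f: "\<And>i. i \<in> I \<Longrightarrow> f i \<in> borel_measurable borel" and I: "finite I"
    and sf: "\<And>i. sigma_finite_measure (density lborel (f i))"
  shows "Pi\<^sub>M I (\<lambda>i. density lborel (f i)) = density (lb I) (\<lambda>x. \<Prod>i\<in>I. f i (x i))"
proof -
  interpret P: product_sigma_finite "\<lambda>i. density lborel (f i)" by (rule product_sigma_finite.intro[OF sf])
  have fm: "(\<lambda>x. f i (x i)) \<in> borel_measurable (lb I)" if "i \<in> I" for i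
    by (rule measurable_compose[OF component_measurable f]) (use that in auto)
  show ?thesis
  proof (rule P.PiM_eqI[symmetric, OF I])
    show "sets (density (lb I) (\<lambda>x. \<Prod>i\<in>I. f i (x i))) = sets (Pi\<^sub>M I (\<lambda>i. density lborel (f i)))"
      by (simp cong: sets_PiM_cong)
    fix A assume A: "\<And>i. i \<in> I \<Longrightarrow> A i \<in> sets (density lborel (f i))"
    have PA: "Pi\<^sub>E I A \<in> sets (lb I)" by (rule sets_PiM_I_finite[OF I]) (use A in auto)
    have "emeasure (density (lb I) (\<lambda>x. \<Prod>i\<in>I. f i (x i))) (Pi\<^sub>E I A) = (\<integral>\<^sup>+x. (\<Prod>i\<in>I. f i (x i)) * indicator (Pi\<^sub>E I A) x \<partial>lb I)"
      by (rule emeasure_density) (use PA fm in \<open>auto intro: borel_measurable_prod\<close>)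
    also have "\<dots> = (\<integral>\<^sup>+x. (\<Prod>i\<in>I. f i (x i) * indicator (A i) (x i)) \<partial>lb I)"
    proof (rule nn_integral_cong)
      fix x assume x: "x \<in> space (lb I)"
      have "indicator (Pi\<^sub>E I A) x = (\<Prod>i\<in>I. indicator (A i) (x i) :: ennreal)"
      proof (cases "\<forall>i\<in>I. x i \<in> A i")
        case True
        then have "x \<in> Pi\<^sub>E I A" using x by (auto simp: space_PiM PiE_iff)
        then show ?thesis using True by simp
      next
        case False
        then obtain i where "i \<in> I" "x i \<notin> A i" by blast
        then have "x \<notin> Pi\<^sub>E I A" "(\<Prod>i\<in>I. indicator (A i) (x i) :: ennreal) = 0"
          using I by (auto intro!: bexI[OF _ \<open>i \<in> I\<close>])
        then show ?thesis by simp
      qed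
      then show "(\<Prod>i\<in>I. f i (x i)) * indicator (Pi\<^sub>E I A) x = (\<Prod>i\<in>I. f i (x i) * indicator (A i) (x i))"
        by (simp add: prod.distrib)
    qed
    also have "\<dots> = (\<Prod>i\<in>I. \<integral>\<^sup>+x. f i x * indicator (A i) x \<partial>lborel)"
      by (rule lbp.product_nn_integral_prod[OF I]) (use f A in auto)
    also have "\<dots> = (\<Prod>i\<in>I. emeasure (density lborel (f i)) (A i))"
      by (rule prod.cong) (use f A in \<open>auto simp: emeasure_density\<close>)
    finally show "emeasure (density (lb I) (\<lambda>x. \<Prod>i\<in>I. f i (x i))) (Pi\<^sub>E I A) = (\<Prod>i\<in>I. emeasure (density lborel (f i)) (A i))" .
  qed
qed

definition phi :: "nat \<Rightarrow> (nat \<Rightarrow> real) \<Rightarrow> real" where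
  "phi n w = (\<Prod>i\<le>n. std_normal_density (w i))"

lemma phi_pos: "0 < phi n w"
  unfolding phi_def by (intro prod_pos) (simp add: normal_density_pos)

lemma phi_measurable [measurable]: "phi n \<in> borel_measurable (lb {..n})"
  unfolding phi_def by (intro borel_measurable_prod measurable_compose[OF component_measurable]) auto

lemma phi_exp: "phi n w = (1 / sqrt (2 * pi)) ^ Suc n * exp (- (\<Sum>i\<le>n. (w i)\<^sup>2) / 2)"
proof -
  have "phi n w = (\<Prod>i\<le>n. 1 / sqrt (2 * pi)) * (\<Prod>i\<le>n. exp (- (w i)\<^sup>2 / 2))"
    unfolding phi_def std_normal_density_def prod.distrib ..
  also have "(\<Prod>i\<le>n. exp (- (w i)\<^sup>2 / 2)) = exp (\<Sum>i\<le>n. - (w i)\<^sup>2 / 2)"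
    by (rule exp_sum[symmetric]) simp
  also have "(\<Sum>i\<le>n. - (w i)\<^sup>2 / 2) = - (\<Sum>i\<le>n. (w i)\<^sup>2) / 2"
    by (simp add: sum_divide_distrib sum_negf)
  finally show ?thesis by simp
qed

lemma PiM_std_normal:
  "Pi\<^sub>M {..n} (\<lambda>i. density lborel std_normal_density) = density (lb {..n}) (\<lambda>w. ennreal (phi n w))"
proof -
  have "sigma_finite_measure (density lborel std_normal_density)"
    by (rule prob_space_imp_sigma_finite) (simp add: prob_space_normal_density)
  then show ?thesis
    by (subst PiM_density_lborel) (auto simp: phi_def prod_ennreal normal_density_nonneg)
qed

lemma message_noise_laws:
  assumes "message_and_noise M n W N"
  shows "prob_space.indep_var M (borel_upto n) (rv_upto W n) (borel_upto T) (rv_upto N T)"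
    and "distr M (borel_upto n) (rv_upto W n) = Pi\<^sub>M {..n} (\<lambda>i. density lborel std_normal_density)"
    and "distr M (borel_upto T) (rv_upto N T) = Pi\<^sub>M {..T} (\<lambda>i. density lborel std_normal_density)"
proof -
  interpret prob_space M using assms by (simp add: message_and_noise_def)
  have ind: "indep_var (borel_upto n) (rv_upto W n) (\<Pi>\<^sub>M t\<in>UNIV. borel) (\<lambda>\<omega> t. N t \<omega>)"
    and dW: "distr M (borel_upto n) (rv_upto W n) = (\<Pi>\<^sub>M i\<in>{..n}. density lborel std_normal_density)"
    and dN: "distr M (\<Pi>\<^sub>M t\<in>UNIV. borel) (\<lambda>\<omega> t. N t \<omega>) = (\<Pi>\<^sub>M t\<in>UNIV. density lborel std_normal_density)"
    using assms by (auto simp: message_and_noise_def)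
  have rm: "(\<lambda>f. restrict f {..T}) \<in> measurable (\<Pi>\<^sub>M t\<in>(UNIV::nat set). borel) (borel_upto T)"
    by (rule measurable_restrict_subset) simp
  have NT: "rv_upto N T = (\<lambda>f. restrict f {..T}) \<circ> (\<lambda>\<omega> t. N t \<omega>)"
    by (auto simp: rv_upto_def fun_eq_iff)
  show "indep_var (borel_upto n) (rv_upto W n) (borel_upto T) (rv_upto N T)"
    unfolding NT using indep_var_compose[OF ind measurable_ident rm] by (simp add: comp_def)
  show "distr M (borel_upto n) (rv_upto W n) = Pi\<^sub>M {..n} (\<lambda>i. density lborel std_normal_density)" by (rule dW)
  have Nm: "(\<lambda>\<omega> t. N t \<omega>) \<in> measurable M (\<Pi>\<^sub>M t\<in>UNIV. borel)" using indep_var_rv2[OF ind] .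
  interpret P: product_prob_space "\<lambda>_::nat. density lborel std_normal_density" UNIV
    unfolding product_prob_space_def product_prob_space_axioms_def product_sigma_finite_def
    using prob_space_normal_density[of 1 0] prob_space_imp_sigma_finite by auto
  have "distr M (borel_upto T) (rv_upto N T) = distr (distr M (\<Pi>\<^sub>M t\<in>UNIV. borel) (\<lambda>\<omega> t. N t \<omega>)) (borel_upto T) (\<lambda>f. restrict f {..T})"
    unfolding NT using distr_distr[OF rm Nm] by (simp add: comp_def)
  also have "\<dots> = distr (\<Pi>\<^sub>M t\<in>UNIV. density lborel std_normal_density) (\<Pi>\<^sub>M t\<in>{..T}. density lborel std_normal_density) (\<lambda>f. restrict f {..T})"
    unfolding dN by (rule distr_cong[OF refl _ refl], rule sets_PiM_cong) auto
  also have "\<dots> = (\<Pi>\<^sub>M t\<in>{..T}. density lborel std_normal_density)"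
    by (rule P.distr_PiM_restrict_finite) auto
  finally show "distr M (borel_upto T) (rv_upto N T) = Pi\<^sub>M {..T} (\<lambda>i. density lborel std_normal_density)" .
qed

lemma message_noise_distributed:
  assumes "message_and_noise M n W N"
  shows "distributed M (lb {..n} \<Otimes>\<^sub>M lb {..T}) (\<lambda>\<omega>. (rv_upto W n \<omega>, rv_upto N T \<omega>)) (\<lambda>(w, v). ennreal (phi n w * phi T v))"
proof -
  interpret prob_space M using assms by (simp add: message_and_noise_def)
  note ind2 = message_noise_laws(1)[OF assms, of T]
  have dNT: "distr M (borel_upto T) (rv_upto N T) = density (lb {..T}) (\<lambda>v. ennreal (phi T v))"
    unfolding message_noise_laws(3)[OF assms] PiM_std_normal ..
  have dW': "distr M (borel_upto n) (rv_upto W n) = density (lb {..n}) (\<lambda>w. ennreal (phi n w))"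
    unfolding message_noise_laws(2)[OF assms] PiM_std_normal ..
  \<comment> \<open>The Borel and the Lebesgue product spaces share their measurable sets and differ
    only in the measure.\<close>
  have sets_eq: "sets (lb {..n} \<Otimes>\<^sub>M lb {..T}) = sets (borel_upto n \<Otimes>\<^sub>M borel_upto T)"
    by (intro sets_pair_measure_cong sets_PiM_cong) auto
  note rvs = indep_var_rv1[OF ind2] indep_var_rv2[OF ind2]
  have Xm: "(\<lambda>\<omega>. (rv_upto W n \<omega>, rv_upto N T \<omega>)) \<in> measurable M (lb {..n} \<Otimes>\<^sub>M lb {..T})"
    unfolding measurable_cong_sets[OF refl sets_eq] using rvs by (rule measurable_Pair)
  have sfT: "sigma_finite_measure (density (lb {..T}) (\<lambda>v. ennreal (phi T v)))"
    unfolding dNT[symmetric] by (rule prob_space_imp_sigma_finite[OF prob_space_distr[OF rvs(2)]])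
  have "distr M (lb {..n} \<Otimes>\<^sub>M lb {..T}) (\<lambda>\<omega>. (rv_upto W n \<omega>, rv_upto N T \<omega>)) =
      distr M (borel_upto n \<Otimes>\<^sub>M borel_upto T) (\<lambda>\<omega>. (rv_upto W n \<omega>, rv_upto N T \<omega>))"
    by (rule distr_cong[OF refl sets_eq refl])
  also have "\<dots> = distr M (borel_upto n) (rv_upto W n) \<Otimes>\<^sub>M distr M (borel_upto T) (rv_upto N T)"
    using ind2 unfolding indep_var_distribution_eq by simp
  also have "\<dots> = density (lb {..n} \<Otimes>\<^sub>M lb {..T}) (\<lambda>(w, v). ennreal (phi n w) * ennreal (phi T v))"
    unfolding dNT dW' by (rule pair_measure_density) (auto intro: sigma_finite_lb sfT)
  also have "(\<lambda>(w, v). ennreal (phi n w) * ennreal (phi T v)) = (\<lambda>(w, v). ennreal (phi n w * phi T v))"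
    by (auto simp: ennreal_mult' less_imp_le[OF phi_pos])
  finally have "distr M (lb {..n} \<Otimes>\<^sub>M lb {..T}) (\<lambda>\<omega>. (rv_upto W n \<omega>, rv_upto N T \<omega>)) =
      density (lb {..n} \<Otimes>\<^sub>M lb {..T}) (\<lambda>(w, v). ennreal (phi n w * phi T v))" .
  moreover have "(\<lambda>(w, v). ennreal (phi n w * phi T v)) \<in> borel_measurable (lb {..n} \<Otimes>\<^sub>M lb {..T})"
    by measurable
  ultimately show ?thesis using Xm by (simp add: distributed_def)
qed

section \<open>Second moments\<close>

text \<open>A moment of one or two coordinates is written as a product of powers over all
  coordinates, most exponents being 0, so that the product integral factors.\<close>

lemma std_normal_product_moments:
  assumes "distr M (borel_upto n) (rv_upto X n) = Pi\<^sub>M {..n} (\<lambda>i. density lborel std_normal_density)"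
    and X: "rv_upto X n \<in> measurable M (borel_upto n)" and "i \<le> n" "j \<le> n"
  shows "integrable M (\<lambda>\<omega>. X i \<omega> * X j \<omega>)" "(\<integral>\<omega>. X i \<omega> * X j \<omega> \<partial>M) = (if i = j then 1 else 0)"
    "integrable M (X i)" "(\<integral>\<omega>. X i \<omega> \<partial>M) = 0"
proof -
  let ?D = "\<lambda>_::nat. density lborel std_normal_density"
  have ps: "prob_space (density lborel std_normal_density)" by (simp add: prob_space_normal_density)
  interpret S: prob_space "density lborel std_normal_density" by (rule ps)
  interpret P: product_sigma_finite ?D by (rule product_sigma_finite.intro) (rule S.sigma_finite_measure_axioms)
  have mom: "integrable (density lborel std_normal_density) (\<lambda>x. x ^ r)"
    "integral\<^sup>L (density lborel std_normal_density) (\<lambda>x. x ^ r) = integral\<^sup>L lborel (\<lambda>x. std_normal_density x * x ^ r)" for r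
    using integrable_std_normal_moment[of r] by (simp_all add: integrable_density integral_density normal_density_nonneg)
  have m0: "integral\<^sup>L (density lborel std_normal_density) (\<lambda>x. 1 :: real) = 1" using S.prob_space by simp
  have m1: "integral\<^sup>L (density lborel std_normal_density) (\<lambda>x. x) = 0"
    using mom(2)[of 1] integral_std_normal_moment_odd[of 0] by simp
  have m2: "integral\<^sup>L (density lborel std_normal_density) (\<lambda>x. x\<^sup>2) = 1"
    using mom(2)[of 2] integral_std_normal_moment_even[of 1] by simp
  have push: "integrable M (\<lambda>\<omega>. \<Prod>l\<le>n. X l \<omega> ^ r l)"
    "(\<integral>\<omega>. (\<Prod>l\<le>n. X l \<omega> ^ r l) \<partial>M) = (\<Prod>l\<le>n. integral\<^sup>L (density lborel std_normal_density) (\<lambda>x. x ^ r l))" for r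
  proof -
    have i: "integrable (Pi\<^sub>M {..n} ?D) (\<lambda>x. \<Prod>l\<le>n. x l ^ r l)"
      by (rule P.product_integrable_prod) (auto intro: mom)
    have m: "(\<lambda>x. \<Prod>l\<le>n. x l ^ r l) \<in> borel_measurable (borel_upto n)" by measurable
    have e: "(\<Prod>l\<le>n. rv_upto X n \<omega> l ^ r l) = (\<Prod>l\<le>n. X l \<omega> ^ r l)" for \<omega> by (auto simp: rv_upto_def intro!: prod.cong)
    show "integrable M (\<lambda>\<omega>. \<Prod>l\<le>n. X l \<omega> ^ r l)"
      using i unfolding assms(1)[symmetric] integrable_distr_eq[OF X m] e .
    show "(\<integral>\<omega>. (\<Prod>l\<le>n. X l \<omega> ^ r l) \<partial>M) = (\<Prod>l\<le>n. integral\<^sup>L (density lborel std_normal_density) (\<lambda>x. x ^ r l))"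
      using integral_distr[OF X m] P.product_integral_prod[of "{..n}" "\<lambda>l x. x ^ r l", OF _ mom(1)] unfolding assms(1) e by simp
  qed
  have p1: "(\<Prod>l\<le>n. a l ^ (if l = i then 1 else 0)) = a i" for a :: "nat \<Rightarrow> real"
    using assms(3) by (simp add: if_distrib[of "\<lambda>r. _ ^ r"] prod.delta cong: if_cong)
  have p1': "(\<Prod>l\<le>n. a l ^ (if l = j then 1 else 0)) = a j" for a :: "nat \<Rightarrow> real"
    using assms(4) by (simp add: if_distrib[of "\<lambda>r. _ ^ r"] prod.delta cong: if_cong)
  have p2: "(\<Prod>l\<le>n. a l ^ ((if l = i then 1 else 0) + (if l = j then 1 else 0))) = a i * a j" for a :: "nat \<Rightarrow> real"
    by (simp only: power_add prod.distrib p1 p1')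
  show "integrable M (X i)" using push(1)[of "\<lambda>l. if l = i then 1 else 0"] unfolding p1 .
  show "integrable M (\<lambda>\<omega>. X i \<omega> * X j \<omega>)"
    using push(1)[of "\<lambda>l. (if l = i then 1 else 0) + (if l = j then 1 else 0)"] unfolding p2 .
  have "(\<Prod>l\<le>n. integral\<^sup>L (density lborel std_normal_density) (\<lambda>x. x ^ (if l = i then 1 else 0))) = 0"
    by (rule prod_zero) (use assms(3) m1 in auto)
  then show "(\<integral>\<omega>. X i \<omega> \<partial>M) = 0" using push(2)[of "\<lambda>l. if l = i then 1 else 0"] unfolding p1 by simp
  have "(\<Prod>l\<le>n. integral\<^sup>L (density lborel std_normal_density) (\<lambda>x. x ^ ((if l = i then 1 else 0) + (if l = j then 1 else 0)))) =
    (if i = j then 1 else 0)"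
  proof (cases "i = j")
    case True
    have "integral\<^sup>L (density lborel std_normal_density) (\<lambda>x. x ^ ((if l = i then 1 else 0) + (if l = j then 1 else 0))) = 1" for l
      using m0 m2 True by (cases "l = i") (simp_all add: power2_eq_square)
    then show ?thesis using True by simp
  next
    case False
    have "(\<Prod>l\<le>n. integral\<^sup>L (density lborel std_normal_density) (\<lambda>x. x ^ ((if l = i then 1 else 0) + (if l = j then 1 else 0)))) = 0"
      by (rule prod_zero) (use assms(3) m1 False in \<open>auto intro!: bexI[of _ i]\<close>)
    then show ?thesis using False by simp
  qed
  then show "(\<integral>\<omega>. X i \<omega> * X j \<omega> \<partial>M) = (if i = j then 1 else 0)"
    using push(2)[of "\<lambda>l. (if l = i then 1 else 0) + (if l = j then 1 else 0)"] unfolding p2 by simp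
qed

lemma orthonormal_linear_forms:
  fixes \<xi> :: "'i \<Rightarrow> 'a \<Rightarrow> real"
  assumes "\<And>a b. a \<in> I \<Longrightarrow> b \<in> I \<Longrightarrow> integrable M (\<lambda>\<omega>. \<xi> a \<omega> * \<xi> b \<omega>)"
    "\<And>a b. a \<in> I \<Longrightarrow> b \<in> I \<Longrightarrow> (\<integral>\<omega>. \<xi> a \<omega> * \<xi> b \<omega> \<partial>M) = (if a = b then 1 else 0)" and "finite I"
  shows "integrable M (\<lambda>\<omega>. (\<Sum>a\<in>I. c a * \<xi> a \<omega>) * (\<Sum>b\<in>I. d b * \<xi> b \<omega>))"
    "(\<integral>\<omega>. (\<Sum>a\<in>I. c a * \<xi> a \<omega>) * (\<Sum>b\<in>I. d b * \<xi> b \<omega>) \<partial>M) = (\<Sum>a\<in>I. c a * d a)"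
proof -
  have e: "(\<Sum>a\<in>I. c a * \<xi> a \<omega>) * (\<Sum>b\<in>I. d b * \<xi> b \<omega>) = (\<Sum>a\<in>I. \<Sum>b\<in>I. c a * d b * (\<xi> a \<omega> * \<xi> b \<omega>))" for \<omega>
    unfolding sum_product by (intro sum.cong) (simp_all add: mult_ac)
  show "integrable M (\<lambda>\<omega>. (\<Sum>a\<in>I. c a * \<xi> a \<omega>) * (\<Sum>b\<in>I. d b * \<xi> b \<omega>))"
    unfolding e by (intro Bochner_Integration.integrable_sum integrable_mult_right assms)
  have "(\<integral>\<omega>. (\<Sum>a\<in>I. c a * \<xi> a \<omega>) * (\<Sum>b\<in>I. d b * \<xi> b \<omega>) \<partial>M) = (\<Sum>a\<in>I. \<Sum>b\<in>I. c a * d b * (if a = b then 1 else 0))"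
    unfolding e
    by (subst Bochner_Integration.integral_sum, (intro Bochner_Integration.integrable_sum integrable_mult_right assms; assumption), rule sum.cong[OF refl])
       (subst Bochner_Integration.integral_sum, (intro integrable_mult_right assms; assumption), rule sum.cong[OF refl], simp add: assms)
  also have "\<dots> = (\<Sum>a\<in>I. c a * d a)"
    by (rule sum.cong) (use assms(3) in \<open>simp_all add: if_distrib[of "\<lambda>x. _ * x"] cong: if_cong\<close>)
  finally show "(\<integral>\<omega>. (\<Sum>a\<in>I. c a * \<xi> a \<omega>) * (\<Sum>b\<in>I. d b * \<xi> b \<omega>) \<partial>M) = (\<Sum>a\<in>I. c a * d a)" .
qed

locale gauss_obs = obs_rows "Suc n" g for n :: nat and g :: "nat \<Rightarrow> real mat" +
  fixes M :: "'a measure" and W N :: "nat \<Rightarrow> 'a \<Rightarrow> real"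
  assumes mn: "message_and_noise M n W N"
begin

sublocale prob_space M using mn by (simp add: message_and_noise_def)

lemma W_measurable [measurable]: "i \<le> n \<Longrightarrow> W i \<in> borel_measurable M"
proof -
  assume i: "i \<le> n"
  have "(\<lambda>\<omega>. rv_upto W n \<omega> i) \<in> borel_measurable M"
    by (rule measurable_compose[OF indep_var_rv1[OF message_noise_laws(1)[OF mn]]]) (use i in auto)
  then show "W i \<in> borel_measurable M" using i by (simp add: rv_upto_def)
qed

lemma N_measurable [measurable]: "N t \<in> borel_measurable M"
proof -
  have "(\<lambda>\<omega>. rv_upto N t \<omega> t) \<in> borel_measurable M"
    by (rule measurable_compose[OF indep_var_rv2[OF message_noise_laws(1)[OF mn]]]) auto
  then show "N t \<in> borel_measurable M" by (simp add: rv_upto_def)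
qed

lemma message_noise_product_moment:
  assumes i: "i \<le> n"
  shows "integrable M (\<lambda>\<omega>. W i \<omega> * N t \<omega>)" "(\<integral>\<omega>. W i \<omega> * N t \<omega> \<partial>M) = 0"
proof -
  note laws = message_noise_laws[OF mn]
  note W = std_normal_product_moments(3,4)[OF laws(2) indep_var_rv1[OF laws(1)] i i]
  note N = std_normal_product_moments(3,4)[OF laws(3) indep_var_rv2[OF laws(1)] order_refl order_refl, of t]
  have "indep_var borel ((\<lambda>f. f i) \<circ> rv_upto W n) borel ((\<lambda>f. f t) \<circ> rv_upto N t)"
    by (rule indep_var_compose[OF laws(1)]) (use i in auto)
  then have ind: "indep_var borel (W i) borel (N t)" using i by (simp add: rv_upto_def comp_def)
  show "integrable M (\<lambda>\<omega>. W i \<omega> * N t \<omega>)" by (rule indep_var_integrable[OF ind W(1) N(1)])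
  show "(\<integral>\<omega>. W i \<omega> * N t \<omega> \<partial>M) = 0" using indep_var_lebesgue_integral[OF ind W(1) N(1)] W N by simp
qed

text \<open>The sum type indexes message and noise as one orthonormal family, so second moments of
  linear forms become inner products of coefficients.\<close>

lemma orthonormal:
  assumes "a \<in> {..n} <+> UNIV" "b \<in> {..n} <+> UNIV"
  shows "integrable M (\<lambda>\<omega>. case_sum W N a \<omega> * case_sum W N b \<omega>)"
    "(\<integral>\<omega>. case_sum W N a \<omega> * case_sum W N b \<omega> \<partial>M) = (if a = b then 1 else 0)"
proof -
  note laws = message_noise_laws[OF mn]
  note W = std_normal_product_moments(1,2)[OF laws(2) indep_var_rv1[OF laws(1)]]
  note N = std_normal_product_moments(1,2)[OF laws(3) indep_var_rv2[OF laws(1)]]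
  have N': "integrable M (\<lambda>\<omega>. N s \<omega> * N t \<omega>)" "(\<integral>\<omega>. N s \<omega> * N t \<omega> \<partial>M) = (if s = t then 1 else 0)" for s t
    using N[of s "max s t" t] by auto
  note WN = message_noise_product_moment
  note NW = message_noise_product_moment[unfolded mult.commute[of "W _ _"]]
  show "integrable M (\<lambda>\<omega>. case_sum W N a \<omega> * case_sum W N b \<omega>)"
    using assms by (auto intro: W N' WN NW)
  show "(\<integral>\<omega>. case_sum W N a \<omega> * case_sum W N b \<omega> \<partial>M) = (if a = b then 1 else 0)"
    using assms by (auto simp: W N' WN NW split del: if_split)
qed

definition wmat :: "'a \<Rightarrow> real mat" where "wmat \<omega> = mat (Suc n) 1 (\<lambda>(i, j). W i \<omega>)"
abbreviation "rs t \<omega> \<equiv> resid (wmat \<omega>) (\<lambda>s. N s \<omega>) t"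

lemma wmat: "wmat \<omega> \<in> carrier_mat (Suc n) 1" by (simp add: wmat_def)

lemma rs_entry: "i \<le> n \<Longrightarrow> rs t \<omega> $$ (i,0) = W i \<omega> - (\<Sum>s<t. N s \<omega> * g s $$ (0,i))"
  using resid_entry[OF wmat, of i] by (simp add: wmat_def)

text \<open>Coefficients of a residual entry in the orthonormal family. The residual stops before
  time \<open>t\<close>, but the family is later indexed up to \<open>t\<close>, with coefficient 0
  there, so that it also contains \<open>N t\<close>.\<close>

definition cf :: "nat \<Rightarrow> nat \<Rightarrow> nat + nat \<Rightarrow> real" where
  "cf t i = case_sum (\<lambda>j. if j = i then 1 else 0) (\<lambda>s. - (if s < t then g s $$ (0,i) else 0))"

lemma rs_linear_form:
  assumes "i \<le> n"
  shows "rs t \<omega> $$ (i,0) = (\<Sum>a\<in>{..n} <+> {..t}. cf t i a * case_sum W N a \<omega>)"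
  unfolding rs_entry[OF assms] sum.Plus[OF finite_atMost finite_atMost] using assms
  by (simp add: cf_def if_distrib[of "\<lambda>x. x * _"] if_distrib[of uminus] sum_negf[symmetric] sum.If_cases cong: if_cong)
     (auto intro!: sum.cong simp: mult.commute lessThan_def[symmetric] Int_absorb1)

lemma N_linear_form: "N t \<omega> = (\<Sum>a\<in>{..n} <+> {..t}. (if a = Inr t then 1 else 0) * case_sum W N a \<omega>)"
  unfolding sum.Plus[OF finite_atMost finite_atMost] by (simp add: if_distrib[of "\<lambda>x. x * _"] cong: if_cong)

text \<open>The covariance of the residual is the identity plus the sum of the outer products of the
  rows, which is the precision. Only earlier noise enters the residual, hence it is uncorrelated
  with \<open>N t\<close>.\<close>

lemma residual_moments:
  shows "i \<le> n \<Longrightarrow> j \<le> n \<Longrightarrow> integrable M (\<lambda>\<omega>. rs t \<omega> $$ (i,0) * rs t \<omega> $$ (j,0))"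
    "i \<le> n \<Longrightarrow> j \<le> n \<Longrightarrow> (\<integral>\<omega>. rs t \<omega> $$ (i,0) * rs t \<omega> $$ (j,0) \<partial>M) = J t $$ (i,j)"
    "i \<le> n \<Longrightarrow> integrable M (\<lambda>\<omega>. rs t \<omega> $$ (i,0) * N t \<omega>)"
    "i \<le> n \<Longrightarrow> (\<integral>\<omega>. rs t \<omega> $$ (i,0) * N t \<omega> \<partial>M) = 0"
    "integrable M (\<lambda>\<omega>. N t \<omega> * N t \<omega>)" "(\<integral>\<omega>. N t \<omega> * N t \<omega> \<partial>M) = 1"
proof -
  have fin: "finite ({..n} <+> {..t})" by simp
  have sub: "a \<in> {..n} <+> UNIV" if "a \<in> {..n} <+> {..t}" for a using that by auto
  note L = orthonormal_linear_forms[of "{..n} <+> {..t}" M "case_sum W N", OF orthonormal(1)[OF sub sub] orthonormal(2)[OF sub sub] fin]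
  show "integrable M (\<lambda>\<omega>. rs t \<omega> $$ (i,0) * rs t \<omega> $$ (j,0))" if "i \<le> n" "j \<le> n"
    unfolding rs_linear_form[OF that(1)] rs_linear_form[OF that(2)] by (rule L)
  show "integrable M (\<lambda>\<omega>. rs t \<omega> $$ (i,0) * N t \<omega>)" if "i \<le> n"
    unfolding rs_linear_form[OF that] by (subst N_linear_form) (rule L)
  show "(\<integral>\<omega>. rs t \<omega> $$ (i,0) * N t \<omega> \<partial>M) = 0" if "i \<le> n"
    unfolding rs_linear_form[OF that] by (subst N_linear_form, subst L) (simp_all add: cf_def)
  show "integrable M (\<lambda>\<omega>. N t \<omega> * N t \<omega>)" "(\<integral>\<omega>. N t \<omega> * N t \<omega> \<partial>M) = 1"
    using orthonormal[of "Inr t" "Inr t"] by auto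
  show "(\<integral>\<omega>. rs t \<omega> $$ (i,0) * rs t \<omega> $$ (j,0) \<partial>M) = J t $$ (i,j)" if "i \<le> n" "j \<le> n"
  proof -
    have "(\<integral>\<omega>. rs t \<omega> $$ (i,0) * rs t \<omega> $$ (j,0) \<partial>M) = (\<Sum>a\<in>{..n} <+> {..t}. cf t i a * cf t j a)"
      unfolding rs_linear_form[OF that(1)] rs_linear_form[OF that(2)] by (rule L)
    also have "\<dots> = (\<Sum>l\<le>n. (if l = i then 1 else 0) * (if l = j then 1 else 0)) +
        (\<Sum>s\<le>t. if s < t then g s $$ (0,i) * g s $$ (0,j) else 0)"
      unfolding sum.Plus[OF finite_atMost finite_atMost] by (simp add: cf_def if_distrib cong: if_cong)
    also have "(\<Sum>s\<le>t. if s < t then g s $$ (0,i) * g s $$ (0,j) else 0) = (\<Sum>s<t. g s $$ (0,i) * g s $$ (0,j))"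
      by (rule sum.mono_neutral_cong_right) auto
    also have "(\<Sum>l\<le>n. (if l = i then 1 else 0) * (if l = j then 1 else 0)) = (if i = j then 1 else 0 :: real)"
      using that by (simp add: if_distrib[of "\<lambda>x. x * _"] cong: if_cong)
    finally show ?thesis using that by (simp add: J_entry)
  qed
qed

text \<open>The noise coefficients \<beta> and \<gamma> are 1 for the innovation and 0 for the input
  power and the estimation error.\<close>

lemma linear_moments:
  assumes c: "c \<in> carrier_mat 1 (Suc n)" and d: "d \<in> carrier_mat 1 (Suc n)"
  shows "integrable M (\<lambda>\<omega>. ((c * rs t \<omega>) $$ (0,0) + \<beta> * N t \<omega>) * ((d * rs t \<omega>) $$ (0,0) + \<gamma> * N t \<omega>))"
    "(\<integral>\<omega>. ((c * rs t \<omega>) $$ (0,0) + \<beta> * N t \<omega>) * ((d * rs t \<omega>) $$ (0,0) + \<gamma> * N t \<omega>) \<partial>M) = (c * J t * d\<^sup>T) $$ (0,0) + \<beta> * \<gamma>"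
proof -
  have rc: "rs t \<omega> \<in> carrier_mat (Suc n) 1" for \<omega> by (rule carrier_matI) (simp_all add: resid_dim[OF wmat])
  have cr: "(c * rs t \<omega>) $$ (0,0) = (\<Sum>i\<le>n. c $$ (0,i) * rs t \<omega> $$ (i,0))" if "c \<in> carrier_mat 1 (Suc n)" for c \<omega>
    using index_mult_mat_sum[OF that rc, of 0 0] by (simp add: lessThan_Suc_atMost)
  note m = residual_moments
  have e: "((c * rs t \<omega>) $$ (0,0) + \<beta> * N t \<omega>) * ((d * rs t \<omega>) $$ (0,0) + \<gamma> * N t \<omega>) =
     (\<Sum>i\<le>n. \<Sum>j\<le>n. c $$ (0,i) * d $$ (0,j) * (rs t \<omega> $$ (i,0) * rs t \<omega> $$ (j,0))) +
     (\<Sum>i\<le>n. (\<gamma> * c $$ (0,i) + \<beta> * d $$ (0,i)) * (rs t \<omega> $$ (i,0) * N t \<omega>)) + \<beta> * \<gamma> * (N t \<omega> * N t \<omega>)" for \<omega>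
  proof -
    define X Y where "X = (\<Sum>i\<le>n. c $$ (0,i) * rs t \<omega> $$ (i,0))" and "Y = (\<Sum>i\<le>n. d $$ (0,i) * rs t \<omega> $$ (i,0))"
    have "X * Y = (\<Sum>i\<le>n. \<Sum>j\<le>n. c $$ (0,i) * d $$ (0,j) * (rs t \<omega> $$ (i,0) * rs t \<omega> $$ (j,0)))"
      unfolding X_def Y_def sum_product by (intro sum.cong) (simp_all add: mult_ac)
    moreover have "(\<gamma> * X + \<beta> * Y) * N t \<omega> = (\<Sum>i\<le>n. (\<gamma> * c $$ (0,i) + \<beta> * d $$ (0,i)) * (rs t \<omega> $$ (i,0) * N t \<omega>))"
      unfolding X_def Y_def sum_distrib_left sum_distrib_right sum.distrib[symmetric] by (simp add: algebra_simps)
    moreover have "(X + \<beta> * N t \<omega>) * (Y + \<gamma> * N t \<omega>) = X * Y + (\<gamma> * X + \<beta> * Y) * N t \<omega> + \<beta> * \<gamma> * (N t \<omega> * N t \<omega>)"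
      by (simp add: algebra_simps)
    ultimately show ?thesis unfolding cr[OF c] cr[OF d] X_def[symmetric] Y_def[symmetric] by simp
  qed
  have int: "integrable M (\<lambda>\<omega>. \<Sum>i\<le>n. \<Sum>j\<le>n. c $$ (0,i) * d $$ (0,j) * (rs t \<omega> $$ (i,0) * rs t \<omega> $$ (j,0)))"
    "integrable M (\<lambda>\<omega>. \<Sum>i\<le>n. (\<gamma> * c $$ (0,i) + \<beta> * d $$ (0,i)) * (rs t \<omega> $$ (i,0) * N t \<omega>))"
    "integrable M (\<lambda>\<omega>. \<beta> * \<gamma> * (N t \<omega> * N t \<omega>))"
    by (auto intro!: Bochner_Integration.integrable_sum integrable_mult_right m)
  show "integrable M (\<lambda>\<omega>. ((c * rs t \<omega>) $$ (0,0) + \<beta> * N t \<omega>) * ((d * rs t \<omega>) $$ (0,0) + \<gamma> * N t \<omega>))"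
    unfolding e by (intro Bochner_Integration.integrable_add int)
  have 1: "(\<integral>\<omega>. (\<Sum>i\<le>n. \<Sum>j\<le>n. c $$ (0,i) * d $$ (0,j) * (rs t \<omega> $$ (i,0) * rs t \<omega> $$ (j,0))) \<partial>M)
     = (\<Sum>i\<le>n. \<Sum>j\<le>n. c $$ (0,i) * d $$ (0,j) * J t $$ (i,j))"
    by (subst Bochner_Integration.integral_sum, (intro Bochner_Integration.integrable_sum integrable_mult_right m; simp), rule sum.cong[OF refl])
       (subst Bochner_Integration.integral_sum, (intro integrable_mult_right m; simp), rule sum.cong[OF refl], simp add: m)
  have 2: "(\<integral>\<omega>. (\<Sum>i\<le>n. (\<gamma> * c $$ (0,i) + \<beta> * d $$ (0,i)) * (rs t \<omega> $$ (i,0) * N t \<omega>)) \<partial>M) = 0"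
    by (subst Bochner_Integration.integral_sum, (intro integrable_mult_right m; simp), rule sum.neutral, simp add: m)
  have "(\<integral>\<omega>. ((c * rs t \<omega>) $$ (0,0) + \<beta> * N t \<omega>) * ((d * rs t \<omega>) $$ (0,0) + \<gamma> * N t \<omega>) \<partial>M) =
     (\<Sum>i\<le>n. \<Sum>j\<le>n. c $$ (0,i) * d $$ (0,j) * J t $$ (i,j)) + \<beta> * \<gamma>"
    unfolding e using int 1 2 m(6)[of t] by simp
  also have "(\<Sum>i\<le>n. \<Sum>j\<le>n. c $$ (0,i) * d $$ (0,j) * J t $$ (i,j)) = (c * J t * d\<^sup>T) $$ (0,0)"
  proof -
    have cJ: "c * J t \<in> carrier_mat 1 (Suc n)" using c J_carrier by (rule mult_carrier_mat)
    have dT: "d\<^sup>T \<in> carrier_mat (Suc n) 1" using d by simp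
    have "(c * J t * d\<^sup>T) $$ (0,0) = (\<Sum>j\<le>n. (c * J t) $$ (0,j) * d\<^sup>T $$ (j,0))"
      using index_mult_mat_sum[OF cJ dT, of 0 0] by (simp add: lessThan_Suc_atMost)
    also have "\<dots> = (\<Sum>j\<le>n. (\<Sum>i\<le>n. c $$ (0,i) * J t $$ (i,j)) * d $$ (0,j))"
    proof (rule sum.cong[OF refl])
      fix j assume "j \<in> {..n}"
      then show "(c * J t) $$ (0,j) * d\<^sup>T $$ (j,0) = (\<Sum>i\<le>n. c $$ (0,i) * J t $$ (i,j)) * d $$ (0,j)"
        using index_mult_mat_sum[OF c J_carrier, of 0 j t] d by (simp add: lessThan_Suc_atMost)
    qed
    also have "\<dots> = (\<Sum>i\<le>n. \<Sum>j\<le>n. c $$ (0,i) * d $$ (0,j) * J t $$ (i,j))"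
      unfolding sum_distrib_right by (subst sum.swap) (simp add: mult_ac)
    finally show ?thesis by simp
  qed
  finally show "(\<integral>\<omega>. ((c * rs t \<omega>) $$ (0,0) + \<beta> * N t \<omega>) * ((d * rs t \<omega>) $$ (0,0) + \<gamma> * N t \<omega>) \<partial>M) = (c * J t * d\<^sup>T) $$ (0,0) + \<beta> * \<gamma>" .
qed

text \<open>The error is \<open>Ji t\<close> applied to the residual, so its covariance is
  \<open>Ji t * J t * Ji t\<close>, which is \<open>Ji t\<close>.\<close>

lemma error_moments:
  assumes c: "c \<in> carrier_mat 1 (Suc n)" and d: "d \<in> carrier_mat 1 (Suc n)"
  shows "integrable M (\<lambda>\<omega>. ((c * err (wmat \<omega>) (\<lambda>s. N s \<omega>) t) $$ (0,0) + \<beta> * N t \<omega>) * ((d * err (wmat \<omega>) (\<lambda>s. N s \<omega>) t) $$ (0,0) + \<gamma> * N t \<omega>))"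
    "(\<integral>\<omega>. ((c * err (wmat \<omega>) (\<lambda>s. N s \<omega>) t) $$ (0,0) + \<beta> * N t \<omega>) * ((d * err (wmat \<omega>) (\<lambda>s. N s \<omega>) t) $$ (0,0) + \<gamma> * N t \<omega>) \<partial>M)
     = (c * Ji t * d\<^sup>T) $$ (0,0) + \<beta> * \<gamma>"
proof -
  have dm: "dim_row c = 1" "dim_col c = Suc n" "dim_row d = 1" "dim_col d = Suc n" using c d by auto
  have e: "c * err (wmat \<omega>) (\<lambda>s. N s \<omega>) t = (c * Ji t) * rs t \<omega>" if "dim_col c = Suc n" for c \<omega>
    unfolding err_def using that resid_dim[OF wmat] by (simp add: mult_assoc_dim)
  have cc: "c * Ji t \<in> carrier_mat 1 (Suc n)" "d * Ji t \<in> carrier_mat 1 (Suc n)" using c d Ji(1) by auto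
  have "(c * Ji t) * J t * (d * Ji t)\<^sup>T = c * (Ji t * J t) * (Ji t * d\<^sup>T)"
    using dm by (simp add: transpose_mult_dim Ji_sym mult_assoc_dim del: Ji)
  also have "\<dots> = c * Ji t * d\<^sup>T" using dm by (simp add: Ji mult_assoc_dim)
  finally have q: "(c * Ji t) * J t * (d * Ji t)\<^sup>T = c * Ji t * d\<^sup>T" .
  show "integrable M (\<lambda>\<omega>. ((c * err (wmat \<omega>) (\<lambda>s. N s \<omega>) t) $$ (0,0) + \<beta> * N t \<omega>) * ((d * err (wmat \<omega>) (\<lambda>s. N s \<omega>) t) $$ (0,0) + \<gamma> * N t \<omega>))"
    unfolding e[OF dm(2)] e[OF dm(4)] by (rule linear_moments[OF cc])
  show "(\<integral>\<omega>. ((c * err (wmat \<omega>) (\<lambda>s. N s \<omega>) t) $$ (0,0) + \<beta> * N t \<omega>) * ((d * err (wmat \<omega>) (\<lambda>s. N s \<omega>) t) $$ (0,0) + \<gamma> * N t \<omega>) \<partial>M)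
     = (c * Ji t * d\<^sup>T) $$ (0,0) + \<beta> * \<gamma>"
    unfolding e[OF dm(2)] e[OF dm(4)] linear_moments(2)[OF cc] q ..
qed

abbreviation "en t \<omega> \<equiv> innov (wmat \<omega>) (\<lambda>s. N s \<omega>) t"

lemma innovation_moment:
  shows "integrable M (\<lambda>\<omega>. (en t \<omega>)\<^sup>2)" "(\<integral>\<omega>. (en t \<omega>)\<^sup>2 \<partial>M) = K t"
  using error_moments[OF g g, where \<beta> = 1 and \<gamma> = 1] by (simp_all add: innov_def K_def power2_eq_square)

end

section \<open>The law of the innovations\<close>

text \<open>Triangular maps whose shift depends on a first component: the message when observations
  are treated, the innovations when the estimation error is.\<close>

locale tri_pair =
  fixes L :: "'b measure" and b :: "'b \<Rightarrow> nat \<Rightarrow> real" and \<kappa> :: "nat \<Rightarrow> nat \<Rightarrow> real" and T :: nat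
  assumes L: "sigma_finite_measure L" and b: "t \<le> T \<Longrightarrow> (\<lambda>x. b x t) \<in> borel_measurable L"
begin

abbreviation "S \<equiv> L \<Otimes>\<^sub>M lb {..T}"

definition fwd :: "'b \<times> (nat \<Rightarrow> real) \<Rightarrow> 'b \<times> (nat \<Rightarrow> real)" where
  "fwd z = (fst z, tri \<kappa> {..T} (b (fst z)) (snd z))"

definition bwd :: "'b \<times> (nat \<Rightarrow> real) \<Rightarrow> 'b \<times> (nat \<Rightarrow> real)" where
  "bwd z = (fst z, \<lambda>t\<in>{..T}. tri_inv \<kappa> (b (fst z)) (snd z) t)"

lemma fwd_measurable: "fwd \<in> measurable S S"
proof -
  have "(\<lambda>z. tri \<kappa> {..T} (b (fst z)) (snd z)) \<in> measurable S (lb {..T})"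
    using tri_measurable[of T b L \<kappa>, OF b] by (simp add: case_prod_beta')
  then show ?thesis unfolding fwd_def[abs_def] by (intro measurable_Pair measurable_fst)
qed

lemma bwd_measurable: "bwd \<in> measurable S S"
proof -
  have "(\<lambda>z. \<lambda>t\<in>{..T}. tri_inv \<kappa> (b (fst z)) (snd z) t) \<in> measurable S (lb {..T})"
    using tri_inv_measurable[of T b L \<kappa>, OF b] by (simp add: case_prod_beta')
  then show ?thesis unfolding bwd_def[abs_def] by (intro measurable_Pair measurable_fst)
qed

lemma snd_space: "z \<in> space S \<Longrightarrow> snd z \<in> extensional {..T}"
  by (auto simp: space_pair_measure space_PiM PiE_def)

lemma bwd_fwd: "z \<in> space S \<Longrightarrow> bwd (fwd z) = z"
  using snd_space[of z] by (auto simp: bwd_def fwd_def tri_inv_tri fun_eq_iff extensional_def prod_eq_iff)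

lemma fwd_bwd: "z \<in> space S \<Longrightarrow> fwd (bwd z) = z"
proof -
  assume z: "z \<in> space S"
  have "tri \<kappa> {..T} (b (fst z)) (\<lambda>t\<in>{..T}. tri_inv \<kappa> (b (fst z)) (snd z) t) = tri \<kappa> {..T} (b (fst z)) (tri_inv \<kappa> (b (fst z)) (snd z))"
    by (auto simp: tri_def fun_eq_iff)
  then show ?thesis using snd_space[OF z] tri_tri_inv[of _ T \<kappa> "b (fst z)" "snd z"]
    by (auto simp: bwd_def fwd_def fun_eq_iff extensional_def prod_eq_iff tri_def)
qed

lemma nn_integral_fwd: "f \<in> borel_measurable S \<Longrightarrow> (\<integral>\<^sup>+z. f (fwd z) \<partial>S) = (\<integral>\<^sup>+z. f z \<partial>S)"
  unfolding fwd_def by (rule nn_integral_tri_pair[OF L b])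

lemma nn_integral_bwd: "f \<in> borel_measurable S \<Longrightarrow> (\<integral>\<^sup>+z. f (bwd z) \<partial>S) = (\<integral>\<^sup>+z. f z \<partial>S)"
proof -
  assume f: "f \<in> borel_measurable S"
  have "(\<integral>\<^sup>+z. f (bwd z) \<partial>S) = (\<integral>\<^sup>+z. f (bwd (fwd z)) \<partial>S)"
    by (rule nn_integral_fwd[symmetric]) (rule measurable_compose[OF bwd_measurable f])
  also have "\<dots> = (\<integral>\<^sup>+z. f z \<partial>S)" by (rule nn_integral_cong) (simp add: bwd_fwd)
  finally show ?thesis .
qed

lemma distributed_fwd:
  assumes "distributed M S (\<lambda>\<omega>. (X \<omega>, Y \<omega>)) p" "\<And>\<omega>. Y \<omega> = tri \<kappa> {..T} (b (X \<omega>)) (Z \<omega>)" "\<And>\<omega>. Z \<omega> \<in> extensional {..T}"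
  shows "distributed M S (\<lambda>\<omega>. (X \<omega>, Z \<omega>)) (\<lambda>z. p (fwd z))"
proof (rule distributed_change_of_variables[OF assms(1) fwd_measurable bwd_measurable nn_integral_fwd bwd_fwd])
  show "(X \<omega>, Z \<omega>) = bwd (X \<omega>, Y \<omega>)" for \<omega>
    using assms(3)[of \<omega>] by (auto simp: bwd_def assms(2) tri_inv_tri fun_eq_iff extensional_def)
qed

lemma distributed_bwd:
  assumes "distributed M S (\<lambda>\<omega>. (X \<omega>, Z \<omega>)) p" "\<And>\<omega>. Y \<omega> = tri \<kappa> {..T} (b (X \<omega>)) (Z \<omega>)"
  shows "distributed M S (\<lambda>\<omega>. (X \<omega>, Y \<omega>)) (\<lambda>z. p (bwd z))"
  by (rule distributed_change_of_variables[OF assms(1) bwd_measurable fwd_measurable nn_integral_bwd fwd_bwd])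
     (auto simp: fwd_def assms(2))

end

definition normal_prod :: "nat \<Rightarrow> (nat \<Rightarrow> real) \<Rightarrow> (nat \<Rightarrow> real) \<Rightarrow> real" where
  "normal_prod T K z = (\<Prod>t\<le>T. normal_density 0 (sqrt (K t)) (z t))"

lemma normal_prod_measurable [measurable]: "normal_prod T K \<in> borel_measurable (lb {..T})"
  unfolding normal_prod_def by (intro borel_measurable_prod measurable_compose[OF component_measurable]) auto

lemma phi_eq_normal_prod: "phi T z = normal_prod T (\<lambda>_. 1) z"
  by (simp add: phi_def normal_prod_def)

lemma normal_prod_pos: "(\<And>t. 0 < K t) \<Longrightarrow> 0 < normal_prod T K z"
  unfolding normal_prod_def by (intro prod_pos) (simp add: normal_density_pos)

lemma normal_prod_exp:
  assumes "\<And>t. 0 < K t"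
  shows "normal_prod T K z = (1 / sqrt (2 * pi)) ^ Suc T * (\<Prod>t\<le>T. 1 / sqrt (K t)) * exp (- (\<Sum>t\<le>T. (z t)\<^sup>2 / K t) / 2)"
proof -
  have "normal_prod T K z = (\<Prod>t\<le>T. 1 / sqrt (2 * pi) * (1 / sqrt (K t)) * exp (- ((z t)\<^sup>2 / K t) / 2))"
    unfolding normal_prod_def by (rule prod.cong) (use less_imp_le[OF assms] in \<open>simp_all add: normal_density_def real_sqrt_mult mult.commute\<close>)
  also have "\<dots> = (1 / sqrt (2 * pi)) ^ Suc T * (\<Prod>t\<le>T. 1 / sqrt (K t)) * (\<Prod>t\<le>T. exp (- ((z t)\<^sup>2 / K t) / 2))"
    unfolding prod.distrib by simp
  also have "(\<Prod>t\<le>T. exp (- ((z t)\<^sup>2 / K t) / 2)) = exp (\<Sum>t\<le>T. - ((z t)\<^sup>2 / K t) / 2)" by (rule exp_sum[symmetric]) simp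
  also have "(\<Sum>t\<le>T. - ((z t)\<^sup>2 / K t) / 2) = - (\<Sum>t\<le>T. (z t)\<^sup>2 / K t) / 2" by (simp add: sum_divide_distrib sum_negf)
  finally show ?thesis .
qed

lemma ln_normal_prod:
  assumes "\<And>t. 0 < K t"
  shows "ln (normal_prod T K z) = - (\<Sum>t\<le>T. ln (2 * pi * K t) + (z t)\<^sup>2 / K t) / 2"
proof -
  have nz: "normal_density 0 (sqrt (K t)) x \<noteq> 0" for t x
    using normal_density_pos[of "sqrt (K t)" 0 x] assms[of t] by simp
  have "ln (normal_prod T K z) = (\<Sum>t\<le>T. ln (normal_density 0 (sqrt (K t)) (z t)))"
    unfolding normal_prod_def by (rule ln_prod) (use assms nz in auto)
  also have "\<dots> = (\<Sum>t\<le>T. - (ln (2 * pi * K t) + (z t)\<^sup>2 / K t) / 2)"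
    by (rule sum.cong) (use assms less_imp_le[OF assms] in \<open>simp_all add: normal_density_def ln_mult ln_div ln_sqrt algebra_simps diff_divide_distrib add_divide_distrib\<close>)
  also have "\<dots> = - (\<Sum>t\<le>T. ln (2 * pi * K t) + (z t)\<^sup>2 / K t) / 2"
    by (simp only: minus_divide_left[symmetric] sum_negf sum_divide_distrib)
  finally show ?thesis .
qed

lemma nn_integral_normal_prod:
  assumes "\<And>t. 0 < K t"
  shows "(\<integral>\<^sup>+z. ennreal (normal_prod T K z) \<partial>lb {..T}) = 1"
proof -
  have ps: "prob_space (density lborel (normal_density 0 (sqrt (K t))))" for t
    using assms by (simp add: prob_space_normal_density)
  have "Pi\<^sub>M {..T} (\<lambda>t. density lborel (normal_density 0 (sqrt (K t)))) = density (lb {..T}) (\<lambda>x. \<Prod>t\<in>{..T}. ennreal (normal_density 0 (sqrt (K t)) (x t)))"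
    by (rule PiM_density_lborel) (auto intro: prob_space_imp_sigma_finite ps)
  also have "(\<lambda>x. \<Prod>t\<in>{..T}. ennreal (normal_density 0 (sqrt (K t)) (x t))) = (\<lambda>x. ennreal (normal_prod T K x))"
    by (simp add: normal_prod_def prod_ennreal normal_density_nonneg)
  finally have e: "Pi\<^sub>M {..T} (\<lambda>t. density lborel (normal_density 0 (sqrt (K t)))) = density (lb {..T}) (\<lambda>x. ennreal (normal_prod T K x))" .
  interpret P: prob_space "density (lb {..T}) (\<lambda>x. ennreal (normal_prod T K x))"
    unfolding e[symmetric] by (rule prob_space_PiM[OF ps])
  have "emeasure (density (lb {..T}) (\<lambda>x. ennreal (normal_prod T K x))) (space (lb {..T})) = 1" using P.emeasure_space_1 by simp
  then show ?thesis by (subst (asm) emeasure_density) (auto simp: nn_integral_set_ennreal[symmetric] cong: nn_integral_cong)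
qed

context gauss_obs
begin

text \<open>The shift that recovers the noise from an observation by removing the message
  term.\<close>

definition bw :: "(nat \<Rightarrow> real) \<Rightarrow> nat \<Rightarrow> real" where "bw w t = - (\<Sum>i\<le>n. g t $$ (0,i) * w i)"

lemma bw_measurable: "(\<lambda>w. bw w t) \<in> borel_measurable (lb {..n})"
  unfolding bw_def by (intro borel_measurable_uminus borel_measurable_sum borel_measurable_times borel_measurable_const component_measurable)

lemma bw_rv: "bw (rv_upto W n \<omega>) t = - (g t * wmat \<omega>) $$ (0,0)"
  using index_mult_mat_sum[OF g wmat, of 0 0 t \<omega>] by (simp add: bw_def rv_upto_def lessThan_Suc_atMost wmat_def)

lemma tri_pair_bw: "tri_pair (lb {..n}) bw T"
  by (rule tri_pair.intro[OF sigma_finite_lb bw_measurable])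

text \<open>Serves the innovations with kernel \<open>ker\<close> and the feedback-free observation
  with kernel 0.\<close>

lemma observation_distributed:
  assumes "\<And>t \<omega>. t \<le> T \<Longrightarrow> N t \<omega> = Z t \<omega> + (\<Sum>s<t. \<kappa> t s * Z s \<omega>) - (g t * wmat \<omega>) $$ (0,0)"
  shows "distributed M (lb {..n} \<Otimes>\<^sub>M lb {..T}) (\<lambda>\<omega>. (rv_upto W n \<omega>, rv_upto Z T \<omega>))
    (\<lambda>(w, z). ennreal (phi n w * phi T (tri \<kappa> {..T} (bw w) z)))"
proof -
  interpret tri_pair "lb {..n}" bw \<kappa> T by (rule tri_pair_bw)
  have "distributed M S (\<lambda>\<omega>. (rv_upto W n \<omega>, rv_upto Z T \<omega>)) (\<lambda>z. (\<lambda>(w, v). ennreal (phi n w * phi T v)) (fwd z))"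
    by (rule distributed_fwd[OF message_noise_distributed[OF mn]])
       (auto simp: rv_upto_def tri_def fun_eq_iff assms bw_rv[unfolded rv_upto_def])
  then show ?thesis by (simp add: fwd_def case_prod_beta')
qed

definition ker :: "nat \<Rightarrow> nat \<Rightarrow> real" where "ker t s = (g t * (Ji s * (g s)\<^sup>T)) $$ (0,0) / K s"

definition wm :: "(nat \<Rightarrow> real) \<Rightarrow> real mat" where "wm w = mat (Suc n) 1 (\<lambda>(i, j). w i)"

lemma wm: "wm w \<in> carrier_mat (Suc n) 1" by (simp add: wm_def)

lemma bw_wm: "bw w t = - (g t * wm w) $$ (0,0)"
  using index_mult_mat_sum[OF g wm, of 0 0 t w] by (simp add: bw_def lessThan_Suc_atMost wm_def)

text \<open>Converse of \<open>innov_noise\<close>: a triangular system has a unique solution, so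
  the coordinates \<open>z\<close> from which the noise is built are its innovations.\<close>

lemma innov_ker:
  assumes "\<And>t. t \<le> T \<Longrightarrow> v t = z t + (\<Sum>s<t. ker t s * z s) + bw w t" and "t \<le> T"
  shows "innov (wm w) v t = z t"
  using assms(2)
proof (induction t rule: less_induct)
  case (less t)
  have "(\<Sum>s<t. ker t s * innov (wm w) v s) = (\<Sum>s<t. ker t s * z s)"
    by (rule sum.cong) (use less in auto)
  then show ?case using innov_noise[OF wm, of v t w] assms(1)[OF less.prems] by (simp add: ker_def bw_wm)
qed

text \<open>The least squares estimate of the message as a function of the innovations; compare
  \<open>err_sum\<close>.\<close>

definition mu :: "nat \<Rightarrow> (nat \<Rightarrow> real) \<Rightarrow> nat \<Rightarrow> real" where
  "mu T z i = (\<Sum>s\<le>T. z s / K s * (Ji s * (g s)\<^sup>T) $$ (i,0))"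

text \<open>The centred Gaussian density with covariance \<open>Ji (Suc T)\<close>: by
  \<open>det_J\<close> the product is the square root of the determinant of the precision.\<close>

definition qd :: "nat \<Rightarrow> (nat \<Rightarrow> real) \<Rightarrow> real" where
  "qd T x = (1 / sqrt (2 * pi)) ^ Suc n * (\<Prod>t\<le>T. sqrt (K t)) * exp (- ((wm x)\<^sup>T * (J (Suc T) * wm x)) $$ (0,0) / 2)"

lemma K_pos: "0 < K t" using K_ge_1[of t] by simp

text \<open>Completing the square in the message.\<close>
lemma joint_density_factor:
  "phi n w * phi T (tri ker {..T} (bw w) z) = qd T (\<lambda>i. w i - mu T z i) * normal_prod T K z"
proof -
  define v where "v = tri ker {..T} (bw w) z"
  have in_z: "innov (wm w) v t = z t" if "t \<le> T" for t
    by (rule innov_ker[of T]) (use that in \<open>auto simp: v_def tri_def\<close>)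
  have err: "err (wm w) v (Suc T) = wm (\<lambda>i. w i - mu T z i)"
    unfolding err_sum[OF wm] using in_z by (intro eq_matI) (auto simp: wm_def mu_def lessThan_Suc_atMost)
  have "(\<Sum>i<Suc n. (wm w $$ (i,0))\<^sup>2) + (\<Sum>s<Suc T. (v s)\<^sup>2) =
    ((wm (\<lambda>i. w i - mu T z i))\<^sup>T * (J (Suc T) * wm (\<lambda>i. w i - mu T z i))) $$ (0,0) + (\<Sum>s<Suc T. (innov (wm w) v s)\<^sup>2 / K s)"
    unfolding innov_quadratic[OF wm] err ..
  also have "(\<Sum>s<Suc T. (innov (wm w) v s)\<^sup>2 / K s) = (\<Sum>s\<le>T. (z s)\<^sup>2 / K s)"
    unfolding lessThan_Suc_atMost by (rule sum.cong) (simp_all add: in_z)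
  also have "(\<Sum>i<Suc n. (wm w $$ (i,0))\<^sup>2) = (\<Sum>i\<le>n. (w i)\<^sup>2)"
    unfolding lessThan_Suc_atMost by (rule sum.cong) (simp_all add: wm_def)
  finally have q: "(\<Sum>i\<le>n. (w i)\<^sup>2) + (\<Sum>s\<le>T. (v s)\<^sup>2) =
    ((wm (\<lambda>i. w i - mu T z i))\<^sup>T * (J (Suc T) * wm (\<lambda>i. w i - mu T z i))) $$ (0,0) + (\<Sum>s\<le>T. (z s)\<^sup>2 / K s)"
    unfolding lessThan_Suc_atMost .
  define Q where "Q = ((wm (\<lambda>i. w i - mu T z i))\<^sup>T * (J (Suc T) * wm (\<lambda>i. w i - mu T z i))) $$ (0,0)"
  have K1: "(\<Prod>t\<le>T. sqrt (K t)) * (\<Prod>t\<le>T. 1 / sqrt (K t)) = 1"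
    unfolding prod.distrib[symmetric] using K_pos by (intro prod.neutral) (auto simp: less_imp_neq[OF K_pos, symmetric])
  have "exp (- (\<Sum>i\<le>n. (w i)\<^sup>2) / 2) * exp (- (\<Sum>s\<le>T. (v s)\<^sup>2) / 2) = exp (- ((\<Sum>i\<le>n. (w i)\<^sup>2) + (\<Sum>s\<le>T. (v s)\<^sup>2)) / 2)"
    unfolding exp_add[symmetric] by (simp add: field_simps)
  also have "\<dots> = exp (- Q / 2) * exp (- (\<Sum>s\<le>T. (z s)\<^sup>2 / K s) / 2)"
    unfolding q Q_def[symmetric] exp_add[symmetric] by (simp add: field_simps)
  finally have e: "exp (- (\<Sum>i\<le>n. (w i)\<^sup>2) / 2) * exp (- (\<Sum>s\<le>T. (v s)\<^sup>2) / 2) = exp (- Q / 2) * exp (- (\<Sum>s\<le>T. (z s)\<^sup>2 / K s) / 2)" .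
  have "phi n w * phi T v = (1 / sqrt (2 * pi)) ^ Suc n * (1 / sqrt (2 * pi)) ^ Suc T *
     (exp (- (\<Sum>i\<le>n. (w i)\<^sup>2) / 2) * exp (- (\<Sum>s\<le>T. (v s)\<^sup>2) / 2))"
    unfolding phi_exp by (simp only: mult_ac)
  also have "\<dots> = (1 / sqrt (2 * pi)) ^ Suc n * (1 / sqrt (2 * pi)) ^ Suc T *
     ((\<Prod>t\<le>T. sqrt (K t)) * (\<Prod>t\<le>T. 1 / sqrt (K t))) * (exp (- Q / 2) * exp (- (\<Sum>s\<le>T. (z s)\<^sup>2 / K s) / 2))"
    unfolding e K1 by simp
  also have "\<dots> = qd T (\<lambda>i. w i - mu T z i) * normal_prod T K z"
    unfolding qd_def normal_prod_exp[OF K_pos] Q_def[symmetric] by (simp only: mult_ac)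
  finally show ?thesis unfolding v_def .
qed

text \<open>A difference such as \<open>w i - mu T z i\<close> need not be extensional; only the
  entries up to \<open>n\<close> count.\<close>

lemma qd_restrict: "qd T (\<lambda>i\<in>{..n}. x i) = qd T x"
proof -
  have "wm (\<lambda>i\<in>{..n}. x i) = wm x" by (rule eq_matI) (auto simp: wm_def)
  then show ?thesis by (simp add: qd_def)
qed

lemma qd_nonneg: "0 \<le> qd T x"
  unfolding qd_def using K_pos by (intro mult_nonneg_nonneg prod_nonneg) (auto simp: less_imp_le)

lemma qd_measurable: "qd T \<in> borel_measurable (lb {..n})"
proof -
  have e: "((wm x)\<^sup>T * (J (Suc T) * wm x)) $$ (0,0) = (\<Sum>i\<le>n. x i * (\<Sum>j\<le>n. J (Suc T) $$ (i,j) * x j))" for x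
  proof -
    have c: "(wm x)\<^sup>T \<in> carrier_mat 1 (Suc n)" using wm[of x] by simp
    have d: "J (Suc T) * wm x \<in> carrier_mat (Suc n) 1" using J_carrier wm by (rule mult_carrier_mat)
    have "((wm x)\<^sup>T * (J (Suc T) * wm x)) $$ (0,0) = (\<Sum>i<Suc n. (wm x)\<^sup>T $$ (0,i) * (J (Suc T) * wm x) $$ (i,0))"
      by (rule index_mult_mat_sum[OF c d]) auto
    also have "\<dots> = (\<Sum>i<Suc n. x i * (\<Sum>j<Suc n. J (Suc T) $$ (i,j) * x j))"
    proof (rule sum.cong[OF refl])
      fix i assume i: "i \<in> {..<Suc n}"
      have "(J (Suc T) * wm x) $$ (i,0) = (\<Sum>j<Suc n. J (Suc T) $$ (i,j) * wm x $$ (j,0))"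
        by (rule index_mult_mat_sum[OF J_carrier wm]) (use i in auto)
      then show "(wm x)\<^sup>T $$ (0,i) * (J (Suc T) * wm x) $$ (i,0) = x i * (\<Sum>j<Suc n. J (Suc T) $$ (i,j) * x j)"
        using i by (simp add: wm_def del: precision.simps)
    qed
    finally show ?thesis unfolding lessThan_Suc_atMost .
  qed
  have "(\<lambda>x. - (\<Sum>i\<le>n. x i * (\<Sum>j\<le>n. J (Suc T) $$ (i,j) * x j)) / 2) \<in> borel_measurable (lb {..n})"
    by (intro borel_measurable_divide borel_measurable_uminus borel_measurable_sum borel_measurable_times borel_measurable_const component_measurable)
  then show ?thesis unfolding qd_def e
    by (intro borel_measurable_times borel_measurable_const measurable_compose[OF _ borel_measurable_exp])
qed

text \<open>Translating the message by \<open>mu T z\<close>, a triangular map with kernel 0,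
  removes \<open>z\<close> from the error factor.\<close>

lemma marginal_factor:
  "(\<integral>\<^sup>+w. ennreal (phi n w * phi T (tri ker {..T} (bw w) z)) \<partial>lb {..n}) =
   (\<integral>\<^sup>+w. ennreal (qd T w) \<partial>lb {..n}) * ennreal (normal_prod T K z)"
proof -
  have np: "0 \<le> normal_prod T K z" by (rule less_imp_le[OF normal_prod_pos[OF K_pos]])
  have e: "ennreal (phi n w * phi T (tri ker {..T} (bw w) z)) =
    ennreal (qd T (tri (\<lambda>_ _. 0) {..n} (\<lambda>i. - mu T z i) w)) * ennreal (normal_prod T K z)" for w
    unfolding joint_density_factor ennreal_mult'[OF qd_nonneg] ennreal_mult'[OF np, symmetric] by (simp add: tri_def qd_restrict ennreal_mult' np)
  show ?thesis unfolding e
    by (subst nn_integral_multc, (rule measurable_compose[OF _ measurable_ennreal], rule measurable_compose[OF _ qd_measurable]), simp add: tri_def measurable_restrict_lborel component_measurable)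
       (subst nn_integral_tri, use qd_measurable in auto)
qed

lemma innovations_joint:
  "distributed M (lb {..n} \<Otimes>\<^sub>M lb {..T}) (\<lambda>\<omega>. (rv_upto W n \<omega>, rv_upto en T \<omega>))
    (\<lambda>(w, z). ennreal (phi n w * phi T (tri ker {..T} (bw w) z)))"
  by (rule observation_distributed) (use innov_noise[OF wmat] in \<open>simp add: ker_def\<close>)

text \<open>The joint law has mass one and so has the product density of the innovations; the
  remaining constant must be 1, without evaluating the integral.\<close>

lemma qd_normalized: "(\<integral>\<^sup>+w. ennreal (qd T w) \<partial>lb {..n}) = 1"
proof -
  let ?c = "\<integral>\<^sup>+w. ennreal (qd T w) \<partial>lb {..n}"
  have D: "distributed M (lb {..T}) (rv_upto en T) (\<lambda>z. ?c * ennreal (normal_prod T K z))"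
    using distr_marginal2[OF sigma_finite_lb sigma_finite_lb innovations_joint] by (simp add: marginal_factor)
  have "1 = emeasure (distr M (lb {..T}) (rv_upto en T)) (space (lb {..T}))"
    using prob_space.emeasure_space_1[OF prob_space_distr[OF distributed_measurable[OF D]]] by simp
  also have "\<dots> = (\<integral>\<^sup>+z. ?c * ennreal (normal_prod T K z) \<partial>lb {..T})"
    unfolding distributed_distr_eq_density[OF D]
    by (subst emeasure_density) (auto cong: nn_integral_cong)
  also have "\<dots> = ?c"
    by (subst nn_integral_cmult) (auto simp: nn_integral_normal_prod[OF K_pos])
  finally show ?thesis ..
qed

lemma marginal:
  "(\<integral>\<^sup>+w. ennreal (phi n w * phi T (tri ker {..T} (bw w) z)) \<partial>lb {..n}) = ennreal (normal_prod T K z)"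
  unfolding marginal_factor qd_normalized by simp

lemma innovations_distributed: "distributed M (lb {..T}) (rv_upto en T) (\<lambda>z. ennreal (normal_prod T K z))"
  using distr_marginal2[OF sigma_finite_lb sigma_finite_lb innovations_joint] by (simp add: marginal)

end

section \<open>Entropy and mutual information\<close>

context gauss_obs
begin

sublocale information_space M 2 by unfold_locales simp

lemma expectation_innov_sum:
  "integrable M (\<lambda>\<omega>. \<Sum>t\<le>T. ln (2 * pi * K t) + (en t \<omega>)\<^sup>2 / K t)"
  "(\<integral>\<omega>. (\<Sum>t\<le>T. ln (2 * pi * K t) + (en t \<omega>)\<^sup>2 / K t) \<partial>M) = (\<Sum>t\<le>T. ln (2 * pi * K t) + 1)"
proof -
  have i: "integrable M (\<lambda>\<omega>. ln (2 * pi * K t) + (en t \<omega>)\<^sup>2 / K t)" for t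
    by (intro Bochner_Integration.integrable_add integrable_const integrable_divide innovation_moment)
  show "integrable M (\<lambda>\<omega>. \<Sum>t\<le>T. ln (2 * pi * K t) + (en t \<omega>)\<^sup>2 / K t)"
    by (intro Bochner_Integration.integrable_sum i)
  have e: "(\<integral>\<omega>. ln (2 * pi * K t) + (en t \<omega>)\<^sup>2 / K t \<partial>M) = ln (2 * pi * K t) + 1" for t
    using innovation_moment[of t] less_imp_neq[OF K_pos[of t]] by (simp add: prob_space)
  show "(\<integral>\<omega>. (\<Sum>t\<le>T. ln (2 * pi * K t) + (en t \<omega>)\<^sup>2 / K t) \<partial>M) = (\<Sum>t\<le>T. ln (2 * pi * K t) + 1)"
    by (subst Bochner_Integration.integral_sum) (auto simp: e i)
qed

lemma expectation_noise_sum: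
  "integrable M (\<lambda>\<omega>. \<Sum>t\<le>T. ln (2 * pi * 1) + (N t \<omega>)\<^sup>2 / 1)"
  "(\<integral>\<omega>. (\<Sum>t\<le>T. ln (2 * pi * 1) + (N t \<omega>)\<^sup>2 / 1) \<partial>M) = (\<Sum>t\<le>T. ln (2 * pi) + 1)"
proof -
  have i: "integrable M (\<lambda>\<omega>. ln (2 * pi * 1) + (N t \<omega>)\<^sup>2 / 1)" for t
    unfolding power2_eq_square
    by (intro Bochner_Integration.integrable_add integrable_const integrable_divide residual_moments)
  show "integrable M (\<lambda>\<omega>. \<Sum>t\<le>T. ln (2 * pi * 1) + (N t \<omega>)\<^sup>2 / 1)"
    by (intro Bochner_Integration.integrable_sum i)
  have e: "(\<integral>\<omega>. ln (2 * pi * 1) + (N t \<omega>)\<^sup>2 / 1 \<partial>M) = ln (2 * pi) + 1" for t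
    using residual_moments(5,6)[of t] by (simp add: prob_space power2_eq_square)
  show "(\<integral>\<omega>. (\<Sum>t\<le>T. ln (2 * pi * 1) + (N t \<omega>)\<^sup>2 / 1) \<partial>M) = (\<Sum>t\<le>T. ln (2 * pi) + 1)"
    by (subst Bochner_Integration.integral_sum) (simp_all add: e[simplified] i[simplified])
qed

lemma ln_2_pi_K: "ln (2 * pi * K t) = ln (2 * pi) + ln (K t)"
  by (rule ln_mult_pos) (simp_all add: K_pos)

lemma normal_prod_rv: "normal_prod T \<kappa> (rv_upto X T \<omega>) = normal_prod T \<kappa> (\<lambda>t. X t \<omega>)"
  unfolding normal_prod_def by (rule prod.cong) (simp_all add: rv_upto_def)

text \<open>Entropy is the mean of the negative logarithm of the density, here an affine function of
  the squared innovations, whose means are known.\<close>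

lemma diff_entropy_innovations:
  "diff_entropy M T en = (\<Sum>t\<le>T. log 2 (K t)) / 2 + (real T + 1) * (log 2 (2 * pi * exp 1) / 2)"
proof -
  have np: "0 \<le> normal_prod T K z" for z by (rule less_imp_le[OF normal_prod_pos[OF K_pos]])
  have "diff_entropy M T en = - (\<integral>z. normal_prod T K z * log 2 (normal_prod T K z) \<partial>lb {..T})"
    unfolding diff_entropy_def by (rule entropy_distr[OF innovations_distributed np])
  also have "(\<integral>z. normal_prod T K z * log 2 (normal_prod T K z) \<partial>lb {..T}) =
      (\<integral>\<omega>. log 2 (normal_prod T K (rv_upto en T \<omega>)) \<partial>M)"
    by (rule distributed_integral[OF innovations_distributed _ np]) simp
  also have "(\<lambda>\<omega>. log 2 (normal_prod T K (rv_upto en T \<omega>))) = (\<lambda>\<omega>. - (1 / (2 * ln 2)) * (\<Sum>t\<le>T. ln (2 * pi * K t) + (en t \<omega>)\<^sup>2 / K t))"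
    unfolding normal_prod_rv log_def ln_normal_prod[OF K_pos] by (simp add: fun_eq_iff diff_divide_distrib add_divide_distrib)
  also have "(\<integral>\<omega>. - (1 / (2 * ln 2)) * (\<Sum>t\<le>T. ln (2 * pi * K t) + (en t \<omega>)\<^sup>2 / K t) \<partial>M) = - (1 / (2 * ln 2)) * (\<Sum>t\<le>T. ln (2 * pi * K t) + 1)"
    by (subst integral_mult_right_zero, subst expectation_innov_sum(2)) simp
  \<comment> \<open>Each normalized square has mean 1, which turns into the factor
    \<open>exp 1\<close> under the logarithm.\<close>
  also have "(\<Sum>t\<le>T. ln (2 * pi * K t) + 1) = (\<Sum>t\<le>T. ln (K t)) + (real T + 1) * ln (2 * pi * exp 1)"
    unfolding ln_2_pi_K ln_mult_pos[OF _ exp_gt_zero, of "2 * pi", simplified] by (simp add: sum.distrib algebra_simps)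
  finally show ?thesis
    by (simp add: log_def sum_divide_distrib[symmetric] add_divide_distrib)
qed

text \<open>In the information density the message density cancels, leaving the noise density over
  the innovation density. The quadratic terms of both have mean 1 per sample, so only the logarithms
  of \<open>K\<close> remain, whatever the causal kernel \<kappa>.\<close>

lemma mutual_info_observation:
  assumes Y: "\<And>t \<omega>. Y t \<omega> = en t \<omega> + (\<Sum>s<t. \<kappa> t s * en s \<omega>)"
  shows "mutual_info M n W T Y = (\<Sum>t\<le>T. log 2 (K t)) / 2"
proof -
  interpret tri_pair "lb {..n}" "\<lambda>_ _. 0" \<kappa> T
    by (rule tri_pair.intro[OF sigma_finite_lb]) simp
  let ?S = "lb {..n} \<Otimes>\<^sub>M lb {..T}"
  define Pe where "Pe z = phi n (fst z) * phi T (tri ker {..T} (bw (fst z)) (snd z))" for z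
  \<comment> \<open>Recovers the innovations from the output by forward substitution.\<close>
  define h where "h y = (\<lambda>t\<in>{..T}. tri_inv \<kappa> (\<lambda>_. 0) y t)" for y
  have Ye: "rv_upto Y T \<omega> = tri \<kappa> {..T} (\<lambda>_. 0) (rv_upto en T \<omega>)" for \<omega>
    by (auto simp: rv_upto_def tri_def fun_eq_iff Y)
  have bw: "bwd z = (fst z, h (snd z))" for z by (simp add: bwd_def h_def)
  have hY: "h (rv_upto Y T \<omega>) = rv_upto en T \<omega>" for \<omega>
    unfolding h_def Ye by (auto simp: fun_eq_iff tri_inv_tri rv_upto_def)
  have Pe0: "0 \<le> Pe z" for z unfolding Pe_def by (simp add: less_imp_le[OF phi_pos])
  have je: "distributed M ?S (\<lambda>\<omega>. (rv_upto W n \<omega>, rv_upto en T \<omega>)) (\<lambda>z. ennreal (Pe z))"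
    using innovations_joint[of T] by (simp add: Pe_def case_prod_beta')
  have jy: "distributed M ?S (\<lambda>\<omega>. (rv_upto W n \<omega>, rv_upto Y T \<omega>)) (\<lambda>z. ennreal (Pe (fst z, h (snd z))))"
    using distributed_bwd[OF je Ye] by (simp add: bw)
  have Dy: "distributed M (lb {..T}) (rv_upto Y T) (\<lambda>y. ennreal (normal_prod T K (h y)))"
    using distr_marginal2[OF sigma_finite_lb sigma_finite_lb jy] by (simp add: Pe_def marginal)
  have laws: "rv_upto W n \<in> measurable M (borel_upto n)" by (rule indep_var_rv1[OF message_noise_laws(1)[OF mn]])
  have s1: "sets (borel_upto k) = sets (lb {..k})" for k by (rule sets_PiM_cong) auto
  have dn: "distr M (borel_upto k) X = distr M (lb {..k}) X" for k and X :: "'a \<Rightarrow> nat \<Rightarrow> real"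
    by (rule distr_cong[OF refl s1]) simp
  have Dw: "distributed M (lb {..n}) (rv_upto W n) (\<lambda>w. ennreal (phi n w))"
    using message_noise_laws(2)[OF mn] laws unfolding distributed_def dn PiM_std_normal measurable_cong_sets[OF refl s1]
    by simp
  have nn: "0 \<le> phi n w" "0 \<le> normal_prod T K z" for w z
    by (rule less_imp_le[OF phi_pos], rule less_imp_le[OF normal_prod_pos[OF K_pos]])
  have "mutual_info M n W T Y = mutual_information 2 (lb {..n}) (lb {..T}) (rv_upto W n) (rv_upto Y T)"
    unfolding mutual_info_def mutual_information_def dn
    by (rule arg_cong[where f = "KL_divergence 2 _"], rule distr_cong[OF refl _ refl], intro sets_pair_measure_cong s1)
  also have "\<dots> = (\<integral>z. Pe (fst z, h (snd z)) * log 2 (Pe (fst z, h (snd z)) / (phi n (fst z) * normal_prod T K (h (snd z)))) \<partial>?S)"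
    by (rule mutual_information_distr[OF sigma_finite_lb sigma_finite_lb Dw _ Dy _ jy]) (auto intro: nn Pe0)
  also have "\<dots> = (\<integral>\<omega>. log 2 (Pe (rv_upto W n \<omega>, h (rv_upto Y T \<omega>)) / (phi n (rv_upto W n \<omega>) * normal_prod T K (h (rv_upto Y T \<omega>)))) \<partial>M)"
  proof -
    have m1: "(\<lambda>z. Pe (fst z, h (snd z))) \<in> borel_measurable ?S"
      by (rule distributed_real_measurable[OF _ jy]) (rule Pe0)
    have m2: "(\<lambda>z. phi n (fst z)) \<in> borel_measurable ?S" by measurable
    have m3: "(\<lambda>z. normal_prod T K (h (snd z))) \<in> borel_measurable ?S"
      by (rule measurable_compose[OF measurable_snd distributed_real_measurable[OF _ Dy]]) (rule nn)
    have "(\<lambda>z. log 2 (Pe (fst z, h (snd z)) / (phi n (fst z) * normal_prod T K (h (snd z))))) \<in> borel_measurable ?S"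
      using m1 m2 m3 by measurable
    from distributed_integral[OF jy this Pe0] show ?thesis by simp
  qed
  also have "\<dots> = (\<integral>\<omega>. 1 / (2 * ln 2) * ((\<Sum>t\<le>T. ln (2 * pi * K t) + (en t \<omega>)\<^sup>2 / K t) - (\<Sum>t\<le>T. ln (2 * pi * 1) + (N t \<omega>)\<^sup>2 / 1)) \<partial>M)"
  proof (rule Bochner_Integration.integral_cong[OF refl])
    fix \<omega>
    \<comment> \<open>Evaluated at the actual signals, the triangular map returns the noise.\<close>
    have tr: "tri ker {..T} (bw (rv_upto W n \<omega>)) (rv_upto en T \<omega>) = rv_upto N T \<omega>"
      using innov_noise[OF wmat, of "\<lambda>s. N s \<omega>"] by (auto simp: tri_def rv_upto_def fun_eq_iff bw_rv[unfolded rv_upto_def] ker_def)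
    have "Pe (rv_upto W n \<omega>, h (rv_upto Y T \<omega>)) / (phi n (rv_upto W n \<omega>) * normal_prod T K (h (rv_upto Y T \<omega>))) =
        phi T (rv_upto N T \<omega>) / normal_prod T K (rv_upto en T \<omega>)"
      unfolding hY Pe_def fst_conv snd_conv tr using phi_pos[of n "rv_upto W n \<omega>"] by simp
    also have "\<dots> = normal_prod T (\<lambda>_. 1) (\<lambda>t. N t \<omega>) / normal_prod T K (\<lambda>t. en t \<omega>)"
      unfolding phi_eq_normal_prod normal_prod_rv ..
    finally have q: "Pe (rv_upto W n \<omega>, h (rv_upto Y T \<omega>)) / (phi n (rv_upto W n \<omega>) * normal_prod T K (h (rv_upto Y T \<omega>))) =
       normal_prod T (\<lambda>_. 1) (\<lambda>t. N t \<omega>) / normal_prod T K (\<lambda>t. en t \<omega>)" .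
    have one: "0 < normal_prod T (\<lambda>_. 1) z" for z by (rule normal_prod_pos) simp
    have ln_one: "ln (normal_prod T (\<lambda>_. 1) z) = - (\<Sum>t\<le>T. ln (2 * pi * 1) + (z t)\<^sup>2 / 1) / 2" for z
      by (rule ln_normal_prod) simp
    show "log 2 (Pe (rv_upto W n \<omega>, h (rv_upto Y T \<omega>)) / (phi n (rv_upto W n \<omega>) * normal_prod T K (h (rv_upto Y T \<omega>)))) =
       1 / (2 * ln 2) * ((\<Sum>t\<le>T. ln (2 * pi * K t) + (en t \<omega>)\<^sup>2 / K t) - (\<Sum>t\<le>T. ln (2 * pi * 1) + (N t \<omega>)\<^sup>2 / 1))"
      unfolding q log_def ln_divide_pos[OF one normal_prod_pos[of K, OF K_pos]]
        ln_normal_prod[of K, OF K_pos] ln_one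
      by (simp add: field_simps)
  qed
  also have "\<dots> = 1 / (2 * ln 2) * ((\<Sum>t\<le>T. ln (2 * pi * K t) + 1) - (\<Sum>t\<le>T. ln (2 * pi) + 1))"
    unfolding integral_mult_right_zero
    by (subst Bochner_Integration.integral_diff[OF expectation_innov_sum(1) expectation_noise_sum(1)])
       (simp only: expectation_innov_sum expectation_noise_sum)
  also have "(\<Sum>t\<le>T. ln (2 * pi * K t) + 1) - (\<Sum>t\<le>T. ln (2 * pi) + 1) = (\<Sum>t\<le>T. ln (K t))"
    unfolding sum_subtractf[symmetric] ln_2_pi_K by simp
  finally show ?thesis by (simp add: log_def sum_divide_distrib[symmetric])
qed

end

section \<open>The minimum mean-squared error\<close>

context gauss_obs
begin

text \<open>The estimation error. By \<open>joint_density_factor\<close> it is independent of the innovations, so \<open>mu\<close> is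
  the conditional mean of the message.\<close>
definition xe :: "nat \<Rightarrow> nat \<Rightarrow> 'a \<Rightarrow> real" where
  "xe T i \<omega> = W i \<omega> - mu T (\<lambda>t. en t \<omega>) i"

lemma xe_err: "i \<le> n \<Longrightarrow> xe T i \<omega> = err (wmat \<omega>) (\<lambda>s. N s \<omega>) (Suc T) $$ (i,0)"
  unfolding err_sum[OF wmat] by (simp add: xe_def mu_def wmat_def lessThan_Suc_atMost)

lemma mu_rv: "mu T (rv_upto en T \<omega>) = mu T (\<lambda>t. en t \<omega>)"
  by (auto simp: mu_def rv_upto_def fun_eq_iff intro!: sum.cong)

lemma mu_measurable: "(\<lambda>z. mu T z i) \<in> borel_measurable (lb {..T})"
  unfolding mu_def
  by (intro borel_measurable_sum borel_measurable_times borel_measurable_divide borel_measurable_const component_measurable) auto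

text \<open>Shifting the message by the estimate, with the innovations as first component, separates
  the joint density into two factors; this is the source of independence.\<close>

lemma xe_innovations_joint:
  "distributed M (lb {..T} \<Otimes>\<^sub>M lb {..n}) (\<lambda>\<omega>. (rv_upto en T \<omega>, rv_upto (xe T) n \<omega>))
    (\<lambda>(e, x). ennreal (normal_prod T K e) * ennreal (qd T x))"
proof -
  interpret tri_pair "lb {..T}" "mu T" "\<lambda>_ _. 0" n
    by (rule tri_pair.intro[OF sigma_finite_lb mu_measurable])
  have "distributed M S (\<lambda>\<omega>. (rv_upto en T \<omega>, rv_upto W n \<omega>)) (\<lambda>(e, w). ennreal (qd T (\<lambda>i. w i - mu T e i) * normal_prod T K e))"
    using distributed_swap[OF sigma_finite_lb sigma_finite_lb innovations_joint[of T]] by (simp add: joint_density_factor case_prod_beta')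
  then have "distributed M S (\<lambda>\<omega>. (rv_upto en T \<omega>, rv_upto (xe T) n \<omega>))
      (\<lambda>z. (\<lambda>(e, w). ennreal (qd T (\<lambda>i. w i - mu T e i) * normal_prod T K e)) (fwd z))"
    by (rule distributed_fwd) (auto simp: rv_upto_def[of _ n] tri_def mu_rv xe_def fun_eq_iff)
  also have "(\<lambda>z. (\<lambda>(e, w). ennreal (qd T (\<lambda>i. w i - mu T e i) * normal_prod T K e)) (fwd z)) =
     (\<lambda>(e, x). ennreal (normal_prod T K e) * ennreal (qd T x))"
  proof (rule ext, clarsimp simp: fwd_def)
    fix e x
    have "qd T (\<lambda>i. tri (\<lambda>_ _. 0) {..n} (mu T e) x i - mu T e i) = qd T (\<lambda>i\<in>{..n}. tri (\<lambda>_ _. 0) {..n} (mu T e) x i - mu T e i)"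
      by (rule qd_restrict[symmetric])
    also have "(\<lambda>i\<in>{..n}. tri (\<lambda>_ _. 0) {..n} (mu T e) x i - mu T e i) = (\<lambda>i\<in>{..n}. x i)" by (auto simp: tri_def)
    finally have "qd T (\<lambda>i. tri (\<lambda>_ _. 0) {..n} (mu T e) x i - mu T e i) = qd T x" unfolding qd_restrict .
    then show "ennreal (qd T (\<lambda>i. tri (\<lambda>_ _. 0) {..n} (mu T e) x i - mu T e i) * normal_prod T K e) = ennreal (normal_prod T K e) * ennreal (qd T x)"
      using less_imp_le[OF normal_prod_pos[OF K_pos]] by (simp add: ennreal_mult' qd_nonneg mult.commute)
  qed
  finally show ?thesis .
qed

lemma xe_innovations_indep: "indep_var (lb {..T}) (rv_upto en T) (lb {..n}) (rv_upto (xe T) n)"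
proof -
  note D = xe_innovations_joint[of T]
  have X: "distributed M (lb {..n}) (rv_upto (xe T) n) (\<lambda>x. ennreal (qd T x))"
    using distr_marginal2[OF sigma_finite_lb sigma_finite_lb D]
    by (simp add: nn_integral_multc nn_integral_normal_prod[OF K_pos])
  note E = innovations_distributed[of T]
  have sf: "sigma_finite_measure (density (lb {..n}) (\<lambda>x. ennreal (qd T x)))"
    unfolding distributed_distr_eq_density[OF X, symmetric]
    by (rule prob_space_imp_sigma_finite[OF prob_space_distr[OF distributed_measurable[OF X]]])
  show ?thesis
    unfolding indep_var_distribution_eq distributed_distr_eq_density[OF X] distributed_distr_eq_density[OF E] distributed_distr_eq_density[OF D]
    using distributed_measurable[OF X] distributed_measurable[OF E] qd_measurable
    by (subst pair_measure_density) (auto intro: sigma_finite_lb sf measurable_compose[OF _ measurable_ennreal])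
qed

lemma xe_mean:
  assumes i: "i \<le> n"
  shows "integrable M (xe T i)" "(\<integral>\<omega>. xe T i \<omega> \<partial>M) = 0"
proof -
  note laws = message_noise_laws[OF mn]
  note W = std_normal_product_moments(3,4)[OF laws(2) indep_var_rv1[OF laws(1)]]
  note N = std_normal_product_moments(3,4)[OF laws(3) indep_var_rv2[OF laws(1)]]
  have Ni: "integrable M (N s)" "(\<integral>\<omega>. N s \<omega> \<partial>M) = 0" for s using N[of s s s] by auto
  have rs: "integrable M (\<lambda>\<omega>. rs t \<omega> $$ (j,0))" "(\<integral>\<omega>. rs t \<omega> $$ (j,0) \<partial>M) = 0" if j: "j \<le> n" for t j
  proof -
    note W = W[OF j j]
    have i2: "integrable M (\<lambda>\<omega>. \<Sum>s<t. N s \<omega> * g s $$ (0,j))"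
      by (intro Bochner_Integration.integrable_sum integrable_mult_left Ni)
    show "integrable M (\<lambda>\<omega>. rs t \<omega> $$ (j,0))"
      unfolding rs_entry[OF j] by (intro Bochner_Integration.integrable_diff W i2)
    have "(\<integral>\<omega>. (\<Sum>s<t. N s \<omega> * g s $$ (0,j)) \<partial>M) = 0"
      by (subst Bochner_Integration.integral_sum) (auto intro!: integrable_mult_left Ni simp: Ni)
    then show "(\<integral>\<omega>. rs t \<omega> $$ (j,0) \<partial>M) = 0"
      unfolding rs_entry[OF j] using W i2 by simp
  qed
  have rc: "rs t \<omega> \<in> carrier_mat (Suc n) 1" for t \<omega> by (rule carrier_matI) (simp_all add: resid_dim[OF wmat])
  have "xe T i \<omega> = (\<Sum>j\<le>n. Ji (Suc T) $$ (i,j) * rs (Suc T) \<omega> $$ (j,0))" for \<omega>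
    unfolding xe_err[OF i] err_def lessThan_Suc_atMost[symmetric]
    by (rule index_mult_mat_sum[OF Ji(1) rc]) (use i in auto)
  then have e: "xe T i = (\<lambda>\<omega>. \<Sum>j\<le>n. Ji (Suc T) $$ (i,j) * rs (Suc T) \<omega> $$ (j,0))" ..
  show "integrable M (xe T i)" unfolding e by (intro Bochner_Integration.integrable_sum integrable_mult_right rs) auto
  show "(\<integral>\<omega>. xe T i \<omega> \<partial>M) = 0" unfolding e
    by (subst Bochner_Integration.integral_sum, intro integrable_mult_right rs) (auto simp: rs simp del: resid.simps intro!: sum.neutral)
qed

lemma xe_moment:
  assumes i: "i \<le> n" and j: "j \<le> n"
  shows "(\<integral>\<omega>. xe T i \<omega> * xe T j \<omega> \<partial>M) = Ji (Suc T) $$ (i,j)"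
proof -
  define c :: "nat \<Rightarrow> real mat" where "c i = mat 1 (Suc n) (\<lambda>(_, j). if j = i then 1 else 0)" for i
  have c: "c i \<in> carrier_mat 1 (Suc n)" for i by (simp add: c_def)
  have cX: "(c i * X) $$ (0,r) = X $$ (i,r)" if "i \<le> n" "r < l" "X \<in> carrier_mat (Suc n) l" for i X r l
  proof -
    have "(c i * X) $$ (0,r) = (\<Sum>j<Suc n. c i $$ (0,j) * X $$ (j,r))" by (rule index_mult_mat_sum[OF c that(3)]) (use that in auto)
    also have "\<dots> = (\<Sum>j<Suc n. if j = i then X $$ (j,r) else 0)" by (rule sum.cong) (auto simp: c_def)
    finally show ?thesis using that(1) by (simp add: sum.delta less_Suc_eq_le del: sum.lessThan_Suc)
  qed
  have ec: "err (wmat \<omega>) (\<lambda>s. N s \<omega>) t \<in> carrier_mat (Suc n) 1" for t \<omega> by (rule carrier_matI) (simp_all add: err_dim[OF wmat])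
  have cJ: "c i * Ji t \<in> carrier_mat 1 (Suc n)" for i t using c Ji(1) by (rule mult_carrier_mat)
  have "(\<integral>\<omega>. xe T i \<omega> * xe T j \<omega> \<partial>M) = (c i * Ji (Suc T) * (c j)\<^sup>T) $$ (0,0)"
    using error_moments(2)[OF c c, of i "Suc T" 0 j 0] by (simp add: cX[OF i _ ec] cX[OF j _ ec] xe_err i j)
  also have "\<dots> = (\<Sum>l<Suc n. (c i * Ji (Suc T)) $$ (0,l) * (c j)\<^sup>T $$ (l,0))"
    by (rule index_mult_mat_sum[OF cJ, of "(c j)\<^sup>T" 1]) (use c[of j] in simp_all)
  also have "\<dots> = (\<Sum>l<Suc n. if l = j then Ji (Suc T) $$ (i,l) else 0)"
    by (rule sum.cong) (use c[of j] in \<open>auto simp: cX[OF i _ Ji(1)], auto simp: c_def\<close>)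
  finally show ?thesis using j by (simp add: sum.delta less_Suc_eq_le del: sum.lessThan_Suc)
qed

text \<open>The observation and the innovations determine each other causally, so both generate the
  same events. On each of them the error integrates to 0, being centred and independent of the
  innovations, which characterizes \<open>mu\<close> as conditional mean.\<close>

lemma MSE_eq:
  assumes Z: "\<And>t \<omega>. t \<le> T \<Longrightarrow> Z t \<omega> = (g t * wmat \<omega>) $$ (0,0) + N t \<omega>"
  shows "MSE M n W T Z = Ji (Suc T)"
proof -
  define F where "F = vimage_algebra (space M) (rv_upto Z T) (borel_upto T)"
  have Ze: "rv_upto Z T \<omega> = tri ker {..T} (\<lambda>_. 0) (rv_upto en T \<omega>)" for \<omega>
  proof -
    have "Z t \<omega> = en t \<omega> + (\<Sum>s<t. ker t s * en s \<omega>)" if "t \<le> T" for t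
      using innov_noise[OF wmat[of \<omega>], of "\<lambda>s. N s \<omega>" t] Z[OF that, of \<omega>] unfolding ker_def by linarith
    then show ?thesis by (auto simp: tri_def rv_upto_def fun_eq_iff)
  qed
  define h where "h y = (\<lambda>t\<in>{..T}. tri_inv ker (\<lambda>_. 0) y t)" for y
  have eZ: "rv_upto en T \<omega> = h (rv_upto Z T \<omega>)" for \<omega>
    unfolding h_def Ze by (auto simp: fun_eq_iff tri_inv_tri rv_upto_def)
  \<comment> \<open>A trivial first component yields the measurability of the triangular map and of
    its inverse on a single factor.\<close>
  interpret tp: tri_pair "count_space UNIV :: unit measure" "\<lambda>_ _. 0" ker T
    by (rule tri_pair.intro) (auto intro: sigma_finite_measure_count_space_finite)
  have sets_eq: "sets (borel_upto T) = sets (lb {..T})" by (rule sets_PiM_cong) auto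
  have pm: "(\<lambda>y. ((), y)) \<in> measurable (lb {..T}) (count_space UNIV \<Otimes>\<^sub>M lb {..T})" by simp
  have hm: "h \<in> measurable (lb {..T}) (lb {..T})"
    using measurable_compose[OF measurable_compose[OF pm tp.bwd_measurable] measurable_snd] by (simp add: tp.bwd_def h_def[abs_def])
  have tm: "tri ker {..T} (\<lambda>_. 0) \<in> measurable (lb {..T}) (lb {..T})"
    using measurable_compose[OF measurable_compose[OF pm tp.fwd_measurable] measurable_snd] by (simp add: tp.fwd_def)
  have em: "rv_upto en T \<in> measurable M (lb {..T})" by (rule distributed_measurable[OF innovations_distributed])
  have Zm: "rv_upto Z T \<in> measurable M (borel_upto T)"
    unfolding measurable_cong_sets[OF refl sets_eq] Ze[abs_def] by (rule measurable_compose[OF em tm])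
  have sub: "subalgebra M F" unfolding subalgebra_def F_def
    using measurable_sets[OF Zm] measurable_space[OF Zm] by (auto simp: sets_vimage_algebra2)
  interpret F: finite_measure_subalgebra M F by unfold_locales (rule sub)
  have ZF: "rv_upto Z T \<in> measurable F (borel_upto T)"
    unfolding F_def by (rule measurable_vimage_algebra1) (use measurable_space[OF Zm] in auto)
  have muF: "(\<lambda>\<omega>. mu T (\<lambda>t. en t \<omega>) i) \<in> borel_measurable F" for i
  proof -
    have "(\<lambda>\<omega>. mu T (h (rv_upto Z T \<omega>)) i) \<in> borel_measurable F"
      by (rule measurable_compose[OF ZF measurable_compose[OF _ mu_measurable]]) (use hm measurable_cong_sets[OF sets_eq refl] in simp)
    then show ?thesis unfolding eZ[symmetric] mu_rv .
  qed
  have AEm: "AE \<omega> in M. real_cond_exp M F (W i) \<omega> = mu T (\<lambda>t. en t \<omega>) i" if i: "i \<le> n" for i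
  proof (rule F.real_cond_exp_charact)
    note laws = message_noise_laws[OF mn]
    show Wi: "integrable M (W i)" by (rule std_normal_product_moments(3)[OF laws(2) indep_var_rv1[OF laws(1)] i i])
    note xi = xe_mean[OF i, of T]
    have m_eq: "mu T (\<lambda>t. en t \<omega>) i = W i \<omega> - xe T i \<omega>" for \<omega> by (simp add: xe_def)
    show mi: "integrable M (\<lambda>\<omega>. mu T (\<lambda>t. en t \<omega>) i)" unfolding m_eq using Wi xi by simp
    show "(\<lambda>\<omega>. mu T (\<lambda>t. en t \<omega>) i) \<in> borel_measurable F" by (rule muF)
    fix A assume A: "A \<in> sets F"
    then have AM: "A \<in> sets M" using sub by (auto simp: subalgebra_def)
    obtain B where B: "B \<in> sets (borel_upto T)" "A = rv_upto Z T -` B \<inter> space M"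
      using A measurable_space[OF Zm] unfolding F_def by (subst (asm) sets_vimage_algebra2) auto
    \<comment> \<open>The same event expressed through the innovations.\<close>
    define B' where "B' = tri ker {..T} (\<lambda>_. 0) -` B \<inter> space (lb {..T})"
    have B': "B' \<in> sets (lb {..T})" unfolding B'_def by (rule measurable_sets[OF tm]) (use B sets_eq in simp)
    have ind: "indep_var borel (indicator B' \<circ> rv_upto en T :: 'a \<Rightarrow> real) borel ((\<lambda>x. x i) \<circ> rv_upto (xe T) n)"
      by (rule indep_var_compose[OF xe_innovations_indep]) (use i B' in auto)
    have c1: "(\<lambda>x. x i) \<circ> rv_upto (xe T) n = xe T i" using i by (auto simp: rv_upto_def)
    have c2: "indicator A \<omega> = (indicator B' \<circ> rv_upto en T) \<omega>" if "\<omega> \<in> space M" for \<omega>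
      using that measurable_space[OF em that] unfolding B(2) B'_def Ze by (auto simp: indicator_def)
    have ii: "integrable M (indicator B' \<circ> rv_upto en T :: 'a \<Rightarrow> real)"
      by (rule integrable_const_bound[of _ 1]) (use measurable_compose[OF em, of "indicator B'" borel] B' in \<open>auto simp: comp_def indicator_def\<close>)
    have "(\<integral>\<omega>\<in>A. xe T i \<omega> \<partial>M) = (\<integral>\<omega>. (indicator B' \<circ> rv_upto en T) \<omega> * xe T i \<omega> \<partial>M)"
      unfolding set_lebesgue_integral_def by (rule Bochner_Integration.integral_cong) (auto simp: c2)
    also have "\<dots> = 0" using indep_var_lebesgue_integral[OF ind ii] xi unfolding c1 by simp
    finally have 0: "(\<integral>\<omega>\<in>A. xe T i \<omega> \<partial>M) = 0" .
    have si: "set_integrable M A f" if "integrable M f" for f :: "'a \<Rightarrow> real"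
      unfolding set_integrable_def by (rule integrable_mult_indicator[OF AM that])
    have "(\<integral>\<omega>\<in>A. W i \<omega> - xe T i \<omega> \<partial>M) = (\<integral>\<omega>\<in>A. W i \<omega> \<partial>M) - (\<integral>\<omega>\<in>A. xe T i \<omega> \<partial>M)"
      by (rule set_integral_diff(2)[OF si[OF Wi] si[OF xi(1)]])
    then show "(\<integral>\<omega>\<in>A. W i \<omega> \<partial>M) = (\<integral>\<omega>\<in>A. mu T (\<lambda>t. en t \<omega>) i \<partial>M)" unfolding m_eq 0 by simp
  qed
  have "(\<integral>\<omega>. (W i \<omega> - real_cond_exp M F (W i) \<omega>) * (W j \<omega> - real_cond_exp M F (W j) \<omega>) \<partial>M) = Ji (Suc T) $$ (i,j)"
    if ij: "i \<le> n" "j \<le> n" for i j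
  proof -
    have Wm: "W i \<in> borel_measurable M" "W j \<in> borel_measurable M" using W_measurable ij by auto
    have cm: "real_cond_exp M F f \<in> borel_measurable M" for f by (rule borel_measurable_cond_exp2)
    have xm: "xe T i \<in> borel_measurable M" "xe T j \<in> borel_measurable M"
      using xe_mean(1)[OF ij(1)] xe_mean(1)[OF ij(2)] by auto
    have "(\<integral>\<omega>. (W i \<omega> - real_cond_exp M F (W i) \<omega>) * (W j \<omega> - real_cond_exp M F (W j) \<omega>) \<partial>M) = (\<integral>\<omega>. xe T i \<omega> * xe T j \<omega> \<partial>M)"
    proof (rule integral_cong_AE)
      show "AE \<omega> in M. (W i \<omega> - real_cond_exp M F (W i) \<omega>) * (W j \<omega> - real_cond_exp M F (W j) \<omega>) = xe T i \<omega> * xe T j \<omega>"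
        using AEm[OF ij(1)] AEm[OF ij(2)] by eventually_elim (simp add: xe_def)
    qed (use Wm cm xm in simp_all)
    then show ?thesis using xe_moment[OF ij] by simp
  qed
  then show ?thesis unfolding MSE_def Let_def F_def[symmetric] by (intro eq_matI) auto
qed

end

section \<open>The Bayesian Fisher information\<close>

lemma emeasure_lborel_open_pos:
  assumes "open U" "x \<in> U" shows "0 < emeasure lborel (U :: real set)"
proof -
  obtain a b where ab: "a < x" "x < b" "{a..b} \<subseteq> U"
    using openE[OF assms] by (metis cball_eq_atLeastAtMost centre_in_ball dual_order.strict_trans2 open_contains_cball assms add_less_same_cancel1 diff_less_eq less_add_same_cancel1 diff_gt_0_iff_gt)
  have "0 < emeasure lborel {a..b}" using ab by simp
  also have "\<dots> \<le> emeasure lborel U" by (rule emeasure_mono) (use ab assms in auto)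
  finally show ?thesis .
qed

text \<open>Open sets refer to all coordinates, the measure only to those up to \<open>T\<close>.
  Extensional points agree outside this range, so a basic neighbourhood restricts to a box of
  positive measure.\<close>

lemma open_nbhd_contains_box:
  fixes z :: "nat \<Rightarrow> real"
  assumes "open V" "z \<in> V" "z \<in> extensional {..T}"
  obtains B where "B \<in> sets (lb {..T})" "z \<in> B" "B \<subseteq> V" "0 < emeasure (lb {..T}) B"
proof -
  obtain X where X: "z \<in> Pi\<^sub>E UNIV X" "\<And>i. open (X i)" "Pi\<^sub>E UNIV X \<subseteq> V"
    using product_topology_open_contains_basis[of "\<lambda>_. euclidean" UNIV V z] assms(1,2)
    by (auto simp: open_fun_def)
  define B where "B = Pi\<^sub>E {..T} X"
  have "Pi\<^sub>E {..T} X \<subseteq> Pi\<^sub>E UNIV X"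
  proof
    fix y assume y: "y \<in> Pi\<^sub>E {..T} X"
    have "y i \<in> X i" for i
    proof (cases "i \<le> T")
      case False
      then have "y i = z i" using y assms(3) by (auto simp: PiE_def extensional_def)
      then show ?thesis using X(1) by (auto simp: PiE_def)
    qed (use y in \<open>auto simp: PiE_def\<close>)
    then show "y \<in> Pi\<^sub>E UNIV X" by auto
  qed
  then have "B \<subseteq> V" using X(3) by (simp add: B_def)
  moreover have "z \<in> B" using X(1) assms(3) by (auto simp: B_def PiE_def)
  moreover have "B \<in> sets (lb {..T})" unfolding B_def by (rule sets_PiM_I_finite) (use X(2) in auto)
  moreover have "0 < emeasure (lb {..T}) B"
    unfolding B_def using X(1) emeasure_lborel_open_pos[OF X(2)]
    by (subst lbp.emeasure_PiM) (use X(2) in \<open>auto simp: prod_pos zero_less_iff_neq_zero PiE_def Pi_def intro!: prod_zero_iff[THEN iffD1]\<close>)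
  ultimately show ?thesis using that by blast
qed

text \<open>If two continuous versions differed at a point, they would differ on a box around it,
  and boxes are not null sets.\<close>

lemma continuous_density_unique:
  fixes p f :: "(nat \<Rightarrow> real) \<times> (nat \<Rightarrow> real) \<Rightarrow> real"
  assumes ae: "AE z in lb {..T} \<Otimes>\<^sub>M lb {..n}. p z = f z"
    and p: "continuous_on (space (lb {..T}) \<times> space (lb {..n})) p"
    and f: "continuous_on (space (lb {..T}) \<times> space (lb {..n})) f"
    and x: "x \<in> space (lb {..T})" "y \<in> space (lb {..n})"
  shows "p (x, y) = f (x, y)"
proof (rule ccontr)
  let ?E = "space (lb {..T}) \<times> space (lb {..n})"
  assume "p (x, y) \<noteq> f (x, y)"
  then have nz: "p (x, y) - f (x, y) \<noteq> 0" by simp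
  have "continuous_on ?E (\<lambda>z. p z - f z)" using p f by (intro continuous_intros)
  then obtain O' where O': "open O'" "O' \<inter> ?E = (\<lambda>z. p z - f z) -` (- {0}) \<inter> ?E"
    unfolding continuous_on_open_invariant by (meson open_Compl closed_singleton)
  have "(x, y) \<in> O'" using O'(2) nz x by auto
  then obtain V1 V2 where V: "open V1" "open V2" "x \<in> V1" "y \<in> V2" "V1 \<times> V2 \<subseteq> O'"
    using open_prod_elim[OF O'(1)] by (metis SigmaE2)
  have ext: "x \<in> extensional {..T}" "y \<in> extensional {..n}" using x by (auto simp: space_PiM PiE_def)
  obtain B1 where B1: "B1 \<in> sets (lb {..T})" "B1 \<subseteq> V1" "0 < emeasure (lb {..T}) B1"
    using open_nbhd_contains_box[OF V(1,3) ext(1)] by metis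
  obtain B2 where B2: "B2 \<in> sets (lb {..n})" "B2 \<subseteq> V2" "0 < emeasure (lb {..n}) B2"
    using open_nbhd_contains_box[OF V(2,4) ext(2)] by metis
  have "emeasure (lb {..T} \<Otimes>\<^sub>M lb {..n}) (B1 \<times> B2) = emeasure (lb {..T}) B1 * emeasure (lb {..n}) B2"
    by (rule sigma_finite_measure.emeasure_pair_measure_Times[OF sigma_finite_lb B1(1) B2(1)])
  then have pos: "0 < emeasure (lb {..T} \<Otimes>\<^sub>M lb {..n}) (B1 \<times> B2)" using B1(3) B2(3) by (simp add: ennreal_zero_less_mult_iff)
  have "B1 \<times> B2 \<subseteq> ?E" using sets.sets_into_space[OF B1(1)] sets.sets_into_space[OF B2(1)] by auto
  then have ne: "\<forall>z \<in> B1 \<times> B2. p z \<noteq> f z" using O'(2) V(5) B1(2) B2(2) by fastforce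
  have "B1 \<times> B2 \<in> null_sets (lb {..T} \<Otimes>\<^sub>M lb {..n})"
    by (rule iffD2[OF AE_iff_null_sets]) (use B1 B2 ne ae in \<open>auto elim!: eventually_mono\<close>)
  then show False using pos by auto
qed

context gauss_obs
begin

text \<open>An explicit continuous version of the joint density, in the argument order of
  \<open>joint_density\<close>.\<close>

abbreviation fj :: "nat \<Rightarrow> (nat \<Rightarrow> real) \<times> (nat \<Rightarrow> real) \<Rightarrow> real" where
  "fj T \<equiv> \<lambda>(z, w). phi n w * phi T (tri (\<lambda>_ _. 0) {..T} (bw w) z)"

lemma fj_eq: "fj T (z, w) = phi n w * phi T (\<lambda>t. z t + bw w t)"
  by (simp add: phi_def tri_def)

lemma continuous_fj: "continuous_on S (fj T)"
proof -
  have c: "continuous_on S (\<lambda>x. fst x i)" "continuous_on S (\<lambda>x. snd x i)" for i and S :: "((nat \<Rightarrow> real) \<times> (nat \<Rightarrow> real)) set"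
    by (rule continuous_on_product_then_coordinatewise, intro continuous_intros)+
  have s: "continuous_on S (\<lambda>x. std_normal_density (f x))" if "continuous_on S f" for f :: "(nat \<Rightarrow> real) \<times> (nat \<Rightarrow> real) \<Rightarrow> real" and S
    unfolding std_normal_density_def using that by (intro continuous_intros) auto
  have "fj T = (\<lambda>x. phi n (snd x) * phi T (\<lambda>t. fst x t + bw (snd x) t))" using fj_eq by force
  then show ?thesis unfolding phi_def bw_def
    by (simp only:) (intro continuous_intros s c)
qed

context
  fixes T :: nat and Z :: "nat \<Rightarrow> 'a \<Rightarrow> real"
  assumes Z: "\<And>t \<omega>. t \<le> T \<Longrightarrow> Z t \<omega> = (g t * wmat \<omega>) $$ (0,0) + N t \<omega>"
begin

text \<open>The choice operator may select any continuous version; it agrees with \<open>fj\<close>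
  almost everywhere, hence by continuity everywhere.\<close>

lemma joint_density_eq:
  assumes "z \<in> space (lb {..T})" "w \<in> space (lb {..n})"
  shows "joint_density M n W T Z (z, w) = fj T (z, w)"
proof -
  let ?P = "\<lambda>p. distributed M (lb {..T} \<Otimes>\<^sub>M lb {..n}) (\<lambda>\<omega>. (rv_upto Z T \<omega>, rv_upto W n \<omega>)) (\<lambda>z. ennreal (p z)) \<and>
              continuous_on (space (lb {..T}) \<times> space (lb {..n})) p"
  have "distributed M (lb {..n} \<Otimes>\<^sub>M lb {..T}) (\<lambda>\<omega>. (rv_upto W n \<omega>, rv_upto Z T \<omega>))
    (\<lambda>(w, z). ennreal (phi n w * phi T (tri (\<lambda>_ _. 0) {..T} (bw w) z)))"
    by (rule observation_distributed) (simp add: Z del: index_mult_mat)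
  from distributed_swap[OF sigma_finite_lb sigma_finite_lb this]
  have D: "distributed M (lb {..T} \<Otimes>\<^sub>M lb {..n}) (\<lambda>\<omega>. (rv_upto Z T \<omega>, rv_upto W n \<omega>)) (\<lambda>z. ennreal (fj T z))"
    by (simp add: case_prod_beta')
  have eq: "joint_density M n W T Z = (SOME p. ?P p)" by (simp only: joint_density_def)
  have P: "?P (joint_density M n W T Z)" unfolding eq by (rule someI[of ?P "fj T"]) (use D continuous_fj in blast)
  have fpos: "0 < fj T z" for z by (cases z) (simp add: phi_pos)
  have "AE z in lb {..T} \<Otimes>\<^sub>M lb {..n}. ennreal (joint_density M n W T Z z) = ennreal (fj T z)"
    by (rule distributed_unique[OF conjunct1[OF P] D])
  \<comment> \<open>The embedding into \<open>ennreal\<close> cuts negative values to 0, which the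
    positivity of \<open>fj\<close> rules out.\<close>
  then have "AE z in lb {..T} \<Otimes>\<^sub>M lb {..n}. joint_density M n W T Z z = fj T z"
  proof eventually_elim
    case (elim z)
    then show ?case using fpos[of z] by (cases "0 \<le> joint_density M n W T Z z") (auto simp: ennreal_neg)
  qed
  from continuous_density_unique[OF this conjunct2[OF P] continuous_fj assms] show ?thesis .
qed

text \<open>The logarithm of the density is quadratic in each message entry. Its derivative at the
  true message is the negative residual, so the Fisher information is the covariance of the
  residual.\<close>

lemma score_eq:
  assumes i: "i \<le> n"
  shows "score M n W T Z i \<omega> = - rs (Suc T) \<omega> $$ (i,0)"
proof -
  let ?w = "rv_upto W n \<omega>" and ?z = "rv_upto Z T \<omega>"
  have sp: "?z \<in> space (lb {..T})" "?w(i := c) \<in> space (lb {..n})" for c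
    using i by (auto simp: space_PiM rv_upto_def PiE_def extensional_def)
  have ln_phi: "ln (phi m x) = - (\<Sum>l\<le>m. ln (2 * pi * 1) + (x l)\<^sup>2 / 1) / 2" for m x
    unfolding phi_eq_normal_prod by (rule ln_normal_prod) simp
  have bwc: "bw (?w(i := c)) t = bw ?w t - g t $$ (0,i) * (c - W i \<omega>)" for c t
  proof -
    have "(\<Sum>l\<le>n. g t $$ (0,l) * (?w(i := c)) l) = (\<Sum>l\<le>n. g t $$ (0,l) * ?w l + (if l = i then g t $$ (0,i) * (c - W i \<omega>) else 0))"
      by (rule sum.cong) (use i in \<open>auto simp: rv_upto_def algebra_simps\<close>)
    then show ?thesis using i by (simp add: bw_def sum.distrib)
  qed
  have wc: "(\<Sum>l\<le>n. ((?w(i := c)) l)\<^sup>2) = (\<Sum>l\<le>n. (?w l)\<^sup>2) + (c\<^sup>2 - (W i \<omega>)\<^sup>2)" for c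
  proof -
    have "(\<Sum>l\<le>n. ((?w(i := c)) l)\<^sup>2) = (\<Sum>l\<le>n. (?w l)\<^sup>2 + (if l = i then c\<^sup>2 - (W i \<omega>)\<^sup>2 else 0))"
      by (rule sum.cong) (use i in \<open>auto simp: rv_upto_def\<close>)
    then show ?thesis using i by (simp add: sum.distrib)
  qed
  have zN: "?z t + bw ?w t = N t \<omega>" if "t \<le> T" for t
    using that unfolding bw_rv by (simp add: rv_upto_def Z)
  have "ln (joint_density M n W T Z (?z, ?w(i := c))) =
      - ((\<Sum>l\<le>n. ln (2 * pi)) + ((\<Sum>l\<le>n. (?w l)\<^sup>2) + (c\<^sup>2 - (W i \<omega>)\<^sup>2))) / 2
      - ((\<Sum>t\<le>T. ln (2 * pi)) + (\<Sum>t\<le>T. (N t \<omega> - g t $$ (0,i) * (c - W i \<omega>))\<^sup>2)) / 2" for c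
  proof -
    have "(\<Sum>t\<le>T. (?z t + bw (?w(i := c)) t)\<^sup>2) = (\<Sum>t\<le>T. (N t \<omega> - g t $$ (0,i) * (c - W i \<omega>))\<^sup>2)"
      by (rule sum.cong) (simp_all add: bwc zN[symmetric] algebra_simps)
    then show ?thesis
      unfolding joint_density_eq[OF sp] fj_eq ln_mult_pos[OF phi_pos phi_pos] ln_phi wc[symmetric]
      by (simp add: sum.distrib add_divide_distrib diff_divide_distrib)
  qed
  moreover have "((\<lambda>c. - ((\<Sum>l\<le>n. ln (2 * pi)) + ((\<Sum>l\<le>n. (?w l)\<^sup>2) + (c\<^sup>2 - (W i \<omega>)\<^sup>2))) / 2
      - ((\<Sum>t\<le>T. ln (2 * pi)) + (\<Sum>t\<le>T. (N t \<omega> - g t $$ (0,i) * (c - W i \<omega>))\<^sup>2)) / 2)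
     has_real_derivative - W i \<omega> + (\<Sum>t\<le>T. N t \<omega> * g t $$ (0,i))) (at (W i \<omega>))"
    by (rule derivative_eq_intros refl | simp add: sum_divide_distrib sum_negf[symmetric] mult.commute)+
  ultimately have "score M n W T Z i \<omega> = - W i \<omega> + (\<Sum>t\<le>T. N t \<omega> * g t $$ (0,i))"
    unfolding score_def by (simp only: DERIV_imp_deriv)
  then show ?thesis unfolding rs_entry[OF i] lessThan_Suc_atMost by simp
qed

lemma fisher_info_eq: "fisher_info M n W T Z = J (Suc T)"
  unfolding fisher_info_def
  by (rule eq_matI) (simp_all add: score_eq residual_moments(2)[of _ _ "Suc T"] del: precision.simps resid.simps)

lemma CRB_eq: "CRB M n W T Z = Ji (Suc T)"
  unfolding CRB_def fisher_info_eq Ji_def ..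

end

end

section \<open>Asymptotic rates\<close>

lemma cesaro_mean:
  fixes X :: "nat \<Rightarrow> real"
  assumes X: "X \<longlonglongrightarrow> L"
  shows "(\<lambda>T. (\<Sum>t\<le>T. X t) / (real T + 1)) \<longlonglongrightarrow> L"
proof (rule LIMSEQ_I)
  fix r :: real assume r: "0 < r"
  obtain m where m: "\<And>t. t \<ge> m \<Longrightarrow> \<bar>X t - L\<bar> < r / 2"
    using LIMSEQ_D[OF X, of "r / 2"] r by auto
  define B where "B = (\<Sum>t<m. \<bar>X t - L\<bar>)"
  have B0: "0 \<le> B" unfolding B_def by (rule sum_nonneg) simp
  \<comment> \<open>From horizon \<open>k\<close> on, the finitely many early deviations contribute
    less than half of \<open>r\<close> to the mean.\<close>
  obtain k :: nat where k: "2 * B / r < real k" using reals_Archimedean2 by blast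
  show "\<exists>no. \<forall>T\<ge>no. norm ((\<Sum>t\<le>T. X t) / (real T + 1) - L) < r"
  proof (intro exI allI impI)
    fix T assume T: "max k m \<le> T"
    have "(\<Sum>t\<le>T. X t) / (real T + 1) - L = (\<Sum>t\<le>T. X t - L) / (real T + 1)"
      by (simp add: sum_subtractf field_simps)
    then have "\<bar>(\<Sum>t\<le>T. X t) / (real T + 1) - L\<bar> = \<bar>\<Sum>t\<le>T. X t - L\<bar> / (real T + 1)" by simp
    also have "\<dots> \<le> (\<Sum>t\<le>T. \<bar>X t - L\<bar>) / (real T + 1)"
      by (rule divide_right_mono) (auto intro: sum_abs)
    also have "(\<Sum>t\<le>T. \<bar>X t - L\<bar>) \<le> (\<Sum>t\<le>T. (if t < m then \<bar>X t - L\<bar> else 0) + r / 2)"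
      by (rule sum_mono) (use m r in \<open>auto simp: not_less intro: less_imp_le\<close>)
    also have "\<dots> = (\<Sum>t\<le>T. if t < m then \<bar>X t - L\<bar> else 0) + (real T + 1) * (r / 2)"
      by (simp add: sum.distrib algebra_simps)
    also have "(\<Sum>t\<le>T. if t < m then \<bar>X t - L\<bar> else 0) = B"
      unfolding B_def by (rule sum.mono_neutral_cong_right) (use T in auto)
    finally have "\<bar>(\<Sum>t\<le>T. X t) / (real T + 1) - L\<bar> \<le> (B + (real T + 1) * (r / 2)) / (real T + 1)"
      by (simp add: divide_right_mono)
    moreover have "B < (real T + 1) * (r / 2)"
    proof -
      have "B < real k * (r / 2)" using k r by (simp add: field_simps)
      also have "\<dots> \<le> (real T + 1) * (r / 2)" using T r by (intro mult_right_mono) auto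
      finally show ?thesis .
    qed
    moreover from this have "(B + (real T + 1) * (r / 2)) / (real T + 1) < r"
      by (simp add: pos_divide_less_eq field_simps)
    ultimately show "norm ((\<Sum>t\<le>T. X t) / (real T + 1) - L) < r" by simp
  qed
qed

lemma (in obs_rows) log_det_J: "log 2 (det (J (Suc T))) = (\<Sum>t\<le>T. log 2 (K t))"
proof -
  have "K t \<noteq> 0" for t using K_ge_1[of t] by simp
  then show ?thesis unfolding det_J lessThan_Suc_atMost log_def by (simp add: ln_prod sum_divide_distrib)
qed

lemma (in obs_rows) log_det_Ji: "log 2 (det (Ji t)) = - log 2 (det (J t))"
proof -
  have "det (J t) * det (Ji t) = 1" using det_mult[OF J_carrier Ji(1), of t t] by (simp add: Ji del: precision.simps)
  then have "det (Ji t) = inverse (det (J t))" by (metis inverse_unique)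
  then show ?thesis using det_J_pos[of t] by (simp add: log_inverse)
qed

theorem proposition6:
  fixes M :: "'a measure" and W N :: "nat \<Rightarrow> 'a \<Rightarrow> real"
    and p q :: "real poly" and F G H A C :: "real mat" and m n :: nat
    and AA CC DD \<Sigma> :: "real mat" and y e u :: "nat \<Rightarrow> 'a \<Rightarrow> real"
    and ybar :: "nat \<Rightarrow> nat \<Rightarrow> 'a \<Rightarrow> real"
  assumes "channel_tf p q"
    and "m \<ge> 1"
    and "minimal_realization m F G H 1 q p"
    and "stable_mat F"
    and "admissible n F A C"
    and "message_and_noise M n W N"
  defines "AA \<equiv> blockA F G A C"
    and "CC \<equiv> blockC H C"
    and "DD \<equiv> blockD H C"
    and "\<Sigma> \<equiv> Sigma_inf AA CC"
    and "y \<equiv> proc_y F G H A C W N"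
    and "e \<equiv> proc_e F G H A C W N"
    and "u \<equiv> proc_u F G H A C W N"
    and "ybar \<equiv> est_obs (impulse_response p q) A C n W N"
  shows "(\<exists>!S. stabilizing_solution AA CC S) \<and>
    (\<exists>R h.
      (\<lambda>T. mutual_info M n W T y / (real T + 1)) \<longlonglongrightarrow> R \<and>
      has_entropy_rate M e h \<and>
      R = h - 1 / 2 * log 2 (2 * pi * exp 1) \<and>
      R = log 2 (DI A) \<and>
      R = (LINT \<theta>:{-1/2..1/2}|lborel. log 2 (cmod (sensitivity AA CC (cis (2 * pi * \<theta>))))) \<and>
      R = 1 / 2 * log 2 ((CC * \<Sigma> * CC\<^sup>T) $$ (0,0) + 1) \<and>
      (\<lambda>T. log 2 (det (fisher_info M n W T (ybar T))) / (2 * (real T + 1))) \<longlonglongrightarrow> R \<and>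
      (\<lambda>T. log 2 (det (MSE M n W T (ybar T))) / (2 * (real T + 1))) \<longlonglongrightarrow> - R \<and>
      (\<lambda>T. log 2 (det (CRB M n W T (ybar T))) / (2 * (real T + 1))) \<longlonglongrightarrow> - R) \<and>
    (\<lambda>T. (\<integral>\<omega>. (\<Sum>t\<le>T. (u t \<omega>)\<^sup>2) \<partial>M) / (real T + 1)) \<longlonglongrightarrow> (DD * \<Sigma> * DD\<^sup>T) $$ (0,0)"
proof -
  have re: "realizes m F G H 1 q p" using assms(3) by (simp add: minimal_realization_def)
  have FGH: "F \<in> carrier_mat m m" "G \<in> carrier_mat m 1" "H \<in> carrier_mat 1 m" using re by (auto simp: realizes_def)
  have AC: "A \<in> carrier_mat (Suc n) (Suc n)" "C \<in> carrier_mat 1 (Suc n)" "observable A C"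
    "\<And>a. ceigenvalue A a \<Longrightarrow> cmod a \<noteq> 1"
    using assms(5) by (auto simp: admissible_def)
  interpret c: coding "Suc n" m F G H A C
    by (rule coding.intro[OF AC(1,2) FGH assms(4) AC(3,4) realization_inverse_channel[OF assms(1) re assms(4)]])
  interpret o: gauss_obs n c.g M W N
    by unfold_locales (rule assms(6))
  note [simp del] = index_mult_mat(1)
  have wm: "c.wcol (\<lambda>i. W i \<omega>) = o.wmat \<omega>" for \<omega> by (simp add: c.wcol_def o.wmat_def)
  have e_eq: "e = o.en" unfolding e_def proc_e_def proc_state_def by (intro ext) (simp only: c.sig_e_eq[of "\<lambda>i. W i _" "\<lambda>i. N i _"] wm)
  have y_eq: "y t \<omega> = o.en t \<omega> + (\<Sum>s<t. c.kap t s * o.en s \<omega>)" for t \<omega>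
    unfolding y_def proc_y_def proc_state_def c.sig_y_eq[of "\<lambda>i. W i \<omega>" "\<lambda>i. N i \<omega>"] wm ..
  have u_eq: "u t \<omega> = (c.DD * c.Phi t * c.err (o.wmat \<omega>) (\<lambda>s. N s \<omega>) t) $$ (0,0)" for t \<omega>
    unfolding u_def proc_u_def proc_state_def c.sig_u_eq wm c.Xt_def
    by (simp add: mult_assoc_dim c.err_dim[OF o.wmat])
  have ybar: "ybar T t \<omega> = (c.g t * o.wmat \<omega>) $$ (0,0) + N t \<omega>" if "t \<le> T" for T t \<omega>
    unfolding ybar_def c.est_obs_eq[OF assms(1) re that Suc_eq_plus1]
    using o.bw_rv[of \<omega> t] by (simp add: o.bw_def rv_upto_def)
  obtain Sg where Sg: "mat_tendsto (Suc n + m) (Suc n + m) (riccati_seq AA CC (c.E * c.E\<^sup>T)) Sg"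
    "stabilizing_solution AA CC Sg" "innov_var CC Sg = (DI A)\<^sup>2"
    using c.stabilizing_limit_DI unfolding AA_def CC_def by blast
  have uniq: "S = Sg" if "stabilizing_solution AA CC S" for S
    using stabilizing_solution_unique[OF c.AA c.CC] that Sg(2) unfolding AA_def CC_def by blast
  have Sigma: "\<Sigma> = Sg" unfolding \<Sigma>_def Sigma_inf_def by (rule the_equality[of "stabilizing_solution AA CC", OF Sg(2) uniq])
  have DI0: "0 \<le> DI A" unfolding DI_def by (rule prod_nonneg) simp
  \<comment> \<open>Inherited from \<open>1 \<le> K t\<close>; with nonnegativity it makes the
    logarithms meaningful.\<close>
  have "1 \<le> (DI A)\<^sup>2" by (rule LIMSEQ_le_const[OF c.K_tendsto_DI]) (use c.K_ge_1 in auto)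
  then have DI: "0 < DI A" using DI0 by (cases "DI A = 0") auto
  define R where "R = log 2 (DI A)"
  have logDI: "log 2 ((DI A)\<^sup>2) = 2 * R" unfolding R_def using log_nat_power[OF DI0, of 2 2] by simp
  have "(\<lambda>t. log 2 (c.K t)) \<longlonglongrightarrow> log 2 ((DI A)\<^sup>2)"
    by (rule tendsto_log[OF tendsto_const c.K_tendsto_DI]) (use DI in auto)
  from tendsto_divide[OF cesaro_mean[OF this] tendsto_const[of 2]]
  have rate: "(\<lambda>T. (\<Sum>t\<le>T. log 2 (c.K t)) / 2 / (real T + 1)) \<longlonglongrightarrow> R"
    unfolding logDI by (simp add: mult.commute)
  have 1: "(\<lambda>T. mutual_info M n W T y / (real T + 1)) \<longlonglongrightarrow> R"
    unfolding o.mutual_info_observation[OF y_eq] by (rule rate)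
  have 2: "has_entropy_rate M e (R + log 2 (2 * pi * exp 1) / 2)"
  proof -
    have "diff_entropy M T o.en / (real T + 1) = (\<Sum>t\<le>T. log 2 (c.K t)) / 2 / (real T + 1) + log 2 (2 * pi * exp 1) / 2" for T
    proof -
      have nz: "real T + 1 \<noteq> 0" by linarith
      show ?thesis unfolding o.diff_entropy_innovations add_divide_distrib[of _ _ "real T + 1"]
        nonzero_mult_div_cancel_left[OF nz] ..
    qed
    then show ?thesis unfolding has_entropy_rate_def e_eq by (simp only:) (intro tendsto_add rate tendsto_const)
  qed
  have est: "fisher_info M n W T (ybar T) = c.J (Suc T)" "MSE M n W T (ybar T) = c.Ji (Suc T)"
    "CRB M n W T (ybar T) = c.Ji (Suc T)" for T
    by (rule o.fisher_info_eq o.MSE_eq o.CRB_eq, erule ybar)+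
  have fi: "(\<lambda>T. log 2 (det (fisher_info M n W T (ybar T))) / (2 * (real T + 1))) \<longlonglongrightarrow> R"
    unfolding est c.log_det_J using rate by simp
  have mi: "(\<lambda>T. log 2 (det (c.Ji (Suc T))) / (2 * (real T + 1))) \<longlonglongrightarrow> - R"
    unfolding c.log_det_Ji c.log_det_J using tendsto_minus[OF rate] by simp
  have pw: "(\<lambda>T. (\<integral>\<omega>. (\<Sum>t\<le>T. (u t \<omega>)\<^sup>2) \<partial>M) / (real T + 1)) \<longlonglongrightarrow> (DD * \<Sigma> * DD\<^sup>T) $$ (0,0)"
  proof -
    have Dc: "c.DD \<in> carrier_mat 1 (Suc n + m)" by (rule carrier_matI) simp_all
    have cc: "c.DD * c.Phi t \<in> carrier_mat 1 (Suc n)" for t by (rule carrier_matI) simp_all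
    have "(c.DD * c.Phi t) * c.Ji t * (c.DD * c.Phi t)\<^sup>T = c.DD * riccati_seq AA CC (c.E * c.E\<^sup>T) t * c.DD\<^sup>T" for t
      unfolding AA_def CC_def c.riccati_seq_closed_form by (simp add: transpose_mult_dim mult_assoc_dim)
    then have um: "integrable M (\<lambda>\<omega>. (u t \<omega>)\<^sup>2)"
      "(\<integral>\<omega>. (u t \<omega>)\<^sup>2 \<partial>M) = (c.DD * riccati_seq AA CC (c.E * c.E\<^sup>T) t * c.DD\<^sup>T) $$ (0,0)" for t
      using o.error_moments[OF cc cc, of t t 0 t 0] by (simp_all add: u_eq power2_eq_square)
    have "mat_tendsto 1 1 (\<lambda>t. c.DD * riccati_seq AA CC (c.E * c.E\<^sup>T) t * c.DD\<^sup>T) (c.DD * Sg * c.DD\<^sup>T)"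
      by (intro mat_tendsto_mult[OF mat_tendsto_mult[OF mat_tendsto_const[OF Dc] Sg(1)] mat_tendsto_const]) (use Dc in simp)
    from mat_tendsto_entry[OF this, of 0 0] have "(\<lambda>t. \<integral>\<omega>. (u t \<omega>)\<^sup>2 \<partial>M) \<longlonglongrightarrow> (DD * \<Sigma> * DD\<^sup>T) $$ (0,0)"
      unfolding um Sigma DD_def c.DD_def by simp
    from cesaro_mean[OF this] show ?thesis using um(1) by (simp add: Bochner_Integration.integral_sum)
  qed
  have iv: "R = 1 / 2 * log 2 ((CC * \<Sigma> * CC\<^sup>T) $$ (0,0) + 1)"
    using Sg(3) logDI unfolding Sigma innov_var_def by simp
  have se: "R = (LINT \<theta>:{-1/2..1/2}|lborel. log 2 (cmod (sensitivity AA CC (cis (2 * pi * \<theta>)))))"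
    using c.sensitivity_integral[OF Sg(2)[unfolded AA_def CC_def]] unfolding AA_def CC_def R_def by simp
  have ms: "(\<lambda>T. log 2 (det (MSE M n W T (ybar T))) / (2 * (real T + 1))) \<longlonglongrightarrow> - R"
    unfolding est by (rule mi)
  have cr: "(\<lambda>T. log 2 (det (CRB M n W T (ybar T))) / (2 * (real T + 1))) \<longlonglongrightarrow> - R"
    unfolding est by (rule mi)
  have ex1: "\<exists>!S. stabilizing_solution AA CC S" using Sg(2) uniq by blast
  show ?thesis
    by (rule conjI[OF ex1 conjI[OF _ pw]], rule exI[of _ R], rule exI[of _ "R + log 2 (2 * pi * exp 1) / 2"],
        intro conjI 1 2 se iv fi ms cr) (simp_all add: R_def)
qed

end
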